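(* Let $X$ be a metrisable space, let $d_{\rm sqz}$ be a metric generating the topology on the squeezed space $\mathcal R(X)$, and for paths $\pi_1,\pi_2\in\Pi(X)$ set $$d_{\rm H}(\pi_1,\pi_2):=\inf_{C\in{\rm Corr}(\pi_1,\pi_2)}\ \sup_{(z_1,z_2)\in C}d_{\rm sqz}(z_1,z_2),\qquad d_{\rm tot}(\pi_1,\pi_2):=\inf_{C\in{\rm Cor}_+(\pi_1,\pi_2)}\ \sup_{(z_1,z_2)\in C}d_{\rm sqz}(z_1,z_2),$$ $$d_{\rm part}(\pi_1,\pi_2):=d^2_{\rm H}\big(\pi_1^{\langle 2\rangle},\pi_2^{\langle 2\rangle}\big).$$ Then: (a) $d_{\rm H}(\pi_1,\pi_2)\le d_{\rm part}(\pi_1,\pi_2)\le d_{\rm tot}(\pi_1,\pi_2)$ for all $\pi_1,\pi_2\in\Pi(X)$. (b) $d_{\rm tot}$ and $d_{\rm part}$ are metrics on $\Pi(X)$ that generate the same topology (called the J1 topology on $\Pi(X)$). This topology does not depend on the choice of the metric $d_{\rm sqz}$ generating the topology on $\mathcal R(X)$. (c) On the space $\Pi_{\rm c}(X)$ of continuous paths, all three of $d_{\rm H}$, $d_{\rm tot}$, $d_{\rm part}$ are metrics and generate the same topology. (d) $\Pi^|_{\rm c}(X)$ is a closed subset of $\Pi(X)$. (e) If $X$ is Polish, then so are $\Pi(X)$, $\Pi_{\rm c}(X)$, and, for each closed real interval $I$ of positive length, $\mathcal D_I(X)$ (each equipped with the topology generated by $d_{\rm tot}$, or equivalently by $d_{\rm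 part}$). (f) For each closed real interval $I$ of positive length, on $\mathcal D_I(X)$ the metrics $d_{\rm tot}$ and $d_{\rm part}$ generate Skorokhod's J1 topology, while $d_{\rm H}$ is a metric on $\mathcal D_I(X)$ that generates Skorokhod's J2 topology.
   Context: A topological space is Polish if it is separable and its topology is generated by some complete metric. Let $\overline{\mathbb R}=[-\infty,\infty]$. Squeezed space: for a metrisable space $X$, $\mathcal R(X):=(X\times\mathbb R)\cup\{(\ast,-\infty),(\ast,\infty)\}$, equipped with the unique metrisable topology such that $(x_n,t_n)\to(x,t)$ iff $t_n\to t$ in $\overline{\mathbb R}$ and, if $t\in\mathbb R$, also $x_n\to x$. Paths: $\Pi(X)$ is the set of pairs $(\pi,\preceq)$ (often just written $\pi$) where $\pi$ is a nonempty compact subset of $\mathcal R(X)$ and $\preceq$ is a total order on $\pi$ such that: (i) $\pi^{\langle 2\rangle}:=\{(z,z')\in\pi^2:z\preceq z'\}$ is closed in $\pi^2$; (ii) if $(x,s),(x',s')\in\pi$ and $s<s'$, then $(x,s)\preceq(x',s')$; (iii) for each $t\in\mathbb R$ the set $\{x\in X:(x,t)\in\pi\}$ has at most two elements. Put $\hat I(\pi):=\{t\in\overline{\mathbb R}:(x,t)\in\pi\text{ for some }x\in X\cup\{\ast\}\}$ and $I(\pi):=\hat I(\pi)\cap\mathbb R$. For $t\in I(\pi)$, $\pi(t-),\pi(t+)$ are defined by $\{x:(x,t)\in\pi\}=\{\pi(t-),\pi(t+)\}$ with $(\pi(t-),t)\preceq(\pi(t+),t)$. Further $\Pi_{\rm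 c}(X):=\{\pi\in\Pi(X):\pi(t-)=\pi(t+)\ \forall t\in I(\pi)\}$, $\Pi^|(X):=\{\pi\in\Pi(X):\hat I(\pi)\text{ is an interval}\}$, and $\Pi^|_{\rm c}(X):=\Pi^|(X)\cap\Pi_{\rm c}(X)$. Correspondences: ${\rm Corr}(A,B)$ is the set of $C\subset A\times B$ such that every $a\in A$ has some $b\in B$ with $(a,b)\in C$ and every $b\in B$ has some $a\in A$ with $(a,b)\in C$. For paths, ${\rm Cor}_+(\pi_1,\pi_2)$ is the set of $C\in{\rm Corr}(\pi_1,\pi_2)$ that are monotone: there are no $(z_1,z_2),(z_1',z_2')\in C$ with $z_1\prec z_1'$ and $z_2'\prec z_2$, where $z\prec z'$ means $z\preceq z'$ and $z\ne z'$. $d^2_{\rm H}$ is the Hausdorff metric on nonempty compact subsets of $\mathcal R(X)^2$ associated with the metric $d^2_{\rm sqz}((z_1,z_1'),(z_2,z_2')):=d_{\rm sqz}(z_1,z_2)\vee d_{\rm sqz}(z_1',z_2')$. The space $\mathcal D_I(X)$: for a closed real interval $I$ of positive length with set of finite endpoints $\partial I$, $\mathcal D_I(X)$ is the set of $\pi\in\Pi(X)$ with $\hat I(\pi)=I\cup\{-\infty,\infty\}$ and $\pi(t-)=\pi(t+)$ for all $t\in\partial I$. It is identified, via $f(t)=\pi(t+)$, with the set of right continuous functions $f:I\to X$ that have a left limit $f(t-)$ at each $t\in I$ other than the left endpoint of $I$ and that satisfy $f(r-)=f(r)$ if $r:=\sup I<\infty$. Skorokhod's J1 and J2 topologies on $\mathcal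 D_I(X)$: let $d$ be a metric generating the topology on $X$. For a compact interval $J=[a,b]$, $a<b$, let $\Lambda(J)$ be the set of all bijections $\lambda:J\to J$ and $\Lambda_+(J)$ the set of increasing ones. For right continuous $f,g:J\to X$ with left limits set $\rho_J(f,g):=\inf_{\lambda\in\Lambda_+(J)}\sup_{s\in J}[d(f(s),g(\lambda(s)))\vee|s-\lambda(s)|]$, and define $\rho'_J$ in the same way with $\Lambda(J)$ in place of $\Lambda_+(J)$. If $I$ is compact, the J1 (resp. J2) topology is the one generated by $\rho_I$ (resp. $\rho'_I$). If $I$ is not compact, it is the metrisable topology in which $f_n\to f$ iff $\rho_J(f_n|_J,f|_J)\to0$ (resp. $\rho'_J(f_n|_J,f|_J)\to 0$) for every compact $J=[a,b]\subset I$ with $a<b$ such that each of $a,b$ is either a finite endpoint of $I$ or a continuity point of $f$. *)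

theory Defs
  imports "HOL-Analysis.Analysis"
begin

definition metrizes :: "('a \<Rightarrow> 'a \<Rightarrow> real) \<Rightarrow> 'a topology \<Rightarrow> bool" where
  "metrizes d T \<longleftrightarrow> Metric_space (topspace T) d \<and> Metric_space.mtopology (topspace T) d = T"

definition Polish_space :: "'a topology \<Rightarrow> bool" where
  "Polish_space T \<longleftrightarrow> separable_space T \<and> completely_metrizable_space T"


section \<open>The squeezed space\<close>

text \<open>The point \<open>(x, t)\<close> with \<open>x\<close> in \<open>X\<close> and \<open>t\<close> real is \<open>(Some x, ereal t)\<close>; the extra
  symbol \<open>\<ast>\<close> is \<open>None\<close>.\<close>

type_synonym 'a spoint = "'a option \<times> ereal"

definition squeezed :: "'a topology \<Rightarrow> 'a spoint set" where
  "squeezed X = {(Some x, ereal t) | x t. x \<in> topspace X} \<union> {(None, -\<infinity>), (None, \<infinity>)}"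

text \<open>If \<open>snd (\<sigma> n)\<close> tends to a real number, then \<open>fst (\<sigma> n) = None\<close> for at most finitely many \<open>n\<close>,
  so the value of \<open>the None\<close> is irrelevant below.\<close>

definition squeezed_topology :: "'a topology \<Rightarrow> 'a spoint topology" where
  "squeezed_topology X = (THE T. topspace T = squeezed X \<and> metrizable_space T \<and>
     (\<forall>\<sigma> z. range \<sigma> \<subseteq> squeezed X \<longrightarrow> z \<in> squeezed X \<longrightarrow>
        (limitin T \<sigma> z sequentially \<longleftrightarrow>
           (\<lambda>n. snd (\<sigma> n)) \<longlonglongrightarrow> snd z \<and>
           (\<forall>x. fst z = Some x \<longrightarrow> limitin X (\<lambda>n. the (fst (\<sigma> n))) x sequentially))))"


section \<open>Paths\<close>

text \<open>A path is a pair of its set of points and its order relation, a subset of the square of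
  the former.\<close>

type_synonym 'a path = "'a spoint set \<times> 'a spoint rel"

definition order2 :: "'a path \<Rightarrow> 'a spoint rel" where
  "order2 \<pi> = {(z, z') \<in> fst \<pi> \<times> fst \<pi>. (z, z') \<in> snd \<pi>}"

definition paths :: "'a topology \<Rightarrow> 'a path set" where
  "paths X = {(P, R). P \<noteq> {} \<and> compactin (squeezed_topology X) P \<and>
     R \<subseteq> P \<times> P \<and> linear_order_on P R \<and>
     closedin (subtopology (prod_topology (squeezed_topology X) (squeezed_topology X)) (P \<times> P))
       (order2 (P, R)) \<and>
     (\<forall>x s x' s'. (x, s) \<in> P \<and> (x', s') \<in> P \<and> s < s' \<longrightarrow> ((x, s), (x', s')) \<in> R) \<and>
     (\<forall>t::real. finite {x. (Some x, ereal t) \<in> P} \<and> card {x. (Some x, ereal t) \<in> P} \<le> 2)}"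

definition domain_ext :: "'a path \<Rightarrow> ereal set" where
  "domain_ext \<pi> = {t. \<exists>x. (x, t) \<in> fst \<pi>}"

definition domain_real :: "'a path \<Rightarrow> real set" where
  "domain_real \<pi> = {t. ereal t \<in> domain_ext \<pi>}"

definition is_values :: "'a path \<Rightarrow> real \<Rightarrow> 'a \<Rightarrow> 'a \<Rightarrow> bool" where
  "is_values \<pi> t x y \<longleftrightarrow> {x'. (Some x', ereal t) \<in> fst \<pi>} = {x, y} \<and>
     ((Some x, ereal t), (Some y, ereal t)) \<in> snd \<pi>"

definition left_val :: "'a path \<Rightarrow> real \<Rightarrow> 'a" where
  "left_val \<pi> t = (THE x. \<exists>y. is_values \<pi> t x y)"

definition right_val :: "'a path \<Rightarrow> real \<Rightarrow> 'a" where
  "right_val \<pi> t = (THE y. \<exists>x. is_values \<pi> t x y)"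

definition paths_c :: "'a topology \<Rightarrow> 'a path set" where
  "paths_c X = {\<pi> \<in> paths X. \<forall>t \<in> domain_real \<pi>. left_val \<pi> t = right_val \<pi> t}"

text \<open>Intervals of extended reals may be degenerate, i.e. consist of a single point.\<close>

definition paths_int :: "'a topology \<Rightarrow> 'a path set" where
  "paths_int X = {\<pi> \<in> paths X. \<forall>a \<in> domain_ext \<pi>. \<forall>b \<in> domain_ext \<pi>. {a..b} \<subseteq> domain_ext \<pi>}"

definition paths_int_c :: "'a topology \<Rightarrow> 'a path set" where
  "paths_int_c X = paths_int X \<inter> paths_c X"

definition closed_pos_interval :: "real set \<Rightarrow> bool" where
  "closed_pos_interval I \<longleftrightarrow> is_interval I \<and> closed I \<and> (\<exists>a\<in>I. \<exists>b\<in>I. a < b)"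

text \<open>For a closed interval \<open>I\<close>, \<^term>\<open>frontier I\<close> is the set of its finite endpoints.\<close>

definition skor_paths :: "'a topology \<Rightarrow> real set \<Rightarrow> 'a path set" where
  "skor_paths X I = {\<pi> \<in> paths X. domain_ext \<pi> = ereal ` I \<union> {-\<infinity>, \<infinity>} \<and>
     (\<forall>t \<in> frontier I. left_val \<pi> t = right_val \<pi> t)}"


section \<open>The distances between paths\<close>

text \<open>Infima and suprema are taken in \<^typ>\<open>ennreal\<close> and converted back to \<^typ>\<open>real\<close>, so that the
  distances are total, non-negative and symmetric functions, as \<^locale>\<open>Metric_space\<close> requires. On
  paths they are finite, so \<^term>\<open>enn2real\<close> loses nothing there: paths are nonempty and compact,
  and there always is a monotone correspondence between two of them.\<close>

definition Corr :: "'a set \<Rightarrow> 'b set \<Rightarrow> ('a \<times> 'b) set set" where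
  "Corr A B = {C. C \<subseteq> A \<times> B \<and> (\<forall>a\<in>A. \<exists>b\<in>B. (a, b) \<in> C) \<and> (\<forall>b\<in>B. \<exists>a\<in>A. (a, b) \<in> C)}"

definition strictly_before :: "'a path \<Rightarrow> 'a spoint \<Rightarrow> 'a spoint \<Rightarrow> bool" where
  "strictly_before \<pi> z z' \<longleftrightarrow> (z, z') \<in> snd \<pi> \<and> z \<noteq> z'"

definition Corr_mono :: "'a path \<Rightarrow> 'a path \<Rightarrow> ('a spoint \<times> 'a spoint) set set" where
  "Corr_mono \<pi>1 \<pi>2 = {C \<in> Corr (fst \<pi>1) (fst \<pi>2).
     \<not> (\<exists>z1 z2 z1' z2'. (z1, z2) \<in> C \<and> (z1', z2') \<in> C \<and>
          strictly_before \<pi>1 z1 z1' \<and> strictly_before \<pi>2 z2' z2)}"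

definition corr_dist :: "('a \<Rightarrow> 'a \<Rightarrow> real) \<Rightarrow> ('a \<times> 'a) set set \<Rightarrow> real" where
  "corr_dist d \<C> = enn2real (INF C\<in>\<C>. SUP (z1, z2)\<in>C. ennreal (d z1 z2))"

definition d_H :: "('a spoint \<Rightarrow> 'a spoint \<Rightarrow> real) \<Rightarrow> 'a path \<Rightarrow> 'a path \<Rightarrow> real" where
  "d_H d \<pi>1 \<pi>2 = corr_dist d (Corr (fst \<pi>1) (fst \<pi>2))"

definition d_tot :: "('a spoint \<Rightarrow> 'a spoint \<Rightarrow> real) \<Rightarrow> 'a path \<Rightarrow> 'a path \<Rightarrow> real" where
  "d_tot d \<pi>1 \<pi>2 = corr_dist d (Corr_mono \<pi>1 \<pi>2)"

definition hausdorff_dist :: "('a \<Rightarrow> 'a \<Rightarrow> real) \<Rightarrow> 'a set \<Rightarrow> 'a set \<Rightarrow> real" where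
  "hausdorff_dist d A B = enn2real
     (max (SUP a\<in>A. INF b\<in>B. ennreal (d a b)) (SUP b\<in>B. INF a\<in>A. ennreal (d a b)))"

definition max_dist :: "('a \<Rightarrow> 'a \<Rightarrow> real) \<Rightarrow> 'a \<times> 'a \<Rightarrow> 'a \<times> 'a \<Rightarrow> real" where
  "max_dist d = (\<lambda>(z1, z1') (z2, z2'). max (d z1 z2) (d z1' z2'))"

definition d_part :: "('a spoint \<Rightarrow> 'a spoint \<Rightarrow> real) \<Rightarrow> 'a path \<Rightarrow> 'a path \<Rightarrow> real" where
  "d_part d \<pi>1 \<pi>2 = hausdorff_dist (max_dist d) (order2 \<pi>1) (order2 \<pi>2)"


section \<open>Skorokhod's topologies\<close>

text \<open>Functions on \<open>I\<close> are represented extensionally. At the right endpoint of \<open>I\<close> the filter in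
  the clause for right continuity is \<^term>\<open>bot\<close>, so that this clause is then void.\<close>

definition cadlag :: "'a topology \<Rightarrow> real set \<Rightarrow> (real \<Rightarrow> 'a) set" where
  "cadlag X I = {f \<in> I \<rightarrow>\<^sub>E topspace X.
     (\<forall>t\<in>I. limitin X f (f t) (at t within (I \<inter> {t<..}))) \<and>
     (\<forall>t\<in>I. (\<exists>s\<in>I. s < t) \<longrightarrow> (\<exists>l. limitin X f l (at t within (I \<inter> {..<t})))) \<and>
     (\<forall>r\<in>I. (\<forall>t\<in>I. t \<le> r) \<longrightarrow> limitin X f (f r) (at r within (I \<inter> {..<r})))}"

definition time_changes :: "real set \<Rightarrow> (real \<Rightarrow> real) set" where
  "time_changes J = {l. bij_betw l J J}"

definition time_changes_mono :: "real set \<Rightarrow> (real \<Rightarrow> real) set" where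
  "time_changes_mono J = {l. bij_betw l J J \<and> strict_mono_on J l}"

text \<open>The parameter \<open>\<Lambda>\<close> is \<^const>\<open>time_changes_mono\<close> for J1 and \<^const>\<open>time_changes\<close> for J2. Only the
  values of \<open>f\<close> and \<open>g\<close> on \<open>J\<close> matter in \<open>skor_dist \<Lambda> d J f g\<close>.\<close>

definition skor_dist :: "(real set \<Rightarrow> (real \<Rightarrow> real) set) \<Rightarrow> ('a \<Rightarrow> 'a \<Rightarrow> real) \<Rightarrow> real set
    \<Rightarrow> (real \<Rightarrow> 'a) \<Rightarrow> (real \<Rightarrow> 'a) \<Rightarrow> real" where
  "skor_dist \<Lambda> d J f g = enn2real
     (INF l\<in>\<Lambda> J. SUP s\<in>J. ennreal (max (d (f s) (g (l s))) \<bar>s - l s\<bar>))"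

definition skor_conv :: "(real set \<Rightarrow> (real \<Rightarrow> real) set) \<Rightarrow> ('a \<Rightarrow> 'a \<Rightarrow> real) \<Rightarrow> 'a topology
    \<Rightarrow> real set \<Rightarrow> (nat \<Rightarrow> real \<Rightarrow> 'a) \<Rightarrow> (real \<Rightarrow> 'a) \<Rightarrow> bool" where
  "skor_conv \<Lambda> d X I fs f \<longleftrightarrow>
     (\<forall>a b. a < b \<and> {a..b} \<subseteq> I \<and>
        (\<forall>t\<in>{a, b}. t \<in> frontier I \<or> limitin X f (f t) (at t within I)) \<longrightarrow>
        (\<lambda>n. skor_dist \<Lambda> d {a..b} (fs n) f) \<longlonglongrightarrow> 0)"

definition skor_topology :: "(real set \<Rightarrow> (real \<Rightarrow> real) set) \<Rightarrow> ('a \<Rightarrow> 'a \<Rightarrow> real) \<Rightarrow> 'a topology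
    \<Rightarrow> real set \<Rightarrow> (real \<Rightarrow> 'a) topology" where
  "skor_topology \<Lambda> d X I =
     (if compact I then Metric_space.mtopology (cadlag X I) (skor_dist \<Lambda> d I)
      else (THE T. topspace T = cadlag X I \<and> metrizable_space T \<and>
        (\<forall>fs f. range fs \<subseteq> cadlag X I \<longrightarrow> f \<in> cadlag X I \<longrightarrow>
           (limitin T fs f sequentially \<longleftrightarrow> skor_conv \<Lambda> d X I fs f))))"

abbreviation J1_topology where "J1_topology \<equiv> skor_topology time_changes_mono"
abbreviation J2_topology where "J2_topology \<equiv> skor_topology time_changes"

text \<open>The function by which a path in \<open>skor_paths X I\<close> is identified with an element of
  \<open>cadlag X I\<close>.\<close>

definition path_fun :: "real set \<Rightarrow> 'a path \<Rightarrow> real \<Rightarrow> 'a" where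
  "path_fun I \<pi> = (\<lambda>t\<in>I. right_val \<pi> t)"

end

theory Submission
  imports Defs
begin

text \<open>Since paths are compact, their orders are compact subsets of the square of the squeezed space, so
  that \<open>d_part\<close> is a metric by the general theory of Hausdorff distances. A correspondence between
  two paths that comes from a good matching of their orders is almost monotone. Replacing each of its
  points by a running maximum, and filling the gaps in the other direction, turns it into a monotone
  one at no cost. This yields the triangle inequality for \<open>d_tot\<close> and, by uniform
  continuity on the compact limit path, the equality of the topologies of \<open>d_tot\<close> and \<open>d_part\<close>.

  For Polishness, \<open>d_part\<close> for a complete cone metric on the squeezed space embeds the space
  of paths isometrically into the complete space of nonempty compact sets, with a \<open>G\<^sub>\<delta>\<close> set as image.

  A path in \<^term>\<open>skor_paths X I\<close> is the closed graph of a right continuous function. If two such graphs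
  are close by a monotone correspondence, then the latter maps a fine partition for one function to a
  partition for the other one, and the time change is piecewise affine. If they are merely close, then
  each time is mapped to a time in a nearby cell of the partition; as the cells have the cardinality
  of the continuum, this can be made injective in both directions, and the Schroeder--Bernstein theorem
  gives a bijection. Conversely, time changes on a large interval between continuity points move
  graphs by little, because the squeezed space is small near infinity.\<close>

text \<open>Two obstacles shape the proof. Monotonicity of a correspondence is neither stable under
  composition nor implied by an approximate matching of the orders. In both cases the defect is a
  crossing, that is, two pairs in opposite relative order, and the refinement adds only corners of
  crossings. It thus suffices to control crossings: in a composition they run through a common
  middle point, and on a compact path antisymmetry holds uniformly. The second obstacle is that a
  Hausdorff limit of orders need not be an order of a path; antisymmetry and the bound of two points
  per time have to be required of it. Each of them fails with a positive margin on a closed set,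
  which is why a countable intersection of open sets appears. As the topologies do not depend on the
  metric of the squeezed space, completeness and the comparison with Skorokhod's topologies are
  needed only for the cone metric, which allows explicit estimates. Infinite infima would be sent to
  0 by \<open>enn2real\<close>, so each passage from a distance to a correspondence or time change
  starts with a finite bound.\<close>

abbreviation vanishes :: "(nat \<Rightarrow> real) \<Rightarrow> bool" where
  "vanishes u \<equiv> u \<longlonglongrightarrow> 0"

section \<open>Metric spaces\<close>

text \<open>The radius may depend on the centre \<open>x\<close>. This suffices below, where radii
  come from the compactness of one fixed path.\<close>

lemma mtopology_eqI:
  assumes "Metric_space M d" "Metric_space M d'"
    and "\<And>x e. x \<in> M \<Longrightarrow> e > 0 \<Longrightarrow> \<exists>\<delta>>0. \<forall>y\<in>M. d x y < \<delta> \<longrightarrow> d' x y < e"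
    and "\<And>x e. x \<in> M \<Longrightarrow> e > 0 \<Longrightarrow> \<exists>\<delta>>0. \<forall>y\<in>M. d' x y < \<delta> \<longrightarrow> d x y < e"
  shows "Metric_space.mtopology M d = Metric_space.mtopology M d'"
proof -
  interpret A: Metric_space M d by fact
  interpret B: Metric_space M d' by fact
  have "openin A.mtopology U \<longleftrightarrow> openin B.mtopology U" for U
  proof
    assume U: "openin A.mtopology U"
    show "openin B.mtopology U"
      unfolding B.openin_mtopology
    proof (intro conjI allI impI)
      show "U \<subseteq> M" using U A.openin_mtopology by blast
      fix x assume "x \<in> U"
      then obtain r where r: "r > 0" "A.mball x r \<subseteq> U" using U A.openin_mtopology by blast
      have "x \<in> M" using U \<open>x \<in> U\<close> A.openin_mtopology by blast
      then obtain \<delta> where "\<delta> > 0" "\<forall>y\<in>M. d' x y < \<delta> \<longrightarrow> d x y < r" using assms(4) r by blast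
      then show "\<exists>r>0. B.mball x r \<subseteq> U" using r by (intro exI[of _ \<delta>]) auto
    qed
  next
    assume U: "openin B.mtopology U"
    show "openin A.mtopology U"
      unfolding A.openin_mtopology
    proof (intro conjI allI impI)
      show "U \<subseteq> M" using U B.openin_mtopology by blast
      fix x assume "x \<in> U"
      then obtain r where r: "r > 0" "B.mball x r \<subseteq> U" using U B.openin_mtopology by blast
      have "x \<in> M" using U \<open>x \<in> U\<close> B.openin_mtopology by blast
      then obtain \<delta> where "\<delta> > 0" "\<forall>y\<in>M. d x y < \<delta> \<longrightarrow> d' x y < r" using assms(3) r by blast
      then show "\<exists>r>0. A.mball x r \<subseteq> U" using r by (intro exI[of _ \<delta>]) auto
    qed
  qed
  then show ?thesis by (simp add: topology_eq)
qed

text \<open>A metrizable topology is determined by its convergent sequences, since its closed sets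
  are the sequentially closed ones. This is the uniqueness behind the definite descriptions in
  \<open>squeezed_topology\<close> and \<open>skor_topology\<close>.\<close>

lemma metrizable_space_eqI:
  assumes "metrizable_space S" "metrizable_space T" and top: "topspace S = topspace T"
    and lim: "\<And>\<sigma> l. range \<sigma> \<subseteq> topspace T \<Longrightarrow> l \<in> topspace T \<Longrightarrow>
      limitin S \<sigma> l sequentially \<longleftrightarrow> limitin T \<sigma> l sequentially"
  shows "S = T"
proof -
  obtain M d where "Metric_space M d" and S: "S = Metric_space.mtopology M d"
    using assms(1) metrizable_space_def by blast
  then interpret A: Metric_space M d by simp
  obtain M' d' where "Metric_space M' d'" and T: "T = Metric_space.mtopology M' d'"
    using assms(2) metrizable_space_def by blast
  then interpret B: Metric_space M' d' by simp
  have M: "M' = M" using top by (simp add: S T)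
  have "closedin S C \<longleftrightarrow> closedin T C" for C
  proof -
    have eq: "limitin S \<sigma> l sequentially \<longleftrightarrow> limitin T \<sigma> l sequentially" if "C \<subseteq> M" "range \<sigma> \<subseteq> C" for \<sigma> l
    proof (cases "l \<in> M")
      case True
      have "topspace T = M" unfolding T B.topspace_mtopology by (rule M)
      then have "range \<sigma> \<subseteq> topspace T" "l \<in> topspace T" using that True by auto
      then show ?thesis by (rule lim)
    next
      \<comment> \<open>Limits outside the carrier are not covered by \<open>lim\<close>; for them
        both sides are false.\<close>
      case False
      then show ?thesis using A.limitin_mspace[of \<sigma> l sequentially] B.limitin_mspace[of \<sigma> l sequentially] M unfolding S T by blast
    qed
    have S': "closedin S C \<longleftrightarrow> C \<subseteq> M \<and> (\<forall>\<sigma> l. range \<sigma> \<subseteq> C \<and> limitin S \<sigma> l sequentially \<longrightarrow> l \<in> C)"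
      unfolding S by (rule A.metric_closedin_iff_sequentially_closed)
    have T': "closedin T C \<longleftrightarrow> C \<subseteq> M \<and> (\<forall>\<sigma> l. range \<sigma> \<subseteq> C \<and> limitin T \<sigma> l sequentially \<longrightarrow> l \<in> C)"
      using B.metric_closedin_iff_sequentially_closed[of C] unfolding T[symmetric] by (simp add: M)
    show ?thesis unfolding S' T' using eq by blast
  qed
  then show ?thesis by (simp add: topology_eq openin_closedin_eq top)
qed

context Metric_space
begin

lemma limitin_seq_iff:
  assumes "\<And>n. \<sigma> n \<in> M" "l \<in> M"
  shows "limitin mtopology \<sigma> l sequentially \<longleftrightarrow> vanishes (\<lambda>n. d (\<sigma> n) l)"
  using assms by (simp add: limitin_metric tendsto_iff)

lemma compactin_subseq:
  assumes "compactin mtopology P" "\<And>n. \<sigma> n \<in> P"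
  obtains r l where "strict_mono (r :: nat \<Rightarrow> nat)" "l \<in> P" "vanishes (\<lambda>n. d (\<sigma> (r n)) l)"
proof -
  have P: "P \<subseteq> M" using assms(1) compactin_sequentially by blast
  have "range \<sigma> \<subseteq> P" using assms(2) by blast
  then obtain l r where "l \<in> P" "strict_mono r" "limitin mtopology (\<sigma> \<circ> r) l sequentially"
    using assms(1) compactin_sequentially by meson
  then show ?thesis
    using that limitin_seq_iff[of "\<sigma> \<circ> r" l] assms(2) P by auto
qed

lemma compactinI:
  assumes "P \<subseteq> M"
    and "\<And>\<sigma>. (\<And>n. \<sigma> n \<in> P) \<Longrightarrow> \<exists>r l. strict_mono (r :: nat \<Rightarrow> nat) \<and> l \<in> P \<and> vanishes (\<lambda>n. d (\<sigma> (r n)) l)"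
  shows "compactin mtopology P"
  unfolding compactin_sequentially
proof (intro conjI allI impI)
  fix \<sigma> :: "nat \<Rightarrow> 'a" assume \<sigma>: "range \<sigma> \<subseteq> P"
  then obtain r l where r: "strict_mono r" "l \<in> P" "vanishes (\<lambda>n. d (\<sigma> (r n)) l)"
    using assms(2)[of \<sigma>] by blast
  then have "limitin mtopology (\<sigma> \<circ> r) l sequentially"
    using \<sigma> assms(1) by (subst limitin_seq_iff) auto
  then show "\<exists>l r. l \<in> P \<and> strict_mono r \<and> limitin mtopology (\<sigma> \<circ> r) l sequentially"
    using r by blast
qed (use assms in auto)

lemma tendsto_dist_trans:
  assumes "\<And>n. x n \<in> M" "\<And>n. y n \<in> M" "l \<in> M"
    and "vanishes (\<lambda>n. d (x n) (y n))" "vanishes (\<lambda>n. d (y n) l)"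
  shows "vanishes (\<lambda>n. d (x n) l)"
proof (rule tendsto_sandwich[of "\<lambda>_. 0" _ _ "\<lambda>n. d (x n) (y n) + d (y n) l"])
  show "\<forall>\<^sub>F n in sequentially. d (x n) l \<le> d (x n) (y n) + d (y n) l"
    using assms triangle by (intro always_eventually) blast
  show "vanishes (\<lambda>n. d (x n) (y n) + d (y n) l)" using tendsto_add[OF assms(4,5)] by simp
qed auto

lemma tendsto_dist_unique:
  assumes "\<And>n. x n \<in> M" "l \<in> M" "l' \<in> M" "vanishes (\<lambda>n. d (x n) l)" "vanishes (\<lambda>n. d (x n) l')"
  shows "l = l'"
  using limitin_metric_unique[of x l sequentially l'] assms by (simp add: limitin_seq_iff)

lemma tendsto_dist_dist:
  assumes "\<And>n. x n \<in> M" "\<And>n. y n \<in> M" "l \<in> M" "l' \<in> M" "vanishes (\<lambda>n. d (x n) l)" "vanishes (\<lambda>n. d (y n) l')"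
  shows "(\<lambda>n. d (x n) (y n)) \<longlonglongrightarrow> d l l'"
proof (rule LIM_zero_cancel, rule tendsto_sandwich[of "\<lambda>n. - (d (x n) l + d (y n) l')" _ _ "\<lambda>n. d (x n) l + d (y n) l'"])
  have "\<bar>d (x n) (y n) - d l l'\<bar> \<le> d (x n) l + d (y n) l'" for n
    using triangle[of "x n" l "y n"] triangle[of l l' "y n"] triangle[of l "x n" l'] triangle[of "x n" "y n" l']
      assms(1-4) commute[of l "x n"] commute[of l' "y n"] by (smt (verit))
  then show "\<forall>\<^sub>F n in sequentially. d (x n) (y n) - d l l' \<le> d (x n) l + d (y n) l'"
    "\<forall>\<^sub>F n in sequentially. - (d (x n) l + d (y n) l') \<le> d (x n) (y n) - d l l'"
    by (auto intro!: always_eventually simp: abs_le_iff) (smt (verit, ccfv_threshold))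
  have "(\<lambda>n. d (x n) l + d (y n) l') \<longlonglongrightarrow> 0 + 0" by (intro tendsto_intros assms)
  then show "vanishes (\<lambda>n. d (x n) l + d (y n) l')" by simp
  then show "vanishes (\<lambda>n. - (d (x n) l + d (y n) l'))" using tendsto_minus by force
qed

lemma compactin_mbounded: "compactin mtopology P \<Longrightarrow> mbounded P"
  using compactin_imp_mtotally_bounded mtotally_bounded_imp_mbounded by blast

lemma compactin_bounded2:
  assumes "compactin mtopology P" "compactin mtopology Q"
  obtains B where "\<And>x y. x \<in> P \<Longrightarrow> y \<in> Q \<Longrightarrow> d x y \<le> B"
proof -
  have "mbounded (P \<union> Q)" using assms compactin_mbounded mbounded_Un by blast
  then show ?thesis using that unfolding mbounded_alt by blast
qed

lemma compactin_closed_seq: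
  assumes "compactin mtopology P" "\<And>n. \<sigma> n \<in> P" "l \<in> M" "vanishes (\<lambda>n. d (\<sigma> n) l)"
  shows "l \<in> P"
proof -
  have "closedin mtopology P" using assms(1) compactin_imp_closedin Hausdorff_space_mtopology by blast
  then show ?thesis
    using metric_closedin_iff_sequentially_closed assms limitin_seq_iff[of \<sigma> l]
    by (metis image_subset_iff subsetD)
qed

lemma closedin_seqI:
  assumes "S \<subseteq> M" "\<And>\<sigma> l. (\<And>n. \<sigma> n \<in> S) \<Longrightarrow> l \<in> M \<Longrightarrow> vanishes (\<lambda>n. d (\<sigma> n) l) \<Longrightarrow> l \<in> S"
  shows "closedin mtopology S"
  unfolding metric_closedin_iff_sequentially_closed
proof (intro conjI allI impI)
  fix \<sigma> :: "nat \<Rightarrow> 'a" and l assume *: "range \<sigma> \<subseteq> S \<and> limitin mtopology \<sigma> l sequentially"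
  then have "l \<in> M" using limitin_mspace by blast
  then show "l \<in> S" using * assms limitin_seq_iff[of \<sigma> l] by blast
qed fact

text \<open>Separability in metric form: such a witness passes by approximation to subspaces,
  hyperspaces, squares and cones.\<close>

definition dense_set :: "'a set \<Rightarrow> bool" where
  "dense_set D \<longleftrightarrow> countable D \<and> D \<subseteq> M \<and> (\<forall>x\<in>M. \<forall>e>0. \<exists>a\<in>D. d x a < e)"

lemma separable_iff_dense_set: "separable_space mtopology \<longleftrightarrow> (\<exists>D. dense_set D)"
  unfolding separable_space_def dense_set_def
  by (rule arg_cong[where f=Ex], rule ext) (simp add: metric_closure_of set_eq_iff, blast)

text \<open>\<open>D\<close> may miss \<open>A\<close>. Each of its points is replaced by nearby
  points of \<open>A\<close>, one for every scale \<open>1 / Suc n\<close> at which there is one;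
  indexing by the scale keeps the family countable.\<close>

lemma dense_set_subset:
  assumes "dense_set D" "A \<subseteq> M"
  shows "\<exists>D. Metric_space.dense_set A d D"
proof -
  interpret Submetric M d A by unfold_locales (rule assms(2))
  define p where "p a n = (SOME x. x \<in> A \<and> d a x < 1 / real (Suc n))" for a n
  define I where "I = {(a, n). a \<in> D \<and> (\<exists>x. x \<in> A \<and> d a x < 1 / real (Suc n))}"
  have p: "p a n \<in> A \<and> d a (p a n) < 1 / real (Suc n)" if "(a, n) \<in> I" for a n
    using that unfolding I_def p_def by simp (rule someI_ex, blast)
  have "I \<subseteq> D \<times> UNIV" unfolding I_def by blast
  moreover have "countable (D \<times> (UNIV :: nat set))" using assms(1) unfolding dense_set_def by simp
  ultimately have "countable I" using countable_subset by blast
  moreover have "(\<lambda>(a, n). p a n) ` I \<subseteq> A" using p by auto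
  moreover have "\<exists>a\<in>(\<lambda>(a, n). p a n) ` I. d x a < e" if "x \<in> A" "e > 0" for x e
  proof -
    \<comment> \<open>Half of \<open>e\<close>, since the ways from \<open>x\<close> to
      \<open>a\<close> and from \<open>a\<close> to \<open>p a n\<close> are both shorter than
      \<open>1 / Suc n\<close>.\<close>
    obtain n where n: "1 / real (Suc n) < e / 2" using \<open>e > 0\<close> by (meson half_gt_zero nat_approx_posE)
    have "x \<in> M" using that assms by blast
    moreover have "1 / real (Suc n) > 0" by simp
    ultimately obtain a where a: "a \<in> D" "d x a < 1 / real (Suc n)" using assms(1) unfolding dense_set_def by blast
    then have I: "(a, n) \<in> I" unfolding I_def using \<open>x \<in> A\<close> commute by auto
    have "d x (p a n) \<le> d x a + d a (p a n)"
      using triangle \<open>x \<in> M\<close> a p[OF I] assms unfolding dense_set_def by blast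
    then have "d x (p a n) < e" using a p[OF I] n by linarith
    then show ?thesis using I by force
  qed
  moreover have "countable ((\<lambda>(a, n). p a n) ` I)" using \<open>countable I\<close> by simp
  ultimately show ?thesis unfolding sub.dense_set_def by (intro exI[of _ "(\<lambda>(a, n). p a n) ` I"]) simp
qed

text \<open>The tail of the geometric series from \<open>k\<close> on sums to
  \<open>2 * e / 2 ^ k\<close>, which bounds the distance of \<open>y k\<close> from the
  limit.\<close>

lemma geometric_limit:
  assumes "mcomplete" "\<And>k. y k \<in> M" "\<And>k. d (y k) (y (Suc k)) \<le> e / 2 ^ k"
  obtains x where "x \<in> M" "\<And>k. d (y k) x \<le> 2 * e / 2 ^ k"
proof -
  have e: "e \<ge> 0" using assms(3)[of 0] order_trans[OF nonneg] by force
  \<comment> \<open>The partial sums in closed form; without the factor \<open>1 - 1 / 2 ^ j\<close>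
    the induction on \<open>j\<close> would not close.\<close>
  have *: "d (y k) (y (k + j)) \<le> 2 * e / 2 ^ k * (1 - 1 / 2 ^ j)" for k j
  proof (induction j)
    case 0 then show ?case using assms(2) by simp
  next
    case (Suc j)
    have "d (y k) (y (k + Suc j)) \<le> d (y k) (y (k + j)) + d (y (k + j)) (y (Suc (k + j)))"
      using triangle assms(2) by simp
    also have "\<dots> \<le> 2 * e / 2 ^ k * (1 - 1 / 2 ^ j) + e / 2 ^ (k + j)"
      using Suc assms(3)[of "k + j"] by simp
    also have "\<dots> = 2 * e / 2 ^ k * (1 - 1 / 2 ^ Suc j)" by (simp add: field_simps power_add)
    finally show ?case .
  qed
  have **: "d (y k) (y (k + j)) \<le> 2 * e / 2 ^ k" for k j
  proof -
    have "2 * e / 2 ^ k * (1 - 1 / 2 ^ j) \<le> 2 * e / 2 ^ k * 1" using e by (intro mult_left_mono) auto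
    then show ?thesis using *[of k j] by linarith
  qed
  have lim: "vanishes (\<lambda>k. 2 * e / 2 ^ k)"
    using LIMSEQ_divide_realpow_zero[of 2 "2 * e"] by simp
  have "MCauchy y"
    unfolding MCauchy_def
  proof (intro conjI allI impI)
    show "range y \<subseteq> M" using assms(2) by blast
    fix \<epsilon> :: real assume "\<epsilon> > 0"
    then obtain N where "\<forall>k\<ge>N. 2 * e / 2 ^ k < \<epsilon>" using order_tendstoD(2)[OF lim] unfolding eventually_sequentially by blast
    then have N: "2 * e / 2 ^ n < \<epsilon>" if "n \<ge> N" for n using that by blast
    have N': "d (y n) (y m) < \<epsilon>" if "N \<le> n" "n \<le> m" for n m
      using **[of n "m - n"] N[OF that(1)] that(2) by simp
    have "d (y n) (y m) < \<epsilon>" if "N \<le> n" "N \<le> m" for n m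
      using N'[of n m] N'[of m n] that commute by (metis linear)
    then show "\<exists>N. \<forall>n n'. N \<le> n \<longrightarrow> N \<le> n' \<longrightarrow> d (y n) (y n') < \<epsilon>" by blast
  qed
  then obtain x where x: "limitin mtopology y x sequentially" using assms(1) mcomplete_def by blast
  then have xM: "x \<in> M" using limitin_mspace by blast
  then have x: "vanishes (\<lambda>n. d (y n) x)" using x limitin_seq_iff assms(2) by simp
  have "d (y k) x \<le> 2 * e / 2 ^ k" for k
  proof -
    have "(\<lambda>n. d (y k) (y n)) \<longlonglongrightarrow> d (y k) x"
      by (rule tendsto_dist_dist) (use assms(2) xM x in auto)
    moreover have "\<forall>\<^sub>F n in sequentially. d (y k) (y n) \<le> 2 * e / 2 ^ k"
      using eventually_ge_at_top[of k]
    proof eventually_elim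
      case (elim n) then show ?case using **[of k "n - k"] by simp
    qed
    ultimately show ?thesis by (rule tendsto_upperbound) simp
  qed
  then show ?thesis using that xM by blast
qed

end

section \<open>Correspondence and Hausdorff distances\<close>

lemma corr_dist_le:
  assumes "C \<in> \<C>" "\<And>a b. (a, b) \<in> C \<Longrightarrow> d a b \<le> r" "0 \<le> r"
  shows "corr_dist d \<C> \<le> r"
proof -
  have "(INF C\<in>\<C>. SUP (z1, z2)\<in>C. ennreal (d z1 z2)) \<le> (SUP (z1, z2)\<in>C. ennreal (d z1 z2))"
    using assms(1) by (rule INF_lower)
  also have "\<dots> \<le> ennreal r" using assms(2) by (auto intro!: SUP_least ennreal_leI)
  finally show ?thesis unfolding corr_dist_def using assms(3) by (simp add: enn2real_leI)
qed

text \<open>The member \<open>C0\<close> of bounded distances makes the infimum finite. Otherwise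
  \<open>enn2real\<close> could have turned an infinite infimum into 0, and a small value of
  \<open>corr_dist\<close> would yield nothing.\<close>

lemma corr_dist_lessD:
  assumes "C0 \<in> \<C>" "\<And>a b. (a, b) \<in> C0 \<Longrightarrow> d a b \<le> B" "corr_dist d \<C> < r"
  shows "\<exists>C\<in>\<C>. \<forall>(a, b)\<in>C. d a b < r"
proof -
  let ?I = "INF C\<in>\<C>. SUP (z1, z2)\<in>C. ennreal (d z1 z2)"
  have "?I \<le> (SUP (z1, z2)\<in>C0. ennreal (d z1 z2))"
    using assms(1) by (rule INF_lower)
  also have "\<dots> \<le> ennreal B" using assms(2) by (auto intro!: SUP_least ennreal_leI)
  finally have fin: "?I < top" by (simp add: order_le_less_trans)
  have r: "0 < r" using assms(3) unfolding corr_dist_def by (rule order_le_less_trans[OF enn2real_nonneg])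
  have "?I < ennreal r" using assms(3) fin r unfolding corr_dist_def
    by (metis ennreal_enn2real ennreal_less_iff enn2real_nonneg)
  then obtain C where C: "C \<in> \<C>" "(SUP (z1, z2)\<in>C. ennreal (d z1 z2)) < ennreal r" by (auto simp: INF_less_iff)
  have "d a b < r" if "(a, b) \<in> C" for a b
  proof -
    have "ennreal (d a b) \<le> (SUP (z1, z2)\<in>C. ennreal (d z1 z2))"
      by (rule SUP_upper2[OF that]) simp
    then have "ennreal (d a b) < ennreal r" using C by order
    then show ?thesis using r by (meson ennreal_leI not_le)
  qed
  then show ?thesis using C by blast
qed

lemma corr_dist_nonneg [simp]: "0 \<le> corr_dist d \<C>"
  unfolding corr_dist_def by simp

lemma hausdorff_dist_le:
  assumes "\<And>a. a \<in> A \<Longrightarrow> \<exists>b\<in>B. d a b \<le> r" "\<And>b. b \<in> B \<Longrightarrow> \<exists>a\<in>A. d a b \<le> r" "0 \<le> r"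
  shows "hausdorff_dist d A B \<le> r"
proof -
  have "(INF b\<in>B. ennreal (d a b)) \<le> ennreal r" if "a \<in> A" for a
    using assms(1)[OF that] by (meson INF_lower2 ennreal_leI)
  moreover have "(INF a\<in>A. ennreal (d a b)) \<le> ennreal r" if "b \<in> B" for b
    using assms(2)[OF that] by (meson INF_lower2 ennreal_leI)
  ultimately have "max (SUP a\<in>A. INF b\<in>B. ennreal (d a b)) (SUP b\<in>B. INF a\<in>A. ennreal (d a b)) \<le> ennreal r"
    by (auto intro!: SUP_least)
  then show ?thesis unfolding hausdorff_dist_def using assms(3) by (simp add: enn2real_leI)
qed

text \<open>Finiteness has to be secured before \<open>enn2real\<close> can be undone: over nonempty
  sets the inner infima are at most \<open>K\<close>. An infimum strictly below \<open>r\<close> is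
  then undercut by an actual point.\<close>

lemma hausdorff_dist_lessD:
  assumes ne: "A \<noteq> {}" "B \<noteq> {}" and bd: "\<And>a b. a \<in> A \<Longrightarrow> b \<in> B \<Longrightarrow> d a b \<le> K"
    and "hausdorff_dist d A B < r"
  shows "\<forall>a\<in>A. \<exists>b\<in>B. d a b < r" "\<forall>b\<in>B. \<exists>a\<in>A. d a b < r"
proof -
  let ?X = "max (SUP a\<in>A. INF b\<in>B. ennreal (d a b)) (SUP b\<in>B. INF a\<in>A. ennreal (d a b))"
  obtain a0 b0 where "a0 \<in> A" "b0 \<in> B" using ne by blast
  then have "(INF b\<in>B. ennreal (d a b)) \<le> ennreal K" if "a \<in> A" for a
    using bd[OF that] by (meson INF_lower2 ennreal_leI)
  moreover have "(INF a\<in>A. ennreal (d a b)) \<le> ennreal K" if "b \<in> B" for b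
    using bd[OF \<open>a0 \<in> A\<close> that] \<open>a0 \<in> A\<close> by (meson INF_lower2 ennreal_leI)
  ultimately have "?X \<le> ennreal K" by (auto intro!: SUP_least)
  then have fin: "?X < top" by (simp add: order_le_less_trans del: max_less_iff_conj)
  have r: "0 < r" using assms(4) unfolding hausdorff_dist_def by (rule order_le_less_trans[OF enn2real_nonneg])
  have X: "?X < ennreal r" using assms(4) fin r unfolding hausdorff_dist_def
    by (metis ennreal_enn2real ennreal_less_iff enn2real_nonneg)
  show "\<forall>a\<in>A. \<exists>b\<in>B. d a b < r"
  proof
    fix a assume "a \<in> A"
    then have "(INF b\<in>B. ennreal (d a b)) \<le> (SUP a\<in>A. INF b\<in>B. ennreal (d a b))" by (rule SUP_upper)
    then have "(INF b\<in>B. ennreal (d a b)) < ennreal r" using X by auto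
    then obtain b where "b \<in> B" "ennreal (d a b) < ennreal r" by (auto simp: INF_less_iff)
    then show "\<exists>b\<in>B. d a b < r" by (meson ennreal_leI not_le)
  qed
  show "\<forall>b\<in>B. \<exists>a\<in>A. d a b < r"
  proof
    fix b assume "b \<in> B"
    then have "(INF a\<in>A. ennreal (d a b)) \<le> (SUP b\<in>B. INF a\<in>A. ennreal (d a b))" by (rule SUP_upper)
    then have "(INF a\<in>A. ennreal (d a b)) < ennreal r" using X by auto
    then obtain a where "a \<in> A" "ennreal (d a b) < ennreal r" by (auto simp: INF_less_iff)
    then show "\<exists>a\<in>A. d a b < r" by (meson ennreal_leI not_le)
  qed
qed

lemma hausdorff_dist_nonneg [simp]: "0 \<le> hausdorff_dist d A B"
  unfolding hausdorff_dist_def by simp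

lemma hausdorff_dist_commute:
  assumes "\<And>x y. d x y = d y x"
  shows "hausdorff_dist d A B = hausdorff_dist d B A"
proof -
  have swap: "(SUP a\<in>U. INF b\<in>V. ennreal (d a b)) = (SUP a\<in>U. INF b\<in>V. ennreal (d b a))" for U V
    by (intro SUP_cong INF_cong refl arg_cong[where f = ennreal] assms)
  show ?thesis unfolding hausdorff_dist_def swap[of A B] swap[of B A] by (subst max.commute) (rule refl)
qed

section \<open>The space of nonempty compact sets\<close>

context Metric_space
begin

text \<open>The carrier of the Hausdorff metric: between nonempty bounded sets the distance is
  finite, and closed sets at distance 0 agree.\<close>

definition hyper :: "'a set set" where
  "hyper = {K. K \<noteq> {} \<and> compactin mtopology K}"

lemma hyper_subset: "K \<in> hyper \<Longrightarrow> K \<subseteq> M"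
  unfolding hyper_def using compactin_subset_topspace by fastforce

lemma hyperD: "K \<in> hyper \<Longrightarrow> K \<noteq> {}" "K \<in> hyper \<Longrightarrow> compactin mtopology K"
  unfolding hyper_def by auto

lemma hyper_lessD:
  assumes "A \<in> hyper" "B \<in> hyper" "hausdorff_dist d A B < r"
  shows "a \<in> A \<Longrightarrow> \<exists>b\<in>B. d a b < r" "b \<in> B \<Longrightarrow> \<exists>a\<in>A. d a b < r"
proof -
  obtain K where K: "\<And>x y. x \<in> A \<Longrightarrow> y \<in> B \<Longrightarrow> d x y \<le> K"
    using compactin_bounded2[OF hyperD(2)[OF assms(1)] hyperD(2)[OF assms(2)]] by blast
  note * = hausdorff_dist_lessD[OF hyperD(1)[OF assms(1)] hyperD(1)[OF assms(2)] K assms(3)]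
  show "a \<in> A \<Longrightarrow> \<exists>b\<in>B. d a b < r" "b \<in> B \<Longrightarrow> \<exists>a\<in>A. d a b < r" using * by blast+
qed

lemma hausdorff_dist_zero_subset:
  assumes A: "A \<in> hyper" and B: "B \<in> hyper" and "hausdorff_dist d A B = 0"
  shows "A \<subseteq> B"
proof
  fix a assume a: "a \<in> A"
  have "\<exists>b\<in>B. d a b < 1 / real (Suc n)" for n
    by (rule hyper_lessD(1)[OF A B _ a]) (simp add: assms(3))
  then obtain b where b: "\<And>n. b n \<in> B" "\<And>n. d a (b n) < 1 / real (Suc n)" by metis
  have "vanishes (\<lambda>n. d (b n) a)"
    by (rule tendsto_sandwich[OF _ _ tendsto_const LIMSEQ_Suc[OF lim_1_over_n]])
      (use b in \<open>auto intro!: always_eventually less_imp_le simp: commute\<close>)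
  then show "a \<in> B"
    using compactin_closed_seq[OF hyperD(2)[OF B], of b a] b hyper_subset[OF A] a by blast
qed

lemma Metric_space_hyper: "Metric_space hyper (hausdorff_dist d)"
proof
  show "0 \<le> hausdorff_dist d x y" for x y by simp
  show com: "hausdorff_dist d x y = hausdorff_dist d y x" for x y
    by (rule hausdorff_dist_commute) (rule commute)
  show "hausdorff_dist d A B = 0 \<longleftrightarrow> A = B" if "A \<in> hyper" "B \<in> hyper" for A B
  proof
    assume "hausdorff_dist d A B = 0"
    then show "A = B" using hausdorff_dist_zero_subset[of A B] hausdorff_dist_zero_subset[of B A] com that by auto
  next
    assume "A = B"
    moreover have "hausdorff_dist d A A \<le> 0"
      using hyper_subset[OF that(1)] by (intro hausdorff_dist_le) (auto intro!: bexI)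
    ultimately show "hausdorff_dist d A B = 0" using hausdorff_dist_nonneg[of d A B] by (simp add: order_antisym)
  qed
  show "hausdorff_dist d A C \<le> hausdorff_dist d A B + hausdorff_dist d B C"
    if ABC: "A \<in> hyper" "B \<in> hyper" "C \<in> hyper" for A B C
  proof (rule field_le_epsilon)
    fix e :: real assume "e > 0"
    define r where "r = hausdorff_dist d A B + e / 2"
    define s where "s = hausdorff_dist d B C + e / 2"
    have rs: "hausdorff_dist d A B < r" "hausdorff_dist d B C < s" using \<open>e > 0\<close> unfolding r_def s_def by auto
    have sub: "A \<subseteq> M" "B \<subseteq> M" "C \<subseteq> M" using ABC hyper_subset by auto
    note * = hyper_lessD[OF ABC(1,2) rs(1)] and ** = hyper_lessD[OF ABC(2,3) rs(2)]
    have "hausdorff_dist d A C \<le> r + s"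
    proof (rule hausdorff_dist_le)
      fix a assume a: "a \<in> A"
      then obtain b c where "b \<in> B" "d a b < r" "c \<in> C" "d b c < s" using *(1) **(1) by meson
      then show "\<exists>c\<in>C. d a c \<le> r + s" using triangle[of a b c] a sub by (intro bexI[of _ c]) (auto dest!: subsetD)
    next
      fix c assume c: "c \<in> C"
      then obtain a b where "b \<in> B" "d a b < r" "a \<in> A" "d b c < s" using *(2) **(2) by meson
      then show "\<exists>a\<in>A. d a c \<le> r + s" using triangle[of a b c] c sub by (intro bexI[of _ a]) (auto dest!: subsetD)
    next
      show "0 \<le> r + s" using rs hausdorff_dist_nonneg[of d A B] hausdorff_dist_nonneg[of d B C] by linarith
    qed
    then show "hausdorff_dist d A C \<le> hausdorff_dist d A B + hausdorff_dist d B C + e"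
      unfolding r_def s_def by (simp add: field_simps)
  qed
qed

text \<open>The upper half of Hausdorff convergence: the \<open>x n\<close> are shadowed by points
  of the one compact set \<open>L\<close>, where a subsequence converges.\<close>

lemma hyper_limit_subseq:
  assumes "\<And>n. K n \<in> hyper" "L \<in> hyper" "vanishes (\<lambda>n. hausdorff_dist d (K n) L)" "\<And>n. x n \<in> K n"
  obtains r l where "strict_mono (r :: nat \<Rightarrow> nat)" "l \<in> L" "vanishes (\<lambda>n. d (x (r n)) l)"
proof -
  have "\<exists>y\<in>L. d (x n) y < hausdorff_dist d (K n) L + 1 / real (Suc n)" for n
    by (rule hyper_lessD(1)[OF assms(1,2) _ assms(4)]) simp
  then obtain y where y: "\<And>n. y n \<in> L" "\<And>n. d (x n) (y n) < hausdorff_dist d (K n) L + 1 / real (Suc n)" by metis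
  have M: "x n \<in> M" "y n \<in> M" for n using assms(1,2,4) y hyper_subset by blast+
  have xy: "vanishes (\<lambda>n. d (x n) (y n))"
  proof (rule tendsto_sandwich[OF _ _ tendsto_const])
    show "vanishes (\<lambda>n. hausdorff_dist d (K n) L + 1 / real (Suc n))"
      using tendsto_add[OF assms(3) LIMSEQ_Suc[OF lim_1_over_n]] by simp
  qed (use y in \<open>auto intro!: always_eventually less_imp_le\<close>)
  obtain r l where r: "strict_mono r" "l \<in> L" "vanishes (\<lambda>n. d (y (r n)) l)"
    by (rule compactin_subseq[OF hyperD(2)[OF assms(2)] y(1)])
  have "vanishes (\<lambda>n. d (x (r n)) l)"
  proof (rule tendsto_dist_trans[OF _ _ _ _ r(3)])
    show "vanishes (\<lambda>n. d (x (r n)) (y (r n)))"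
      using LIMSEQ_subseq_LIMSEQ[OF xy r(1)] by (simp add: o_def)
  qed (use M r hyper_subset[OF assms(2)] in auto)
  then show ?thesis using that r by blast
qed

text \<open>The lower half of Hausdorff convergence: no point of \<open>L\<close> appears only in
  the limit.\<close>

lemma hyper_limit_approx:
  assumes "\<And>n. K n \<in> hyper" "L \<in> hyper" "vanishes (\<lambda>n. hausdorff_dist d (K n) L)" "l \<in> L"
  obtains x where "\<And>n. x n \<in> K n" "vanishes (\<lambda>n. d (x n) l)"
proof -
  have "\<exists>x\<in>K n. d x l < hausdorff_dist d (K n) L + 1 / real (Suc n)" for n
    by (rule hyper_lessD(2)[OF assms(1,2) _ assms(4)]) simp
  then obtain x where x: "\<And>n. x n \<in> K n" "\<And>n. d (x n) l < hausdorff_dist d (K n) L + 1 / real (Suc n)" by metis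
  have "vanishes (\<lambda>n. d (x n) l)"
  proof (rule tendsto_sandwich[OF _ _ tendsto_const])
    show "vanishes (\<lambda>n. hausdorff_dist d (K n) L + 1 / real (Suc n))"
      using tendsto_add[OF assms(3) LIMSEQ_Suc[OF lim_1_over_n]] by simp
  qed (use x in \<open>auto intro!: always_eventually less_imp_le\<close>)
  then show ?thesis using that x by blast
qed

text \<open>The limit \<open>L\<close> is the lower limit of the sets. Every point of a late
  \<open>K n\<close> has a point of \<open>L\<close> nearby, namely the limit of a chain that runs
  through later and later sets with geometrically decreasing steps. Compactness of \<open>L\<close>
  comes from a finite net of a late \<open>K N\<close>, moved into \<open>L\<close>.\<close>

lemma hyper_mcomplete:
  assumes "mcomplete"
  shows "Metric_space.mcomplete hyper (hausdorff_dist d)"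
proof -
  interpret H: Metric_space hyper "hausdorff_dist d" by (rule Metric_space_hyper)
  show ?thesis
    unfolding H.mcomplete_def
  proof (intro allI impI)
    fix K assume K: "H.MCauchy K"
    then have Kh: "K n \<in> hyper" for n unfolding H.MCauchy_def by blast
    have KM: "K n \<subseteq> M" for n using Kh hyper_subset by blast
    have Kc: "\<exists>N. \<forall>n\<ge>N. \<forall>m\<ge>N. hausdorff_dist d (K n) (K m) < e" if "e > 0" for e
      using K that unfolding H.MCauchy_def by meson
    define L where "L = {x \<in> M. \<forall>e>0. \<exists>N. \<forall>n\<ge>N. \<exists>y\<in>K n. d x y < e}"
    have near: "\<exists>x\<in>L. d y x \<le> 2 * e" if "e > 0" and N: "\<forall>n\<ge>N. \<forall>m\<ge>N. hausdorff_dist d (K n) (K m) < e"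
      and n: "n \<ge> N" and y: "y \<in> K n" for e N n y
    proof -
      have "\<forall>k. \<exists>N. \<forall>n\<ge>N. \<forall>m\<ge>N. hausdorff_dist d (K n) (K m) < e / 2 ^ k" using Kc \<open>e > 0\<close> by simp
      then obtain N' where N': "\<And>k n m. n \<ge> N' k \<Longrightarrow> m \<ge> N' k \<Longrightarrow> hausdorff_dist d (K n) (K m) < e / 2 ^ k" by metis
      \<comment> \<open>The indices of the chain. It starts in the given set \<open>K n\<close>; the
        later indices lie beyond the threshold \<open>N' k\<close> for the step
        \<open>e / 2 ^ k\<close>, and taking maxima makes them nondecreasing.\<close>
      define c where "c k = (if k = 0 then n else Max (insert n (N' ` {..k})))" for k
      have c0: "c 0 = n" by (simp add: c_def)
      have cN: "N' k \<le> c k" if "k > 0" for k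
      proof -
        have "N' k \<le> Max (insert n (N' ` {..k}))" by (rule Max_ge) auto
        then show ?thesis unfolding c_def using that by simp
      qed
      have cmono: "c k \<le> c (Suc k)" for k
      proof -
        have "Max (insert n (N' ` {..k})) \<le> Max (insert n (N' ` {..Suc k}))" by (rule Max_mono) auto
        moreover have "n \<le> Max (insert n (N' ` {..Suc k}))" by (rule Max_ge) auto
        ultimately show ?thesis unfolding c_def by simp
      qed
      have cstep: "hausdorff_dist d (K (c k)) (K m) < e / 2 ^ k" if "m \<ge> c k" for k m
      proof (cases "k = 0")
        case True then show ?thesis using N n that by (simp add: c_def)
      next
        case False then show ?thesis using cN[of k] that by (intro N') auto
      qed
      \<comment> \<open>The clause for \<open>k = 0\<close> ties the start of the chain to the given
        \<open>y\<close>.\<close>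
      have "\<exists>z. \<forall>k. (z k \<in> K (c k) \<and> (k = 0 \<longrightarrow> z k = y)) \<and> d (z k) (z (Suc k)) < e / 2 ^ k"
      proof (rule dependent_nat_choice)
        show "\<exists>x. x \<in> K (c 0) \<and> (0 = (0::nat) \<longrightarrow> x = y)" using y c0 by auto
        fix x k assume x: "x \<in> K (c k) \<and> (k = 0 \<longrightarrow> x = y)"
        have "\<exists>b\<in>K (c (Suc k)). d x b < e / 2 ^ k"
          using hyper_lessD(1)[OF Kh Kh cstep[OF cmono]] x by blast
        then show "\<exists>b. (b \<in> K (c (Suc k)) \<and> (Suc k = 0 \<longrightarrow> b = y)) \<and> d x b < e / 2 ^ k" by blast
      qed
      then obtain z where z: "\<And>k. z k \<in> K (c k)" "z 0 = y" "\<And>k. d (z k) (z (Suc k)) < e / 2 ^ k" by blast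
      obtain x where x: "x \<in> M" "\<And>k. d (z k) x \<le> 2 * e / 2 ^ k"
      proof (rule geometric_limit[OF assms, of z e])
        show "z k \<in> M" for k using z(1) KM by blast
        show "d (z k) (z (Suc k)) \<le> e / 2 ^ k" for k using z(3)[of k] by simp
      qed blast
      have "x \<in> L"
        unfolding L_def
      proof (clarsimp simp: x(1))
        fix \<epsilon> :: real assume "\<epsilon> > 0"
        have "vanishes (\<lambda>k. (3 * e) / 2 ^ k)" by (rule LIMSEQ_divide_realpow_zero) simp
        then have "\<forall>\<^sub>F k in sequentially. 3 * e / 2 ^ k < \<epsilon>" by (rule order_tendstoD(2)) fact
        then obtain k where k: "3 * e / 2 ^ k < \<epsilon>" unfolding eventually_sequentially by (meson order_refl)
        have "\<exists>b\<in>K m. d x b < \<epsilon>" if m: "m \<ge> c k" for m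
        proof -
          obtain b where b: "b \<in> K m" "d (z k) b < e / 2 ^ k"
            using hyper_lessD(1)[OF Kh Kh cstep[OF m] z(1)] by blast
          have "d x b \<le> d (z k) x + d (z k) b" using triangle''[of x "z k" b] x z(1) b KM by blast
          also have "\<dots> < 3 * e / 2 ^ k" using b x(2)[of k] by (simp add: field_simps)
          finally show ?thesis using b k by force
        qed
        then show "\<exists>N. \<forall>n\<ge>N. \<exists>y\<in>K n. d x y < \<epsilon>" by blast
      qed
      then show ?thesis using x(2)[of 0] z(2) by auto
    qed
    have near': "\<exists>y\<in>K n. d y x \<le> 2 * e" if "e > 0" and N: "\<forall>n\<ge>N. \<forall>m\<ge>N. hausdorff_dist d (K n) (K m) < e"
      and n: "n \<ge> N" and x: "x \<in> L" for e N n x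
    proof -
      obtain N' where "\<forall>n\<ge>N'. \<exists>y\<in>K n. d x y < e" using x \<open>e > 0\<close> unfolding L_def by blast
      then obtain y where y: "y \<in> K (max N N')" "d x y < e" by (meson max.cobounded2)
      have "hausdorff_dist d (K n) (K (max N N')) < e" using N n by simp
      then obtain b where b: "b \<in> K n" "d b y < e" using hyper_lessD(2)[OF Kh Kh _ y(1)] by blast
      then have "d b x \<le> d b y + d x y" using triangle'[of b y x] y x KM unfolding L_def by blast
      then show ?thesis using b y by (intro bexI[of _ b]) auto
    qed
    have LM: "L \<subseteq> M" unfolding L_def by blast
    have "L \<noteq> {}"
    proof -
      obtain N where "\<forall>n\<ge>N. \<forall>m\<ge>N. hausdorff_dist d (K n) (K m) < 1" using Kc[of 1] by auto
      moreover obtain y where "y \<in> K N" using hyperD(1)[OF Kh] by blast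
      ultimately show ?thesis using near[of 1 N N y] by auto
    qed
    moreover have "compactin mtopology L"
    proof -
      have "closedin mtopology L"
      proof (rule closedin_seqI[OF LM])
        fix \<sigma> l assume \<sigma>: "\<And>n. \<sigma> n \<in> L" "l \<in> M" "vanishes (\<lambda>n. d (\<sigma> n) l)"
        show "l \<in> L"
          unfolding L_def
        proof (clarsimp simp: \<sigma>(2))
          fix e :: real assume "e > 0"
          then obtain k where k: "d (\<sigma> k) l < e / 2"
            using order_tendstoD(2)[OF \<sigma>(3), of "e / 2"] unfolding eventually_sequentially by auto
          have "\<forall>e>0. \<exists>N. \<forall>n\<ge>N. \<exists>y\<in>K n. d (\<sigma> k) y < e" using \<sigma>(1)[of k] unfolding L_def by simp
          moreover have "e / 2 > 0" using \<open>e > 0\<close> by simp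
          ultimately obtain N where N: "\<forall>n\<ge>N. \<exists>y\<in>K n. d (\<sigma> k) y < e / 2" by blast
          have "\<exists>y\<in>K n. d l y < e" if "n \<ge> N" for n
          proof -
            obtain y where y: "y \<in> K n" "d (\<sigma> k) y < e / 2" using N \<open>n \<ge> N\<close> by blast
            moreover have "\<sigma> k \<in> M" "y \<in> M" using y KM LM \<sigma>(1) by blast+
            ultimately show ?thesis
              using triangle''[of l "\<sigma> k" y] k \<sigma>(1)[of k] \<sigma>(2) KM LM by (intro bexI[of _ y]) auto
          qed
          then show "\<exists>N. \<forall>n\<ge>N. \<exists>y\<in>K n. d l y < e" by blast
        qed
      qed
      moreover have "mtotally_bounded L"
        unfolding mtotally_bounded_def
      proof (intro allI impI)
        fix \<epsilon> :: real assume "\<epsilon> > 0"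
        \<comment> \<open>The way from \<open>p a\<close> via \<open>a\<close> and \<open>y\<close>
          to \<open>x\<close> has length at most \<open>2 * e + e + 2 * e\<close>.\<close>
        define e where "e = \<epsilon> / 8"
        have e: "e > 0" using \<open>\<epsilon> > 0\<close> by (simp add: e_def)
        obtain N where N: "\<forall>n\<ge>N. \<forall>m\<ge>N. hausdorff_dist d (K n) (K m) < e" using Kc[OF e] by auto
        obtain F where F: "finite F" "F \<subseteq> K N" "K N \<subseteq> (\<Union>x\<in>F. mball x e)"
          using compactin_imp_mtotally_bounded[OF hyperD(2)[OF Kh]] e unfolding mtotally_bounded_def by meson
        have "\<exists>x\<in>L. d a x \<le> 2 * e" if "a \<in> F" for a using near[OF e N order_refl] that F(2) by blast
        then obtain p where p: "\<And>a. a \<in> F \<Longrightarrow> p a \<in> L \<and> d a (p a) \<le> 2 * e" by metis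
        have "x \<in> (\<Union>a\<in>p ` F. mball a \<epsilon>)" if xL: "x \<in> L" for x
        proof -
          obtain y where y: "y \<in> K N" "d y x \<le> 2 * e" using near'[OF e N order_refl xL] by blast
          then obtain a where a: "a \<in> F" "d a y < e" using F(3) by auto
          have M: "a \<in> M" "y \<in> M" "x \<in> M" "p a \<in> M" using a F(2) KM y LM xL p[OF a(1)] by blast+
          have "d (p a) x \<le> d a (p a) + (d a y + d y x)"
            using triangle''[of "p a" a x] triangle[of a y x] M by linarith
          also have "\<dots> < \<epsilon>" using a y p[OF a(1)] e unfolding e_def by linarith
          finally show ?thesis using a M by auto
        qed
        then show "\<exists>K. finite K \<and> K \<subseteq> L \<and> L \<subseteq> (\<Union>x\<in>K. mball x \<epsilon>)"
          using F(1) p by (intro exI[of _ "p ` F"]) auto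
      qed
      ultimately show ?thesis
        using mtotally_bounded_eq_compact_closure_of[OF assms, of L] by (simp add: closure_of_closedin)
    qed
    ultimately have Lh: "L \<in> hyper" unfolding hyper_def by blast
    have "limitin H.mtopology K L sequentially"
      unfolding H.limit_metric_sequentially
    proof (intro conjI allI impI Lh)
      fix \<epsilon> :: real assume "\<epsilon> > 0"
      then have e: "\<epsilon> / 4 > 0" by simp
      obtain N where N: "\<forall>n\<ge>N. \<forall>m\<ge>N. hausdorff_dist d (K n) (K m) < \<epsilon> / 4" using Kc[OF e] by auto
      have "hausdorff_dist d (K n) L < \<epsilon>" if "n \<ge> N" for n
      proof -
        have "hausdorff_dist d (K n) L \<le> 2 * (\<epsilon> / 4)"
          by (rule hausdorff_dist_le) (use near[OF e N that] near'[OF e N that] e in auto)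
        then show ?thesis using e by linarith
      qed
      then show "\<exists>N. \<forall>n\<ge>N. K n \<in> hyper \<and> hausdorff_dist d (K n) L < \<epsilon>" using Kh by blast
    qed
    then show "\<exists>x. limitin H.mtopology K x sequentially" by blast
  qed
qed

text \<open>A finite net of \<open>K\<close> approximates \<open>K\<close> itself and can be moved
  point by point into \<open>D\<close>.\<close>

lemma hyper_dense_set:
  assumes "dense_set D"
  shows "Metric_space.dense_set hyper (hausdorff_dist d) {F. finite F \<and> F \<subseteq> D \<and> F \<noteq> {}}"
proof -
  interpret H: Metric_space hyper "hausdorff_dist d" by (rule Metric_space_hyper)
  have D: "countable D" "D \<subseteq> M" "\<And>x e. x \<in> M \<Longrightarrow> e > 0 \<Longrightarrow> \<exists>a\<in>D. d x a < e" using assms unfolding dense_set_def by auto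
  show ?thesis
    unfolding H.dense_set_def
  proof (intro conjI ballI allI impI)
    show "countable {F. finite F \<and> F \<subseteq> D \<and> F \<noteq> {}}"
      by (rule countable_subset[OF _ countable_Collect_finite_subset[OF D(1)]]) auto
    show "{F. finite F \<and> F \<subseteq> D \<and> F \<noteq> {}} \<subseteq> hyper"
      unfolding hyper_def using D(2) by (auto intro!: finite_imp_compactin)
    fix K and e :: real assume K: "K \<in> hyper" and "e > 0"
    then have e: "e / 4 > 0" by simp
    have KM: "K \<subseteq> M" using K hyper_subset by blast
    obtain F where F: "finite F" "F \<subseteq> K" "K \<subseteq> (\<Union>x\<in>F. mball x (e / 4))"
      using compactin_imp_mtotally_bounded[OF hyperD(2)[OF K]] e unfolding mtotally_bounded_def by meson
    have "\<exists>a\<in>D. d x a < e / 4" if "x \<in> F" for x using D(3)[OF _ e] that F(2) KM by blast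
    then obtain p where p: "\<And>a. a \<in> F \<Longrightarrow> p a \<in> D \<and> d a (p a) < e / 4" by metis
    have "hausdorff_dist d K (p ` F) \<le> e / 2"
    proof (rule hausdorff_dist_le)
      fix x assume x: "x \<in> K"
      then obtain a where a: "a \<in> F" "d a x < e / 4" using F(3) by auto
      then have "d x (p a) \<le> d a x + d a (p a)" using triangle''[of x a "p a"] x KM F(2) p[of a] D(2) by blast
      then show "\<exists>b\<in>p ` F. d x b \<le> e / 2" using a p[of a] by (intro bexI[of _ "p a"]) auto
    next
      fix b assume "b \<in> p ` F"
      then obtain a where "a \<in> F" "b = p a" by blast
      then show "\<exists>a\<in>K. d a b \<le> e / 2" using p[of a] F(2) e by (intro bexI[of _ a]) auto
    qed (use e in simp)
    moreover have "F \<noteq> {}" using F(3) hyperD(1)[OF K] by auto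
    ultimately show "\<exists>a\<in>{F. finite F \<and> F \<subseteq> D \<and> F \<noteq> {}}. hausdorff_dist d K a < e"
      using F(1) p e by (intro bexI[of _ "p ` F"]) auto
  qed
qed

subsection \<open>The maximum metric on a product\<close>

lemma max_dist_simp [simp]: "max_dist d (a, b) (a', b') = max (d a a') (d b b')"
  by (simp add: max_dist_def)

lemma max_dist_eq: "max_dist d p q = max (d (fst p) (fst q)) (d (snd p) (snd q))"
  by (simp add: max_dist_def case_prod_beta)

lemma Metric_space_max_dist: "Metric_space (M \<times> M) (max_dist d)"
proof
  show "0 \<le> max_dist d x y" for x y by (simp add: max_dist_eq le_max_iff_disj)
  show "max_dist d x y = max_dist d y x" for x y by (simp add: max_dist_eq commute)
  show "max_dist d x y = 0 \<longleftrightarrow> x = y" if "x \<in> M \<times> M" "y \<in> M \<times> M" for x y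
  proof -
    have "max_dist d x y = 0 \<longleftrightarrow> d (fst x) (fst y) = 0 \<and> d (snd x) (snd y) = 0"
      using nonneg[of "fst x" "fst y"] nonneg[of "snd x" "snd y"] unfolding max_dist_eq by linarith
    then show ?thesis using that by (auto simp: prod_eq_iff mem_Times_iff)
  qed
  show "max_dist d x z \<le> max_dist d x y + max_dist d y z" if "x \<in> M \<times> M" "y \<in> M \<times> M" "z \<in> M \<times> M" for x y z
    using that triangle[of "fst x" "fst y" "fst z"] triangle[of "snd x" "snd y" "snd z"]
    unfolding max_dist_eq by (auto simp: max_def)
qed

lemma max_dist_tendsto:
  "vanishes (\<lambda>n. max_dist d (\<sigma> n) l) \<longleftrightarrow>
    vanishes (\<lambda>n. d (fst (\<sigma> n)) (fst l)) \<and> vanishes (\<lambda>n. d (snd (\<sigma> n)) (snd l))" (is "?L \<longleftrightarrow> ?R")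
proof
  assume L: ?L
  show ?R
    by (intro conjI tendsto_sandwich[OF _ _ tendsto_const L]) (auto simp: max_dist_eq)
next
  assume ?R
  then have "(\<lambda>n. max (d (fst (\<sigma> n)) (fst l)) (d (snd (\<sigma> n)) (snd l))) \<longlonglongrightarrow> max 0 0"
    by (intro tendsto_max) auto
  then show ?L by (simp add: max_dist_eq)
qed

lemma mcomplete_max_dist:
  assumes "mcomplete"
  shows "Metric_space.mcomplete (M \<times> M) (max_dist d)"
proof -
  interpret P: Metric_space "M \<times> M" "max_dist d" by (rule Metric_space_max_dist)
  show ?thesis
    unfolding P.mcomplete_def
  proof (intro allI impI)
    fix \<sigma> assume \<sigma>: "P.MCauchy \<sigma>"
    then have r: "\<sigma> n \<in> M \<times> M" for n unfolding P.MCauchy_def by blast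
    then have r1: "fst (\<sigma> n) \<in> M" "snd (\<sigma> n) \<in> M" for n by (auto simp: mem_Times_iff)
    have "MCauchy (fst \<circ> \<sigma>)" "MCauchy (snd \<circ> \<sigma>)"
      using \<sigma> r1 unfolding MCauchy_def P.MCauchy_def max_dist_eq by (auto simp: image_subset_iff, meson+)
    then obtain x y where "limitin mtopology (fst \<circ> \<sigma>) x sequentially" "limitin mtopology (snd \<circ> \<sigma>) y sequentially"
      using assms unfolding mcomplete_def by blast
    moreover then have "x \<in> M" "y \<in> M" using limitin_mspace by blast+
    ultimately have "limitin P.mtopology \<sigma> (x, y) sequentially"
      using r r1 by (simp add: limitin_seq_iff P.limitin_seq_iff max_dist_tendsto)
    then show "\<exists>x. limitin P.mtopology \<sigma> x sequentially" by blast
  qed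
qed

lemma dense_set_max_dist:
  assumes "dense_set D"
  shows "Metric_space.dense_set (M \<times> M) (max_dist d) (D \<times> D)"
proof -
  interpret P: Metric_space "M \<times> M" "max_dist d" by (rule Metric_space_max_dist)
  show ?thesis
    unfolding P.dense_set_def
  proof (intro conjI ballI allI impI)
    fix x and e :: real assume "x \<in> M \<times> M" "e > 0"
    moreover then obtain a b where "a \<in> D" "d (fst x) a < e" "b \<in> D" "d (snd x) b < e"
      using assms unfolding dense_set_def by (metis mem_Times_iff)
    ultimately show "\<exists>a\<in>D \<times> D. max_dist d x a < e" by (intro bexI[of _ "(a, b)"]) (auto simp: max_dist_eq)
  qed (use assms in \<open>auto simp: dense_set_def\<close>)
qed

text \<open>The metric \<open>prod_dist\<close> for the product topology supplies the sequential
  criterion. The hypothesis mentions only the convergence of the two coordinates, so no choice of a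
  product metric is visible afterwards.\<close>

lemma closedin_prod_seqI:
  assumes "S \<subseteq> M \<times> M"
    and "\<And>\<sigma> \<tau> x y. (\<And>n. (\<sigma> n, \<tau> n) \<in> S) \<Longrightarrow> x \<in> M \<Longrightarrow> y \<in> M \<Longrightarrow>
      vanishes (\<lambda>n. d (\<sigma> n) x) \<Longrightarrow> vanishes (\<lambda>n. d (\<tau> n) y) \<Longrightarrow> (x, y) \<in> S"
  shows "closedin (prod_topology mtopology mtopology) S"
proof -
  interpret PP: Metric_space12 M d M d by unfold_locales
  show ?thesis
    unfolding PP.mtopology_prod_metric[symmetric]
  proof (rule PP.Prod_metric.closedin_seqI[OF assms(1)])
    fix \<sigma> l assume \<sigma>: "\<And>n. \<sigma> n \<in> S" "l \<in> M \<times> M" "vanishes (\<lambda>n. prod_dist d d (\<sigma> n) l)"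
    have sM: "\<sigma> n \<in> M \<times> M" for n using \<sigma>(1) assms(1) by blast
    have "limitin PP.Prod_metric.mtopology \<sigma> l sequentially"
      using PP.Prod_metric.limitin_seq_iff[of \<sigma> l] sM \<sigma> by blast
    then have "limitin mtopology (fst \<circ> \<sigma>) (fst l) sequentially" "limitin mtopology (snd \<circ> \<sigma>) (snd l) sequentially"
      unfolding PP.mtopology_prod_metric limitin_pairwise by auto
    then have "vanishes (\<lambda>n. d (fst (\<sigma> n)) (fst l))" "vanishes (\<lambda>n. d (snd (\<sigma> n)) (snd l))"
      using sM \<sigma>(2) limitin_seq_iff[of "fst \<circ> \<sigma>" "fst l"] limitin_seq_iff[of "snd \<circ> \<sigma>" "snd l"]
      by (auto simp: mem_Times_iff)
    then have "(fst l, snd l) \<in> S" using assms(2)[of "fst \<circ> \<sigma>" "snd \<circ> \<sigma>" "fst l" "snd l"] \<sigma>(1,2) by auto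
    then show "l \<in> S" by simp
  qed
qed

lemma closedin_prod_seqD:
  assumes "closedin (prod_topology mtopology mtopology) S" "\<And>n. (\<sigma> n, \<tau> n) \<in> S" "x \<in> M" "y \<in> M"
    "vanishes (\<lambda>n. d (\<sigma> n) x)" "vanishes (\<lambda>n. d (\<tau> n) y)"
  shows "(x, y) \<in> S"
proof -
  have "S \<subseteq> M \<times> M" using closedin_subset[OF assms(1)] by simp
  then have "\<sigma> n \<in> M" "\<tau> n \<in> M" for n using assms(2) by blast+
  then have "limitin (prod_topology mtopology mtopology) (\<lambda>n. (\<sigma> n, \<tau> n)) (x, y) sequentially"
    using assms by (simp add: limitin_pairwise o_def limitin_seq_iff)
  then show ?thesis by (rule limitin_closedin[OF _ assms(1)]) (use assms(2) in simp_all)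
qed

end

section \<open>The squeezed space\<close>

text \<open>An order isomorphism of the extended reals onto \<open>[-1, 1]\<close>. For real
  \<open>t\<close> the distance of its value from the nearer end is \<open>1 / (1 + |t|)\<close>,
  the height of the cone over \<open>X\<close> at time \<open>t\<close>.\<close>

fun squeeze :: "ereal \<Rightarrow> real" where
  "squeeze (ereal t) = t / (1 + \<bar>t\<bar>)"
| "squeeze PInfty = 1"
| "squeeze MInfty = -1"

lemma squeeze_infty [simp]: "squeeze \<infinity> = 1" "squeeze (-\<infinity>) = -1"
  using squeeze.simps(2,3) by (simp_all only: infinity_ereal_def uminus_ereal.simps)

lemma abs_squeeze_ereal: "\<bar>squeeze (ereal t)\<bar> < 1"
  by (auto simp: abs_if field_simps)

lemma squeeze_ereal_bounds: "-1 < squeeze (ereal t)" "squeeze (ereal t) < 1"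
  using abs_squeeze_ereal[of t] unfolding abs_less_iff by linarith+

lemma abs_squeeze_le: "\<bar>squeeze t\<bar> \<le> 1"
  using abs_squeeze_ereal by (cases t) (auto simp: less_imp_le simp del: squeeze.simps(1))

lemma abs_squeeze_eq_1: "\<bar>squeeze t\<bar> = 1 \<longleftrightarrow> t = \<infinity> \<or> t = -\<infinity>"
  using abs_squeeze_ereal by (cases t) (auto simp del: squeeze.simps(1) simp: less_le)

lemma squeeze_strict_mono: "s < t \<Longrightarrow> squeeze s < squeeze t"
proof (cases s; cases t)
  fix a b assume *: "s < t" "s = ereal a" "t = ereal b"
  \<comment> \<open>The part of the cross-multiplied claim that depends on signs: the two sides
    agree unless \<open>a\<close> and \<open>b\<close> have opposite signs.\<close>
  have "a * \<bar>b\<bar> \<le> b * \<bar>a\<bar>"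
    using * by (cases "a \<ge> 0"; cases "b \<ge> 0") (auto simp: mult_nonpos_nonneg mult_nonneg_nonpos)
  then have "a * (1 + \<bar>b\<bar>) < b * (1 + \<bar>a\<bar>)" using * by (simp add: algebra_simps)
  then have "a / (1 + \<bar>a\<bar>) < b / (1 + \<bar>b\<bar>)"
    using frac_less_eq[of "1 + \<bar>a\<bar>" "1 + \<bar>b\<bar>" a b] by (simp add: divide_less_eq less_divide_eq abs_add_one_gt_zero add_pos_nonneg)
  then show "squeeze s < squeeze t" using * by simp
qed (auto simp: squeeze_ereal_bounds simp del: squeeze.simps(1))

lemma squeeze_less_iff: "squeeze s < squeeze t \<longleftrightarrow> s < t"
  using squeeze_strict_mono by (metis less_asym linorder_neqE)

lemma squeeze_le_iff: "squeeze s \<le> squeeze t \<longleftrightarrow> s \<le> t"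
  using squeeze_less_iff by (meson not_le)

lemma squeeze_eq_iff: "squeeze s = squeeze t \<longleftrightarrow> s = t"
  by (simp add: order_eq_iff squeeze_le_iff)

text \<open>The inverse in the open interval is \<open>u / (1 - |u|)\<close>.\<close>

lemma squeeze_surj:
  assumes "\<bar>u\<bar> \<le> 1"
  obtains t where "squeeze t = u"
proof (cases "\<bar>u\<bar> = 1")
  case True
  then show ?thesis using that[of \<infinity>] that[of "-\<infinity>"] by (auto simp: abs_if split: if_splits)
next
  case False
  then have u: "\<bar>u\<bar> < 1" using assms by simp
  then have "1 + \<bar>u / (1 - \<bar>u\<bar>)\<bar> = 1 / (1 - \<bar>u\<bar>)" by (simp add: abs_divide field_simps)
  then have "squeeze (ereal (u / (1 - \<bar>u\<bar>))) = u" using u by simp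
  then show ?thesis by (rule that)
qed

text \<open>The slope of \<open>squeeze\<close> at \<open>t\<close> is
  \<open>1 / (1 + |t|) ^ 2\<close>, hence at most 1; the proof clears denominators instead of
  differentiating.\<close>

lemma squeeze_lipschitz: "\<bar>squeeze (ereal s) - squeeze (ereal t)\<bar> \<le> \<bar>s - t\<bar>"
proof -
  have *: "squeeze (ereal t) - squeeze (ereal s) \<le> t - s" if "s \<le> t" for s t
  proof -
    have "t * \<bar>s\<bar> - s * \<bar>t\<bar> \<le> (t - s) * (\<bar>s\<bar> + \<bar>t\<bar>)"
    proof (cases "s \<ge> 0 \<or> t \<le> 0")
      case True
      then have "t * \<bar>s\<bar> - s * \<bar>t\<bar> = 0" using that by auto
      moreover have "0 \<le> (t - s) * (\<bar>s\<bar> + \<bar>t\<bar>)" using that by simp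
      ultimately show ?thesis by linarith
    next
      \<comment> \<open>Here \<open>s < 0 < t\<close>, and the two sides differ by a sum of
        squares.\<close>
      case False
      then have "(t - s) * (\<bar>s\<bar> + \<bar>t\<bar>) - (t * \<bar>s\<bar> - s * \<bar>t\<bar>) = s * s + t * t" by (simp add: algebra_simps)
      moreover have "0 \<le> s * s + t * t" by simp
      ultimately show ?thesis by linarith
    qed
    moreover have "0 \<le> (t - s) * (\<bar>s\<bar> * \<bar>t\<bar>)" using that by simp
    ultimately have le: "t * (1 + \<bar>s\<bar>) - s * (1 + \<bar>t\<bar>) \<le> (t - s) * ((1 + \<bar>t\<bar>) * (1 + \<bar>s\<bar>))"
      by (simp add: algebra_simps)
    have pos: "0 < 1 + \<bar>t\<bar>" "0 < 1 + \<bar>s\<bar>" by linarith+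
    then have "squeeze (ereal t) - squeeze (ereal s) = (t * (1 + \<bar>s\<bar>) - s * (1 + \<bar>t\<bar>)) / ((1 + \<bar>t\<bar>) * (1 + \<bar>s\<bar>))"
      by (simp add: diff_frac_eq)
    also have "\<dots> \<le> t - s" using le pos by (subst pos_divide_le_eq) auto
    finally show ?thesis .
  qed
  show ?thesis
  proof (cases "s \<le> t")
    case True
    then show ?thesis using *[of s t] squeeze_le_iff[of "ereal s" "ereal t"] by (simp del: squeeze.simps(1))
  next
    case False
    then show ?thesis using *[of t s] squeeze_le_iff[of "ereal t" "ereal s"] by (simp del: squeeze.simps(1))
  qed
qed

text \<open>An order isomorphism respects limits in the order topologies. Bounds outside
  \<open>[-1, 1]\<close> have no preimage under \<open>squeeze\<close>; for them the claim is
  trivial.\<close>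

lemma tendsto_squeeze_iff: "(\<lambda>n. squeeze (f n)) \<longlonglongrightarrow> squeeze t \<longleftrightarrow> f \<longlonglongrightarrow> t"
proof
  assume L: "(\<lambda>n. squeeze (f n)) \<longlonglongrightarrow> squeeze t"
  show "f \<longlonglongrightarrow> t"
    unfolding order_tendsto_iff
    using order_tendstoD(1)[OF L, of "squeeze l" for l] order_tendstoD(2)[OF L, of "squeeze l" for l]
    by (simp add: squeeze_less_iff)
next
  assume R: "f \<longlonglongrightarrow> t"
  show "(\<lambda>n. squeeze (f n)) \<longlonglongrightarrow> squeeze t"
    unfolding order_tendsto_iff
  proof (intro conjI allI impI)
    fix l assume l: "l < squeeze t"
    show "\<forall>\<^sub>F n in sequentially. l < squeeze (f n)"
    proof (cases "l < -1")
      case True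
      then have "l < squeeze s" for s using abs_squeeze_le[of s] by linarith
      then show ?thesis by simp
    next
      case False
      then have "\<bar>l\<bar> \<le> 1" using l abs_squeeze_le[of t] by linarith
      then obtain s where s: "squeeze s = l" by (rule squeeze_surj)
      then show ?thesis using order_tendstoD(1)[OF R, of s] l by (simp add: s[symmetric] squeeze_less_iff)
    qed
  next
    fix l assume l: "squeeze t < l"
    show "\<forall>\<^sub>F n in sequentially. squeeze (f n) < l"
    proof (cases "l > 1")
      case True
      then have "squeeze s < l" for s using abs_squeeze_le[of s] by linarith
      then show ?thesis by simp
    next
      case False
      then have "\<bar>l\<bar> \<le> 1" using l abs_squeeze_le[of t] by linarith
      then obtain s where s: "squeeze s = l" by (rule squeeze_surj)
      then show ?thesis using order_tendstoD(2)[OF R, of s] l by (simp add: s[symmetric] squeeze_less_iff)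
    qed
  qed
qed

text \<open>The minimum is a cone factor: it makes the distance in \<open>X\<close> irrelevant at the two points at
  infinity, where it vanishes.\<close>

definition cone_dist :: "('a \<Rightarrow> 'a \<Rightarrow> real) \<Rightarrow> 'a spoint \<Rightarrow> 'a spoint \<Rightarrow> real" where
  "cone_dist d z w = \<bar>squeeze (snd z) - squeeze (snd w)\<bar> +
     min (1 - \<bar>squeeze (snd z)\<bar>) (1 - \<bar>squeeze (snd w)\<bar>) * min 1 (d (the (fst z)) (the (fst w)))"

lemma squeezed_cases:
  assumes "z \<in> squeezed X"
  obtains x t where "z = (Some x, ereal t)" "x \<in> topspace X" | "z = (None, -\<infinity>)" | "z = (None, \<infinity>)"
  using assms unfolding squeezed_def by blast

lemma squeezed_simps [simp]:
  "(Some x, t) \<in> squeezed X \<longleftrightarrow> x \<in> topspace X \<and> (\<exists>s. t = ereal s)"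
  "(None, t) \<in> squeezed X \<longleftrightarrow> t = \<infinity> \<or> t = -\<infinity>"
  unfolding squeezed_def by auto

text \<open>Here \<open>t\<close>, \<open>u\<close>, \<open>v\<close> are squeezed times and
  \<open>D\<close>, \<open>D1\<close>, \<open>D2\<close> distances in \<open>X\<close>. If the
  height \<open>1 - |u|\<close> is at least the smaller of the other two heights, the factors on the
  right dominate the one on the left. If it is smaller, the detour in time pays for the lost height.
  The last hypothesis is conditional because a point at infinity has no position in
  \<open>X\<close>, so that no triangle inequality is available there.\<close>

lemma cone_triangle:
  fixes t u v D D1 D2 :: real
  assumes "\<bar>t\<bar> \<le> 1" "\<bar>u\<bar> \<le> 1" "\<bar>v\<bar> \<le> 1" "0 \<le> D" "D \<le> 1" "0 \<le> D1" "0 \<le> D2"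
    and "\<bar>u\<bar> < 1 \<Longrightarrow> 0 < min (1 - \<bar>t\<bar>) (1 - \<bar>v\<bar>) \<Longrightarrow> D \<le> D1 + D2"
  shows "\<bar>t - v\<bar> + min (1 - \<bar>t\<bar>) (1 - \<bar>v\<bar>) * D \<le>
    (\<bar>t - u\<bar> + min (1 - \<bar>t\<bar>) (1 - \<bar>u\<bar>) * D1) + (\<bar>u - v\<bar> + min (1 - \<bar>u\<bar>) (1 - \<bar>v\<bar>) * D2)"
proof -
  define m where "m = min (1 - \<bar>t\<bar>) (1 - \<bar>v\<bar>)"
  define b where "b = 1 - \<bar>u\<bar>"
  have nn: "0 \<le> m" "0 \<le> b" using assms unfolding m_def b_def by auto
  have P: "0 \<le> min (1 - \<bar>t\<bar>) b * D1" "0 \<le> min b (1 - \<bar>v\<bar>) * D2"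
    using assms nn by (intro mult_nonneg_nonneg; simp)+
  show ?thesis
  proof (cases "m \<le> b")
    case True
    have "m * D \<le> min (1 - \<bar>t\<bar>) b * D1 + min b (1 - \<bar>v\<bar>) * D2"
    proof (cases "0 < m")
      case m: True
      then have "D \<le> D1 + D2" using True assms(8) unfolding m_def b_def by simp
      then have "m * D \<le> m * D1 + m * D2" using m by (metis distrib_left less_imp_le mult_left_mono)
      also have "\<dots> \<le> min (1 - \<bar>t\<bar>) b * D1 + min b (1 - \<bar>v\<bar>) * D2"
      proof (intro add_mono mult_right_mono)
        show "m \<le> min (1 - \<bar>t\<bar>) b" "m \<le> min b (1 - \<bar>v\<bar>)" using True unfolding m_def by linarith+
      qed (use assms in auto)
      finally show ?thesis .
    qed (use P nn in simp)
    then have "\<bar>t - v\<bar> + m * D \<le> (\<bar>t - u\<bar> + \<bar>u - v\<bar>) + (min (1 - \<bar>t\<bar>) b * D1 + min b (1 - \<bar>v\<bar>) * D2)"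
      by (intro add_mono) linarith+
    then show ?thesis by (simp add: m_def b_def add_ac)
  next
    case False
    then have min: "min (1 - \<bar>t\<bar>) b = b" "min b (1 - \<bar>v\<bar>) = b" unfolding m_def by auto
    \<comment> \<open>Since \<open>|u|\<close> exceeds both \<open>|t|\<close> and
      \<open>|v|\<close> by at least \<open>m - b\<close>, going via \<open>u\<close> is a detour of
      at least this length.\<close>
    have "\<bar>t - v\<bar> + (m - b) \<le> \<bar>t - u\<bar> + \<bar>u - v\<bar>" 
    proof -
      have "m \<le> 1 - \<bar>t\<bar>" "m \<le> 1 - \<bar>v\<bar>" unfolding m_def by auto
      then show ?thesis using False unfolding b_def by (cases "t \<le> v"; cases "0 \<le> u"; linarith)
    qed
    \<comment> \<open>Split \<open>m\<close> into \<open>(m - b) + b\<close>: the excess is charged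
      in full, as \<open>D\<close> is at most 1, and the rest uses the triangle inequality for
      \<open>D\<close>.\<close>
    moreover have "m * D \<le> (m - b) + (b * D1 + b * D2)"
    proof (cases "b = 0")
      case True
      then show ?thesis using assms nn mult_left_le[of D m] by simp
    next
      case b: False
      then have "\<bar>u\<bar> < 1" "0 < m" using False nn unfolding b_def by linarith+
      then have "D \<le> D1 + D2" using assms(8) unfolding m_def by blast
      then have "b * D \<le> b * D1 + b * D2" using nn by (metis distrib_left mult_left_mono)
      moreover have "(m - b) * D \<le> m - b" using False assms mult_left_le[of D "m - b"] by simp
      ultimately show ?thesis by (simp add: algebra_simps)
    qed
    ultimately have "\<bar>t - v\<bar> + m * D \<le> \<bar>t - u\<bar> + \<bar>u - v\<bar> + (b * D1 + b * D2)" by linarith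
    then show ?thesis unfolding m_def[symmetric] b_def[symmetric] min by (simp add: add_ac)
  qed
qed

context Metric_space
begin

lemma Metric_space_cone_dist:
  assumes "topspace X = M"
  shows "Metric_space (squeezed X) (cone_dist d)"
proof
  have nn: "0 \<le> min (1 - \<bar>squeeze s\<bar>) (1 - \<bar>squeeze t\<bar>) * min 1 (d x y)" for s t x y
    using abs_squeeze_le[of s] abs_squeeze_le[of t] by simp
  show "0 \<le> cone_dist d z w" for z w
    unfolding cone_dist_def using nn[of "snd z" "snd w"] by (simp add: add_nonneg_nonneg)
  show "cone_dist d z w = cone_dist d w z" for z w
    unfolding cone_dist_def by (simp add: commute abs_minus_commute min.commute)
  show "cone_dist d z w = 0 \<longleftrightarrow> z = w" if z: "z \<in> squeezed X" and w: "w \<in> squeezed X" for z w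
  proof
    assume 0: "cone_dist d z w = 0"
    then have "squeeze (snd z) = squeeze (snd w)"
      using nn[of "snd z" "snd w" "the (fst z)" "the (fst w)"] unfolding cone_dist_def by linarith
    then have st: "snd z = snd w" by (simp add: squeeze_eq_iff)
    show "z = w"
    proof (cases rule: squeezed_cases[OF z])
      case (1 x t)
      then obtain y where y: "w = (Some y, ereal t)" "y \<in> M" using w st assms by (cases w; cases "fst w") auto
      have "1 - \<bar>squeeze (ereal t)\<bar> > 0" using abs_squeeze_ereal[of t] by simp
      then have "min 1 (d x y) = 0" using 0 st 1 y unfolding cone_dist_def by (simp del: squeeze.simps)
      then show ?thesis using 1 y assms by (auto simp: min_def split: if_splits)
    qed (use w st in \<open>cases w; cases "fst w"; auto\<close>)+
  next
    assume "z = w"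
    show "cone_dist d z w = 0"
    proof (cases rule: squeezed_cases[OF z])
      case (1 x t) then show ?thesis using \<open>z = w\<close> assms unfolding cone_dist_def by simp
    qed (use \<open>z = w\<close> in \<open>simp_all add: cone_dist_def\<close>)
  qed
  show "cone_dist d z v \<le> cone_dist d z w + cone_dist d w v"
    if z: "z \<in> squeezed X" and w: "w \<in> squeezed X" and v: "v \<in> squeezed X" for z w v
  proof -
    \<comment> \<open>\<open>the None\<close> is an arbitrary value that need not lie in
      \<open>M\<close>; it occurs only where the cone factor vanishes.\<close>
    have M: "the (fst z) \<in> M \<or> \<bar>squeeze (snd z)\<bar> = 1" if "z \<in> squeezed X" for z
      using that assms by (cases rule: squeezed_cases) auto
    show ?thesis
      unfolding cone_dist_def
    proof (rule cone_triangle)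
      assume "\<bar>squeeze (snd w)\<bar> < 1" "0 < min (1 - \<bar>squeeze (snd z)\<bar>) (1 - \<bar>squeeze (snd v)\<bar>)"
      then have "the (fst z) \<in> M" "the (fst w) \<in> M" "the (fst v) \<in> M" using M[OF z] M[OF w] M[OF v] by auto
      from triangle[OF this]
      show "min 1 (d (the (fst z)) (the (fst v))) \<le> min 1 (d (the (fst z)) (the (fst w))) + min 1 (d (the (fst w)) (the (fst v)))"
        using nonneg[of "the (fst z)" "the (fst w)"] nonneg[of "the (fst w)" "the (fst v)"] by linarith
    qed (simp_all add: abs_squeeze_le)
  qed
qed

text \<open>The cone factor \<open>p n\<close> tends to the height of the limit point. At a real
  time this is positive, so the distance in \<open>X\<close> can be recovered by division; at
  infinity it is 0 and the position in \<open>X\<close> is forgotten.\<close>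

lemma cone_dist_tendsto_iff:
  assumes "topspace X = M" "\<And>n. \<sigma> n \<in> squeezed X" "z \<in> squeezed X"
  shows "vanishes (\<lambda>n. cone_dist d (\<sigma> n) z) \<longleftrightarrow> (\<lambda>n. snd (\<sigma> n)) \<longlonglongrightarrow> snd z \<and>
     (\<forall>x. fst z = Some x \<longrightarrow> vanishes (\<lambda>n. d (the (fst (\<sigma> n))) x))" (is "?L \<longleftrightarrow> ?T \<and> ?R")
proof -
  define p where "p n = min (1 - \<bar>squeeze (snd (\<sigma> n))\<bar>) (1 - \<bar>squeeze (snd z)\<bar>)" for n
  have p: "0 \<le> p n" for n unfolding p_def using abs_squeeze_le[of "snd (\<sigma> n)"] abs_squeeze_le[of "snd z"] by simp
  have c: "cone_dist d (\<sigma> n) z = \<bar>squeeze (snd (\<sigma> n)) - squeeze (snd z)\<bar> + p n * min 1 (d (the (fst (\<sigma> n))) (the (fst z)))" for n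
    unfolding cone_dist_def p_def by simp
  have pn: "0 \<le> p n * min 1 (d (the (fst (\<sigma> n))) (the (fst z)))" for n using p by simp
  have LT: ?T if ?L
  proof -
    have "vanishes (\<lambda>n. squeeze (snd (\<sigma> n)) - squeeze (snd z))"
      by (rule Lim_null_comparison[OF _ that]) (use c pn in \<open>auto intro!: always_eventually\<close>)
    then have "(\<lambda>n. squeeze (snd (\<sigma> n))) \<longlonglongrightarrow> squeeze (snd z)" by (rule LIM_zero_cancel)
    then show ?T by (simp only: tendsto_squeeze_iff)
  qed
  have sq: "vanishes (\<lambda>n. \<bar>squeeze (snd (\<sigma> n)) - squeeze (snd z)\<bar>)" if ?T
    using that tendsto_squeeze_iff[of "\<lambda>n. snd (\<sigma> n)" "snd z"] by (intro tendsto_rabs_zero LIM_zero) simp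
  have plim: "p \<longlonglongrightarrow> 1 - \<bar>squeeze (snd z)\<bar>" if ?T
  proof -
    have "p \<longlonglongrightarrow> min (1 - \<bar>squeeze (snd z)\<bar>) (1 - \<bar>squeeze (snd z)\<bar>)"
      unfolding p_def using that tendsto_squeeze_iff[of "\<lambda>n. snd (\<sigma> n)" "snd z"] by (intro tendsto_intros) simp
    then show ?thesis by simp
  qed
  have iff: "vanishes (\<lambda>n. p n * min 1 (d (the (fst (\<sigma> n))) (the (fst z)))) \<longleftrightarrow> ?R" if T: ?T
  proof (cases "fst z")
    case None
    then have "1 - \<bar>squeeze (snd z)\<bar> = 0" using assms(3) by (cases z) auto
    then have "p \<longlonglongrightarrow> 0" using plim[OF T] by simp
    have "vanishes (\<lambda>n. p n * min 1 (d (the (fst (\<sigma> n))) (the (fst z))))"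
      by (rule tendsto_sandwich[OF _ _ tendsto_const \<open>p \<longlonglongrightarrow> 0\<close>])
        (use pn p in \<open>auto intro!: always_eventually mult_left_le\<close>)
    then show ?thesis using None by simp
  next
    case (Some x)
    then obtain t where t: "z = (Some x, ereal t)" using assms(3) by (cases z) auto
    then have pos: "1 - \<bar>squeeze (snd z)\<bar> > 0" using abs_squeeze_ereal[of t] by simp
    have "?R" if 0: "vanishes (\<lambda>n. p n * min 1 (d (the (fst (\<sigma> n))) (the (fst z))))"
    proof -
      have "(\<lambda>n. p n * min 1 (d (the (fst (\<sigma> n))) (the (fst z))) / p n) \<longlonglongrightarrow> 0 / (1 - \<bar>squeeze (snd z)\<bar>)"
        using pos by (intro tendsto_divide 0 plim T) simp
      moreover have "\<forall>\<^sub>F n in sequentially. p n * min 1 (d (the (fst (\<sigma> n))) (the (fst z))) / p n = min 1 (d (the (fst (\<sigma> n))) x)"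
        using order_tendstoD(1)[OF plim[OF T] pos] unfolding Some option.sel
      proof eventually_elim
        case (elim n) then show ?case by simp
      qed
      ultimately have m: "vanishes (\<lambda>n. min 1 (d (the (fst (\<sigma> n))) x))" by (simp add: tendsto_cong)
      have "\<forall>\<^sub>F n in sequentially. min 1 (d (the (fst (\<sigma> n))) x) = d (the (fst (\<sigma> n))) x"
        using order_tendstoD(2)[OF m zero_less_one] by eventually_elim (auto simp: min_def)
      then show ?R using m Some by (simp add: tendsto_cong)
    qed
    moreover have "vanishes (\<lambda>n. p n * min 1 (d (the (fst (\<sigma> n))) (the (fst z))))" if R: ?R
    proof -
      have "(\<lambda>n. p n * min 1 (d (the (fst (\<sigma> n))) (the (fst z)))) \<longlonglongrightarrow> (1 - \<bar>squeeze (snd z)\<bar>) * min 1 0"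
        using R Some by (intro tendsto_intros plim T) simp
      then show ?thesis by simp
    qed
    ultimately show ?thesis by blast
  qed
  show ?thesis
  proof
    assume L: ?L
    note T = LT[OF L]
    have "(\<lambda>n. cone_dist d (\<sigma> n) z - \<bar>squeeze (snd (\<sigma> n)) - squeeze (snd z)\<bar>) \<longlonglongrightarrow> 0 - 0"
      by (intro tendsto_diff L sq T)
    then have "vanishes (\<lambda>n. p n * min 1 (d (the (fst (\<sigma> n))) (the (fst z))))" by (simp add: c)
    then show "?T \<and> ?R" using T iff by blast
  next
    assume TR: "?T \<and> ?R"
    have "(\<lambda>n. cone_dist d (\<sigma> n) z) \<longlonglongrightarrow> 0 + 0"
      unfolding c using TR iff by (intro tendsto_add sq) auto
    then show ?L by simp
  qed
qed

text \<open>The times of a Cauchy sequence converge. If their limit is infinite, the sequence tends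
  to the corresponding point at infinity; otherwise the heights eventually stay away from 0, and the
  positions form a Cauchy sequence in \<open>X\<close>.\<close>

lemma mcomplete_cone_dist:
  assumes "topspace X = M" "mcomplete"
  shows "Metric_space.mcomplete (squeezed X) (cone_dist d)"
proof -
  interpret S: Metric_space "squeezed X" "cone_dist d" by (rule Metric_space_cone_dist[OF assms(1)])
  show ?thesis
    unfolding S.mcomplete_def
  proof (intro allI impI)
    fix \<sigma> assume \<sigma>: "S.MCauchy \<sigma>"
    then have rg: "\<sigma> n \<in> squeezed X" for n unfolding S.MCauchy_def by blast
    have Cau: "\<exists>N. \<forall>n\<ge>N. \<forall>m\<ge>N. cone_dist d (\<sigma> n) (\<sigma> m) < e" if "e > 0" for e
      using \<sigma> that unfolding S.MCauchy_def by meson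
    have le: "\<bar>squeeze (snd z) - squeeze (snd w)\<bar> \<le> cone_dist d z w" for z w :: "'a spoint"
      unfolding cone_dist_def using abs_squeeze_le[of "snd z"] abs_squeeze_le[of "snd w"] by simp
    have "Cauchy (\<lambda>n. squeeze (snd (\<sigma> n)))"
    proof (rule CauchyI)
      fix e :: real assume "e > 0"
      then obtain N where "\<forall>n\<ge>N. \<forall>m\<ge>N. cone_dist d (\<sigma> n) (\<sigma> m) < e" using Cau by blast
      then show "\<exists>M. \<forall>m\<ge>M. \<forall>n\<ge>M. norm (squeeze (snd (\<sigma> m)) - squeeze (snd (\<sigma> n))) < e"
        using le order_le_less_trans unfolding real_norm_def by blast
    qed
    then obtain u where u: "(\<lambda>n. squeeze (snd (\<sigma> n))) \<longlonglongrightarrow> u" using Cauchy_convergent convergent_def by blast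
    have "\<bar>u\<bar> \<le> 1"
      by (rule LIMSEQ_le_const2[OF tendsto_rabs[OF u]]) (auto simp: abs_squeeze_le)
    then obtain t where t: "squeeze t = u" by (rule squeeze_surj)
    then have T: "(\<lambda>n. snd (\<sigma> n)) \<longlonglongrightarrow> t" using u tendsto_squeeze_iff[of "\<lambda>n. snd (\<sigma> n)" t] by simp
    show "\<exists>x. limitin S.mtopology \<sigma> x sequentially"
    proof (cases "\<bar>t\<bar> = \<infinity>")
      case True
      then have "(None, t) \<in> squeezed X" by (cases t) auto
      moreover have "vanishes (\<lambda>n. cone_dist d (\<sigma> n) (None, t))"
        using cone_dist_tendsto_iff[OF assms(1), of \<sigma> "(None, t)"] rg calculation T by simp
      ultimately show ?thesis using S.limitin_seq_iff[of \<sigma> "(None, t)"] rg by blast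
    next
      case False
      \<comment> \<open>Half the height at the limit time. Late points are higher than
        \<open>c\<close>, so their distances in \<open>X\<close>, truncated at 1, are at most
        \<open>1 / c\<close> times their cone distances.\<close>
      define c where "c = (1 - \<bar>u\<bar>) / 2"
      have "\<bar>u\<bar> \<noteq> 1" using False t abs_squeeze_eq_1[of t] by auto
      then have c: "c > 0" unfolding c_def using \<open>\<bar>u\<bar> \<le> 1\<close> by simp
      have "\<forall>\<^sub>F n in sequentially. \<bar>squeeze (snd (\<sigma> n))\<bar> < 1 - c"
        by (rule order_tendstoD(2)[OF tendsto_rabs[OF u]]) (use c in \<open>simp add: c_def\<close>, simp add: field_simps)
      then obtain N0 where N0: "\<And>n. n \<ge> N0 \<Longrightarrow> \<bar>squeeze (snd (\<sigma> n))\<bar> < 1 - c"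
        unfolding eventually_sequentially by blast
      have xM: "the (fst (\<sigma> n)) \<in> M" if "n \<ge> N0" for n
        using rg[of n] N0[OF that] c assms(1) by (cases rule: squeezed_cases) auto
      define x where "x n = the (fst (\<sigma> (n + N0)))" for n
      have "MCauchy x"
        unfolding MCauchy_def
      proof (intro conjI allI impI)
        show "range x \<subseteq> M" using xM by (auto simp: x_def)
        fix e :: real assume "e > 0"
        then obtain N where N: "\<forall>n\<ge>N. \<forall>m\<ge>N. cone_dist d (\<sigma> n) (\<sigma> m) < c * min 1 e" using Cau[of "c * min 1 e"] c by auto
        have "d (x n) (x m) < e" if "N \<le> n" "N \<le> m" for n m
        proof -
          have "c * min 1 (d (x n) (x m)) \<le> cone_dist d (\<sigma> (n + N0)) (\<sigma> (m + N0))"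
          proof -
            have "c \<le> min (1 - \<bar>squeeze (snd (\<sigma> (n + N0)))\<bar>) (1 - \<bar>squeeze (snd (\<sigma> (m + N0)))\<bar>)"
              using N0[of "n + N0"] N0[of "m + N0"] by simp
            then have "c * min 1 (d (x n) (x m)) \<le> min (1 - \<bar>squeeze (snd (\<sigma> (n + N0)))\<bar>) (1 - \<bar>squeeze (snd (\<sigma> (m + N0)))\<bar>) * min 1 (d (x n) (x m))"
              by (rule mult_right_mono) simp
            then show ?thesis unfolding cone_dist_def x_def by linarith
          qed
          also have "\<dots> < c * min 1 e" using N that by simp
          finally show ?thesis using c by (simp add: min_def split: if_splits)
        qed
        then show "\<exists>N. \<forall>n n'. N \<le> n \<longrightarrow> N \<le> n' \<longrightarrow> d (x n) (x n') < e" by blast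
      qed
      then obtain l where "limitin mtopology x l sequentially" using assms(2) mcomplete_def by blast
      then have l: "l \<in> M" "vanishes (\<lambda>n. d (x n) l)" using limitin_mspace limitin_seq_iff[of x l] xM by (auto simp: x_def)
      have "vanishes (\<lambda>n. d (the (fst (\<sigma> n))) l)"
        using l(2) unfolding x_def by (rule LIMSEQ_offset)
      moreover have z: "(Some l, t) \<in> squeezed X" using l assms(1) False by (cases t) auto
      ultimately have "vanishes (\<lambda>n. cone_dist d (\<sigma> n) (Some l, t))"
        using cone_dist_tendsto_iff[OF assms(1), of \<sigma> "(Some l, t)"] rg T by simp
      then show ?thesis using S.limitin_seq_iff[of \<sigma> "(Some l, t)"] rg z by blast
    qed
  qed
qed

lemma dense_set_cone_dist:
  assumes "topspace X = M" "dense_set D"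
  shows "Metric_space.dense_set (squeezed X) (cone_dist d)
    ((\<lambda>(x, t). (Some x, ereal t)) ` (D \<times> \<rat>) \<union> {(None, -\<infinity>), (None, \<infinity>)})"
proof -
  interpret S: Metric_space "squeezed X" "cone_dist d" by (rule Metric_space_cone_dist[OF assms(1)])
  have D: "countable D" "D \<subseteq> M" "\<And>x e. x \<in> M \<Longrightarrow> e > 0 \<Longrightarrow> \<exists>a\<in>D. d x a < e" using assms unfolding dense_set_def by auto
  show ?thesis
    unfolding S.dense_set_def
  proof (intro conjI ballI allI impI)
    fix z and e :: real assume z: "z \<in> squeezed X" and "e > 0"
    show "\<exists>a\<in>(\<lambda>(x, t). (Some x, ereal t)) ` (D \<times> \<rat>) \<union> {(None, -\<infinity>), (None, \<infinity>)}. cone_dist d z a < e"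
    proof (cases rule: squeezed_cases[OF z])
      case (1 x t)
      obtain a where a: "a \<in> D" "d x a < e / 2" using D(3)[of x "e / 2"] 1 assms \<open>e > 0\<close> by auto
      obtain q where q: "q \<in> \<rat>" "t - e / 2 < q" "q < t + e / 2" using Rats_dense_in_real[of "t - e / 2" "t + e / 2"] \<open>e > 0\<close> by auto
      have "cone_dist d z (Some a, ereal q) \<le> \<bar>t - q\<bar> + 1 * d x a"
        unfolding cone_dist_def 1 snd_conv fst_conv option.sel
        by (intro add_mono mult_mono squeeze_lipschitz) (auto simp del: squeeze.simps simp: min_le_iff_disj)
      also have "\<dots> < e" using a q by (auto simp: abs_if)
      finally show ?thesis using a q by force
    qed (use \<open>e > 0\<close> in \<open>auto simp: cone_dist_def\<close>)
  qed (use D assms in \<open>auto simp: countable_rat\<close>)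
qed

end

text \<open>The cone metric shows that the topology described in the definition exists; metrizable
  topologies with the same convergent sequences coincide.\<close>

lemma squeezed_topology_eq:
  assumes "metrizes d X"
  shows "squeezed_topology X = Metric_space.mtopology (squeezed X) (cone_dist d)"
proof -
  interpret M: Metric_space "topspace X" d using assms unfolding metrizes_def by blast
  have X: "M.mtopology = X" using assms unfolding metrizes_def by blast
  interpret S: Metric_space "squeezed X" "cone_dist d" by (rule M.Metric_space_cone_dist) simp
  \<comment> \<open>Convergence in \<open>X\<close> requires that the positions eventually belong to
    \<open>X\<close>, while \<open>the None\<close> may lie anywhere. A real limit time leaves only
    finitely many indices at infinity.\<close>
  have fin: "finite {n. fst (\<sigma> n) = None}"
    if "\<And>n. \<sigma> n \<in> squeezed X" "(\<lambda>n. snd (\<sigma> n)) \<longlonglongrightarrow> ereal t" for \<sigma> t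
  proof -
    have "\<forall>\<^sub>F n in sequentially. snd (\<sigma> n) < \<infinity>" "\<forall>\<^sub>F n in sequentially. -\<infinity> < snd (\<sigma> n)"
      using order_tendstoD(1)[OF that(2), of "-\<infinity>"] order_tendstoD(2)[OF that(2), of \<infinity>] by simp_all
    then have "\<forall>\<^sub>F n in sequentially. fst (\<sigma> n) \<noteq> None"
    proof eventually_elim
      case (elim n) show ?case by (rule squeezed_cases[OF that(1)[of n]]) (use elim in auto)
    qed
    then show ?thesis by (simp add: cofinite_eq_sequentially[symmetric] eventually_cofinite)
  qed
  have char: "limitin S.mtopology \<sigma> z sequentially \<longleftrightarrow> (\<lambda>n. snd (\<sigma> n)) \<longlonglongrightarrow> snd z \<and>
       (\<forall>x. fst z = Some x \<longrightarrow> limitin X (\<lambda>n. the (fst (\<sigma> n))) x sequentially)"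
    if "range \<sigma> \<subseteq> squeezed X" "z \<in> squeezed X" for \<sigma> z
  proof -
    have rg: "\<sigma> n \<in> squeezed X" for n using that by blast
    have "limitin X (\<lambda>n. the (fst (\<sigma> n))) x sequentially \<longleftrightarrow> vanishes (\<lambda>n. d (the (fst (\<sigma> n))) x)"
      if *: "(\<lambda>n. snd (\<sigma> n)) \<longlonglongrightarrow> snd z" "fst z = Some x" for x
    proof -
      obtain t where t: "snd z = ereal t" "x \<in> topspace X" using \<open>z \<in> squeezed X\<close> * by (cases z) auto
      have "(\<lambda>n. snd (\<sigma> n)) \<longlonglongrightarrow> ereal t" using * t by simp
      then have "\<forall>\<^sub>F n in sequentially. fst (\<sigma> n) \<noteq> None"
        using fin[OF rg] by (simp add: cofinite_eq_sequentially[symmetric] eventually_cofinite)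
      then have ev: "\<forall>\<^sub>F n in sequentially. the (fst (\<sigma> n)) \<in> topspace X"
      proof eventually_elim
        case (elim n) show ?case by (rule squeezed_cases[OF rg[of n]]) (use elim in auto)
      qed
      have "limitin M.mtopology (\<lambda>n. the (fst (\<sigma> n))) x sequentially \<longleftrightarrow> (\<forall>e>0. \<forall>\<^sub>F n in sequentially. d (the (fst (\<sigma> n))) x < e)"
        using t ev by (simp add: M.limitin_metric eventually_conj_iff)
      then show ?thesis unfolding X tendsto_iff by simp
    qed
    moreover have "limitin S.mtopology \<sigma> z sequentially \<longleftrightarrow> vanishes (\<lambda>n. cone_dist d (\<sigma> n) z)"
      by (rule S.limitin_seq_iff) (use rg that in auto)
    ultimately show ?thesis using M.cone_dist_tendsto_iff[of X \<sigma> z, OF refl rg that(2)] by blast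
  qed
  show ?thesis
    unfolding squeezed_topology_def
  proof (rule the_equality)
    show "topspace S.mtopology = squeezed X \<and> metrizable_space S.mtopology \<and>
     (\<forall>\<sigma> z. range \<sigma> \<subseteq> squeezed X \<longrightarrow> z \<in> squeezed X \<longrightarrow>
        (limitin S.mtopology \<sigma> z sequentially \<longleftrightarrow>
           (\<lambda>n. snd (\<sigma> n)) \<longlonglongrightarrow> snd z \<and>
           (\<forall>x. fst z = Some x \<longrightarrow> limitin X (\<lambda>n. the (fst (\<sigma> n))) x sequentially)))"
      using char S.metrizable_space_mtopology by simp
  next
    fix T
    assume T: "topspace T = squeezed X \<and> metrizable_space T \<and>
     (\<forall>\<sigma> z. range \<sigma> \<subseteq> squeezed X \<longrightarrow> z \<in> squeezed X \<longrightarrow>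
        (limitin T \<sigma> z sequentially \<longleftrightarrow>
           (\<lambda>n. snd (\<sigma> n)) \<longlonglongrightarrow> snd z \<and>
           (\<forall>x. fst z = Some x \<longrightarrow> limitin X (\<lambda>n. the (fst (\<sigma> n))) x sequentially)))"
    show "T = S.mtopology"
    proof (rule metrizable_space_eqI)
      show "metrizable_space T" "topspace T = topspace S.mtopology" using T by simp_all
      fix \<sigma> :: "nat \<Rightarrow> _" and l assume "range \<sigma> \<subseteq> topspace S.mtopology" "l \<in> topspace S.mtopology"
      then have *: "range \<sigma> \<subseteq> squeezed X" "l \<in> squeezed X" by simp_all
      show "limitin T \<sigma> l sequentially \<longleftrightarrow> limitin S.mtopology \<sigma> l sequentially"
        unfolding char[OF *] using T * by blast
    qed (rule S.metrizable_space_mtopology)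
  qed
qed

lemma metrizes_cone_dist:
  assumes "metrizes d X"
  shows "metrizes (cone_dist d) (squeezed_topology X)"
proof -
  interpret M: Metric_space "topspace X" d using assms unfolding metrizes_def by blast
  interpret S: Metric_space "squeezed X" "cone_dist d" by (rule M.Metric_space_cone_dist) simp
  show ?thesis unfolding metrizes_def squeezed_topology_eq[OF assms] using S.Metric_space_axioms by simp
qed

lemma metrizable_space_metrizes: "metrizable_space X \<longleftrightarrow> (\<exists>d. metrizes d X)"
  unfolding metrizable_space_def metrizes_def by (metis Metric_space.topspace_mtopology)

declare split_paired_All [simp del] split_paired_Ex [simp del]

section \<open>Compact totally ordered sets\<close>

context Metric_space
begin

lemma compactin_subseq2:
  assumes "compactin mtopology P" "\<And>n. \<sigma> n \<in> P" "compactin mtopology Q" "\<And>n. \<tau> n \<in> Q"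
  obtains r l m where "strict_mono (r :: nat \<Rightarrow> nat)" "l \<in> P" "m \<in> Q"
    "vanishes (\<lambda>n. d (\<sigma> (r n)) l)" "vanishes (\<lambda>n. d (\<tau> (r n)) m)"
proof -
  obtain r l where r: "strict_mono (r :: nat \<Rightarrow> nat)" "l \<in> P" "vanishes (\<lambda>n. d (\<sigma> (r n)) l)"
    by (rule compactin_subseq[OF assms(1,2)])
  obtain s m where s: "strict_mono (s :: nat \<Rightarrow> nat)" "m \<in> Q" "vanishes (\<lambda>n. d (\<tau> (r (s n))) m)"
    by (rule compactin_subseq[OF assms(3), of "\<lambda>n. \<tau> (r n)"]) (use assms(4) in auto)
  have "vanishes (\<lambda>n. d (\<sigma> (r (s n))) l)"
    using LIMSEQ_subseq_LIMSEQ[OF r(3) s(1)] by (simp add: o_def)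
  then show ?thesis using that[of "r \<circ> s" l m] r s by (simp add: strict_mono_o)
qed

text \<open>The closed sets \<open>up a\<close> have the finite intersection property by totality
  and transitivity, and compactness yields a point in all of them. The relation is a parameter, so
  that its converse gives minima.\<close>

lemma compact_order_max:
  assumes S: "compactin mtopology S" "S \<noteq> {}" and tot: "\<And>a b. a \<in> S \<Longrightarrow> b \<in> S \<Longrightarrow> (a, b) \<in> R \<or> (b, a) \<in> R"
    and tr: "\<And>a b c. (a, b) \<in> R \<Longrightarrow> (b, c) \<in> R \<Longrightarrow> (a, c) \<in> R"
    and cl: "\<And>a \<sigma> l. (\<And>n. \<sigma> n \<in> S) \<Longrightarrow> l \<in> S \<Longrightarrow> (\<And>n. (a, \<sigma> n) \<in> R) \<Longrightarrow> vanishes (\<lambda>n. d (\<sigma> n) l) \<Longrightarrow> (a, l) \<in> R"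
  obtains m where "m \<in> S" "\<And>s. s \<in> S \<Longrightarrow> (s, m) \<in> R"
proof -
  have SM: "S \<subseteq> M" using S compactin_subset_topspace by fastforce
  define up where "up a = {s \<in> S. (a, s) \<in> R}" for a
  have closed: "closedin mtopology (up a)" for a
  proof (rule closedin_seqI)
    fix \<sigma> l assume \<sigma>: "\<And>n. \<sigma> n \<in> up a" "l \<in> M" "vanishes (\<lambda>n. d (\<sigma> n) l)"
    then have "l \<in> S" using compactin_closed_seq[OF S(1), of \<sigma> l] by (auto simp: up_def)
    then show "l \<in> up a" using cl[of \<sigma> l a] \<sigma> by (auto simp: up_def)
  qed (use SM in \<open>auto simp: up_def\<close>)
  have fin: "\<exists>m\<in>S. \<forall>a\<in>F. (a, m) \<in> R" if "finite F" "F \<subseteq> S" for F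
    using that
  proof (induction F)
    case empty then show ?case using S by auto
  next
    case (insert x F)
    then obtain m where m: "m \<in> S" "\<forall>a\<in>F. (a, m) \<in> R" by auto
    have "x \<in> S" using insert by blast
    then consider "(x, m) \<in> R" | "(m, x) \<in> R" using tot m by blast
    then show ?case
    proof cases
      case 2
      moreover have "(x, x) \<in> R" using tot \<open>x \<in> S\<close> by blast
      ultimately show ?thesis using m tr \<open>x \<in> S\<close> by (intro bexI[of _ x]) auto
    qed (use m in auto)
  qed
  have "S \<inter> \<Inter> (up ` S) \<noteq> {}"
  proof -
    have "(\<forall>C\<in>up ` S. closedin mtopology C)" using closed by blast
    moreover have "S \<inter> \<Inter> \<F> \<noteq> {}" if F: "finite \<F>" "\<F> \<subseteq> up ` S" for \<F>
    proof -
      obtain F where F': "F \<subseteq> S" "finite F" "\<F> = up ` F" using finite_subset_image[OF F] by blast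
      then obtain m where "m \<in> S" "\<forall>a\<in>F. (a, m) \<in> R" using fin by blast
      then have "m \<in> S \<inter> \<Inter> \<F>" using F' by (auto simp: up_def)
      then show ?thesis by blast
    qed
    ultimately show ?thesis using S(1) unfolding compactin_fip by blast
  qed
  then show ?thesis using that S(2) unfolding up_def by blast
qed

end

lemma linear_order_onD:
  assumes "linear_order_on P R"
  shows "R \<subseteq> P \<times> P" "z \<in> P \<Longrightarrow> (z, z) \<in> R" "(x, y) \<in> R \<Longrightarrow> (y, z) \<in> R \<Longrightarrow> (x, z) \<in> R"
    "(x, y) \<in> R \<Longrightarrow> (y, x) \<in> R \<Longrightarrow> x = y" "x \<in> P \<Longrightarrow> y \<in> P \<Longrightarrow> (x, y) \<in> R \<or> (y, x) \<in> R"
proof -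
  have p: "partial_order_on P R" and t: "total_on P R" using assms unfolding linear_order_on_def by auto
  note po = partial_order_onD[OF p]
  show "R \<subseteq> P \<times> P" by (rule po(4))
  show r: "z \<in> P \<Longrightarrow> (z, z) \<in> R" for z using po(1) unfolding refl_on_def by blast
  show "(x, y) \<in> R \<Longrightarrow> (y, z) \<in> R \<Longrightarrow> (x, z) \<in> R" using po(2) unfolding trans_def by blast
  show "(x, y) \<in> R \<Longrightarrow> (y, x) \<in> R \<Longrightarrow> x = y" using po(3) unfolding antisym_def by blast
  show "x \<in> P \<Longrightarrow> y \<in> P \<Longrightarrow> (x, y) \<in> R \<or> (y, x) \<in> R" using t r[of x] unfolding total_on_def by (cases "x = y") auto
qed

lemma mem_converse_image: "C \<in> converse ` S \<longleftrightarrow> converse C \<in> S"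
proof
  assume "converse C \<in> S"
  then have "converse (converse C) \<in> converse ` S" by (rule imageI)
  then show "C \<in> converse ` S" by simp
qed auto

lemma corr_dist_converse:
  assumes "\<And>x y. d x y = d y x"
  shows "corr_dist d (converse ` \<C>) = corr_dist d \<C>"
proof -
  have "(SUP (z1, z2)\<in>C\<inverse>. ennreal (d z1 z2)) = (SUP (z1, z2)\<in>C. ennreal (d z1 z2))" for C
  proof (rule antisym; rule SUP_least; clarify)
    show "ennreal (d a b) \<le> (SUP (z1, z2)\<in>C. ennreal (d z1 z2))" if "(b, a) \<in> C" for a b
      by (rule SUP_upper2[OF that]) (simp add: assms[of a b])
    show "ennreal (d a b) \<le> (SUP (z1, z2)\<in>C\<inverse>. ennreal (d z1 z2))" if "(a, b) \<in> C" for a b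
      by (rule SUP_upper2[of "(b, a)"]) (use that in \<open>simp_all add: assms[of a b]\<close>)
  qed
  then show ?thesis unfolding corr_dist_def by (simp add: image_image)
qed

section \<open>Paths\<close>

text \<open>An arbitrary metric for the squeezed topology. Where completeness or explicit estimates
  matter, the instance \<open>cone_dist\<close> is used; independence of the metric is shown by
  comparing two instances.\<close>

locale squeezed_metric = Metric_space "squeezed X" d for X :: "'a topology" and d +
  assumes metr: "metrizable_space X" and mtop: "mtopology = squeezed_topology X"

lemma squeezed_metric_iff:
  assumes "metrizable_space X"
  shows "squeezed_metric X d \<longleftrightarrow> metrizes d (squeezed_topology X)"
proof -
  obtain \<rho> where "metrizes \<rho> X" using assms metrizable_space_metrizes by blast
  then have "metrizes (cone_dist \<rho>) (squeezed_topology X)" "squeezed_topology X = Metric_space.mtopology (squeezed X) (cone_dist \<rho>)"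
    using metrizes_cone_dist squeezed_topology_eq by blast+
  then have "topspace (squeezed_topology X) = squeezed X"
    using Metric_space.topspace_mtopology by (metis Metric_space.Metric_space_cone_dist \<open>metrizes \<rho> X\<close> metrizes_def)
  then show ?thesis
    unfolding metrizes_def squeezed_metric_def squeezed_metric_axioms_def using assms by simp
qed

lemma squeezed_metric_cone_dist:
  assumes "metrizes \<rho> X"
  shows "squeezed_metric X (cone_dist \<rho>)"
  using assms squeezed_metric_iff metrizable_space_metrizes metrizes_cone_dist by blast

context squeezed_metric
begin

text \<open>Convergence is a matter of topology, so its description for \<open>cone_dist\<close>
  carries over to \<open>d\<close>.\<close>

lemma tendsto_iff_snd:
  assumes "metrizes \<rho> X" "\<And>n. \<sigma> n \<in> squeezed X" "z \<in> squeezed X"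
  shows "vanishes (\<lambda>n. d (\<sigma> n) z) \<longleftrightarrow> (\<lambda>n. snd (\<sigma> n)) \<longlonglongrightarrow> snd z \<and>
     (\<forall>x. fst z = Some x \<longrightarrow> vanishes (\<lambda>n. \<rho> (the (fst (\<sigma> n))) x))"
proof -
  interpret M: Metric_space "topspace X" \<rho> using assms unfolding metrizes_def by blast
  interpret S: Metric_space "squeezed X" "cone_dist \<rho>" by (rule M.Metric_space_cone_dist) simp
  have "mtopology = S.mtopology" using mtop squeezed_topology_eq[OF assms(1)] by simp
  then have "vanishes (\<lambda>n. d (\<sigma> n) z) \<longleftrightarrow> vanishes (\<lambda>n. cone_dist \<rho> (\<sigma> n) z)"
    using limitin_seq_iff[of \<sigma> z, OF assms(2,3)] S.limitin_seq_iff[of \<sigma> z, OF assms(2,3)] by simp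
  then show ?thesis using M.cone_dist_tendsto_iff[of X \<sigma> z, OF refl assms(2,3)] by simp
qed

lemma tendsto_snd:
  assumes "\<And>n. \<sigma> n \<in> squeezed X" "z \<in> squeezed X" "vanishes (\<lambda>n. d (\<sigma> n) z)"
  shows "(\<lambda>n. snd (\<sigma> n)) \<longlonglongrightarrow> snd z"
proof -
  obtain \<rho> where "metrizes \<rho> X" using metr metrizable_space_metrizes by blast
  then show ?thesis using tendsto_iff_snd[of \<rho> \<sigma> z] assms by blast
qed

text \<open>The square of the compact set \<open>P\<close> is closed, so relative closedness of the
  order is closedness, which sequences detect.\<close>

lemma paths_iff: "(P, R) \<in> paths X \<longleftrightarrow> P \<noteq> {} \<and> compactin mtopology P \<and> linear_order_on P R \<and>
     (\<forall>\<sigma> \<tau> x y. (\<forall>n. (\<sigma> n, \<tau> n) \<in> R) \<longrightarrow> x \<in> P \<longrightarrow> y \<in> P \<longrightarrow>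
        vanishes (\<lambda>n. d (\<sigma> n) x) \<longrightarrow> vanishes (\<lambda>n. d (\<tau> n) y) \<longrightarrow> (x, y) \<in> R) \<and>
     (\<forall>x s x' s'. (x, s) \<in> P \<and> (x', s') \<in> P \<and> s < s' \<longrightarrow> ((x, s), (x', s')) \<in> R) \<and>
     (\<forall>t::real. finite {x. (Some x, ereal t) \<in> P} \<and> card {x. (Some x, ereal t) \<in> P} \<le> 2)"
proof -
  have "closedin (subtopology (prod_topology mtopology mtopology) (P \<times> P)) (order2 (P, R)) \<longleftrightarrow>
     (\<forall>\<sigma> \<tau> x y. (\<forall>n. (\<sigma> n, \<tau> n) \<in> R) \<longrightarrow> x \<in> P \<longrightarrow> y \<in> P \<longrightarrow>
        vanishes (\<lambda>n. d (\<sigma> n) x) \<longrightarrow> vanishes (\<lambda>n. d (\<tau> n) y) \<longrightarrow> (x, y) \<in> R)" (is "?L \<longleftrightarrow> ?R")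
    if c: "compactin mtopology P" and R: "R \<subseteq> P \<times> P"
  proof -
    have PM: "P \<subseteq> squeezed X" using c compactin_subset_topspace by fastforce
    have "closedin mtopology P" using c compactin_imp_closedin Hausdorff_space_mtopology by blast
    then have "closedin (prod_topology mtopology mtopology) (P \<times> P)" by (simp add: closedin_prod_Times_iff)
    then have L: "?L \<longleftrightarrow> closedin (prod_topology mtopology mtopology) R"
    proof -
      have "order2 (P, R) = R" using R by (auto simp: order2_def)
      then show ?thesis using closedin_closed_subtopology[OF \<open>closedin _ (P \<times> P)\<close>, of R] R by simp
    qed
    show ?thesis
    proof
      assume ?L
      then show ?R using closedin_prod_seqD PM unfolding L by blast
    next
      assume r: ?R
      show ?L
        unfolding L
      proof (rule closedin_prod_seqI)
        fix \<sigma> \<tau> x y assume *: "\<And>n. (\<sigma> n, \<tau> n) \<in> R" "x \<in> squeezed X" "y \<in> squeezed X"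
          "vanishes (\<lambda>n. d (\<sigma> n) x)" "vanishes (\<lambda>n. d (\<tau> n) y)"
        have "\<sigma> n \<in> P" "\<tau> n \<in> P" for n using *(1)[of n] R by auto
        then have "x \<in> P" "y \<in> P" using compactin_closed_seq[OF c] * by blast+
        then show "(x, y) \<in> R" using r * by blast
      qed (use R PM in blast)
    qed
  qed
  moreover have "linear_order_on P R \<Longrightarrow> R \<subseteq> P \<times> P" by (rule linear_order_onD(1))
  ultimately show ?thesis
    unfolding paths_def mtop[symmetric] by auto
qed

lemma pathD:
  assumes "\<pi> \<in> paths X"
  shows "fst \<pi> \<noteq> {}" "compactin mtopology (fst \<pi>)" "fst \<pi> \<subseteq> squeezed X" "fst \<pi> \<in> hyper" "snd \<pi> \<subseteq> fst \<pi> \<times> fst \<pi>"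
    "z \<in> fst \<pi> \<Longrightarrow> (z, z) \<in> snd \<pi>"
    "(u, v) \<in> snd \<pi> \<Longrightarrow> (v, w) \<in> snd \<pi> \<Longrightarrow> (u, w) \<in> snd \<pi>"
    "(u, v) \<in> snd \<pi> \<Longrightarrow> (v, u) \<in> snd \<pi> \<Longrightarrow> u = v"
    "u \<in> fst \<pi> \<Longrightarrow> v \<in> fst \<pi> \<Longrightarrow> (u, v) \<in> snd \<pi> \<or> (v, u) \<in> snd \<pi>"
    "u \<in> fst \<pi> \<Longrightarrow> v \<in> fst \<pi> \<Longrightarrow> snd u < snd v \<Longrightarrow> (u, v) \<in> snd \<pi>"
    "order2 \<pi> = snd \<pi>"
    "(u, v) \<in> snd \<pi> \<Longrightarrow> snd u \<le> snd v"
    "(u, v) \<in> snd \<pi> \<Longrightarrow> u \<in> fst \<pi>"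
    "(u, v) \<in> snd \<pi> \<Longrightarrow> v \<in> fst \<pi>"
proof -
  obtain P R where \<pi>: "\<pi> = (P, R)" by (cases \<pi>)
  have *: "P \<noteq> {}" "compactin mtopology P" "linear_order_on P R"
    "\<And>x s x' s'. (x, s) \<in> P \<and> (x', s') \<in> P \<and> s < s' \<longrightarrow> ((x, s), (x', s')) \<in> R"
    using assms unfolding \<pi> paths_iff by blast+
  show 0: "fst \<pi> \<noteq> {}" "compactin mtopology (fst \<pi>)" "fst \<pi> \<subseteq> squeezed X" "fst \<pi> \<in> hyper" "snd \<pi> \<subseteq> fst \<pi> \<times> fst \<pi>"
    "z \<in> fst \<pi> \<Longrightarrow> (z, z) \<in> snd \<pi>"
    "(u, v) \<in> snd \<pi> \<Longrightarrow> (v, w) \<in> snd \<pi> \<Longrightarrow> (u, w) \<in> snd \<pi>"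
    "u \<in> fst \<pi> \<Longrightarrow> v \<in> fst \<pi> \<Longrightarrow> (u, v) \<in> snd \<pi> \<or> (v, u) \<in> snd \<pi>"
    using * linear_order_onD[OF *(3)] hyper_subset[of P] unfolding \<pi> hyper_def by auto
  show as: "(u, v) \<in> snd \<pi> \<Longrightarrow> (v, u) \<in> snd \<pi> \<Longrightarrow> u = v" for u v using linear_order_onD(4)[OF *(3)] \<pi> by auto
  show ti: "u \<in> fst \<pi> \<Longrightarrow> v \<in> fst \<pi> \<Longrightarrow> snd u < snd v \<Longrightarrow> (u, v) \<in> snd \<pi>" for u v
    using *(4)[of "fst u" "snd u" "fst v" "snd v"] \<pi> by simp
  show "order2 \<pi> = snd \<pi>" using 0(5) unfolding order2_def by auto
  show m: "(u, v) \<in> snd \<pi> \<Longrightarrow> u \<in> fst \<pi>" "(u, v) \<in> snd \<pi> \<Longrightarrow> v \<in> fst \<pi>" using 0(5) by auto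
  show "(u, v) \<in> snd \<pi> \<Longrightarrow> snd u \<le> snd v" using ti[of v u] as[of u v] m by (metis leI less_irrefl)
qed

lemma path_closed:
  assumes "\<pi> \<in> paths X" "\<And>n. (\<sigma> n, \<tau> n) \<in> snd \<pi>" "x \<in> fst \<pi>" "y \<in> fst \<pi>"
    "vanishes (\<lambda>n. d (\<sigma> n) x)" "vanishes (\<lambda>n. d (\<tau> n) y)"
  shows "(x, y) \<in> snd \<pi>"
  using assms paths_iff[of "fst \<pi>" "snd \<pi>", unfolded prod.collapse] by blast

lemma path_two:
  assumes "\<pi> \<in> paths X" "(x, ereal t) \<in> fst \<pi>" "(y, ereal t) \<in> fst \<pi>" "(z, ereal t) \<in> fst \<pi>"
  shows "x = y \<or> y = z \<or> x = z"
proof (rule ccontr)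
  assume ne: "\<not> ?thesis"
  obtain x' y' z' where xyz: "x = Some x'" "y = Some y'" "z = Some z'"
    using assms pathD(3)[OF assms(1)] by (metis ereal.distinct(1,3) MInfty_neq_ereal(1) PInfty_neq_ereal(1) not_None_eq squeezed_simps(2) subsetD)
  let ?S = "{x. (Some x, ereal t) \<in> fst \<pi>}"
  have "finite ?S" "card ?S \<le> 2" using assms(1) paths_iff[of "fst \<pi>" "snd \<pi>"] by simp_all
  moreover have "{x', y', z'} \<subseteq> ?S" using assms xyz by auto
  ultimately have "card {x', y', z'} \<le> 2" using card_mono order_trans by blast
  then show False using ne xyz by auto
qed

text \<open>By totality the strict order is the complement of the closed reversed order, hence
  relatively open.\<close>

lemma path_strict_open:
  assumes \<pi>: "\<pi> \<in> paths X" and "(x, y) \<in> snd \<pi>" "x \<noteq> y"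
  obtains e where "e > 0" "\<And>u v. u \<in> fst \<pi> \<Longrightarrow> v \<in> fst \<pi> \<Longrightarrow> d u x < e \<Longrightarrow> d v y < e \<Longrightarrow> (v, u) \<notin> snd \<pi>"
proof (rule ccontr)
  assume "\<not> thesis"
  then have "\<exists>u v. u \<in> fst \<pi> \<and> v \<in> fst \<pi> \<and> d u x < 1 / real (Suc n) \<and> d v y < 1 / real (Suc n) \<and> (v, u) \<in> snd \<pi>" for n
    using that[of "1 / real (Suc n)"] by force
  then obtain u v where uv: "\<And>n. u n \<in> fst \<pi>" "\<And>n. v n \<in> fst \<pi>" "\<And>n. d (u n) x < 1 / real (Suc n)"
    "\<And>n. d (v n) y < 1 / real (Suc n)" "\<And>n. (v n, u n) \<in> snd \<pi>" by metis
  have "vanishes (\<lambda>n. d (u n) x)" "vanishes (\<lambda>n. d (v n) y)"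
    by (rule tendsto_sandwich[OF _ _ tendsto_const LIMSEQ_Suc[OF lim_1_over_n]],
        use uv in \<open>auto intro!: always_eventually less_imp_le\<close>)+
  then have "(y, x) \<in> snd \<pi>"
    using path_closed[OF \<pi>, of v u y x] uv(5) pathD(13)[OF \<pi> assms(2)] pathD(14)[OF \<pi> assms(2)] by blast
  then show False using pathD(8)[OF \<pi>] assms by blast
qed

text \<open>Counterexamples at ever smaller scales would converge, by compactness, to two points
  that precede each other but are at least \<open>e\<close> apart. This uniform antisymmetry is what
  makes almost monotone correspondences harmless.\<close>

lemma path_uniform_antisym:
  assumes \<pi>: "\<pi> \<in> paths X" and "e > 0"
  obtains \<delta> where "\<delta> > 0" "\<And>w w' u u'. (w, w') \<in> snd \<pi> \<Longrightarrow> (u', u) \<in> snd \<pi> \<Longrightarrow>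
    d w u < \<delta> \<Longrightarrow> d w' u' < \<delta> \<Longrightarrow> d w w' < e"
proof (rule ccontr)
  assume "\<not> thesis"
  then have "\<exists>w w' u u'. (w, w') \<in> snd \<pi> \<and> (u', u) \<in> snd \<pi> \<and>
    d w u < 1 / real (Suc n) \<and> d w' u' < 1 / real (Suc n) \<and> \<not> d w w' < e" for n
    using that[of "1 / real (Suc n)"] by force
  then obtain w w' u u' where *: "\<And>n. (w n, w' n) \<in> snd \<pi>" "\<And>n. (u' n, u n) \<in> snd \<pi>"
    "\<And>n. d (w n) (u n) < 1 / real (Suc n)" "\<And>n. d (w' n) (u' n) < 1 / real (Suc n)" "\<And>n. \<not> d (w n) (w' n) < e"
    by metis
  have P: "w n \<in> fst \<pi>" "w' n \<in> fst \<pi>" "u n \<in> fst \<pi>" "u' n \<in> fst \<pi>" for n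
    using *(1,2)[of n] pathD(13,14)[OF \<pi>] by blast+
  note sub = subsetD[OF pathD(3)[OF \<pi>]]
  obtain r l l' where r: "strict_mono (r :: nat \<Rightarrow> nat)" "l \<in> fst \<pi>" "l' \<in> fst \<pi>"
    "vanishes (\<lambda>n. d (u (r n)) l)" "vanishes (\<lambda>n. d (u' (r n)) l')"
    by (rule compactin_subseq2[OF pathD(2)[OF \<pi>] P(3) pathD(2)[OF \<pi>] P(4)])
  have "vanishes (\<lambda>n. d (w n) (u n))" "vanishes (\<lambda>n. d (w' n) (u' n))"
    by (rule tendsto_sandwich[OF _ _ tendsto_const LIMSEQ_Suc[OF lim_1_over_n]],
        use * in \<open>auto intro!: always_eventually less_imp_le\<close>)+
  then have "vanishes (\<lambda>n. d (w (r n)) (u (r n)))" "vanishes (\<lambda>n. d (w' (r n)) (u' (r n)))"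
    using LIMSEQ_subseq_LIMSEQ[OF _ r(1)] by (force simp: o_def)+
  note wu = this
  have lim: "vanishes (\<lambda>n. d (w (r n)) l)" "vanishes (\<lambda>n. d (w' (r n)) l')"
    by (rule tendsto_dist_trans[OF _ _ _ wu(1) r(4)], (rule sub P r(2))+)
      (rule tendsto_dist_trans[OF _ _ _ wu(2) r(5)], (rule sub P r(3))+)
  have "(l, l') \<in> snd \<pi>" "(l', l) \<in> snd \<pi>"
    by (rule path_closed[OF \<pi> *(1) r(2,3) lim], rule path_closed[OF \<pi> *(2) r(3,2) r(5,4)])
  then have "l = l'" using pathD(8)[OF \<pi>] by blast
  then have "vanishes (\<lambda>n. d (w (r n)) (w' (r n)))"
    using tendsto_dist_dist[OF _ _ _ _ lim] sub P r(2,3) mdist_zero[OF sub[OF r(3)]] by simp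
  then have "\<forall>\<^sub>F n in sequentially. d (w (r n)) (w' (r n)) < e" using \<open>e > 0\<close> by (rule order_tendstoD(2))
  then show False using * by simp
qed

section \<open>The orders of paths as compact sets, and the metrics \<open>d_part\<close> and
  \<open>d_H\<close>\<close>

lemma order2_hyper:
  assumes \<pi>: "\<pi> \<in> paths X"
  shows "order2 \<pi> \<in> Metric_space.hyper (squeezed X \<times> squeezed X) (max_dist d)"
proof -
  interpret P: Metric_space "squeezed X \<times> squeezed X" "max_dist d" by (rule Metric_space_max_dist)
  have "compactin P.mtopology (snd \<pi>)"
  proof (rule P.compactinI)
    show "snd \<pi> \<subseteq> squeezed X \<times> squeezed X" using pathD(3,5)[OF \<pi>] by blast
    fix \<sigma> assume \<sigma>: "\<And>n::nat. \<sigma> n \<in> snd \<pi>"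
    then have "\<sigma> n \<in> fst \<pi> \<times> fst \<pi>" for n using pathD(5)[OF \<pi>] by blast
    then have "fst (\<sigma> n) \<in> fst \<pi>" "snd (\<sigma> n) \<in> fst \<pi>" for n by (simp_all add: mem_Times_iff)
    then obtain r l m where r: "strict_mono (r :: nat \<Rightarrow> nat)" "l \<in> fst \<pi>" "m \<in> fst \<pi>"
      "vanishes (\<lambda>n. d (fst (\<sigma> (r n))) l)" "vanishes (\<lambda>n. d (snd (\<sigma> (r n))) m)"
      by (rule compactin_subseq2[OF pathD(2)[OF \<pi>] _ pathD(2)[OF \<pi>]])
    have "(l, m) \<in> snd \<pi>" by (rule path_closed[OF \<pi> _ r(2-5)]) (use \<sigma> in simp)
    then show "\<exists>r l. strict_mono (r :: nat \<Rightarrow> nat) \<and> l \<in> snd \<pi> \<and> vanishes (\<lambda>n. max_dist d (\<sigma> (r n)) l)"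
      using r by (intro exI[of _ r] exI[of _ "(l, m)"]) (simp add: max_dist_tendsto)
  qed
  moreover have "snd \<pi> \<noteq> {}" using pathD(1,6)[OF \<pi>] by blast
  ultimately show ?thesis unfolding P.hyper_def pathD(11)[OF \<pi>] by simp
qed

lemma d_part_lessD:
  assumes "\<pi>1 \<in> paths X" "\<pi>2 \<in> paths X" "d_part d \<pi>1 \<pi>2 < r"
  shows "(z, z') \<in> snd \<pi>1 \<Longrightarrow> \<exists>w w'. (w, w') \<in> snd \<pi>2 \<and> d z w < r \<and> d z' w' < r"
    "(w, w') \<in> snd \<pi>2 \<Longrightarrow> \<exists>z z'. (z, z') \<in> snd \<pi>1 \<and> d z w < r \<and> d z' w' < r"
proof -
  interpret P: Metric_space "squeezed X \<times> squeezed X" "max_dist d" by (rule Metric_space_max_dist)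
  note * = P.hyper_lessD[OF order2_hyper[OF assms(1)] order2_hyper[OF assms(2)] assms(3)[unfolded d_part_def],
      unfolded pathD(11)[OF assms(1)] pathD(11)[OF assms(2)]]
  show "(z, z') \<in> snd \<pi>1 \<Longrightarrow> \<exists>w w'. (w, w') \<in> snd \<pi>2 \<and> d z w < r \<and> d z' w' < r"
  proof -
    assume "(z, z') \<in> snd \<pi>1"
    then obtain p where "p \<in> snd \<pi>2" "max_dist d (z, z') p < r" using *(1) by blast
    then show ?thesis by (intro exI[of _ "fst p"] exI[of _ "snd p"]) (simp add: max_dist_eq)
  qed
  show "(w, w') \<in> snd \<pi>2 \<Longrightarrow> \<exists>z z'. (z, z') \<in> snd \<pi>1 \<and> d z w < r \<and> d z' w' < r"
  proof -
    assume "(w, w') \<in> snd \<pi>2"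
    then obtain p where "p \<in> snd \<pi>1" "max_dist d p (w, w') < r" using *(2) by blast
    then show ?thesis by (intro exI[of _ "fst p"] exI[of _ "snd p"]) (simp add: max_dist_eq)
  qed
qed

lemma d_part_le:
  assumes "\<pi>1 \<in> paths X" "\<pi>2 \<in> paths X" "0 \<le> r"
    and "\<And>z z'. (z, z') \<in> snd \<pi>1 \<Longrightarrow> \<exists>w w'. (w, w') \<in> snd \<pi>2 \<and> d z w \<le> r \<and> d z' w' \<le> r"
    and "\<And>w w'. (w, w') \<in> snd \<pi>2 \<Longrightarrow> \<exists>z z'. (z, z') \<in> snd \<pi>1 \<and> d z w \<le> r \<and> d z' w' \<le> r"
  shows "d_part d \<pi>1 \<pi>2 \<le> r"
  unfolding d_part_def pathD(11)[OF assms(1)] pathD(11)[OF assms(2)]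
proof (rule hausdorff_dist_le[OF _ _ assms(3)])
  show "\<exists>b\<in>snd \<pi>2. max_dist d a b \<le> r" if a: "a \<in> snd \<pi>1" for a
  proof -
    obtain w w' where "(w, w') \<in> snd \<pi>2" "d (fst a) w \<le> r" "d (snd a) w' \<le> r"
      using assms(4)[of "fst a" "snd a"] a unfolding prod.collapse by blast
    then show ?thesis by (intro bexI[of _ "(w, w')"]) (simp_all add: max_dist_eq)
  qed
  show "\<exists>a\<in>snd \<pi>1. max_dist d a b \<le> r" if b: "b \<in> snd \<pi>2" for b
  proof -
    obtain w w' where "(w, w') \<in> snd \<pi>1" "d w (fst b) \<le> r" "d w' (snd b) \<le> r"
      using assms(5)[of "fst b" "snd b"] b unfolding prod.collapse by blast
    then show ?thesis by (intro bexI[of _ "(w, w')"]) (simp_all add: max_dist_eq)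
  qed
qed

lemma d_part_nonneg [simp]: "0 \<le> d_part d \<pi>1 \<pi>2"
  unfolding d_part_def by simp

lemma Metric_space_d_part: "Metric_space (paths X) (d_part d)"
proof -
  interpret P: Metric_space "squeezed X \<times> squeezed X" "max_dist d" by (rule Metric_space_max_dist)
  interpret H: Metric_space P.hyper "hausdorff_dist (max_dist d)" by (rule P.Metric_space_hyper)
  show ?thesis
  proof
    show "d_part d x y = 0 \<longleftrightarrow> x = y" if "x \<in> paths X" "y \<in> paths X" for x y
    proof -
      \<comment> \<open>By reflexivity a path is recovered from its order alone; therefore a metric
        on the orders separates paths.\<close>
      have "fst \<pi> = {z. (z, z) \<in> snd \<pi>}" if "\<pi> \<in> paths X" for \<pi> using pathD(6,13)[OF that] by blast
      then have "snd x = snd y \<Longrightarrow> fst x = fst y" using that by simp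
      then have "snd x = snd y \<longleftrightarrow> x = y" by (auto intro: prod_eqI)
      moreover have "d_part d x y = 0 \<longleftrightarrow> order2 x = order2 y"
        unfolding d_part_def using that by (intro H.zero order2_hyper)
      ultimately show ?thesis using pathD(11)[OF that(1)] pathD(11)[OF that(2)] by simp
    qed
    show "d_part d x y = d_part d y x" for x y unfolding d_part_def by (rule H.commute)
    show "d_part d x z \<le> d_part d x y + d_part d y z" if "x \<in> paths X" "y \<in> paths X" "z \<in> paths X" for x y z
      unfolding d_part_def using that order2_hyper by (intro H.triangle)
  qed simp
qed

text \<open>For \<open>r\<close> above the Hausdorff distance, all pairs at distance below
  \<open>r\<close> together form a correspondence; conversely a correspondence provides every point
  with a partner.\<close>

lemma d_H_eq_hausdorff_dist:
  assumes "fst \<pi>1 \<in> hyper" "fst \<pi>2 \<in> hyper"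
  shows "d_H d \<pi>1 \<pi>2 = hausdorff_dist d (fst \<pi>1) (fst \<pi>2)"
proof (rule antisym)
  let ?A = "fst \<pi>1" and ?B = "fst \<pi>2"
  show "d_H d \<pi>1 \<pi>2 \<le> hausdorff_dist d ?A ?B"
  proof (rule field_le_epsilon)
    fix e :: real assume e: "e > 0"
    define r where "r = hausdorff_dist d ?A ?B + e"
    have r: "hausdorff_dist d ?A ?B < r" "0 \<le> r" using e by (auto simp: r_def add_nonneg_pos less_imp_le)
    have "{(a, b). a \<in> ?A \<and> b \<in> ?B \<and> d a b < r} \<in> Corr ?A ?B"
      unfolding Corr_def using hyper_lessD[OF assms r(1)] by auto
    then show "d_H d \<pi>1 \<pi>2 \<le> hausdorff_dist d ?A ?B + e"
      unfolding d_H_def r_def[symmetric] by (rule corr_dist_le) (use r in auto)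
  qed
  show "hausdorff_dist d ?A ?B \<le> d_H d \<pi>1 \<pi>2"
  proof (rule field_le_epsilon)
    fix e :: real assume e: "e > 0"
    obtain K where K: "\<And>x y. x \<in> ?A \<Longrightarrow> y \<in> ?B \<Longrightarrow> d x y \<le> K"
      using compactin_bounded2[OF hyperD(2)[OF assms(1)] hyperD(2)[OF assms(2)]] by blast
    have "?A \<times> ?B \<in> Corr ?A ?B" unfolding Corr_def using hyperD(1)[OF assms(1)] hyperD(1)[OF assms(2)] by blast
    then have "\<exists>C\<in>Corr ?A ?B. \<forall>(a, b)\<in>C. d a b < d_H d \<pi>1 \<pi>2 + e"
      by (rule corr_dist_lessD[where B = K]) (use K e in \<open>auto simp: d_H_def\<close>)
    then obtain C where C: "C \<in> Corr ?A ?B" "\<And>a b. (a, b) \<in> C \<Longrightarrow> d a b < d_H d \<pi>1 \<pi>2 + e" by auto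
    show "hausdorff_dist d ?A ?B \<le> d_H d \<pi>1 \<pi>2 + e"
    proof (rule hausdorff_dist_le)
      show "\<exists>b\<in>?B. d a b \<le> d_H d \<pi>1 \<pi>2 + e" if "a \<in> ?A" for a
        using C that unfolding Corr_def by (force intro: less_imp_le)
      show "\<exists>a\<in>?A. d a b \<le> d_H d \<pi>1 \<pi>2 + e" if "b \<in> ?B" for b
        using C that unfolding Corr_def by (force intro: less_imp_le)
      show "0 \<le> d_H d \<pi>1 \<pi>2 + e" using e by (simp add: d_H_def add_nonneg_pos less_imp_le)
    qed
  qed
qed

lemma d_H_paths: "\<pi>1 \<in> paths X \<Longrightarrow> \<pi>2 \<in> paths X \<Longrightarrow> d_H d \<pi>1 \<pi>2 = hausdorff_dist d (fst \<pi>1) (fst \<pi>2)"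
  by (intro d_H_eq_hausdorff_dist pathD(4))

lemma d_H_le:
  assumes "\<pi>1 \<in> paths X" "\<pi>2 \<in> paths X" "0 \<le> r"
    and "\<And>z. z \<in> fst \<pi>1 \<Longrightarrow> \<exists>w\<in>fst \<pi>2. d z w \<le> r" "\<And>w. w \<in> fst \<pi>2 \<Longrightarrow> \<exists>z\<in>fst \<pi>1. d z w \<le> r"
  shows "d_H d \<pi>1 \<pi>2 \<le> r"
  unfolding d_H_paths[OF assms(1,2)] using assms by (intro hausdorff_dist_le)

lemma d_H_lessD:
  assumes "\<pi>1 \<in> paths X" "\<pi>2 \<in> paths X" "d_H d \<pi>1 \<pi>2 < r"
  shows "z \<in> fst \<pi>1 \<Longrightarrow> \<exists>w\<in>fst \<pi>2. d z w < r" "w \<in> fst \<pi>2 \<Longrightarrow> \<exists>z\<in>fst \<pi>1. d z w < r"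
  using hyper_lessD[OF pathD(4)[OF assms(1)] pathD(4)[OF assms(2)]] assms(3) unfolding d_H_paths[OF assms(1,2)] by blast+

lemma d_H_commute: "d_H d \<pi>1 \<pi>2 = d_H d \<pi>2 \<pi>1"
proof -
  let ?A = "fst \<pi>1" and ?B = "fst \<pi>2"
  have "Corr ?B ?A = converse ` Corr ?A ?B"
  proof (rule set_eqI)
    fix C
    have "C \<in> Corr ?B ?A \<longleftrightarrow> converse C \<in> Corr ?A ?B" unfolding Corr_def by auto
    then show "C \<in> Corr ?B ?A \<longleftrightarrow> C \<in> converse ` Corr ?A ?B"
      by (simp only: mem_converse_image)
  qed
  then have "corr_dist d (Corr (fst \<pi>2) (fst \<pi>1)) = corr_dist d (converse ` Corr (fst \<pi>1) (fst \<pi>2))" by simp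
  also have "\<dots> = corr_dist d (Corr (fst \<pi>1) (fst \<pi>2))" by (rule corr_dist_converse) (rule commute)
  finally show ?thesis unfolding d_H_def ..
qed

text \<open>\<open>d_H\<close> does not see the orders, so it separates the members of
  \<open>Q\<close> only if their point sets do. This is the case for continuous paths and for the
  paths of \<open>skor_paths\<close>.\<close>

lemma Metric_space_d_H:
  assumes "Q \<subseteq> paths X" "\<And>\<pi>1 \<pi>2. \<pi>1 \<in> Q \<Longrightarrow> \<pi>2 \<in> Q \<Longrightarrow> fst \<pi>1 = fst \<pi>2 \<Longrightarrow> \<pi>1 = \<pi>2"
  shows "Metric_space Q (d_H d)"
proof -
  interpret H: Metric_space hyper "hausdorff_dist d" by (rule Metric_space_hyper)
  show ?thesis
  proof
    show "0 \<le> d_H d x y" for x y by (simp add: d_H_def)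
    show "d_H d x y = d_H d y x" for x y by (rule d_H_commute)
    show "d_H d x y = 0 \<longleftrightarrow> x = y" if "x \<in> Q" "y \<in> Q" for x y
    proof -
      have "d_H d x y = 0 \<longleftrightarrow> fst x = fst y"
      proof -
        have "x \<in> paths X" "y \<in> paths X" using that assms(1) by auto
        then show ?thesis unfolding d_H_paths[OF \<open>x \<in> paths X\<close> \<open>y \<in> paths X\<close>] by (intro H.zero pathD(4))
      qed
      then show ?thesis using assms(2)[OF that] by blast
    qed
    show "d_H d x z \<le> d_H d x y + d_H d y z" if "x \<in> Q" "y \<in> Q" "z \<in> Q" for x y z
    proof -
      have Q: "x \<in> paths X" "y \<in> paths X" "z \<in> paths X" using that assms(1) by auto
      show ?thesis
        unfolding d_H_paths[OF Q(1,2)] d_H_paths[OF Q(2,3)] d_H_paths[OF Q(1,3)] by (intro H.triangle pathD(4) Q)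
    qed
  qed
qed

section \<open>Monotone correspondences and the metric \<open>d_tot\<close>\<close>

lemma Corr_mono_converse: "C \<in> Corr_mono \<pi>1 \<pi>2 \<Longrightarrow> converse C \<in> Corr_mono \<pi>2 \<pi>1"
  unfolding Corr_mono_def Corr_def by blast

lemma d_tot_commute: "d_tot d \<pi>1 \<pi>2 = d_tot d \<pi>2 \<pi>1"
proof -
  have "Corr_mono \<pi>2 \<pi>1 = converse ` Corr_mono \<pi>1 \<pi>2"
  proof (rule set_eqI)
    fix C
    have "C \<in> Corr_mono \<pi>2 \<pi>1 \<longleftrightarrow> converse C \<in> Corr_mono \<pi>1 \<pi>2"
      using Corr_mono_converse[of C \<pi>2 \<pi>1] Corr_mono_converse[of "converse C" \<pi>1 \<pi>2] by auto
    then show "C \<in> Corr_mono \<pi>2 \<pi>1 \<longleftrightarrow> C \<in> converse ` Corr_mono \<pi>1 \<pi>2"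
      by (simp only: mem_converse_image)
  qed
  then have "corr_dist d (Corr_mono \<pi>2 \<pi>1) = corr_dist d (converse ` Corr_mono \<pi>1 \<pi>2)" by simp
  also have "\<dots> = corr_dist d (Corr_mono \<pi>1 \<pi>2)" by (rule corr_dist_converse) (rule commute)
  finally show ?thesis unfolding d_tot_def ..
qed

lemma Corr_monoI:
  assumes "C \<subseteq> fst \<pi>1 \<times> fst \<pi>2" "\<And>z. z \<in> fst \<pi>1 \<Longrightarrow> \<exists>w. (z, w) \<in> C" "\<And>w. w \<in> fst \<pi>2 \<Longrightarrow> \<exists>z. (z, w) \<in> C"
    and "\<And>z w z' w'. (z, w) \<in> C \<Longrightarrow> (z', w') \<in> C \<Longrightarrow> (z, z') \<in> snd \<pi>1 \<Longrightarrow> z \<noteq> z' \<Longrightarrow> (w', w) \<in> snd \<pi>2 \<Longrightarrow> w' = w"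
  shows "C \<in> Corr_mono \<pi>1 \<pi>2"
  using assms unfolding Corr_mono_def Corr_def strictly_before_def by blast

lemma Corr_monoD:
  assumes "C \<in> Corr_mono \<pi>1 \<pi>2"
  shows "C \<subseteq> fst \<pi>1 \<times> fst \<pi>2" "z \<in> fst \<pi>1 \<Longrightarrow> \<exists>w. (z, w) \<in> C" "w \<in> fst \<pi>2 \<Longrightarrow> \<exists>z. (z, w) \<in> C"
    "(z, w) \<in> C \<Longrightarrow> (z', w') \<in> C \<Longrightarrow> (z, z') \<in> snd \<pi>1 \<Longrightarrow> z \<noteq> z' \<Longrightarrow> (w', w) \<in> snd \<pi>2 \<Longrightarrow> w' = w"
  using assms unfolding Corr_mono_def Corr_def strictly_before_def by blast+

text \<open>The witness consists of the running maxima of \<open>A\<close> together with the vertical gaps of their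
  graph, in the form of running minima in the other direction.\<close>

lemma corr_refine:
  assumes \<pi>1: "\<pi>1 \<in> paths X" and \<pi>2: "\<pi>2 \<in> paths X" and A: "A \<in> Corr (fst \<pi>1) (fst \<pi>2)"
    and cl: "\<And>\<sigma> \<tau> x y. (\<And>n. (\<sigma> n, \<tau> n) \<in> A) \<Longrightarrow> x \<in> fst \<pi>1 \<Longrightarrow> y \<in> fst \<pi>2 \<Longrightarrow>
        vanishes (\<lambda>n. d (\<sigma> n) x) \<Longrightarrow> vanishes (\<lambda>n. d (\<tau> n) y) \<Longrightarrow> (x, y) \<in> A"
  obtains B where "B \<in> Corr_mono \<pi>1 \<pi>2"
    "\<forall>z w. (z, w) \<in> B \<longrightarrow>
      (\<exists>z' w'. (z', w) \<in> A \<and> (z, w') \<in> A \<and> (z', z) \<in> snd \<pi>1 \<and> (w', w) \<in> snd \<pi>2) \<or>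
      (\<exists>z' w'. (z', w) \<in> A \<and> (z, w') \<in> A \<and> (z, z') \<in> snd \<pi>1 \<and> (w, w') \<in> snd \<pi>2)"
proof -
  note p1 = pathD[OF \<pi>1] and p2 = pathD[OF \<pi>2]
  have AP: "A \<subseteq> fst \<pi>1 \<times> fst \<pi>2" "\<And>z. z \<in> fst \<pi>1 \<Longrightarrow> \<exists>w. (z, w) \<in> A" "\<And>w. w \<in> fst \<pi>2 \<Longrightarrow> \<exists>z. (z, w) \<in> A"
    using A unfolding Corr_def by blast+
  \<comment> \<open>\<open>V z\<close> collects the partners of all points up to \<open>z\<close>,
    and its maximum is the running maximum at \<open>z\<close>. \<open>W w\<close> is its
    counterpart for the other direction: all points with a partner from \<open>w\<close> on, of
    which the minimum is taken.\<close>
  define V where "V z = {w. \<exists>z'. (z', w) \<in> A \<and> (z', z) \<in> snd \<pi>1}" for z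
  define W where "W w = {z. \<exists>w'. (z, w') \<in> A \<and> (w, w') \<in> snd \<pi>2}" for w
  have VW: "V z \<subseteq> fst \<pi>2" "W w \<subseteq> fst \<pi>1" for z w unfolding V_def W_def using AP by blast+
  have Vmax: "\<exists>m\<in>V z. \<forall>w\<in>V z. (w, m) \<in> snd \<pi>2" if z: "z \<in> fst \<pi>1" for z
  proof -
    have "compactin mtopology (V z)"
    proof (rule compactinI)
      show "V z \<subseteq> squeezed X" using VW p2(3) by blast
      fix \<tau> assume \<tau>: "\<And>n::nat. \<tau> n \<in> V z"
      then obtain \<sigma> where \<sigma>: "\<And>n. (\<sigma> n, \<tau> n) \<in> A" "\<And>n. (\<sigma> n, z) \<in> snd \<pi>1" unfolding V_def mem_Collect_eq by metis
      have P: "\<sigma> n \<in> fst \<pi>1" "\<tau> n \<in> fst \<pi>2" for n using \<sigma>(1)[of n] AP(1) by auto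
      obtain r l m where r: "strict_mono (r :: nat \<Rightarrow> nat)" "l \<in> fst \<pi>1" "m \<in> fst \<pi>2"
        "vanishes (\<lambda>n. d (\<sigma> (r n)) l)" "vanishes (\<lambda>n. d (\<tau> (r n)) m)"
        by (rule compactin_subseq2[OF p1(2) P(1) p2(2) P(2)])
      have "(l, m) \<in> A" by (rule cl[OF \<sigma>(1) r(2-5)])
      moreover have "(l, z) \<in> snd \<pi>1"
        by (rule path_closed[OF \<pi>1 \<sigma>(2) r(2) z r(4)]) (use z p1(3) in auto)
      ultimately show "\<exists>r l. strict_mono (r :: nat \<Rightarrow> nat) \<and> l \<in> V z \<and> vanishes (\<lambda>n. d (\<tau> (r n)) l)"
        using r unfolding V_def by blast
    qed
    moreover have "V z \<noteq> {}" using AP(2)[OF z] p1(6)[OF z] unfolding V_def by blast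
    ultimately show ?thesis
    proof (rule compact_order_max[where R = "snd \<pi>2"])
      show "(a, l) \<in> snd \<pi>2" if "\<And>n. \<sigma> n \<in> V z" "l \<in> V z" "\<And>n. (a, \<sigma> n) \<in> snd \<pi>2" "vanishes (\<lambda>n. d (\<sigma> n) l)" for a \<sigma> l
      proof -
        have a: "a \<in> fst \<pi>2" using p2(13)[OF that(3)] .
        have l: "l \<in> fst \<pi>2" using that(2) VW(1) by blast
        show ?thesis
          by (rule path_closed[OF \<pi>2 that(3) a l _ that(4)]) (simp add: subsetD[OF p2(3) a])
      qed
      show "(a, b) \<in> snd \<pi>2 \<or> (b, a) \<in> snd \<pi>2" if "a \<in> V z" "b \<in> V z" for a b using that VW(1) p2(9) by blast
    qed (blast intro: p2(7))+
  qed
  have Wmin: "\<exists>m\<in>W w. \<forall>z\<in>W w. (m, z) \<in> snd \<pi>1" if w: "w \<in> fst \<pi>2" for w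
  proof -
    have "compactin mtopology (W w)"
    proof (rule compactinI)
      show "W w \<subseteq> squeezed X" using VW p1(3) by blast
      fix \<sigma> assume \<sigma>: "\<And>n::nat. \<sigma> n \<in> W w"
      then obtain \<tau> where \<tau>: "\<And>n. (\<sigma> n, \<tau> n) \<in> A" "\<And>n. (w, \<tau> n) \<in> snd \<pi>2" unfolding W_def mem_Collect_eq by metis
      have P: "\<sigma> n \<in> fst \<pi>1" "\<tau> n \<in> fst \<pi>2" for n using \<tau>(1)[of n] AP(1) by auto
      obtain r l m where r: "strict_mono (r :: nat \<Rightarrow> nat)" "l \<in> fst \<pi>1" "m \<in> fst \<pi>2"
        "vanishes (\<lambda>n. d (\<sigma> (r n)) l)" "vanishes (\<lambda>n. d (\<tau> (r n)) m)"
        by (rule compactin_subseq2[OF p1(2) P(1) p2(2) P(2)])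
      have "(l, m) \<in> A" by (rule cl[OF \<tau>(1) r(2-5)])
      moreover have "(w, m) \<in> snd \<pi>2"
        by (rule path_closed[OF \<pi>2 \<tau>(2) w r(3) _ r(5)]) (use w p2(3) in auto)
      ultimately show "\<exists>r l. strict_mono (r :: nat \<Rightarrow> nat) \<and> l \<in> W w \<and> vanishes (\<lambda>n. d (\<sigma> (r n)) l)"
        using r unfolding W_def by blast
    qed
    moreover have "W w \<noteq> {}" using AP(3)[OF w] p2(6)[OF w] unfolding W_def by blast
    ultimately show ?thesis
    proof (rule compact_order_max[where R = "(snd \<pi>1)\<inverse>"])
      show "(a, l) \<in> (snd \<pi>1)\<inverse>" if "\<And>n. \<sigma> n \<in> W w" "l \<in> W w" "\<And>n. (a, \<sigma> n) \<in> (snd \<pi>1)\<inverse>" "vanishes (\<lambda>n. d (\<sigma> n) l)" for a \<sigma> l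
      proof -
        have *: "(\<sigma> n, a) \<in> snd \<pi>1" for n using that(3) by simp
        then have a: "a \<in> fst \<pi>1" using p1(14) by blast
        have l: "l \<in> fst \<pi>1" using that(2) VW(2) by blast
        show ?thesis
          unfolding converse_iff by (rule path_closed[OF \<pi>1 * l a that(4)]) (simp add: subsetD[OF p1(3) a])
      qed
      show "(a, b) \<in> (snd \<pi>1)\<inverse> \<or> (b, a) \<in> (snd \<pi>1)\<inverse>" if "a \<in> W w" "b \<in> W w" for a b using that VW(2) p1(9) by blast
    qed (blast intro: p1(7))+
  qed
  define B1 where "B1 = {(z, w). z \<in> fst \<pi>1 \<and> w \<in> V z \<and> (\<forall>w'\<in>V z. (w', w) \<in> snd \<pi>2)}"
  define B2 where "B2 = {(z, w). w \<in> fst \<pi>2 \<and> z \<in> W w \<and> (\<forall>z'\<in>W w. (z, z') \<in> snd \<pi>1)}"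
  have Vmono: "V z \<subseteq> V z'" if "(z, z') \<in> snd \<pi>1" for z z' unfolding V_def using that p1(7) by blast
  have Wmono: "W w' \<subseteq> W w" if "(w, w') \<in> snd \<pi>2" for w w' unfolding W_def using that p2(7) by blast
  show ?thesis
  proof (rule that[of "B1 \<union> B2"])
    show "B1 \<union> B2 \<in> Corr_mono \<pi>1 \<pi>2"
    proof (rule Corr_monoI)
      show "B1 \<union> B2 \<subseteq> fst \<pi>1 \<times> fst \<pi>2" unfolding B1_def B2_def using VW by blast
      show "\<exists>w. (z, w) \<in> B1 \<union> B2" if "z \<in> fst \<pi>1" for z using Vmax[OF that] that unfolding B1_def by blast
      show "\<exists>z. (z, w) \<in> B1 \<union> B2" if "w \<in> fst \<pi>2" for w using Wmin[OF that] that unfolding B2_def by blast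
      fix z w z' w' assume B: "(z, w) \<in> B1 \<union> B2" "(z', w') \<in> B1 \<union> B2" and zz: "(z, z') \<in> snd \<pi>1" "z \<noteq> z'" and ww: "(w', w) \<in> snd \<pi>2"
      have nz: "(z', z) \<notin> snd \<pi>1" using zz p1(8) by blast
      have "(w, w') \<in> snd \<pi>2"
      proof (rule ccontr)
        assume nw: "(w, w') \<notin> snd \<pi>2"
        \<comment> \<open>Within \<open>B1\<close> and within \<open>B2\<close> monotonicity holds
          because \<open>V\<close> and \<open>W\<close> are monotone families. In the mixed cases
          the pair of \<open>A\<close> that witnesses the one membership belongs to the family of
          the other pair, and the extremality of the latter gives the contradiction.\<close>
        consider "(z, w) \<in> B1" "(z', w') \<in> B1" | "(z, w) \<in> B2" "(z', w') \<in> B2" | "(z, w) \<in> B1" "(z', w') \<in> B2" | "(z, w) \<in> B2" "(z', w') \<in> B1"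
          using B by blast
        then show False
        proof cases
          case 1 then show ?thesis using Vmono[OF zz(1)] nw unfolding B1_def by blast
        next
          case 2 then show ?thesis using Wmono[OF ww] nz unfolding B2_def by blast
        next
          case 3
          then obtain z'' where "(z'', w) \<in> A" "(z'', z) \<in> snd \<pi>1" unfolding B1_def V_def by blast
          moreover then have "z'' \<in> W w'" using ww unfolding W_def by blast
          ultimately show ?thesis using 3 nz p1(7) unfolding B2_def by blast
        next
          case 4
          then obtain w'' where "(z, w'') \<in> A" "(w, w'') \<in> snd \<pi>2" unfolding B2_def W_def by blast
          moreover then have "w'' \<in> V z'" using zz unfolding V_def by blast
          ultimately show ?thesis using 4 nw p2(7) unfolding B1_def by blast
        qed
      qed
      then show "w' = w" using ww p2(8) by blast
    qed
    \<comment> \<open>A running maximum \<open>w\<close> at \<open>z\<close> comes from some earlier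
      \<open>z'\<close> and is at least as late as any partner \<open>w'\<close> of
      \<open>z\<close>. So \<open>(z', w)\<close> and \<open>(z, w')\<close> cross, and
      \<open>(z, w)\<close> is the upper corner of the crossing; the pairs of \<open>B2\<close> are
      lower corners.\<close>
    show "\<forall>z w. (z, w) \<in> B1 \<union> B2 \<longrightarrow>
      (\<exists>z' w'. (z', w) \<in> A \<and> (z, w') \<in> A \<and> (z', z) \<in> snd \<pi>1 \<and> (w', w) \<in> snd \<pi>2) \<or>
      (\<exists>z' w'. (z', w) \<in> A \<and> (z, w') \<in> A \<and> (z, z') \<in> snd \<pi>1 \<and> (w, w') \<in> snd \<pi>2)"
    proof (intro allI impI)
    fix z w assume "(z, w) \<in> B1 \<union> B2"
    then consider "(z, w) \<in> B1" | "(z, w) \<in> B2" by blast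
    then show "(\<exists>z' w'. (z', w) \<in> A \<and> (z, w') \<in> A \<and> (z', z) \<in> snd \<pi>1 \<and> (w', w) \<in> snd \<pi>2) \<or>
      (\<exists>z' w'. (z', w) \<in> A \<and> (z, w') \<in> A \<and> (z, z') \<in> snd \<pi>1 \<and> (w, w') \<in> snd \<pi>2)"
    proof cases
      case 1
      then obtain z' where z': "(z', w) \<in> A" "(z', z) \<in> snd \<pi>1" "z \<in> fst \<pi>1" unfolding B1_def V_def by blast
      obtain w' where w': "(z, w') \<in> A" using AP(2) z' by blast
      then have "w' \<in> V z" unfolding V_def using p1(6) z' by blast
      then have "(w', w) \<in> snd \<pi>2" using 1 unfolding B1_def by blast
      then show ?thesis using z' w' by blast
    next
      case 2
      then obtain w' where w': "(z, w') \<in> A" "(w, w') \<in> snd \<pi>2" "w \<in> fst \<pi>2" unfolding B2_def W_def by blast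
      obtain z' where z': "(z', w) \<in> A" using AP(3) w' by blast
      then have "z' \<in> W w" unfolding W_def using p2(6) w' by blast
      then have "(z, z') \<in> snd \<pi>1" using 2 unfolding B2_def by blast
      then show ?thesis using z' w' by blast
    qed
    qed
  qed
qed

text \<open>Some monotone correspondence exists, since the full product can be refined to one, and
  its distances are bounded by compactness. Hence the infimum in \<open>d_tot\<close> is
  finite.\<close>

lemma d_tot_lessD:
  assumes "\<pi>1 \<in> paths X" "\<pi>2 \<in> paths X" "d_tot d \<pi>1 \<pi>2 < r"
  obtains C where "C \<in> Corr_mono \<pi>1 \<pi>2" "\<And>z w. (z, w) \<in> C \<Longrightarrow> d z w < r"
proof -
  have "fst \<pi>1 \<times> fst \<pi>2 \<in> Corr (fst \<pi>1) (fst \<pi>2)" using pathD(1)[OF assms(1)] pathD(1)[OF assms(2)] unfolding Corr_def by blast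
  then obtain B where B: "B \<in> Corr_mono \<pi>1 \<pi>2" by (rule corr_refine[OF assms(1,2)]) auto
  obtain K where K: "\<And>x y. x \<in> fst \<pi>1 \<Longrightarrow> y \<in> fst \<pi>2 \<Longrightarrow> d x y \<le> K"
    using compactin_bounded2[OF pathD(2)[OF assms(1)] pathD(2)[OF assms(2)]] by blast
  have "\<exists>C\<in>Corr_mono \<pi>1 \<pi>2. \<forall>(z, w)\<in>C. d z w < r"
    by (rule corr_dist_lessD[OF B, where B = K]) (use K Corr_monoD(1)[OF B] assms in \<open>auto simp: d_tot_def\<close>)
  then show ?thesis using that by blast
qed

lemma d_tot_le:
  assumes "C \<in> Corr_mono \<pi>1 \<pi>2" "\<And>z w. (z, w) \<in> C \<Longrightarrow> d z w \<le> r" "0 \<le> r"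
  shows "d_tot d \<pi>1 \<pi>2 \<le> r"
  unfolding d_tot_def using assms by (rule corr_dist_le)

lemma d_H_le_d_part:
  assumes "\<pi>1 \<in> paths X" "\<pi>2 \<in> paths X"
  shows "d_H d \<pi>1 \<pi>2 \<le> d_part d \<pi>1 \<pi>2"
proof (rule field_le_epsilon)
  fix e :: real assume "e > 0"
  then have less: "d_part d \<pi>1 \<pi>2 < d_part d \<pi>1 \<pi>2 + e" by simp
  show "d_H d \<pi>1 \<pi>2 \<le> d_part d \<pi>1 \<pi>2 + e"
  proof (rule d_H_le[OF assms])
    show "0 \<le> d_part d \<pi>1 \<pi>2 + e" using \<open>e > 0\<close> by (simp add: add_nonneg_pos less_imp_le)
    show "\<exists>w\<in>fst \<pi>2. d z w \<le> d_part d \<pi>1 \<pi>2 + e" if "z \<in> fst \<pi>1" for z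
      using d_part_lessD(1)[OF assms less pathD(6)[OF assms(1) that]] pathD(13)[OF assms(2)] by (meson less_imp_le)
    show "\<exists>z\<in>fst \<pi>1. d z w \<le> d_part d \<pi>1 \<pi>2 + e" if "w \<in> fst \<pi>2" for w
      using d_part_lessD(2)[OF assms less pathD(6)[OF assms(2) that]] pathD(13)[OF assms(1)] by (meson less_imp_le)
  qed
qed

text \<open>A monotone correspondence carries ordered pairs to ordered pairs, except possibly when
  the two points are equal; then one partner is used twice.\<close>

lemma d_part_le_d_tot:
  assumes "\<pi>1 \<in> paths X" "\<pi>2 \<in> paths X"
  shows "d_part d \<pi>1 \<pi>2 \<le> d_tot d \<pi>1 \<pi>2"
proof (rule field_le_epsilon)
  fix e :: real assume "e > 0"
  then obtain C where C: "C \<in> Corr_mono \<pi>1 \<pi>2" "\<And>z w. (z, w) \<in> C \<Longrightarrow> d z w < d_tot d \<pi>1 \<pi>2 + e"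
    using d_tot_lessD[OF assms, of "d_tot d \<pi>1 \<pi>2 + e"] by auto
  note C' = Corr_monoD[OF C(1)] and p1 = pathD[OF assms(1)] and p2 = pathD[OF assms(2)]
  show "d_part d \<pi>1 \<pi>2 \<le> d_tot d \<pi>1 \<pi>2 + e"
  proof (rule d_part_le[OF assms])
    show "0 \<le> d_tot d \<pi>1 \<pi>2 + e" using \<open>e > 0\<close> by (simp add: d_tot_def add_nonneg_pos less_imp_le)
    show "\<exists>w w'. (w, w') \<in> snd \<pi>2 \<and> d z w \<le> d_tot d \<pi>1 \<pi>2 + e \<and> d z' w' \<le> d_tot d \<pi>1 \<pi>2 + e"
      if zz: "(z, z') \<in> snd \<pi>1" for z z'
    proof -
      obtain w w' where w: "(z, w) \<in> C" "(z', w') \<in> C" using C'(2) p1(13,14)[OF zz] by blast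
      then have P: "w \<in> fst \<pi>2" "w' \<in> fst \<pi>2" using C'(1) by auto
      have dl: "d z w \<le> d_tot d \<pi>1 \<pi>2 + e" "d z' w' \<le> d_tot d \<pi>1 \<pi>2 + e" using C(2)[OF w(1)] C(2)[OF w(2)] by linarith+
      consider "(w, w') \<in> snd \<pi>2" | "z = z'" using C'(4)[OF w zz] p2(9)[OF P] p2(6) P by blast
      then show ?thesis using dl p2(6)[OF P(1)] by cases blast+
    qed
    show "\<exists>z z'. (z, z') \<in> snd \<pi>1 \<and> d z w \<le> d_tot d \<pi>1 \<pi>2 + e \<and> d z' w' \<le> d_tot d \<pi>1 \<pi>2 + e"
      if ww: "(w, w') \<in> snd \<pi>2" for w w'
    proof -
      obtain z z' where w: "(z, w) \<in> C" "(z', w') \<in> C" using C'(3) p2(13,14)[OF ww] by blast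
      then have P: "z \<in> fst \<pi>1" "z' \<in> fst \<pi>1" using C'(1) by auto
      have dl: "d z w \<le> d_tot d \<pi>1 \<pi>2 + e" "d z' w' \<le> d_tot d \<pi>1 \<pi>2 + e" using C(2)[OF w(1)] C(2)[OF w(2)] by linarith+
      consider "(z, z') \<in> snd \<pi>1" | "w = w'" using C'(4)[OF w(2,1) _ _ ww] p1(9)[OF P] p1(6) P by blast
      then show ?thesis using dl p1(6)[OF P(1)] by cases blast+
    qed
  qed
qed

text \<open>The composition of two monotone correspondences need not be monotone, but it has a monotone
  refinement inside its closure.\<close>

lemma d_tot_triangle:
  assumes "\<pi>1 \<in> paths X" "\<pi>2 \<in> paths X" "\<pi>3 \<in> paths X"
  shows "d_tot d \<pi>1 \<pi>3 \<le> d_tot d \<pi>1 \<pi>2 + d_tot d \<pi>2 \<pi>3"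
proof (rule field_le_epsilon)
  fix e :: real assume "e > 0"
  define r1 where "r1 = d_tot d \<pi>1 \<pi>2 + e / 2"
  define r2 where "r2 = d_tot d \<pi>2 \<pi>3 + e / 2"
  obtain C1 where C1: "C1 \<in> Corr_mono \<pi>1 \<pi>2" "\<And>z w. (z, w) \<in> C1 \<Longrightarrow> d z w < r1"
    using d_tot_lessD[OF assms(1,2), of r1] \<open>e > 0\<close> unfolding r1_def by auto
  obtain C2 where C2: "C2 \<in> Corr_mono \<pi>2 \<pi>3" "\<And>z w. (z, w) \<in> C2 \<Longrightarrow> d z w < r2"
    using d_tot_lessD[OF assms(2,3), of r2] \<open>e > 0\<close> unfolding r2_def by auto
  note C1' = Corr_monoD[OF C1(1)] and C2' = Corr_monoD[OF C2(1)]
  note p1 = pathD[OF assms(1)] and p2 = pathD[OF assms(2)] and p3 = pathD[OF assms(3)]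
  define E where "E = C1 O C2"
  have EP: "E \<subseteq> fst \<pi>1 \<times> fst \<pi>3" unfolding E_def using C1'(1) C2'(1) by blast
  have EM: "x \<in> squeezed X" "z \<in> squeezed X" if "(x, z) \<in> E" for x z using that EP p1(3) p3(3) by blast+
  have Ed: "d x z \<le> r1 + r2" if xz: "(x, z) \<in> E" for x z
  proof -
    obtain y where y: "(x, y) \<in> C1" "(y, z) \<in> C2" using xz unfolding E_def by blast
    then have "x \<in> squeezed X" "y \<in> squeezed X" "z \<in> squeezed X" using C1'(1) C2'(1) p1(3) p2(3) p3(3) by blast+
    then show ?thesis using triangle[of x y z] C1(2)[OF y(1)] C2(2)[OF y(2)] by linarith
  qed
  \<comment> \<open>Monotonicity of \<open>C1\<close> and of \<open>C2\<close> excludes each strict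
    order of the middle points of a crossing, so these coincide. Through the common middle point all
    four corners belong to \<open>E\<close>.\<close>
  have Ebetween: "(x', w') \<in> E \<and> (x, w) \<in> E"
    if E: "(x, w') \<in> E" "(x', w) \<in> E" "(x, x') \<in> snd \<pi>1" "x \<noteq> x'" "(w, w') \<in> snd \<pi>3" "w \<noteq> w'" for x x' w w'
  proof -
    obtain y y' where y: "(x, y) \<in> C1" "(y, w') \<in> C2" "(x', y') \<in> C1" "(y', w) \<in> C2" using E(1,2) unfolding E_def by blast
    have P: "y \<in> fst \<pi>2" "y' \<in> fst \<pi>2" using y C1'(1) by auto
    have "(y', y) \<in> snd \<pi>2 \<Longrightarrow> y' = y" using C1'(4)[OF y(1,3) E(3,4)] .
    moreover have "(y, y') \<in> snd \<pi>2 \<Longrightarrow> y = y'" using C2'(4)[OF y(2,4) _ _ E(5)] E(6) by blast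
    ultimately have "y = y'" using p2(9)[OF P] by blast
    then show ?thesis using y unfolding E_def by blast
  qed
  \<comment> \<open>The closure of \<open>E\<close>, taken because \<open>corr_refine\<close> needs
    a closed correspondence for its maxima and minima to exist.\<close>
  define A where "A = {(x, z). x \<in> fst \<pi>1 \<and> z \<in> fst \<pi>3 \<and> (\<forall>\<epsilon>>0. \<exists>x' z'. (x', z') \<in> E \<and> d x' x < \<epsilon> \<and> d z' z < \<epsilon>)}"
  have EA: "E \<subseteq> A"
  proof (clarify)
    fix x z assume xz: "(x, z) \<in> E"
    have "\<forall>\<epsilon>>0. \<exists>x' z'. (x', z') \<in> E \<and> d x' x < \<epsilon> \<and> d z' z < \<epsilon>"
      using xz mdist_zero[OF EM(1)[OF xz]] mdist_zero[OF EM(2)[OF xz]] by metis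
    then show "(x, z) \<in> A" unfolding A_def using EP xz by blast
  qed
  have Ad: "d x z \<le> r1 + r2" if xz: "(x, z) \<in> A" for x z
  proof (rule field_le_epsilon)
    fix \<epsilon> :: real assume "\<epsilon> > 0"
    then obtain x' z' where *: "(x', z') \<in> E" "d x' x < \<epsilon> / 2" "d z' z < \<epsilon> / 2" using xz half_gt_zero unfolding A_def by blast
    have M: "x \<in> squeezed X" "z \<in> squeezed X" using xz p1(3) p3(3) unfolding A_def by blast+
    have "d x z \<le> d x' x + d x' z" using triangle''[of x x' z] M EM[OF *(1)] by blast
    moreover have "d x' z \<le> d x' z' + d z' z" using triangle[of x' z' z] M EM[OF *(1)] by blast
    ultimately show "d x z \<le> r1 + r2 + \<epsilon>" using Ed[OF *(1)] * by linarith
  qed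
  \<comment> \<open>The corner property passes to the closure: strict order is an open condition, so
    pairs of \<open>E\<close> close enough to a strict crossing of \<open>A\<close> cross strictly
    as well.\<close>
  have Abetween: "(x', w') \<in> A \<and> (x, w) \<in> A"
    if A: "(x, w') \<in> A" "(x', w) \<in> A" and R: "(x, x') \<in> snd \<pi>1" "(w, w') \<in> snd \<pi>3" for x x' w w'
  proof (cases "x = x' \<or> w = w'")
    case True then show ?thesis using A by auto
  next
    case False
    obtain e1 where e1: "e1 > 0" "\<And>u v. u \<in> fst \<pi>1 \<Longrightarrow> v \<in> fst \<pi>1 \<Longrightarrow> d u x < e1 \<Longrightarrow> d v x' < e1 \<Longrightarrow> (v, u) \<notin> snd \<pi>1"
      using path_strict_open[OF assms(1) R(1)] False by blast
    obtain e3 where e3: "e3 > 0" "\<And>u v. u \<in> fst \<pi>3 \<Longrightarrow> v \<in> fst \<pi>3 \<Longrightarrow> d u w < e3 \<Longrightarrow> d v w' < e3 \<Longrightarrow> (v, u) \<notin> snd \<pi>3"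
      using path_strict_open[OF assms(3) R(2)] False by blast
    have "\<exists>a b a' b'. (a', b') \<in> E \<and> (a, b) \<in> E \<and> d a x < \<epsilon> \<and> d b w < \<epsilon> \<and> d a' x' < \<epsilon> \<and> d b' w' < \<epsilon>" if "\<epsilon> > 0" for \<epsilon>
    proof -
      define m where "m = min \<epsilon> (min e1 e3)"
      have m: "m > 0" "m \<le> \<epsilon>" "m \<le> e1" "m \<le> e3" using that e1 e3 unfolding m_def by auto
      obtain a b' where ab: "(a, b') \<in> E" "d a x < m" "d b' w' < m" using A(1) m(1) unfolding A_def by blast
      obtain a' b where ab': "(a', b) \<in> E" "d a' x' < m" "d b w < m" using A(2) m(1) unfolding A_def by blast
      have P: "a \<in> fst \<pi>1" "a' \<in> fst \<pi>1" "b \<in> fst \<pi>3" "b' \<in> fst \<pi>3" using ab ab' EP by auto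
      have "(a', a) \<notin> snd \<pi>1" "(b', b) \<notin> snd \<pi>3" using e1(2)[OF P(1,2)] e3(2)[OF P(3,4)] ab ab' m by auto
      then have "(a, a') \<in> snd \<pi>1" "a \<noteq> a'" "(b, b') \<in> snd \<pi>3" "b \<noteq> b'"
        using p1(6,9) p3(6,9) P by blast+
      then have "(a', b') \<in> E \<and> (a, b) \<in> E" using Ebetween[OF ab(1) ab'(1)] by blast
      then show ?thesis using ab ab' m by (meson less_le_trans)
    qed
    then show ?thesis using A unfolding A_def by blast
  qed
  have ACorr: "A \<in> Corr (fst \<pi>1) (fst \<pi>3)"
  proof -
    have "\<exists>w. (z, w) \<in> E" if "z \<in> fst \<pi>1" for z unfolding E_def using C1'(1,2) C2'(2) that by blast
    moreover have "\<exists>z. (z, w) \<in> E" if "w \<in> fst \<pi>3" for w unfolding E_def using C1'(3) C2'(1,3) that by blast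
    ultimately show ?thesis using EA EP unfolding Corr_def A_def by blast
  qed
  have Acl: "(x, y) \<in> A" if \<sigma>: "\<And>n. (\<sigma> n, \<tau> n) \<in> A" "x \<in> fst \<pi>1" "y \<in> fst \<pi>3"
     "vanishes (\<lambda>n. d (\<sigma> n) x)" "vanishes (\<lambda>n. d (\<tau> n) y)" for \<sigma> \<tau> x y
  proof -
    have "\<exists>x' z'. (x', z') \<in> E \<and> d x' x < \<epsilon> \<and> d z' y < \<epsilon>" if "\<epsilon> > 0" for \<epsilon>
    proof -
      have e2: "\<epsilon> / 2 > 0" using that by simp
      have "\<forall>\<^sub>F n in sequentially. d (\<sigma> n) x < \<epsilon> / 2 \<and> d (\<tau> n) y < \<epsilon> / 2"
        using order_tendstoD(2)[OF \<sigma>(4) e2] order_tendstoD(2)[OF \<sigma>(5) e2] by eventually_elim simp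
      then obtain n where n: "d (\<sigma> n) x < \<epsilon> / 2" "d (\<tau> n) y < \<epsilon> / 2" unfolding eventually_sequentially by blast
      obtain x' z' where *: "(x', z') \<in> E" "d x' (\<sigma> n) < \<epsilon> / 2" "d z' (\<tau> n) < \<epsilon> / 2"
        using \<sigma>(1)[of n] e2 unfolding A_def by blast
      have M: "\<sigma> n \<in> squeezed X" "\<tau> n \<in> squeezed X" "x \<in> squeezed X" "y \<in> squeezed X"
        using \<sigma>(1)[of n] \<sigma>(2,3) p1(3) p3(3) unfolding A_def by auto
      show ?thesis
        using triangle[of x' "\<sigma> n" x] triangle[of z' "\<tau> n" y] M EM[OF *(1)] * n by (intro exI[of _ x'] exI[of _ z']) auto
    qed
    then show ?thesis using \<sigma>(2,3) unfolding A_def by blast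
  qed
  obtain B where B: "B \<in> Corr_mono \<pi>1 \<pi>3" "\<forall>z w. (z, w) \<in> B \<longrightarrow>
      (\<exists>z' w'. (z', w) \<in> A \<and> (z, w') \<in> A \<and> (z', z) \<in> snd \<pi>1 \<and> (w', w) \<in> snd \<pi>3) \<or>
      (\<exists>z' w'. (z', w) \<in> A \<and> (z, w') \<in> A \<and> (z, z') \<in> snd \<pi>1 \<and> (w, w') \<in> snd \<pi>3)"
    by (rule corr_refine[OF assms(1,3) ACorr Acl])
  \<comment> \<open>The refinement consists of corners of crossings of \<open>A\<close>, so it stays
    inside \<open>A\<close> and the bound for \<open>A\<close> applies.\<close>
  have "(z, w) \<in> A" if "(z, w) \<in> B" for z w using B(2)[rule_format, OF that] Abetween by blast
  then have "d_tot d \<pi>1 \<pi>3 \<le> r1 + r2"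
    using Ad B(1) \<open>e > 0\<close> by (intro d_tot_le[OF B(1)]) (auto simp: r1_def r2_def d_tot_def add_nonneg_pos less_imp_le)
  then show "d_tot d \<pi>1 \<pi>3 \<le> d_tot d \<pi>1 \<pi>2 + d_tot d \<pi>2 \<pi>3 + e" unfolding r1_def r2_def by simp
qed

lemma Metric_space_d_tot: "Metric_space (paths X) (d_tot d)"
proof
  interpret P: Metric_space "paths X" "d_part d" by (rule Metric_space_d_part)
  show "0 \<le> d_tot d x y" for x y by (simp add: d_tot_def)
  show "d_tot d x y = d_tot d y x" for x y by (rule d_tot_commute)
  show "d_tot d x z \<le> d_tot d x y + d_tot d y z" if "x \<in> paths X" "y \<in> paths X" "z \<in> paths X" for x y z
    using d_tot_triangle that by blast
  show "d_tot d x y = 0 \<longleftrightarrow> x = y" if xy: "x \<in> paths X" "y \<in> paths X" for x y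
  proof
    assume "d_tot d x y = 0"
    then show "x = y" using d_part_le_d_tot[OF xy] P.zero[OF xy] by (simp add: order_antisym)
  next
    assume "x = y"
    have "Id_on (fst x) \<in> Corr_mono x x" by (rule Corr_monoI) (use pathD(8)[OF xy(1)] in blast)+
    then have "d_tot d x x \<le> 0" by (rule d_tot_le) (use pathD(3)[OF xy(1)] in auto)
    then show "d_tot d x y = 0" using \<open>x = y\<close> by (simp add: d_tot_def order_antisym)
  qed
qed

text \<open>All pairs at distance at most \<open>\<delta>\<close> are taken and refined. The refined
  pairs are corners of crossings; matching the order of \<open>\<pi>'\<close> back to
  \<open>\<pi>\<close> shows that the two points of \<open>\<pi>\<close> in such a crossing almost
  precede each other, so that they are close by uniform antisymmetry. The radius therefore depends
  on \<open>\<pi>\<close>.\<close>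

lemma d_tot_small:
  assumes \<pi>: "\<pi> \<in> paths X" and "e > 0"
  obtains \<delta> where "\<delta> > 0" "\<And>\<pi>'. \<pi>' \<in> paths X \<Longrightarrow> d_part d \<pi> \<pi>' < \<delta> \<Longrightarrow> d_tot d \<pi> \<pi>' < e"
proof -
  have "e / 4 > 0" using assms by simp
  then obtain \<delta>0 where \<delta>0: "\<delta>0 > 0" "\<And>w w' u u'. (w, w') \<in> snd \<pi> \<Longrightarrow> (u', u) \<in> snd \<pi> \<Longrightarrow>
    d w u < \<delta>0 \<Longrightarrow> d w' u' < \<delta>0 \<Longrightarrow> d w w' < e / 4"
    using path_uniform_antisym[OF \<pi>] by blast
  \<comment> \<open>Comparisons of points of \<open>\<pi>\<close> run through a point of
    \<open>\<pi>'\<close> and cost \<open>2 * \<delta>\<close>, to be at most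
    \<open>\<delta>0\<close>; the bound \<open>e / 4\<close> leaves room for another
    \<open>e / 4\<close> from antisymmetry.\<close>
  define \<delta> where "\<delta> = min (\<delta>0 / 2) (e / 4)"
  have \<delta>: "\<delta> > 0" "2 * \<delta> \<le> \<delta>0" "\<delta> \<le> e / 4" using \<delta>0 assms unfolding \<delta>_def by auto
  have "d_tot d \<pi> \<pi>' < e" if \<pi>': "\<pi>' \<in> paths X" and less: "d_part d \<pi> \<pi>' < \<delta>" for \<pi>'
  proof -
    note p = pathD[OF \<pi>] and p' = pathD[OF \<pi>'] and near = d_part_lessD[OF \<pi> \<pi>' less]
    define A where "A = {(z, w). z \<in> fst \<pi> \<and> w \<in> fst \<pi>' \<and> d z w \<le> \<delta>}"
    have AM: "z \<in> squeezed X" "w \<in> squeezed X" if "(z, w) \<in> A" for z w using that p(3) p'(3) unfolding A_def by auto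
    have RM: "z \<in> squeezed X" "w \<in> squeezed X" if "(z, w) \<in> snd \<pi>" for z w using that p(3,13,14) by blast+
    have tri: "d x z < \<delta>0" if "x \<in> squeezed X" "y \<in> squeezed X" "z \<in> squeezed X" "d x y \<le> \<delta>" "d z y < \<delta>" for x y z
      using triangle'[of x y z] that \<delta> by linarith
    have ACorr: "A \<in> Corr (fst \<pi>) (fst \<pi>')"
    proof -
      have "\<exists>b\<in>fst \<pi>'. d a b \<le> \<delta>" if "a \<in> fst \<pi>" for a
        using near(1)[OF p(6)[OF that]] p'(13) by (meson less_imp_le)
      moreover have "\<exists>a\<in>fst \<pi>. d a b \<le> \<delta>" if "b \<in> fst \<pi>'" for b
        using near(2)[OF p'(6)[OF that]] p(13) by (meson less_imp_le)
      ultimately show ?thesis unfolding Corr_def A_def by blast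
    qed
    have Acl: "(x, y) \<in> A" if \<sigma>: "\<And>n. (\<sigma> n, \<tau> n) \<in> A" "x \<in> fst \<pi>" "y \<in> fst \<pi>'"
        "vanishes (\<lambda>n. d (\<sigma> n) x)" "vanishes (\<lambda>n. d (\<tau> n) y)" for \<sigma> \<tau> x y
    proof -
      have "(\<lambda>n. d (\<sigma> n) (\<tau> n)) \<longlonglongrightarrow> d x y"
        using \<sigma> AM p(3) p'(3) by (intro tendsto_dist_dist) blast+
      then have "d x y \<le> \<delta>" by (rule LIMSEQ_le_const2) (use \<sigma>(1) in \<open>auto simp: A_def\<close>)
      then show ?thesis using \<sigma>(2,3) unfolding A_def by blast
    qed
    obtain B where B: "B \<in> Corr_mono \<pi> \<pi>'" "\<forall>z w. (z, w) \<in> B \<longrightarrow>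
      (\<exists>z' w'. (z', w) \<in> A \<and> (z, w') \<in> A \<and> (z', z) \<in> snd \<pi> \<and> (w', w) \<in> snd \<pi>') \<or>
      (\<exists>z' w'. (z', w) \<in> A \<and> (z, w') \<in> A \<and> (z, z') \<in> snd \<pi> \<and> (w, w') \<in> snd \<pi>')"
      by (rule corr_refine[OF \<pi> \<pi>' ACorr Acl])
    have "d z w \<le> e / 2" if zw: "(z, w) \<in> B" for z w
    proof -
      obtain z' w' where *: "(z', w) \<in> A" "(z, w') \<in> A" "d z' z < e / 4"
      proof -
        from B(2)[rule_format, OF zw] show ?thesis
        proof (elim disjE exE conjE)
          fix z' w' assume 1: "(z', w) \<in> A" "(z, w') \<in> A" "(z', z) \<in> snd \<pi>" "(w', w) \<in> snd \<pi>'"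
          \<comment> \<open>The ordered pair \<open>(w', w)\<close> of \<open>\<pi>'\<close> has an
            ordered pair \<open>(u', u)\<close> of \<open>\<pi>\<close> nearby. As \<open>u\<close>
            is near \<open>z'\<close> and \<open>u'\<close> near \<open>z\<close>, it nearly
            reverses the pair \<open>(z', z)\<close>.\<close>
          obtain u' u where u: "(u', u) \<in> snd \<pi>" "d u' w' < \<delta>" "d u w < \<delta>" using near(2)[OF 1(4)] by blast
          have "d z' u < \<delta>0" "d z u' < \<delta>0"
            using tri[of z' w u] tri[of z w' u'] AM[OF 1(1)] AM[OF 1(2)] RM[OF u(1)] u 1(1,2) unfolding A_def by auto
          then have "d z' z < e / 4" by (rule \<delta>0(2)[OF 1(3) u(1)])
          then show ?thesis by (rule that[OF 1(1,2)])
        next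
          fix z' w' assume 2: "(z', w) \<in> A" "(z, w') \<in> A" "(z, z') \<in> snd \<pi>" "(w, w') \<in> snd \<pi>'"
          obtain u u' where u: "(u, u') \<in> snd \<pi>" "d u w < \<delta>" "d u' w' < \<delta>" using near(2)[OF 2(4)] by blast
          have "d z' u < \<delta>0" "d z u' < \<delta>0"
            using tri[of z' w u] tri[of z w' u'] AM[OF 2(1)] AM[OF 2(2)] RM[OF u(1)] u 2(1,2) unfolding A_def by auto
          then have "d z z' < e / 4" using \<delta>0(2)[OF 2(3) u(1)] by blast
          then show ?thesis using commute[of z z'] by (intro that[OF 2(1,2)]) simp
        qed
      qed
      then show ?thesis using triangle''[of z z' w] AM[OF *(1)] AM[OF *(2)] \<delta> unfolding A_def by auto
    qed
    then have "d_tot d \<pi> \<pi>' \<le> e / 2" using \<open>e > 0\<close> by (intro d_tot_le[OF B(1)]) auto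
    then show ?thesis using \<open>e > 0\<close> by linarith
  qed
  then show ?thesis using that \<delta> by blast
qed

lemma mtopology_d_tot_eq_d_part:
  "Metric_space.mtopology (paths X) (d_tot d) = Metric_space.mtopology (paths X) (d_part d)"
proof (rule mtopology_eqI[OF Metric_space_d_tot Metric_space_d_part])
  show "\<exists>\<delta>>0. \<forall>y\<in>paths X. d_tot d x y < \<delta> \<longrightarrow> d_part d x y < e" if "x \<in> paths X" "e > 0" for x e
    using d_part_le_d_tot[OF that(1)] that(2) by (intro exI[of _ e]) (auto intro: le_less_trans)
  show "\<exists>\<delta>>0. \<forall>y\<in>paths X. d_part d x y < \<delta> \<longrightarrow> d_tot d x y < e" if "x \<in> paths X" "e > 0" for x e
    using d_tot_small[OF that] by metis
qed

end

text \<open>The identity is continuous between the two metrics, and uniformly so at the points of a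
  compact set. Only \<open>w\<close> is confined to \<open>K\<close>; the other point is
  arbitrary.\<close>

lemma uniform_near_compact:
  assumes "Metric_space M d" "Metric_space M d'" "Metric_space.mtopology M d = Metric_space.mtopology M d'"
    and K: "compactin (Metric_space.mtopology M d) K" and "e > 0"
  obtains \<delta> where "\<delta> > 0" "\<And>w z. w \<in> K \<Longrightarrow> z \<in> M \<Longrightarrow> d w z < \<delta> \<Longrightarrow> d' w z < e"
proof (rule ccontr)
  interpret A: Metric_space M d by fact
  interpret B: Metric_space M d' by fact
  assume "\<not> thesis"
  then have "\<exists>w z. w \<in> K \<and> z \<in> M \<and> d w z < 1 / real (Suc n) \<and> \<not> d' w z < e" for n
    using that[of "1 / real (Suc n)"] by force
  then obtain w z where wz: "\<And>n. w n \<in> K" "\<And>n. z n \<in> M" "\<And>n. d (w n) (z n) < 1 / real (Suc n)" "\<And>n. \<not> d' (w n) (z n) < e"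
    by metis
  obtain r l where r: "strict_mono (r :: nat \<Rightarrow> nat)" "l \<in> K" "vanishes (\<lambda>n. d (w (r n)) l)"
    by (rule A.compactin_subseq[OF K wz(1)])
  have KM: "K \<subseteq> M" using K compactin_subset_topspace by fastforce
  have M: "w n \<in> M" "l \<in> M" for n using KM wz r by blast+
  have "vanishes (\<lambda>n. d (z n) (w n))"
    by (rule tendsto_sandwich[OF _ _ tendsto_const LIMSEQ_Suc[OF lim_1_over_n]])
      (use wz in \<open>auto intro!: always_eventually less_imp_le simp: A.commute\<close>)
  then have zw: "vanishes (\<lambda>n. d (z (r n)) (w (r n)))" using LIMSEQ_subseq_LIMSEQ[OF _ r(1)] by (force simp: o_def)
  have "vanishes (\<lambda>n. d (z (r n)) l)" by (rule A.tendsto_dist_trans[OF _ _ _ zw r(3)]) (use wz M in simp_all)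
  then have "vanishes (\<lambda>n. d' (w (r n)) l)" "vanishes (\<lambda>n. d' (z (r n)) l)"
    using r(3) A.limitin_seq_iff[of "\<lambda>n. w (r n)" l] B.limitin_seq_iff[of "\<lambda>n. w (r n)" l]
      A.limitin_seq_iff[of "\<lambda>n. z (r n)" l] B.limitin_seq_iff[of "\<lambda>n. z (r n)" l] M wz(2) assms(3) by simp_all
  then have "(\<lambda>n. d' (w (r n)) (z (r n))) \<longlonglongrightarrow> d' l l" using M wz(2) by (intro B.tendsto_dist_dist)
  then have "\<forall>\<^sub>F n in sequentially. d' (w (r n)) (z (r n)) < e" using M \<open>e > 0\<close> by (intro order_tendstoD(2)) auto
  then show False using wz(4) by simp
qed

locale squeezed_metric2 = squeezed_metric X d + D': squeezed_metric X d' for X :: "'a topology" and d d'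
begin

lemma same_topology: "mtopology = D'.mtopology"
  using mtop D'.mtop by simp

text \<open>One and the same correspondence serves for both metrics: its first coordinates range
  over the compact set \<open>fst \<pi>\<close>, where closeness for \<open>d\<close> implies
  closeness for \<open>d'\<close> uniformly.\<close>

lemma d_tot_near:
  assumes \<pi>: "\<pi> \<in> paths X" and "e > 0"
  shows "\<exists>\<delta>>0. \<forall>\<pi>'\<in>paths X. d_tot d \<pi> \<pi>' < \<delta> \<longrightarrow> d_tot d' \<pi> \<pi>' < e"
proof -
  have "e / 2 > 0" using assms by simp
  then obtain \<delta> where \<delta>: "\<delta> > 0" "\<And>w z. w \<in> fst \<pi> \<Longrightarrow> z \<in> squeezed X \<Longrightarrow> d w z < \<delta> \<Longrightarrow> d' w z < e / 2"
    using uniform_near_compact[OF Metric_space_axioms D'.Metric_space_axioms same_topology pathD(2)[OF \<pi>]] by blast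
  have "d_tot d' \<pi> \<pi>' < e" if \<pi>': "\<pi>' \<in> paths X" "d_tot d \<pi> \<pi>' < \<delta>" for \<pi>'
  proof -
    obtain C where C: "C \<in> Corr_mono \<pi> \<pi>'" "\<And>z w. (z, w) \<in> C \<Longrightarrow> d z w < \<delta>" by (rule d_tot_lessD[OF \<pi> \<pi>']) blast
    have "d' z w \<le> e / 2" if zw: "(z, w) \<in> C" for z w
    proof -
      have "z \<in> fst \<pi>" "w \<in> squeezed X" using zw Corr_monoD(1)[OF C(1)] pathD(3)[OF \<pi>'(1)] by blast+
      then show ?thesis using \<delta>(2)[OF _ _ C(2)[OF zw]] by simp
    qed
    then have "d_tot d' \<pi> \<pi>' \<le> e / 2" using \<open>e > 0\<close> by (intro D'.d_tot_le[OF C(1)]) simp_all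
    then show ?thesis using \<open>e > 0\<close> by linarith
  qed
  then show ?thesis using \<delta> by blast
qed

lemma d_H_near:
  assumes \<pi>: "\<pi> \<in> paths X" and "e > 0"
  shows "\<exists>\<delta>>0. \<forall>\<pi>'\<in>paths X. d_H d \<pi> \<pi>' < \<delta> \<longrightarrow> d_H d' \<pi> \<pi>' < e"
proof -
  have "e / 2 > 0" using assms by simp
  then obtain \<delta> where \<delta>: "\<delta> > 0" "\<And>w z. w \<in> fst \<pi> \<Longrightarrow> z \<in> squeezed X \<Longrightarrow> d w z < \<delta> \<Longrightarrow> d' w z < e / 2"
    using uniform_near_compact[OF Metric_space_axioms D'.Metric_space_axioms same_topology pathD(2)[OF \<pi>]] by blast
  have "d_H d' \<pi> \<pi>' < e" if \<pi>': "\<pi>' \<in> paths X" "d_H d \<pi> \<pi>' < \<delta>" for \<pi>'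
  proof -
    note near = d_H_lessD[OF \<pi> \<pi>'] and sub = pathD(3)[OF \<pi>'(1)]
    have "d_H d' \<pi> \<pi>' \<le> e / 2"
    proof (rule D'.d_H_le[OF \<pi> \<pi>'(1)])
      show "\<exists>w\<in>fst \<pi>'. d' z w \<le> e / 2" if "z \<in> fst \<pi>" for z
        using near(1)[OF that] \<delta>(2)[OF that] sub by (meson less_imp_le subsetD)
      show "\<exists>z\<in>fst \<pi>. d' z w \<le> e / 2" if "w \<in> fst \<pi>'" for w
        using near(2)[OF that] \<delta>(2) that sub by (meson less_imp_le subsetD)
    qed (use \<open>e > 0\<close> in simp)
    then show ?thesis using \<open>e > 0\<close> by linarith
  qed
  then show ?thesis using \<delta> by blast
qed

end

lemma mtopology_d_tot_independent:
  assumes "squeezed_metric X d" "squeezed_metric X d'"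
  shows "Metric_space.mtopology (paths X) (d_tot d) = Metric_space.mtopology (paths X) (d_tot d')"
proof -
  interpret A: squeezed_metric2 X d d' by (intro squeezed_metric2.intro assms)
  interpret B: squeezed_metric2 X d' d by (intro squeezed_metric2.intro assms)
  show ?thesis by (rule mtopology_eqI[OF A.Metric_space_d_tot A.D'.Metric_space_d_tot A.d_tot_near B.d_tot_near])
qed

section \<open>Continuous paths\<close>

lemma mtopology_subset:
  assumes "Metric_space M d" "A \<subseteq> M"
  shows "Metric_space.mtopology A d = subtopology (Metric_space.mtopology M d) A"
proof -
  interpret Submetric M d A using assms by (simp add: Submetric_def Submetric_axioms_def)
  show ?thesis by (rule mtopology_submetric)
qed

context Metric_space
begin

lemma hyper_limit_mem:
  assumes "\<And>n. K n \<in> hyper" "L \<in> hyper" "vanishes (\<lambda>n. hausdorff_dist d (K n) L)" "\<And>n. x n \<in> K n"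
    and "l \<in> M" "vanishes (\<lambda>n. d (x n) l)"
  shows "l \<in> L"
proof -
  obtain r l' where r: "strict_mono (r :: nat \<Rightarrow> nat)" "l' \<in> L" "vanishes (\<lambda>n. d (x (r n)) l')"
    by (rule hyper_limit_subseq[OF assms(1-4)])
  have "vanishes (\<lambda>n. d (x (r n)) l)" using LIMSEQ_subseq_LIMSEQ[OF assms(6) r(1)] by (simp add: o_def)
  then have "l = l'"
    using tendsto_dist_unique[of "\<lambda>n. x (r n)" l l'] r hyper_subset[OF assms(1)] hyper_subset[OF assms(2)] assms(4,5) by blast
  then show ?thesis using r by simp
qed

end

context squeezed_metric
begin

lemma is_values_eq:
  assumes \<pi>: "\<pi> \<in> paths X" and v: "is_values \<pi> t x y"
  shows "left_val \<pi> t = x" "right_val \<pi> t = y"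
proof -
  have uniq: "x' = x \<and> y' = y" if "is_values \<pi> t x' y'" for x' y'
  proof -
    have "{x', y'} = {x, y}" using that v unfolding is_values_def by auto
    then consider "x' = x" "y' = y" | "x' = y" "y' = x" by (auto simp: doubleton_eq_iff)
    then show ?thesis
    proof cases
      case 2
      then have "(Some x, ereal t) = (Some y, ereal t)"
        using that v pathD(8)[OF \<pi>] unfolding is_values_def by blast
      then show ?thesis using 2 by simp
    qed simp
  qed
  show "left_val \<pi> t = x"
    unfolding left_val_def by (rule the_equality) (use v uniq in blast)+
  show "right_val \<pi> t = y"
    unfolding right_val_def by (rule the_equality) (use v uniq in blast)+
qed

lemma path_point_real:
  assumes "\<pi> \<in> paths X" "(x, ereal t) \<in> fst \<pi>"
  obtains y where "x = Some y" "y \<in> topspace X"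
  using pathD(3)[OF assms(1)] assms(2) by (cases x) auto

lemma is_values_left_right:
  assumes \<pi>: "\<pi> \<in> paths X" and t: "t \<in> domain_real \<pi>"
  shows "is_values \<pi> t (left_val \<pi> t) (right_val \<pi> t)"
proof -
  let ?S = "{x. (Some x, ereal t) \<in> fst \<pi>}"
  obtain x' where "(x', ereal t) \<in> fst \<pi>" using t unfolding domain_real_def domain_ext_def by blast
  moreover then obtain x where "x' = Some x" using path_point_real[OF \<pi>] by blast
  ultimately have x: "(Some x, ereal t) \<in> fst \<pi>" by simp
  have "\<exists>x y. is_values \<pi> t x y"
  proof (cases "?S = {x}")
    case True
    then have "is_values \<pi> t x x" unfolding is_values_def using pathD(6)[OF \<pi> x] by simp
    then show ?thesis by blast
  next
    case False
    then obtain y where y: "(Some y, ereal t) \<in> fst \<pi>" "y \<noteq> x" using x by blast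
    then have S: "?S = {x, y}" using path_two[OF \<pi> x y(1)] x by fastforce
    consider "((Some x, ereal t), (Some y, ereal t)) \<in> snd \<pi>" | "((Some y, ereal t), (Some x, ereal t)) \<in> snd \<pi>"
      using pathD(9)[OF \<pi> x y(1)] by blast
    then show ?thesis
    proof cases
      case 1
      then show ?thesis using S unfolding is_values_def by (intro exI[of _ x] exI[of _ y]) simp
    next
      case 2
      then show ?thesis using S unfolding is_values_def by (intro exI[of _ y] exI[of _ x]) (simp add: insert_commute)
    qed
  qed
  then obtain x y where "is_values \<pi> t x y" by blast
  then show ?thesis using is_values_eq[OF \<pi>] by metis
qed

lemma domain_extI: "u \<in> fst \<pi> \<Longrightarrow> snd u \<in> domain_ext \<pi>"
  unfolding domain_ext_def by (cases u) auto

lemma domain_realI: "(x, ereal t) \<in> fst \<pi> \<Longrightarrow> t \<in> domain_real \<pi>"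
  unfolding domain_real_def domain_ext_def by blast

lemma path_values_iff:
  assumes "\<pi> \<in> paths X" "t \<in> domain_real \<pi>"
  shows "(Some x, ereal t) \<in> fst \<pi> \<longleftrightarrow> x = left_val \<pi> t \<or> x = right_val \<pi> t"
  using is_values_left_right[OF assms] unfolding is_values_def by blast

lemma left_eq_right_iff:
  assumes "\<pi> \<in> paths X" "t \<in> domain_real \<pi>"
  shows "left_val \<pi> t = right_val \<pi> t \<longleftrightarrow> (\<forall>u\<in>fst \<pi>. \<forall>v\<in>fst \<pi>. snd u = ereal t \<longrightarrow> snd v = ereal t \<longrightarrow> u = v)"
proof
  assume eq: "left_val \<pi> t = right_val \<pi> t"
  show "\<forall>u\<in>fst \<pi>. \<forall>v\<in>fst \<pi>. snd u = ereal t \<longrightarrow> snd v = ereal t \<longrightarrow> u = v"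
  proof (intro ballI impI)
    fix u v assume uv: "u \<in> fst \<pi>" "v \<in> fst \<pi>" "snd u = ereal t" "snd v = ereal t"
    then obtain x y where "u = (Some x, ereal t)" "v = (Some y, ereal t)"
      using path_point_real[OF assms(1)] by (metis prod.collapse)
    then show "u = v" using uv path_values_iff[OF assms] eq by simp
  qed
next
  assume "\<forall>u\<in>fst \<pi>. \<forall>v\<in>fst \<pi>. snd u = ereal t \<longrightarrow> snd v = ereal t \<longrightarrow> u = v"
  moreover have "(Some (left_val \<pi> t), ereal t) \<in> fst \<pi>" "(Some (right_val \<pi> t), ereal t) \<in> fst \<pi>"
    using path_values_iff[OF assms] by auto
  ultimately show "left_val \<pi> t = right_val \<pi> t" by fastforce
qed

lemma same_infinite_time:
  assumes "u \<in> squeezed X" "v \<in> squeezed X" "snd u = snd v" "\<bar>snd u\<bar> = \<infinity>"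
  shows "u = v"
  by (rule squeezed_cases[OF assms(1)]; rule squeezed_cases[OF assms(2)]) (use assms in auto)

text \<open>Infinite times may be included in the condition, as the squeezed space has a single
  point at each of them.\<close>

lemma paths_c_iff: "\<pi> \<in> paths_c X \<longleftrightarrow> \<pi> \<in> paths X \<and> (\<forall>u\<in>fst \<pi>. \<forall>v\<in>fst \<pi>. snd u = snd v \<longrightarrow> u = v)"
proof (cases "\<pi> \<in> paths X")
  case \<pi>: True
  have "(\<forall>t \<in> domain_real \<pi>. left_val \<pi> t = right_val \<pi> t) \<longleftrightarrow> (\<forall>u\<in>fst \<pi>. \<forall>v\<in>fst \<pi>. snd u = snd v \<longrightarrow> u = v)"
  proof
    assume c: "\<forall>t \<in> domain_real \<pi>. left_val \<pi> t = right_val \<pi> t"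
    show "\<forall>u\<in>fst \<pi>. \<forall>v\<in>fst \<pi>. snd u = snd v \<longrightarrow> u = v"
    proof (intro ballI impI)
      fix u v assume uv: "u \<in> fst \<pi>" "v \<in> fst \<pi>" "snd u = snd v"
      show "u = v"
      proof (cases "snd u")
        case (real t)
        then have "t \<in> domain_real \<pi>" using uv domain_realI[of "fst u" t \<pi>] by (metis prod.collapse)
        then show ?thesis using left_eq_right_iff[OF \<pi>] c uv real by auto
      qed (use same_infinite_time[of u v] uv pathD(3)[OF \<pi>] in auto)
    qed
  next
    assume "\<forall>u\<in>fst \<pi>. \<forall>v\<in>fst \<pi>. snd u = snd v \<longrightarrow> u = v"
    then show "\<forall>t \<in> domain_real \<pi>. left_val \<pi> t = right_val \<pi> t" using left_eq_right_iff[OF \<pi>] by auto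
  qed
  then show ?thesis using \<pi> unfolding paths_c_def by simp
qed (simp add: paths_c_def)

lemma paths_c_order:
  assumes "\<pi> \<in> paths_c X"
  shows "snd \<pi> = {(u, v). u \<in> fst \<pi> \<and> v \<in> fst \<pi> \<and> snd u \<le> snd v}"
proof -
  have \<pi>: "\<pi> \<in> paths X" and c: "\<And>u v. u \<in> fst \<pi> \<Longrightarrow> v \<in> fst \<pi> \<Longrightarrow> snd u = snd v \<Longrightarrow> u = v"
    using assms paths_c_iff by auto
  have "(u, v) \<in> snd \<pi>" if uv: "u \<in> fst \<pi>" "v \<in> fst \<pi>" "snd u \<le> snd v" for u v
  proof (cases "snd u = snd v")
    case True then show ?thesis using c[OF uv(1,2)] pathD(6)[OF \<pi>] uv by simp
  next
    case False then show ?thesis using pathD(10)[OF \<pi> uv(1,2)] uv by simp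
  qed
  then show ?thesis using pathD(12-14)[OF \<pi>] by blast
qed

lemma paths_c_inject: "\<pi>1 \<in> paths_c X \<Longrightarrow> \<pi>2 \<in> paths_c X \<Longrightarrow> fst \<pi>1 = fst \<pi>2 \<Longrightarrow> \<pi>1 = \<pi>2"
  by (rule prod_eqI) (simp_all add: paths_c_order)

text \<open>The counterpart of \<open>path_uniform_antisym\<close> in which times replace the order:
  limits of a sequence of counterexamples have equal times, and continuity identifies them.\<close>

lemma paths_c_uniform:
  assumes \<pi>: "\<pi> \<in> paths_c X" and "e > 0"
  obtains \<delta> where "\<delta> > 0" "\<And>u v z z'. u \<in> fst \<pi> \<Longrightarrow> v \<in> fst \<pi> \<Longrightarrow> z \<in> squeezed X \<Longrightarrow> z' \<in> squeezed X \<Longrightarrow>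
    d u z < \<delta> \<Longrightarrow> d v z' < \<delta> \<Longrightarrow> snd z \<le> snd z' \<Longrightarrow> snd v \<le> snd u \<Longrightarrow> d u v < e"
proof (rule ccontr)
  assume "\<not> thesis"
  then have "\<exists>u v z z'. u \<in> fst \<pi> \<and> v \<in> fst \<pi> \<and> z \<in> squeezed X \<and> z' \<in> squeezed X \<and>
    d u z < 1 / real (Suc n) \<and> d v z' < 1 / real (Suc n) \<and> snd z \<le> snd z' \<and> snd v \<le> snd u \<and> \<not> d u v < e" for n
    using that[of "1 / real (Suc n)"] by force
  then obtain u v z z' where *: "\<And>n. u n \<in> fst \<pi>" "\<And>n. v n \<in> fst \<pi>" "\<And>n. z n \<in> squeezed X" "\<And>n. z' n \<in> squeezed X"
    "\<And>n. d (u n) (z n) < 1 / real (Suc n)" "\<And>n. d (v n) (z' n) < 1 / real (Suc n)"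
    "\<And>n. snd (z n) \<le> snd (z' n)" "\<And>n. snd (v n) \<le> snd (u n)" "\<And>n. \<not> d (u n) (v n) < e"
    by metis
  have \<pi>': "\<pi> \<in> paths X" using \<pi> paths_c_iff by blast
  note sub = subsetD[OF pathD(3)[OF \<pi>']]
  obtain r l l' where r: "strict_mono (r :: nat \<Rightarrow> nat)" "l \<in> fst \<pi>" "l' \<in> fst \<pi>"
    "vanishes (\<lambda>n. d (u (r n)) l)" "vanishes (\<lambda>n. d (v (r n)) l')"
    by (rule compactin_subseq2[OF pathD(2)[OF \<pi>'] *(1) pathD(2)[OF \<pi>'] *(2)])
  have "vanishes (\<lambda>n. d (z n) (u n))" "vanishes (\<lambda>n. d (z' n) (v n))"
    by (rule tendsto_sandwich[OF _ _ tendsto_const LIMSEQ_Suc[OF lim_1_over_n]],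
        use * in \<open>auto intro!: always_eventually less_imp_le simp: commute\<close>)+
  then have zu: "vanishes (\<lambda>n. d (z (r n)) (u (r n)))" "vanishes (\<lambda>n. d (z' (r n)) (v (r n)))"
    using LIMSEQ_subseq_LIMSEQ[OF _ r(1)] by (force simp: o_def)+
  have lim: "vanishes (\<lambda>n. d (z (r n)) l)" "vanishes (\<lambda>n. d (z' (r n)) l')"
    by (rule tendsto_dist_trans[OF _ _ _ zu(1) r(4)], (rule sub * r(2))+)
      (rule tendsto_dist_trans[OF _ _ _ zu(2) r(5)], (rule sub * r(3))+)
  have "snd l \<le> snd l'"
    by (rule LIMSEQ_le[OF tendsto_snd[OF _ _ lim(1)] tendsto_snd[OF _ _ lim(2)]]) (use * sub r in auto)
  moreover have "snd l' \<le> snd l"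
    by (rule LIMSEQ_le[OF tendsto_snd[OF _ _ r(5)] tendsto_snd[OF _ _ r(4)]]) (use * sub r in auto)
  ultimately have "l = l'" using \<pi> r(2,3) paths_c_iff by simp
  then have "vanishes (\<lambda>n. d (u (r n)) (v (r n)))"
    using tendsto_dist_dist[OF _ _ _ _ r(4,5)] sub * r(2,3) mdist_zero[OF sub[OF r(3)]] by simp
  then have "\<forall>\<^sub>F n in sequentially. d (u (r n)) (v (r n)) < e" using \<open>e > 0\<close> by (rule order_tendstoD(2))
  then show False using * by simp
qed

text \<open>If partners of an ordered pair come out in the wrong order, the times of the pair nearly
  agree; by continuity its points are then close, and one partner can serve for both. Only the limit
  path has to be continuous.\<close>

lemma d_part_small_of_d_H:
  assumes \<pi>: "\<pi> \<in> paths_c X" and "e > 0"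
  obtains \<delta> where "\<delta> > 0" "\<And>\<pi>'. \<pi>' \<in> paths X \<Longrightarrow> d_H d \<pi> \<pi>' < \<delta> \<Longrightarrow> d_part d \<pi> \<pi>' < e"
proof -
  have e4: "e / 4 > 0" using assms by simp
  obtain \<delta>0 where \<delta>0: "\<delta>0 > 0" "\<And>u v z z'. u \<in> fst \<pi> \<Longrightarrow> v \<in> fst \<pi> \<Longrightarrow> z \<in> squeezed X \<Longrightarrow> z' \<in> squeezed X \<Longrightarrow>
    d u z < \<delta>0 \<Longrightarrow> d v z' < \<delta>0 \<Longrightarrow> snd z \<le> snd z' \<Longrightarrow> snd v \<le> snd u \<Longrightarrow> d u v < e / 4"
    using paths_c_uniform[OF \<pi> e4] by blast
  have \<pi>p: "\<pi> \<in> paths X" using \<pi> paths_c_iff by blast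
  note p = pathD[OF \<pi>p]
  define \<delta> where "\<delta> = min \<delta>0 (e / 4)"
  have \<delta>: "\<delta> > 0" "\<delta> \<le> \<delta>0" "\<delta> \<le> e / 4" using \<delta>0 e4 unfolding \<delta>_def by auto
  have "d_part d \<pi> \<pi>' < e" if \<pi>': "\<pi>' \<in> paths X" and less: "d_H d \<pi> \<pi>' < \<delta>" for \<pi>'
  proof -
    note p' = pathD[OF \<pi>'] and near = d_H_lessD[OF \<pi>p \<pi>' less]
    have M: "x \<in> squeezed X" if "x \<in> fst \<pi> \<or> x \<in> fst \<pi>'" for x using that p(3) p'(3) by blast
    have "d_part d \<pi> \<pi>' \<le> e / 2"
    proof (rule d_part_le[OF \<pi>p \<pi>'])
      show "0 \<le> e / 2" using \<open>e > 0\<close> by simp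
      fix u v assume uv: "(u, v) \<in> snd \<pi>"
      have P: "u \<in> fst \<pi>" "v \<in> fst \<pi>" "snd u \<le> snd v" using p(12-14)[OF uv] by auto
      obtain z where z: "z \<in> fst \<pi>'" "d u z < \<delta>" using near(1)[OF P(1)] by blast
      obtain z' where z': "z' \<in> fst \<pi>'" "d v z' < \<delta>" using near(1)[OF P(2)] by blast
      show "\<exists>w w'. (w, w') \<in> snd \<pi>' \<and> d u w \<le> e / 2 \<and> d v w' \<le> e / 2"
      proof (cases "(z, z') \<in> snd \<pi>'")
        case True then show ?thesis using z z' \<delta> e4 by (intro exI[of _ z] exI[of _ z']) auto
      next
        \<comment> \<open>The repeated partner is \<open>z\<close>, for which the reflexive pair is
          used.\<close>
        case False
        then have "snd z' \<le> snd z" using p'(9)[OF z(1) z'(1)] p'(12) by blast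
        then have "d v u < e / 4" using \<delta>0(2)[of v u z' z] P z z' M \<delta> by auto
        then have "d v z \<le> e / 2" using triangle[of v u z] M P z \<delta> by auto
        then show ?thesis using z p'(6)[OF z(1)] \<delta> e4 by (intro exI[of _ z]) auto
      qed
    next
      fix z z' assume zz: "(z, z') \<in> snd \<pi>'"
      have P: "z \<in> fst \<pi>'" "z' \<in> fst \<pi>'" "snd z \<le> snd z'" using p'(12-14)[OF zz] by auto
      obtain u where u: "u \<in> fst \<pi>" "d u z < \<delta>" using near(2)[OF P(1)] by blast
      obtain v where v: "v \<in> fst \<pi>" "d v z' < \<delta>" using near(2)[OF P(2)] by blast
      show "\<exists>w w'. (w, w') \<in> snd \<pi> \<and> d w z \<le> e / 2 \<and> d w' z' \<le> e / 2"
      proof (cases "(u, v) \<in> snd \<pi>")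
        case True then show ?thesis using u v \<delta> e4 by (intro exI[of _ u] exI[of _ v]) auto
      next
        case False
        then have "snd v \<le> snd u" using p(9)[OF u(1) v(1)] p(12) by blast
        then have "d u v < e / 4" using \<delta>0(2)[of u v z z'] P u v M \<delta> by auto
        then have "d u z' \<le> e / 2" using triangle[of u v z'] M P u v \<delta> by auto
        then show ?thesis using u p(6)[OF u(1)] \<delta> e4 by (intro exI[of _ u]) auto
      qed
    qed
    then show ?thesis using \<open>e > 0\<close> by linarith
  qed
  then show ?thesis using that \<delta> by blast
qed

lemma paths_c_subset: "paths_c X \<subseteq> paths X"
  unfolding paths_c_def by blast

lemma Metric_space_d_H_paths_c: "Metric_space (paths_c X) (d_H d)"
  by (rule Metric_space_d_H[OF paths_c_subset]) (rule paths_c_inject)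

lemma Metric_space_d_tot_subset: "Q \<subseteq> paths X \<Longrightarrow> Metric_space Q (d_tot d)"
  using Metric_space.subspace[OF Metric_space_d_tot] .

lemma Metric_space_d_part_subset: "Q \<subseteq> paths X \<Longrightarrow> Metric_space Q (d_part d)"
  using Metric_space.subspace[OF Metric_space_d_part] .

lemma mtopology_d_part_subset:
  "Q \<subseteq> paths X \<Longrightarrow> Metric_space.mtopology Q (d_part d) = Metric_space.mtopology Q (d_tot d)"
  using mtopology_subset[OF Metric_space_d_tot] mtopology_subset[OF Metric_space_d_part] mtopology_d_tot_eq_d_part by metis

lemma mtopology_d_H_paths_c:
  "Metric_space.mtopology (paths_c X) (d_H d) = Metric_space.mtopology (paths_c X) (d_tot d)"
proof (rule mtopology_eqI[OF Metric_space_d_H_paths_c Metric_space_d_tot_subset[OF paths_c_subset]])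
  fix \<pi> and e :: real assume \<pi>: "\<pi> \<in> paths_c X" and "e > 0"
  then have \<pi>': "\<pi> \<in> paths X" using paths_c_subset by blast
  obtain \<delta>1 where 1: "\<delta>1 > 0" "\<And>\<pi>'. \<pi>' \<in> paths X \<Longrightarrow> d_part d \<pi> \<pi>' < \<delta>1 \<Longrightarrow> d_tot d \<pi> \<pi>' < e"
    using d_tot_small[OF \<pi>' \<open>e > 0\<close>] by blast
  obtain \<delta>2 where 2: "\<delta>2 > 0" "\<And>\<pi>'. \<pi>' \<in> paths X \<Longrightarrow> d_H d \<pi> \<pi>' < \<delta>2 \<Longrightarrow> d_part d \<pi> \<pi>' < \<delta>1"
    using d_part_small_of_d_H[OF \<pi> 1(1)] by blast
  show "\<exists>\<delta>>0. \<forall>y\<in>paths_c X. d_H d \<pi> y < \<delta> \<longrightarrow> d_tot d \<pi> y < e"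
    using 1 2 paths_c_subset by blast
  show "\<exists>\<delta>>0. \<forall>y\<in>paths_c X. d_tot d \<pi> y < \<delta> \<longrightarrow> d_H d \<pi> y < e"
    using d_H_le_d_part[OF \<pi>'] d_part_le_d_tot[OF \<pi>'] \<open>e > 0\<close> paths_c_subset by (intro exI[of _ e]) force
qed

section \<open>Limits of continuous paths on intervals\<close>

lemma tendsto_d_tot_hausdorff:
  assumes "\<And>n. \<sigma> n \<in> paths X" "l \<in> paths X" "vanishes (\<lambda>n. d_tot d (\<sigma> n) l)"
  shows "vanishes (\<lambda>n. hausdorff_dist d (fst (\<sigma> n)) (fst l))"
    "vanishes (\<lambda>n. hausdorff_dist (max_dist d) (order2 (\<sigma> n)) (order2 l))"
proof -
  have "d_H d (\<sigma> n) l \<le> d_tot d (\<sigma> n) l" for n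
    using d_H_le_d_part[OF assms(1,2)] d_part_le_d_tot[OF assms(1,2)] order_trans by blast
  then have "\<forall>\<^sub>F n in sequentially. hausdorff_dist d (fst (\<sigma> n)) (fst l) \<le> d_tot d (\<sigma> n) l"
    using d_H_paths[OF assms(1,2)] by (intro always_eventually) simp
  then show "vanishes (\<lambda>n. hausdorff_dist d (fst (\<sigma> n)) (fst l))"
    by (intro tendsto_sandwich[OF _ _ tendsto_const assms(3)]) auto
  have "\<forall>\<^sub>F n in sequentially. hausdorff_dist (max_dist d) (order2 (\<sigma> n)) (order2 l) \<le> d_tot d (\<sigma> n) l"
    using d_part_le_d_tot[OF assms(1,2)] unfolding d_part_def by (intro always_eventually) simp
  then show "vanishes (\<lambda>n. hausdorff_dist (max_dist d) (order2 (\<sigma> n)) (order2 l))"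
    by (intro tendsto_sandwich[OF _ _ tendsto_const assms(3)]) auto
qed

text \<open>A time strictly between two times of the limit is eventually strictly between two times
  of the approximating paths. These have points at that time, and the points accumulate at a point
  of the limit.\<close>

lemma path_limit_interval:
  assumes \<sigma>: "\<And>n. \<sigma> n \<in> paths_int X" and l: "l \<in> paths X"
    and lim: "vanishes (\<lambda>n. hausdorff_dist d (fst (\<sigma> n)) (fst l))"
  shows "l \<in> paths_int X"
proof -
  have \<sigma>p: "\<sigma> n \<in> paths X" for n using \<sigma> unfolding paths_int_def by blast
  note Kh = pathD(4)[OF \<sigma>p]
  have mid: "c \<in> domain_ext l" if ab: "a \<in> domain_ext l" "b \<in> domain_ext l" and c: "a < c" "c < b" for a b c
  proof -
    obtain x y where xy: "(x, a) \<in> fst l" "(y, b) \<in> fst l" using ab unfolding domain_ext_def by blast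
    obtain u where u: "\<And>n. u n \<in> fst (\<sigma> n)" "vanishes (\<lambda>n. d (u n) (x, a))"
      by (rule hyper_limit_approx[OF Kh pathD(4)[OF l] lim xy(1)]) blast
    obtain v where v: "\<And>n. v n \<in> fst (\<sigma> n)" "vanishes (\<lambda>n. d (v n) (y, b))"
      by (rule hyper_limit_approx[OF Kh pathD(4)[OF l] lim xy(2)]) blast
    have M: "u n \<in> squeezed X" "v n \<in> squeezed X" for n using u v pathD(3)[OF \<sigma>p] by blast+
    have "(\<lambda>n. snd (u n)) \<longlonglongrightarrow> a" "(\<lambda>n. snd (v n)) \<longlonglongrightarrow> b"
      using tendsto_snd[OF M(1) _ u(2)] tendsto_snd[OF M(2) _ v(2)] xy pathD(3)[OF l] by auto
    then have "\<forall>\<^sub>F n in sequentially. snd (u n) < c \<and> c < snd (v n)"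
      using order_tendstoD c by (intro eventually_conj) blast+
    then obtain N where N: "\<And>n. n \<ge> N \<Longrightarrow> snd (u n) < c \<and> c < snd (v n)" unfolding eventually_sequentially by blast
    have "\<exists>w. (w, c) \<in> fst (\<sigma> (n + N))" for n
    proof -
      have "snd (u (n + N)) \<in> domain_ext (\<sigma> (n + N))" "snd (v (n + N)) \<in> domain_ext (\<sigma> (n + N))"
        using domain_extI u(1)[of "n + N"] v(1)[of "n + N"] by blast+
      then have "{snd (u (n + N))..snd (v (n + N))} \<subseteq> domain_ext (\<sigma> (n + N))" using \<sigma>[of "n + N"] unfolding paths_int_def by blast
      then show ?thesis using N[of "n + N"] unfolding domain_ext_def by (auto simp: subset_iff less_imp_le)
    qed
    then obtain w where w: "\<And>n. (w n, c) \<in> fst (\<sigma> (n + N))" by metis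
    have "vanishes (\<lambda>n. hausdorff_dist d (fst (\<sigma> (n + N))) (fst l))" using LIMSEQ_ignore_initial_segment[OF lim] .
    then obtain r z where r: "strict_mono (r :: nat \<Rightarrow> nat)" "z \<in> fst l" "vanishes (\<lambda>n. d (w (r n), c) z)"
      by (rule hyper_limit_subseq[OF Kh pathD(4)[OF l] _ w])
    have "(\<lambda>n. snd (w (r n), c)) \<longlonglongrightarrow> snd z"
      by (rule tendsto_snd[OF _ _ r(3)]) (use w pathD(3)[OF \<sigma>p] pathD(3)[OF l] r(2) in blast)+
    then have "snd z = c" by (simp add: LIMSEQ_const_iff)
    then show ?thesis using domain_extI[OF r(2)] by simp
  qed
  have "{a..b} \<subseteq> domain_ext l" if "a \<in> domain_ext l" "b \<in> domain_ext l" for a b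
  proof
    fix c assume "c \<in> {a..b}"
    then consider "c = a" | "c = b" | "a < c" "c < b" by (auto simp: less_le)
    then show "c \<in> domain_ext l" using that mid[OF that] by cases auto
  qed
  then show ?thesis unfolding paths_int_def using l by blast
qed

text \<open>The set is a projection of the compact set of those points of the path that lie in a
  closed ball and have times in \<open>{a..b}\<close>.\<close>

lemma path_closed_times:
  assumes \<pi>: "\<pi> \<in> paths X" and "w \<in> squeezed X"
  shows "closed {s. a \<le> s \<and> s \<le> b \<and> (\<exists>u\<in>fst \<pi>. snd u = ereal s \<and> d u w \<le> e)}"
  unfolding closed_sequential_limits
proof (intro allI impI)
  fix s and l :: real
  assume "(\<forall>n. s n \<in> {s. a \<le> s \<and> s \<le> b \<and> (\<exists>u\<in>fst \<pi>. snd u = ereal s \<and> d u w \<le> e)}) \<and> s \<longlonglongrightarrow> l"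
  then have s: "\<And>n. a \<le> s n" "\<And>n. s n \<le> b" "s \<longlonglongrightarrow> l" "\<And>n. \<exists>u\<in>fst \<pi>. snd u = ereal (s n) \<and> d u w \<le> e" by auto
  then obtain u where u: "\<And>n. u n \<in> fst \<pi>" "\<And>n. snd (u n) = ereal (s n)" "\<And>n. d (u n) w \<le> e" by metis
  obtain r z where r: "strict_mono (r :: nat \<Rightarrow> nat)" "z \<in> fst \<pi>" "vanishes (\<lambda>n. d (u (r n)) z)"
    by (rule compactin_subseq[OF pathD(2)[OF \<pi>] u(1)])
  note sub = subsetD[OF pathD(3)[OF \<pi>]]
  have "(\<lambda>n. snd (u (r n))) \<longlonglongrightarrow> snd z" by (rule tendsto_snd[OF _ _ r(3)]) (use u r sub in auto)
  moreover have "(\<lambda>n. ereal (s (r n))) \<longlonglongrightarrow> ereal l" using LIMSEQ_subseq_LIMSEQ[OF s(3) r(1)] by (simp add: o_def)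
  ultimately have "snd z = ereal l" using LIMSEQ_unique unfolding u(2) by blast
  moreover have "d z w \<le> e"
  proof (rule LIMSEQ_le_const2)
    show "(\<lambda>n. d (u (r n)) w) \<longlonglongrightarrow> d z w"
      by (rule tendsto_dist_dist[OF _ _ _ _ r(3)]) (use u sub r assms(2) in auto)
  qed (use u in auto)
  moreover have "a \<le> l" by (rule LIMSEQ_le_const[OF s(3)]) (use s in auto)
  moreover have "l \<le> b" by (rule LIMSEQ_le_const2[OF s(3)]) (use s in auto)
  ultimately show "l \<in> {s. a \<le> s \<and> s \<le> b \<and> (\<exists>u\<in>fst \<pi>. snd u = ereal s \<and> d u w \<le> e)}" using r(2) by auto
qed

text \<open>A continuous path on an interval cannot jump from a neighbourhood of one point to a disjoint
  neighbourhood of another one, as its domain is connected.\<close>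

lemma continuous_path_no_jump:
  assumes \<pi>: "\<pi> \<in> paths_int_c X" and w: "w \<in> squeezed X" "w' \<in> squeezed X" and e: "2 * e < d w w'"
    and u: "u \<in> fst \<pi>" "snd u = ereal s" "d u w \<le> e" and v: "v \<in> fst \<pi>" "snd v = ereal t" "d v w' \<le> e" and "s \<le> t"
  obtains z where "z \<in> fst \<pi>" "ereal s \<le> snd z" "snd z \<le> ereal t" "d z w > e" "d z w' > e"
proof (rule ccontr)
  note found = that
  assume neg: "\<not> thesis"
  have near: "d z w \<le> e \<or> d z w' \<le> e" if "z \<in> fst \<pi>" "ereal s \<le> snd z" "snd z \<le> ereal t" for z
    using found[OF that] neg by linarith
  have p: "\<pi> \<in> paths X" and c: "\<pi> \<in> paths_c X" using \<pi> unfolding paths_int_c_def paths_int_def by auto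
  note sub = subsetD[OF pathD(3)[OF p]]
  define A where "A = {r. s \<le> r \<and> r \<le> t \<and> (\<exists>u\<in>fst \<pi>. snd u = ereal r \<and> d u w \<le> e)}"
  define B where "B = {r. s \<le> r \<and> r \<le> t \<and> (\<exists>u\<in>fst \<pi>. snd u = ereal r \<and> d u w' \<le> e)}"
  have "closed A" "closed B" unfolding A_def B_def using path_closed_times[OF p] w by blast+
  moreover have "{s..t} \<subseteq> A \<union> B"
  proof
    fix r assume r: "r \<in> {s..t}"
    have "ereal s \<in> domain_ext \<pi>" "ereal t \<in> domain_ext \<pi>" using domain_extI[OF u(1)] domain_extI[OF v(1)] u(2) v(2) by simp_all
    then have "{ereal s..ereal t} \<subseteq> domain_ext \<pi>" using \<pi> unfolding paths_int_c_def paths_int_def by blast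
    then have "ereal r \<in> domain_ext \<pi>" using r by auto
    then obtain x where "(x, ereal r) \<in> fst \<pi>" unfolding domain_ext_def by blast
    then show "r \<in> A \<union> B" using near[of "(x, ereal r)"] r unfolding A_def B_def by force
  qed
  \<comment> \<open>A common time carries only one point, as the path is continuous, and this point
    would be within \<open>e\<close> of both \<open>w\<close> and \<open>w'\<close>.\<close>
  moreover have "A \<inter> B \<inter> {s..t} = {}"
  proof (rule ccontr)
    assume "A \<inter> B \<inter> {s..t} \<noteq> {}"
    then obtain r x y where xy: "x \<in> fst \<pi>" "y \<in> fst \<pi>" "snd x = ereal r" "snd y = ereal r" "d x w \<le> e" "d y w' \<le> e"
      unfolding A_def B_def by blast
    then have "x = y" using c unfolding paths_c_iff by simp
    then show False using triangle''[of w x w'] w xy sub e by auto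
  qed
  moreover have "s \<in> A" "t \<in> B" unfolding A_def B_def using u v \<open>s \<le> t\<close> by auto
  moreover have "connected {s..t}" by simp
  ultimately show False unfolding connected_closed using \<open>s \<le> t\<close> by (metis IntI atLeastAtMost_iff empty_iff order_refl)
qed

text \<open>Suppose the limit jumps from \<open>z\<close> to \<open>z'\<close> at time
  \<open>t\<close>. The approximating paths lead from near \<open>z\<close> to near
  \<open>z'\<close> in vanishing time and, being connected, pass through points away from both. Such
  points accumulate at a third point of the limit at time \<open>t\<close>, but a path has at most
  two.\<close>

lemma closedin_paths_int_c: "closedin (Metric_space.mtopology (paths X) (d_tot d)) (paths_int_c X)"
proof -
  interpret T: Metric_space "paths X" "d_tot d" by (rule Metric_space_d_tot)
  interpret P: Metric_space "squeezed X \<times> squeezed X" "max_dist d" by (rule Metric_space_max_dist)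
  show ?thesis
  proof (rule T.closedin_seqI)
    show "paths_int_c X \<subseteq> paths X" unfolding paths_int_c_def paths_int_def by blast
    fix \<sigma> l assume \<sigma>: "\<And>n. \<sigma> n \<in> paths_int_c X" and l: "l \<in> paths X" and lim: "vanishes (\<lambda>n. d_tot d (\<sigma> n) l)"
    have \<sigma>p: "\<sigma> n \<in> paths X" and \<sigma>i: "\<sigma> n \<in> paths_int X" for n using \<sigma> unfolding paths_int_c_def paths_int_def by auto
    note lim' = tendsto_d_tot_hausdorff[OF \<sigma>p l lim]
    note sub = subsetD[OF pathD(3)[OF l]]
    have "l \<in> paths_c X"
      unfolding paths_c_iff
    proof (intro conjI l ballI impI)
      fix z0 z0' assume z0: "z0 \<in> fst l" "z0' \<in> fst l" "snd z0 = snd z0'"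
      show "z0 = z0'"
      proof (rule ccontr)
        assume "z0 \<noteq> z0'"
        then obtain z z' where z: "(z, z') \<in> snd l" "z \<noteq> z'" "snd z = snd z'" "z \<in> fst l" "z' \<in> fst l"
          using pathD(9)[OF l z0(1,2)] z0 by metis
        have zM: "z \<in> squeezed X" "z' \<in> squeezed X" using z sub by auto
        then obtain t where t: "snd z = ereal t" using same_infinite_time[OF zM z(3)] z(2) by (cases "snd z") auto
        \<comment> \<open>With a third of the distance, the closed balls of radius \<open>e\<close>
          about \<open>z\<close> and \<open>z'\<close> are disjoint, so a continuous path has to
          leave both.\<close>
        define e where "e = d z z' / 3"
        have e: "e > 0" "2 * e < d z z'" using z zM mdist_pos_less[of z z'] unfolding e_def by auto
        have "(z, z') \<in> order2 l" using z pathD(11)[OF l] by simp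
        then obtain p where p: "\<And>n. p n \<in> order2 (\<sigma> n)" "vanishes (\<lambda>n. max_dist d (p n) (z, z'))"
          by (rule P.hyper_limit_approx[OF order2_hyper[OF \<sigma>p] order2_hyper[OF l] lim'(2)]) blast
        define u where "u n = fst (p n)" for n
        define v where "v n = snd (p n)" for n
        have uv: "(u n, v n) \<in> snd (\<sigma> n)" for n using p(1)[of n] pathD(11)[OF \<sigma>p] unfolding u_def v_def by simp
        have uvP: "u n \<in> fst (\<sigma> n)" "v n \<in> fst (\<sigma> n)" "snd (u n) \<le> snd (v n)" for n using pathD(12-14)[OF \<sigma>p uv] by auto
        have uvM: "u n \<in> squeezed X" "v n \<in> squeezed X" for n using uvP pathD(3)[OF \<sigma>p] by blast+
        have ul: "vanishes (\<lambda>n. d (u n) z)" "vanishes (\<lambda>n. d (v n) z')"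
          using p(2) unfolding max_dist_tendsto u_def v_def by auto
        have ut: "(\<lambda>n. snd (u n)) \<longlonglongrightarrow> ereal t" "(\<lambda>n. snd (v n)) \<longlonglongrightarrow> ereal t"
          using tendsto_snd[OF uvM(1) zM(1) ul(1)] tendsto_snd[OF uvM(2) zM(2) ul(2)] t z(3) by simp_all
        have "\<forall>\<^sub>F n in sequentially. d (u n) z < e \<and> d (v n) z' < e \<and> -\<infinity> < snd (u n) \<and> snd (v n) < \<infinity>"
          using order_tendstoD(2)[OF ul(1) e(1)] order_tendstoD(2)[OF ul(2) e(1)]
            order_tendstoD(1)[OF ut(1), of "-\<infinity>"] order_tendstoD(2)[OF ut(2), of \<infinity>] by (simp add: eventually_conj_iff)
        then obtain N where N: "\<And>n. n \<ge> N \<Longrightarrow> d (u n) z < e \<and> d (v n) z' < e \<and> -\<infinity> < snd (u n) \<and> snd (v n) < \<infinity>"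
          unfolding eventually_sequentially by blast
        \<comment> \<open>The pairs \<open>(u n, v n)\<close> are ordered, so \<open>u n\<close>
          does not come later than \<open>v n\<close>. From \<open>N\<close> on both times are real,
          which the connectedness argument needs.\<close>
        have "\<exists>w. w \<in> fst (\<sigma> (n + N)) \<and> snd (u (n + N)) \<le> snd w \<and> snd w \<le> snd (v (n + N)) \<and> d w z > e \<and> d w z' > e" for n
        proof -
          let ?n = "n + N"
          obtain s s' where s: "snd (u ?n) = ereal s" "snd (v ?n) = ereal s'" "s \<le> s'"
            using N[of ?n] uvP(3)[of ?n] by (cases "snd (u ?n)"; cases "snd (v ?n)") auto
          have d: "d (u ?n) z \<le> e" "d (v ?n) z' \<le> e" using N[of ?n] by auto
          obtain w where "w \<in> fst (\<sigma> ?n)" "ereal s \<le> snd w" "snd w \<le> ereal s'" "d w z > e" "d w z' > e"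
            by (rule continuous_path_no_jump[OF \<sigma> zM e(2) uvP(1) s(1) d(1) uvP(2) s(2) d(2) s(3)])
          then show ?thesis using s by auto
        qed
        then obtain w where w: "\<And>n. w n \<in> fst (\<sigma> (n + N))" "\<And>n. snd (u (n + N)) \<le> snd (w n)" "\<And>n. snd (w n) \<le> snd (v (n + N))"
          "\<And>n. d (w n) z > e" "\<And>n. d (w n) z' > e" by metis
        have limN: "vanishes (\<lambda>n. hausdorff_dist d (fst (\<sigma> (n + N))) (fst l))" using LIMSEQ_ignore_initial_segment[OF lim'(1)] .
        obtain r y where r: "strict_mono (r :: nat \<Rightarrow> nat)" "y \<in> fst l" "vanishes (\<lambda>n. d (w (r n)) y)"
          by (rule hyper_limit_subseq[OF pathD(4)[OF \<sigma>p] pathD(4)[OF l] limN w(1)])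
        have wM: "w n \<in> squeezed X" for n using w(1) pathD(3)[OF \<sigma>p] by blast
        \<comment> \<open>The times of the exceptional points are squeezed between those of
          \<open>u\<close> and \<open>v\<close>, which both tend to \<open>t\<close>.\<close>
        have "(\<lambda>n. snd (w n)) \<longlonglongrightarrow> ereal t"
          by (rule tendsto_sandwich[OF _ _ LIMSEQ_ignore_initial_segment[OF ut(1), of N] LIMSEQ_ignore_initial_segment[OF ut(2), of N]])
            (use w in auto)
        then have "(\<lambda>n. snd (w (r n))) \<longlonglongrightarrow> ereal t" using LIMSEQ_subseq_LIMSEQ[OF _ r(1)] by (force simp: o_def)
        moreover have "(\<lambda>n. snd (w (r n))) \<longlonglongrightarrow> snd y" by (rule tendsto_snd[OF _ _ r(3)]) (use wM r sub in auto)
        ultimately have "snd y = ereal t" using LIMSEQ_unique by blast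
        then have "y = z \<or> y = z'"
          using path_two[OF l, of "fst y" t "fst z" "fst z'"] r(2) z t by (metis prod.collapse)
        moreover have "d y q \<ge> e" if "\<And>n. d (w n) q > e" "q \<in> squeezed X" for q
        proof (rule LIMSEQ_le_const)
          show "(\<lambda>n. d (w (r n)) q) \<longlonglongrightarrow> d y q"
            by (rule tendsto_dist_dist[OF _ _ _ _ r(3)]) (use wM that r sub in auto)
        qed (use that in \<open>auto intro: less_imp_le\<close>)
        ultimately show False using w(4,5) zM e(1) mdist_zero by (metis not_le)
      qed
    qed
    moreover have "l \<in> paths_int X" by (rule path_limit_interval[OF \<sigma>i l lim'(1)])
    ultimately show "l \<in> paths_int_c X" unfolding paths_int_c_def by blast
  qed
qed

end

section \<open>Polishness\<close>

context Metric_space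
begin

lemma Polish_space_mtopology:
  assumes "completely_metrizable_space mtopology" "dense_set D"
  shows "Polish_space mtopology"
  using assms separable_iff_dense_set unfolding Polish_space_def by blast

lemma Polish_space_subset:
  assumes "completely_metrizable_space mtopology" "dense_set D" "gdelta_in mtopology Q"
  shows "Polish_space (Metric_space.mtopology Q d)"
proof -
  have Q: "Q \<subseteq> M" using gdelta_in_subset[OF assms(3)] by simp
  then interpret S: Submetric M d Q by unfold_locales
  obtain D' where "S.sub.dense_set D'" using dense_set_subset[OF assms(2) Q] by blast
  moreover have "completely_metrizable_space S.sub.mtopology"
    unfolding S.mtopology_submetric by (rule completely_metrizable_space_gdelta_in[OF assms(1,3)])
  ultimately show ?thesis by (intro S.sub.Polish_space_mtopology)
qed

lemma gdelta_in_Diff_UN_closedin: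
  assumes "gdelta_in mtopology S" "\<And>n::nat. closedin mtopology (F n)"
  shows "gdelta_in mtopology (S - (\<Union>n. F n))"
proof -
  have "fsigma_in mtopology (\<Union>n. F n)"
    by (intro fsigma_in_Union) (auto intro: closed_imp_fsigma_in assms(2))
  then show ?thesis using assms(1) by (rule gdelta_in_diff[rotated])
qed

end

lemma subseq_disj:
  fixes A B :: "nat \<Rightarrow> bool"
  assumes "\<And>n. A n \<or> B n"
  shows "\<exists>r. strict_mono (r :: nat \<Rightarrow> nat) \<and> ((\<forall>n. A (r n)) \<or> (\<forall>n. B (r n)))"
proof -
  have "{n. A n} \<union> {n. B n} = UNIV" using assms by blast
  then consider "infinite {n. A n}" | "infinite {n. B n}" by (metis finite_Un infinite_UNIV_nat)
  then show ?thesis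
  proof cases
    case 1
    then show ?thesis
      using strict_mono_enumerate[OF 1] enumerate_in_set[OF 1] by (intro exI[of _ "enumerate {n. A n}"]) auto
  next
    case 2
    then show ?thesis
      using strict_mono_enumerate[OF 2] enumerate_in_set[OF 2] by (intro exI[of _ "enumerate {n. B n}"]) auto
  qed
qed

section \<open>The image of the path space in the hyperspace of the square\<close>

context squeezed_metric
begin

sublocale sq: Metric_space "squeezed X \<times> squeezed X" "max_dist d"
  by (rule Metric_space_max_dist)

abbreviation relation_dist :: "'a spoint rel \<Rightarrow> 'a spoint rel \<Rightarrow> real" where
  "relation_dist \<equiv> hausdorff_dist (max_dist d)"

sublocale hyp: Metric_space sq.hyper relation_dist
  by (rule sq.Metric_space_hyper)

lemma relation_limit_mem:
  assumes "\<And>n. K n \<in> sq.hyper" "L \<in> sq.hyper" "vanishes (\<lambda>n. relation_dist (K n) L)" "strict_mono (r :: nat \<Rightarrow> nat)"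
    "\<And>n. (u (r n), v (r n)) \<in> K (r n)" "x \<in> squeezed X" "y \<in> squeezed X" "vanishes (\<lambda>n. d (u n) x)" "vanishes (\<lambda>n. d (v n) y)"
  shows "(x, y) \<in> L"
proof (rule sq.hyper_limit_mem[of "\<lambda>n. K (r n)" L "\<lambda>n. (u (r n), v (r n))"])
  show "vanishes (\<lambda>n. relation_dist (K (r n)) L)" using LIMSEQ_subseq_LIMSEQ[OF assms(3,4)] by (simp add: o_def)
  show "vanishes (\<lambda>n. max_dist d (u (r n), v (r n)) (x, y))"
    unfolding max_dist_tendsto fst_conv snd_conv
    using LIMSEQ_subseq_LIMSEQ[OF assms(8,4)] LIMSEQ_subseq_LIMSEQ[OF assms(9,4)] by (simp add: o_def)
qed (use assms in auto)

lemma relation_limit_approx: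
  assumes "\<And>n. K n \<in> sq.hyper" "L \<in> sq.hyper" "vanishes (\<lambda>n. relation_dist (K n) L)" "(x, y) \<in> L"
  shows "\<exists>u v. (\<forall>n. (u n, v n) \<in> K n) \<and> vanishes (\<lambda>n. d (u n) x) \<and> vanishes (\<lambda>n. d (v n) y)"
proof -
  obtain p where "\<And>n. p n \<in> K n" "vanishes (\<lambda>n. max_dist d (p n) (x, y))"
    by (rule sq.hyper_limit_approx[OF assms]) blast
  then show ?thesis
    unfolding max_dist_tendsto by (intro exI[of _ "\<lambda>n. fst (p n)"] exI[of _ "\<lambda>n. snd (p n)"]) simp
qed

text \<open>Failure of antisymmetry with margin \<open>e\<close>. Bare failure is not preserved by
  limits, since the two points may merge; the margin makes the condition closed.\<close>

definition cyclic_rel :: "real \<Rightarrow> 'a spoint rel set" where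
  "cyclic_rel e = {K \<in> sq.hyper. \<exists>z z'. (z, z') \<in> K \<and> (z', z) \<in> K \<and> e \<le> d z z'}"

text \<open>Failure of the bound of two points per time, again with a margin. The points are
  recognized by their reflexive pairs, as only the relation is given.\<close>

definition triple_rel :: "real \<Rightarrow> 'a spoint rel set" where
  "triple_rel e = {K \<in> sq.hyper. \<exists>x y z. (x, x) \<in> K \<and> (y, y) \<in> K \<and> (z, z) \<in> K \<and> snd x = snd y \<and> snd y = snd z \<and>
     e \<le> d x y \<and> e \<le> d y z \<and> e \<le> d x z}"

lemma relation_limit_subseq:
  assumes "\<And>n. K n \<in> sq.hyper" "L \<in> sq.hyper" "vanishes (\<lambda>n. relation_dist (K n) L)" "\<And>n. (u n, v n) \<in> K n"
  obtains r x y where "strict_mono (r :: nat \<Rightarrow> nat)" "(x, y) \<in> L" "vanishes (\<lambda>n. d (u (r n)) x)" "vanishes (\<lambda>n. d (v (r n)) y)"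
proof -
  obtain r l where "strict_mono (r :: nat \<Rightarrow> nat)" "l \<in> L" "vanishes (\<lambda>n. max_dist d (u (r n), v (r n)) l)"
    by (rule sq.hyper_limit_subseq[OF assms])
  then show ?thesis unfolding max_dist_tendsto using that[of r "fst l" "snd l"] by simp
qed

lemma closedin_cyclic_rel: "closedin hyp.mtopology (cyclic_rel e)"
proof (rule hyp.closedin_seqI)
  show "cyclic_rel e \<subseteq> sq.hyper" unfolding cyclic_rel_def by blast
  fix K L assume K: "\<And>n. K n \<in> cyclic_rel e" and L: "L \<in> sq.hyper" and lim: "vanishes (\<lambda>n. relation_dist (K n) L)"
  have Kh: "K n \<in> sq.hyper" for n using K unfolding cyclic_rel_def by blast
  obtain z z' where z: "\<And>n. (z n, z' n) \<in> K n" "\<And>n. (z' n, z n) \<in> K n" "\<And>n. e \<le> d (z n) (z' n)"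
    using K unfolding cyclic_rel_def mem_Collect_eq by metis
  have M: "z n \<in> squeezed X" "z' n \<in> squeezed X" for n using z(1) sq.hyper_subset[OF Kh] by blast+
  obtain r x y where r: "strict_mono (r :: nat \<Rightarrow> nat)" "(x, y) \<in> L" "vanishes (\<lambda>n. d (z (r n)) x)" "vanishes (\<lambda>n. d (z' (r n)) y)"
    by (rule relation_limit_subseq[OF Kh L lim z(1)])
  have xy: "x \<in> squeezed X" "y \<in> squeezed X" using r(2) sq.hyper_subset[OF L] by blast+
  have lim': "vanishes (\<lambda>n. relation_dist (K (r n)) L)" using LIMSEQ_subseq_LIMSEQ[OF lim r(1)] by (simp add: o_def)
  have "(y, x) \<in> L"
    by (rule relation_limit_mem[OF _ L lim' strict_mono_id[unfolded id_def] _ xy(2,1) r(4,3)]) (use Kh z in auto)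
  moreover have "e \<le> d x y"
    by (rule LIMSEQ_le_const[OF tendsto_dist_dist[OF _ _ xy r(3,4)]]) (use M z in auto)
  ultimately show "L \<in> cyclic_rel e" using r(2) L unfolding cyclic_rel_def by blast
qed

lemma closedin_triple_rel: "closedin hyp.mtopology (triple_rel e)"
proof (rule hyp.closedin_seqI)
  show "triple_rel e \<subseteq> sq.hyper" unfolding triple_rel_def by blast
  fix K L assume K: "\<And>n. K n \<in> triple_rel e" and L: "L \<in> sq.hyper" and lim: "vanishes (\<lambda>n. relation_dist (K n) L)"
  have Kh: "K n \<in> sq.hyper" for n using K unfolding triple_rel_def by blast
  obtain x y z where z: "\<And>n. (x n, x n) \<in> K n" "\<And>n. (y n, y n) \<in> K n" "\<And>n. (z n, z n) \<in> K n"
    "\<And>n. snd (x n) = snd (y n)" "\<And>n. snd (y n) = snd (z n)" "\<And>n. e \<le> d (x n) (y n)" "\<And>n. e \<le> d (y n) (z n)" "\<And>n. e \<le> d (x n) (z n)"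
    using K unfolding triple_rel_def mem_Collect_eq by metis
  have M: "x n \<in> squeezed X" "y n \<in> squeezed X" "z n \<in> squeezed X" for n using z(1-3)[of n] sq.hyper_subset[OF Kh] by blast+
  have L2: "a \<in> squeezed X \<and> b \<in> squeezed X" if "(a, b) \<in> L" for a b using that sq.hyper_subset[OF L] by blast
  obtain r a a' where r: "strict_mono (r :: nat \<Rightarrow> nat)" "(a, a') \<in> L" "vanishes (\<lambda>n. d (x (r n)) a)" "vanishes (\<lambda>n. d (x (r n)) a')"
    by (rule relation_limit_subseq[OF Kh L lim z(1)])
  have limr: "vanishes (\<lambda>n. relation_dist (K (r n)) L)" using LIMSEQ_subseq_LIMSEQ[OF lim r(1)] by (simp add: o_def)
  obtain s b b' where s: "strict_mono (s :: nat \<Rightarrow> nat)" "(b, b') \<in> L" "vanishes (\<lambda>n. d (y (r (s n))) b)" "vanishes (\<lambda>n. d (y (r (s n))) b')"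
    by (rule relation_limit_subseq[OF Kh L limr z(2)])
  have lims: "vanishes (\<lambda>n. relation_dist (K (r (s n))) L)" using LIMSEQ_subseq_LIMSEQ[OF limr s(1)] by (simp add: o_def)
  obtain t c c' where t: "strict_mono (t :: nat \<Rightarrow> nat)" "(c, c') \<in> L" "vanishes (\<lambda>n. d (z (r (s (t n)))) c)" "vanishes (\<lambda>n. d (z (r (s (t n)))) c')"
    by (rule relation_limit_subseq[OF Kh L lims z(3)])
  define q where "q n = r (s (t n))" for n
  have q: "vanishes (\<lambda>n. d (x (q n)) a)" "vanishes (\<lambda>n. d (y (q n)) b)" "vanishes (\<lambda>n. d (z (q n)) c)"
    using LIMSEQ_subseq_LIMSEQ[OF LIMSEQ_subseq_LIMSEQ[OF r(3) s(1)] t(1)] LIMSEQ_subseq_LIMSEQ[OF s(3) t(1)] t(3)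
    unfolding q_def by (simp_all add: o_def)
  have abc: "a \<in> squeezed X" "b \<in> squeezed X" "c \<in> squeezed X" using L2 r(2) s(2) t(2) by blast+
  have "a = a'" using tendsto_dist_unique[OF _ _ _ r(3,4)] M L2[OF r(2)] by blast
  moreover have "b = b'" using tendsto_dist_unique[OF _ _ _ s(3,4)] M L2[OF s(2)] by blast
  moreover have "c = c'" using tendsto_dist_unique[OF _ _ _ t(3,4)] M L2[OF t(2)] by blast
  moreover have "snd a = snd b"
    using LIMSEQ_unique[OF tendsto_snd[OF M(1) abc(1) q(1)]] tendsto_snd[OF M(2) abc(2) q(2)] z(4) by simp
  moreover have "snd b = snd c"
    using LIMSEQ_unique[OF tendsto_snd[OF M(2) abc(2) q(2)]] tendsto_snd[OF M(3) abc(3) q(3)] z(5) by simp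
  moreover have "e \<le> d a b"
    by (rule LIMSEQ_le_const[OF tendsto_dist_dist[OF _ _ abc(1,2) q(1,2)]]) (use M z in auto)
  moreover have "e \<le> d b c"
    by (rule LIMSEQ_le_const[OF tendsto_dist_dist[OF _ _ abc(2,3) q(2,3)]]) (use M z in auto)
  moreover have "e \<le> d a c"
    by (rule LIMSEQ_le_const[OF tendsto_dist_dist[OF _ _ abc(1,3) q(1,3)]]) (use M z in auto)
  ultimately show "L \<in> triple_rel e" using r(2) s(2) t(2) L unfolding triple_rel_def by blast
qed

lemma finite_card_le_2:
  assumes "\<And>x y z. x \<in> S \<Longrightarrow> y \<in> S \<Longrightarrow> z \<in> S \<Longrightarrow> x = y \<or> y = z \<or> x = z"
  shows "finite S \<and> card S \<le> 2"
proof (cases "\<exists>x y. x \<in> S \<and> y \<in> S \<and> x \<noteq> y")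
  case True
  then obtain x y where "x \<in> S" "y \<in> S" "x \<noteq> y" by blast
  then have "S = {x, y}" using assms by blast
  then show ?thesis by (simp add: card_insert_if)
next
  case False
  then have "S = {} \<or> (\<exists>x. S = {x})" by blast
  then show ?thesis by auto
qed

lemma linear_order_onI:
  assumes "R \<subseteq> P \<times> P" "\<And>z. z \<in> P \<Longrightarrow> (z, z) \<in> R" "\<And>x y z. (x, y) \<in> R \<Longrightarrow> (y, z) \<in> R \<Longrightarrow> (x, z) \<in> R"
    "\<And>x y. (x, y) \<in> R \<Longrightarrow> (y, x) \<in> R \<Longrightarrow> x = y" "\<And>x y. x \<in> P \<Longrightarrow> y \<in> P \<Longrightarrow> (x, y) \<in> R \<or> (y, x) \<in> R"
  shows "linear_order_on P R"
  unfolding order_on_defs refl_on_def trans_def antisym_def total_on_def using assms by blast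

text \<open>Totality, compactness, closedness and compatibility with time survive the limit.
  Antisymmetry and the bound on the number of points are the two hypotheses, and transitivity is
  derived with the help of antisymmetry.\<close>

lemma closure_order2_paths:
  assumes L: "L \<in> hyp.mtopology closure_of (order2 ` paths X)"
    and cyc: "\<And>n. L \<notin> cyclic_rel (1 / real (Suc n))" and tri: "\<And>n. L \<notin> triple_rel (1 / real (Suc n))"
  shows "L \<in> order2 ` paths X"
proof -
  have Lh: "L \<in> sq.hyper" using L hyp.metric_closure_of by auto
  have "\<exists>\<pi>\<in>paths X. relation_dist L (order2 \<pi>) < 1 / real (Suc n)" for n
  proof -
    have "\<forall>r>0. \<exists>y\<in>order2 ` paths X. y \<in> hyp.mball L r" using L unfolding hyp.metric_closure_of by blast
    moreover have "1 / real (Suc n) > 0" by simp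
    ultimately obtain y where "y \<in> order2 ` paths X" "y \<in> hyp.mball L (1 / real (Suc n))" by blast
    then show ?thesis by auto
  qed
  then obtain \<pi> where \<pi>: "\<And>n. \<pi> n \<in> paths X" "\<And>n. relation_dist L (order2 (\<pi> n)) < 1 / real (Suc n)" by metis
  define K where "K n = snd (\<pi> n)" for n
  have K: "K n = order2 (\<pi> n)" for n unfolding K_def using pathD(11)[OF \<pi>(1)] by simp
  have Kh: "K n \<in> sq.hyper" for n unfolding K by (rule order2_hyper[OF \<pi>(1)])
  have lim: "vanishes (\<lambda>n. relation_dist (K n) L)"
    by (rule tendsto_sandwich[OF _ _ tendsto_const LIMSEQ_Suc[OF lim_1_over_n]])
      (use \<pi>(2) in \<open>auto intro!: always_eventually less_imp_le simp: K hyp.commute[of L]\<close>)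
  have LM: "x \<in> squeezed X" "y \<in> squeezed X" if "(x, y) \<in> L" for x y using that sq.hyper_subset[OF Lh] by blast+
  note mem = relation_limit_mem[OF Kh Lh lim] and approx = relation_limit_approx[OF Kh Lh lim]
  note id = strict_mono_id[unfolded id_def]
  have small: "x = y" if "x \<in> squeezed X" "y \<in> squeezed X" "\<And>n. d x y < 1 / real (Suc n)" for x y
  proof (rule ccontr)
    assume "x \<noteq> y"
    then have "d x y > 0" using that by simp
    then obtain n where "1 / real (Suc n) < d x y" by (rule nat_approx_posE)
    then show False using that(3)[of n] by simp
  qed
  have antisym: "x = y" if xy: "(x, y) \<in> L" "(y, x) \<in> L" for x y
  proof (rule small)
    show "d x y < 1 / real (Suc n)" for n
    proof (rule ccontr)
      assume "\<not> d x y < 1 / real (Suc n)"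
      then have "1 / real (Suc n) \<le> d x y" by simp
      then have "L \<in> cyclic_rel (1 / real (Suc n))" using Lh xy unfolding cyclic_rel_def by blast
      then show False using cyc[of n] by blast
    qed
  qed (use LM[OF xy(1)] in auto)
  define P where "P = {z. (z, z) \<in> L}"
  have LP: "x \<in> P" "y \<in> P" if xy: "(x, y) \<in> L" for x y
  proof -
    obtain u v where uv: "\<forall>n. (u n, v n) \<in> K n" "vanishes (\<lambda>n. d (u n) x)" "vanishes (\<lambda>n. d (v n) y)" using approx[OF xy] by blast
    have d: "(u n, u n) \<in> K n" "(v n, v n) \<in> K n" for n
      using uv(1)[rule_format, of n] pathD(6,13,14)[OF \<pi>(1)] unfolding K_def by blast+
    show "x \<in> P" "y \<in> P"
      unfolding P_def mem_Collect_eq using mem[OF id d(1) LM(1)[OF xy] LM(1)[OF xy] uv(2,2)] mem[OF id d(2) LM(2)[OF xy] LM(2)[OF xy] uv(3,3)] by auto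
  qed
  have PM: "x \<in> squeezed X" if "x \<in> P" for x using LM that unfolding P_def by blast
  have Papprox: "\<exists>u. (\<forall>n. u n \<in> fst (\<pi> n)) \<and> vanishes (\<lambda>n. d (u n) x)" if x: "x \<in> P" for x
  proof -
    have "(x, x) \<in> L" using x unfolding P_def by simp
    then obtain u v where uv: "\<forall>n. (u n, v n) \<in> K n" "vanishes (\<lambda>n. d (u n) x)" using approx by blast
    then have "\<forall>n. u n \<in> fst (\<pi> n)" using pathD(13)[OF \<pi>(1)] unfolding K_def by blast
    then show ?thesis using uv(2) by blast
  qed
  have total: "(x, y) \<in> L \<or> (y, x) \<in> L" if xy: "x \<in> P" "y \<in> P" for x y
  proof -
    obtain u where u: "\<forall>n. u n \<in> fst (\<pi> n)" "vanishes (\<lambda>n. d (u n) x)" using Papprox[OF xy(1)] by blast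
    obtain v where v: "\<forall>n. v n \<in> fst (\<pi> n)" "vanishes (\<lambda>n. d (v n) y)" using Papprox[OF xy(2)] by blast
    have "(u n, v n) \<in> K n \<or> (v n, u n) \<in> K n" for n using u v pathD(9)[OF \<pi>(1)] unfolding K_def by blast
    from subseq_disj[of "\<lambda>n. (u n, v n) \<in> K n", OF this]
    obtain r where "strict_mono (r :: nat \<Rightarrow> nat)" "(\<forall>n. (u (r n), v (r n)) \<in> K (r n)) \<or> (\<forall>n. (v (r n), u (r n)) \<in> K (r n))" by blast
    then show ?thesis
      using mem[of r u v x y] mem[of r v u y x] PM[OF xy(1)] PM[OF xy(2)] u(2) v(2) by blast
  qed
  \<comment> \<open>The approximations \<open>v\<close> and \<open>v'\<close> of \<open>y\<close>
    differ, so the orders cannot be chained. By totality either \<open>u\<close> precedes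
    \<open>w\<close> infinitely often, which gives the claim, or \<open>v'\<close> precedes
    \<open>u\<close> infinitely often; then \<open>(y, x)\<close> is in \<open>L\<close> and
    \<open>x = y\<close> by antisymmetry.\<close>
  have trans: "(x, z) \<in> L" if xyz: "(x, y) \<in> L" "(y, z) \<in> L" for x y z
  proof -
    obtain u v where u: "\<forall>n. (u n, v n) \<in> K n" "vanishes (\<lambda>n. d (u n) x)" "vanishes (\<lambda>n. d (v n) y)" using approx[OF xyz(1)] by blast
    obtain v' w where v: "\<forall>n. (v' n, w n) \<in> K n" "vanishes (\<lambda>n. d (v' n) y)" "vanishes (\<lambda>n. d (w n) z)" using approx[OF xyz(2)] by blast
    have "(u n, w n) \<in> K n \<or> (v' n, u n) \<in> K n" for n
    proof -
      have "(u n, w n) \<in> K n \<or> (w n, u n) \<in> K n"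
        using u(1) v(1) pathD(9,13,14)[OF \<pi>(1)] unfolding K_def by blast
      then show ?thesis using v(1) pathD(7)[OF \<pi>(1)] unfolding K_def by blast
    qed
    from subseq_disj[of "\<lambda>n. (u n, w n) \<in> K n", OF this]
    obtain r where "strict_mono (r :: nat \<Rightarrow> nat)" "(\<forall>n. (u (r n), w (r n)) \<in> K (r n)) \<or> (\<forall>n. (v' (r n), u (r n)) \<in> K (r n))" by blast
    then consider "(x, z) \<in> L" | "(y, x) \<in> L"
      using mem[of r u w x z] mem[of r v' u y x] LM[OF xyz(1)] LM[OF xyz(2)] u(2) v(2,3) by blast
    then show ?thesis using antisym[OF xyz(1)] xyz by cases auto
  qed
  have "(P, L) \<in> paths X"
    unfolding paths_iff
  proof (intro conjI allI impI)
    show "P \<noteq> {}" using sq.hyperD(1)[OF Lh] LP by force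
    show "linear_order_on P L"
    proof (rule linear_order_onI)
      show "L \<subseteq> P \<times> P" using LP by auto
      show "(z, z) \<in> L" if "z \<in> P" for z using that unfolding P_def by simp
    qed (use antisym total trans in blast)+
    show "compactin mtopology P"
    proof (rule compactinI)
      show "P \<subseteq> squeezed X" using PM by blast
      fix \<sigma> assume "\<And>n::nat. \<sigma> n \<in> P"
      then have "(\<sigma> n, \<sigma> n) \<in> L" for n unfolding P_def by simp
      then obtain r l where r: "strict_mono (r :: nat \<Rightarrow> nat)" "l \<in> L" "vanishes (\<lambda>n. max_dist d (\<sigma> (r n), \<sigma> (r n)) l)"
        by (rule sq.compactin_subseq[OF sq.hyperD(2)[OF Lh]])
      have "fst l \<in> P" using LP(1)[of "fst l" "snd l"] r(2) by simp
      then show "\<exists>r l. strict_mono (r :: nat \<Rightarrow> nat) \<and> l \<in> P \<and> vanishes (\<lambda>n. d (\<sigma> (r n)) l)"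
        using r(1,3) unfolding max_dist_tendsto by auto
    qed
    show "(x, y) \<in> L" if "\<forall>n. (\<sigma> n, \<tau> n) \<in> L" "x \<in> P" "y \<in> P" "vanishes (\<lambda>n. d (\<sigma> n) x)" "vanishes (\<lambda>n. d (\<tau> n) y)" for \<sigma> \<tau> x y
    proof (rule sq.compactin_closed_seq[OF sq.hyperD(2)[OF Lh], of "\<lambda>n. (\<sigma> n, \<tau> n)"])
      show "vanishes (\<lambda>n. max_dist d (\<sigma> n, \<tau> n) (x, y))" unfolding max_dist_tendsto using that by simp
    qed (use that PM in auto)
    show "((x, s), (x', s')) \<in> L" if *: "(x, s) \<in> P \<and> (x', s') \<in> P \<and> s < s'" for x s x' s'
    proof -
      have P2: "(x, s) \<in> P" "(x', s') \<in> P" "s < s'" using * by auto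
      obtain u where u: "\<forall>n. u n \<in> fst (\<pi> n)" "vanishes (\<lambda>n. d (u n) (x, s))" using Papprox[OF P2(1)] by blast
      obtain v where v: "\<forall>n. v n \<in> fst (\<pi> n)" "vanishes (\<lambda>n. d (v n) (x', s'))" using Papprox[OF P2(2)] by blast
      have M: "u n \<in> squeezed X" "v n \<in> squeezed X" for n using u(1) v(1) pathD(3)[OF \<pi>(1)] by blast+
      obtain c where c: "s < c" "c < s'" using dense[OF P2(3)] by blast
      have "(\<lambda>n. snd (u n)) \<longlonglongrightarrow> s" "(\<lambda>n. snd (v n)) \<longlonglongrightarrow> s'"
        using tendsto_snd[OF M(1) PM[OF P2(1)] u(2)] tendsto_snd[OF M(2) PM[OF P2(2)] v(2)] by simp_all
      then have "\<forall>\<^sub>F n in sequentially. snd (u n) < c \<and> c < snd (v n)"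
        using order_tendstoD c by (intro eventually_conj) blast+
      then obtain N where N: "\<And>n. n \<ge> N \<Longrightarrow> snd (u n) < c \<and> c < snd (v n)" unfolding eventually_sequentially by blast
      have "(u (n + N), v (n + N)) \<in> K (n + N)" for n
      proof -
        have "snd (u (n + N)) < snd (v (n + N))" using N[of "n + N"] by (meson le_add2 less_trans)
        then show ?thesis unfolding K_def using pathD(10)[OF \<pi>(1)] u(1) v(1) by blast
      qed
      moreover have "strict_mono (\<lambda>n. n + N)" by (simp add: strict_mono_def)
      ultimately show ?thesis
        using mem[of "\<lambda>n. n + N" u v] PM[OF P2(1)] PM[OF P2(2)] u(2) v(2) by blast
    qed
    have *: "x = y \<or> y = z \<or> x = z" if xyz: "(Some x, ereal t) \<in> P" "(Some y, ereal t) \<in> P" "(Some z, ereal t) \<in> P" for x y z t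
    proof (rule ccontr)
      assume ne: "\<not> ?thesis"
      let ?x = "(Some x, ereal t)" and ?y = "(Some y, ereal t)" and ?z = "(Some z, ereal t)"
      have "0 < min (d ?x ?y) (min (d ?y ?z) (d ?x ?z))" using ne PM[OF xyz(1)] PM[OF xyz(2)] PM[OF xyz(3)] by auto
      then obtain n where n: "1 / real (Suc n) < min (d ?x ?y) (min (d ?y ?z) (d ?x ?z))" by (rule nat_approx_posE)
      have "L \<in> triple_rel (1 / real (Suc n))"
        unfolding triple_rel_def mem_Collect_eq
        using n xyz Lh unfolding P_def by (intro conjI exI[of _ ?x] exI[of _ ?y] exI[of _ ?z]) auto
      then show False using tri by blast
    qed
    show "finite {x. (Some x, ereal t) \<in> P}" "card {x. (Some x, ereal t) \<in> P} \<le> 2" for t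
      using finite_card_le_2[of "{x. (Some x, ereal t) \<in> P}"] * by blast+
  qed
  moreover have "order2 (P, L) = L" unfolding order2_def using LP by auto
  ultimately show ?thesis by (metis image_eqI)
qed

text \<open>The image is its closure minus two countable unions of closed sets; the margins
  \<open>1 / Suc n\<close> exhaust all positive ones.\<close>

lemma gdelta_in_order2_paths: "gdelta_in hyp.mtopology (order2 ` paths X)"
proof -
  let ?C = "hyp.mtopology closure_of (order2 ` paths X)"
  have nb: "order2 \<pi> \<notin> cyclic_rel e \<and> order2 \<pi> \<notin> triple_rel e" if "e > 0" and \<pi>: "\<pi> \<in> paths X" for \<pi> e
  proof -
    have "order2 \<pi> \<notin> cyclic_rel e"
    proof
      assume "order2 \<pi> \<in> cyclic_rel e"
      then obtain z z' where z: "(z, z') \<in> snd \<pi>" "(z', z) \<in> snd \<pi>" "e \<le> d z z'" unfolding cyclic_rel_def pathD(11)[OF \<pi>] by blast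
      then have "z = z'" "z \<in> squeezed X" using pathD(3,8,13)[OF \<pi>] by blast+
      then show False using z(3) that by simp
    qed
    moreover have "order2 \<pi> \<notin> triple_rel e"
    proof
      assume "order2 \<pi> \<in> triple_rel e"
      then obtain x y z where *: "(x, x) \<in> snd \<pi>" "(y, y) \<in> snd \<pi>" "(z, z) \<in> snd \<pi>" "snd x = snd y" "snd y = snd z" "e \<le> d x y" "e \<le> d y z" "e \<le> d x z"
        unfolding triple_rel_def pathD(11)[OF \<pi>] by blast
      then have P: "x \<in> fst \<pi>" "y \<in> fst \<pi>" "z \<in> fst \<pi>" using pathD(13)[OF \<pi>] by blast+
      then have M: "x \<in> squeezed X" "y \<in> squeezed X" "z \<in> squeezed X" using pathD(3)[OF \<pi>] by blast+
      have "x = y \<or> y = z \<or> x = z"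
      proof (cases "snd x")
        case (real t)
        then show ?thesis using path_two[OF \<pi>, of "fst x" t "fst y" "fst z"] P *(4,5) by (metis prod.collapse)
      qed (use same_infinite_time[OF M(1,2)] *(4) in auto)
      then show False using *(6-8) M that by auto
    qed
    ultimately show ?thesis by blast
  qed
  have eq: "order2 ` paths X = ?C - (\<Union>n. cyclic_rel (1 / real (Suc n))) - (\<Union>n. triple_rel (1 / real (Suc n)))"
    (is "_ = ?R")
  proof (intro equalityI subsetI)
    fix L assume L: "L \<in> order2 ` paths X"
    have "order2 ` paths X \<subseteq> ?C" by (rule closure_of_subset) (use order2_hyper in auto)
    then show "L \<in> ?R" using L nb by auto
  next
    fix L assume "L \<in> ?R"
    then show "L \<in> order2 ` paths X" using closure_order2_paths[of L] by blast
  qed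
  moreover have "gdelta_in hyp.mtopology ?C"
    by (rule closed_imp_gdelta_in[OF hyp.metrizable_space_mtopology]) simp
  ultimately show ?thesis
    by (subst eq) (intro hyp.gdelta_in_Diff_UN_closedin closedin_cyclic_rel closedin_triple_rel)
qed

text \<open>What is transferred along the isometry \<open>order2\<close> is complete metrizability
  of the topology, not completeness of \<open>d_part\<close>: the image is a \<open>G_delta\<close>
  set of a complete space.\<close>

lemma completely_metrizable_dense_paths:
  assumes "mcomplete" "dense_set D"
  shows "completely_metrizable_space (Metric_space.mtopology (paths X) (d_part d)) \<and>
    (\<exists>D. Metric_space.dense_set (paths X) (d_part d) D)"
proof -
  interpret Q: Metric_space "paths X" "d_part d" by (rule Metric_space_d_part)
  let ?S = "order2 ` paths X"
  have sub: "?S \<subseteq> sq.hyper" using order2_hyper by blast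
  interpret S: Submetric sq.hyper relation_dist ?S using sub by unfold_locales
  interpret QS: Metric_space12 "paths X" "d_part d" ?S relation_dist by unfold_locales
  have "homeomorphic_map Q.mtopology S.sub.mtopology order2"
    by (rule QS.isometry_imp_homeomorphic_map) (simp_all add: d_part_def)
  then have hs: "Q.mtopology homeomorphic_space S.sub.mtopology" by (rule homeomorphic_map_imp_homeomorphic_space)
  have "completely_metrizable_space hyp.mtopology"
    by (intro hyp.completely_metrizable_space_mtopology sq.hyper_mcomplete mcomplete_max_dist assms(1))
  then have "completely_metrizable_space S.sub.mtopology"
    unfolding S.mtopology_submetric using gdelta_in_order2_paths by (rule completely_metrizable_space_gdelta_in)
  moreover obtain D' where "S.sub.dense_set D'"
    using hyp.dense_set_subset[OF sq.hyper_dense_set[OF dense_set_max_dist[OF assms(2)]] sub] by blast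
  ultimately show ?thesis
    using homeomorphic_completely_metrizable_space[OF hs] homeomorphic_separable_space[OF hs]
      Q.separable_iff_dense_set S.sub.separable_iff_dense_set by blast
qed

section \<open>Subspaces determined by domains and jumps\<close>

lemma path_limit_subseq2:
  assumes \<sigma>: "\<And>n. \<sigma> n \<in> paths X" and l: "l \<in> paths X" and lim: "vanishes (\<lambda>n. d_part d (\<sigma> n) l)"
    and uv: "\<And>n. u n \<in> fst (\<sigma> n)" "\<And>n. v n \<in> fst (\<sigma> n)"
  obtains r x y where "strict_mono (r :: nat \<Rightarrow> nat)" "x \<in> fst l" "y \<in> fst l" "vanishes (\<lambda>n. d (u (r n)) x)" "vanishes (\<lambda>n. d (v (r n)) y)"
    "(\<lambda>n. snd (u (r n))) \<longlonglongrightarrow> snd x" "(\<lambda>n. snd (v (r n))) \<longlonglongrightarrow> snd y" "(\<lambda>n. d (u (r n)) (v (r n))) \<longlonglongrightarrow> d x y"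
proof -
  have "\<forall>\<^sub>F n in sequentially. hausdorff_dist d (fst (\<sigma> n)) (fst l) \<le> d_part d (\<sigma> n) l"
    using d_H_le_d_part[OF \<sigma> l] d_H_paths[OF \<sigma> l] by (intro always_eventually) simp
  then have h: "vanishes (\<lambda>n. hausdorff_dist d (fst (\<sigma> n)) (fst l))"
    by (intro tendsto_sandwich[OF _ _ tendsto_const lim]) auto
  have M: "u n \<in> squeezed X" "v n \<in> squeezed X" for n using uv pathD(3)[OF \<sigma>] by blast+
  obtain r x where r: "strict_mono (r :: nat \<Rightarrow> nat)" "x \<in> fst l" "vanishes (\<lambda>n. d (u (r n)) x)"
    by (rule hyper_limit_subseq[OF pathD(4)[OF \<sigma>] pathD(4)[OF l] h uv(1)])
  have h': "vanishes (\<lambda>n. hausdorff_dist d (fst (\<sigma> (r n))) (fst l))" using LIMSEQ_subseq_LIMSEQ[OF h r(1)] by (simp add: o_def)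
  obtain s y where s: "strict_mono (s :: nat \<Rightarrow> nat)" "y \<in> fst l" "vanishes (\<lambda>n. d (v (r (s n))) y)"
    by (rule hyper_limit_subseq[OF pathD(4)[OF \<sigma>] pathD(4)[OF l] h' uv(2)])
  have u: "vanishes (\<lambda>n. d (u (r (s n))) x)" using LIMSEQ_subseq_LIMSEQ[OF r(3) s(1)] by (simp add: o_def)
  have xy: "x \<in> squeezed X" "y \<in> squeezed X" using r(2) s(2) pathD(3)[OF l] by blast+
  show ?thesis
  proof (rule that[of "r \<circ> s" x y])
    show "strict_mono (r \<circ> s)" using r(1) s(1) by (rule strict_mono_o)
    show "(\<lambda>n. d (u ((r \<circ> s) n)) (v ((r \<circ> s) n))) \<longlonglongrightarrow> d x y"
      using tendsto_dist_dist[OF _ _ xy u s(3)] M by simp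
    show "(\<lambda>n. snd (u ((r \<circ> s) n))) \<longlonglongrightarrow> snd x" "(\<lambda>n. snd (v ((r \<circ> s) n))) \<longlonglongrightarrow> snd y"
      using tendsto_snd[OF _ xy(1) u] tendsto_snd[OF _ xy(2) s(3)] M by simp_all
  qed (use u s r in simp_all)
qed

text \<open>For positive \<open>e\<close> a jump of size at least \<open>e\<close> cannot vanish in
  the limit. Paths without jumps at times in \<open>T\<close> are those outside all these sets for
  \<open>e = 1 / Suc n\<close>.\<close>

definition jump_paths :: "ereal set \<Rightarrow> real \<Rightarrow> 'a path set" where
  "jump_paths T e = {\<pi> \<in> paths X. \<exists>u\<in>fst \<pi>. \<exists>v\<in>fst \<pi>. snd u = snd v \<and> snd u \<in> T \<and> e \<le> d u v}"

lemma closedin_jump_paths: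
  assumes T: "closed T"
  shows "closedin (Metric_space.mtopology (paths X) (d_part d)) (jump_paths T e)"
proof -
  interpret Q: Metric_space "paths X" "d_part d" by (rule Metric_space_d_part)
  show ?thesis
  proof (rule Q.closedin_seqI)
    show "jump_paths T e \<subseteq> paths X" unfolding jump_paths_def by blast
    fix \<sigma> l assume \<sigma>: "\<And>n. \<sigma> n \<in> jump_paths T e" and l: "l \<in> paths X" and lim: "vanishes (\<lambda>n. d_part d (\<sigma> n) l)"
    have \<sigma>p: "\<sigma> n \<in> paths X" for n using \<sigma> unfolding jump_paths_def by blast
    obtain u v where uv: "\<And>n. u n \<in> fst (\<sigma> n)" "\<And>n. v n \<in> fst (\<sigma> n)" "\<And>n. snd (u n) = snd (v n)" "\<And>n. snd (u n) \<in> T" "\<And>n. e \<le> d (u n) (v n)"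
      using \<sigma> unfolding jump_paths_def mem_Collect_eq by metis
    obtain r x y where r: "strict_mono (r :: nat \<Rightarrow> nat)" "x \<in> fst l" "y \<in> fst l" "vanishes (\<lambda>n. d (u (r n)) x)" "vanishes (\<lambda>n. d (v (r n)) y)"
      "(\<lambda>n. snd (u (r n))) \<longlonglongrightarrow> snd x" "(\<lambda>n. snd (v (r n))) \<longlonglongrightarrow> snd y" "(\<lambda>n. d (u (r n)) (v (r n))) \<longlonglongrightarrow> d x y"
      by (rule path_limit_subseq2[OF \<sigma>p l lim uv(1,2)])
    have "snd x = snd y" using LIMSEQ_unique[OF r(6)] r(7) uv(3) by simp
    moreover have "snd x \<in> T" using closed_sequentially[OF T _ r(6)] uv(4) by blast
    moreover have "e \<le> d x y" by (rule LIMSEQ_le_const[OF r(8)]) (use uv(5) in auto)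
    ultimately show "l \<in> jump_paths T e" using r(2,3) l unfolding jump_paths_def by blast
  qed
qed

text \<open>Points at a common time of the approximating paths accumulate at that time, and a time
  of the limit is a limit of times in the closed set \<open>T\<close>.\<close>

lemma closedin_domain_paths:
  assumes T: "closed T"
  shows "closedin (Metric_space.mtopology (paths X) (d_part d)) {\<pi> \<in> paths X. domain_ext \<pi> = T}"
proof -
  interpret Q: Metric_space "paths X" "d_part d" by (rule Metric_space_d_part)
  show ?thesis
  proof (rule Q.closedin_seqI)
    fix \<sigma> l assume \<sigma>: "\<And>n. \<sigma> n \<in> {\<pi> \<in> paths X. domain_ext \<pi> = T}" and l: "l \<in> paths X" and lim: "vanishes (\<lambda>n. d_part d (\<sigma> n) l)"
    have \<sigma>p: "\<sigma> n \<in> paths X" and \<sigma>T: "domain_ext (\<sigma> n) = T" for n using \<sigma> by auto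
    have "t \<in> domain_ext l" if "t \<in> T" for t
    proof -
      have "\<exists>x. (x, t) \<in> fst (\<sigma> n)" for n using \<sigma>T[of n] that unfolding domain_ext_def by blast
      then obtain x where x: "\<And>n. (x n, t) \<in> fst (\<sigma> n)" by metis
      obtain r z z' where r: "strict_mono (r :: nat \<Rightarrow> nat)" "z \<in> fst l" "z' \<in> fst l"
        "vanishes (\<lambda>n. d (x (r n), t) z)" "vanishes (\<lambda>n. d (x (r n), t) z')"
        "(\<lambda>n. snd (x (r n), t)) \<longlonglongrightarrow> snd z" "(\<lambda>n. snd (x (r n), t)) \<longlonglongrightarrow> snd z'"
        "(\<lambda>n. d (x (r n), t) (x (r n), t)) \<longlonglongrightarrow> d z z'"
        by (rule path_limit_subseq2[OF \<sigma>p l lim x x])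
      then have "snd z = t" by (simp add: LIMSEQ_const_iff)
      then show ?thesis using domain_extI[OF r(2)] by simp
    qed
    moreover have "t \<in> T" if t: "t \<in> domain_ext l" for t
    proof -
      obtain x where x: "(x, t) \<in> fst l" using t unfolding domain_ext_def by blast
      have "((x, t), (x, t)) \<in> order2 l" using pathD(6)[OF l x] pathD(11)[OF l] by simp
      then obtain u v where u: "\<forall>n. (u n, v n) \<in> order2 (\<sigma> n)" "vanishes (\<lambda>n. d (u n) (x, t))"
        using relation_limit_approx[OF order2_hyper[OF \<sigma>p] order2_hyper[OF l] lim[unfolded d_part_def]] by blast
      have uP: "u n \<in> fst (\<sigma> n)" for n using u(1) pathD(13)[OF \<sigma>p] pathD(11)[OF \<sigma>p] by blast
      have "u n \<in> squeezed X" "(x, t) \<in> squeezed X" for n using uP pathD(3)[OF \<sigma>p] pathD(3)[OF l] x by blast+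
      then have "(\<lambda>n. snd (u n)) \<longlonglongrightarrow> t" using tendsto_snd[of u "(x, t)"] u(2) by simp
      moreover have "snd (u n) \<in> T" for n using domain_extI[OF uP[of n]] \<sigma>T[of n] by simp
      ultimately show ?thesis using closed_sequentially[OF T, of "\<lambda>n. snd (u n)" t] by blast
    qed
    ultimately show "l \<in> {\<pi> \<in> paths X. domain_ext \<pi> = T}" using l by blast
  qed blast
qed

lemma gdelta_in_no_jumps:
  assumes "closed T"
  shows "gdelta_in (Metric_space.mtopology (paths X) (d_part d))
    {\<pi> \<in> paths X. \<forall>u\<in>fst \<pi>. \<forall>v\<in>fst \<pi>. snd u = snd v \<longrightarrow> snd u \<in> T \<longrightarrow> u = v}"
proof -
  interpret Q: Metric_space "paths X" "d_part d" by (rule Metric_space_d_part)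
  have eq: "{\<pi> \<in> paths X. \<forall>u\<in>fst \<pi>. \<forall>v\<in>fst \<pi>. snd u = snd v \<longrightarrow> snd u \<in> T \<longrightarrow> u = v} =
      paths X - (\<Union>n. jump_paths T (1 / real (Suc n)))" (is "?L = ?R")
  proof
    show "?L \<subseteq> ?R"
    proof
      fix \<pi> assume \<pi>: "\<pi> \<in> ?L"
      have "\<pi> \<notin> jump_paths T e" if "e > 0" for e
      proof
        assume "\<pi> \<in> jump_paths T e"
        then obtain u v where u: "u \<in> fst \<pi>" "v \<in> fst \<pi>" "snd u = snd v" "snd u \<in> T" "e \<le> d u v" unfolding jump_paths_def by blast
        then have "u = v" "u \<in> squeezed X" using \<pi> pathD(3) by blast+
        then show False using u(5) that by simp
      qed
      then show "\<pi> \<in> ?R" using \<pi> by simp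
    qed
    show "?R \<subseteq> ?L"
    proof
      fix \<pi> assume \<pi>: "\<pi> \<in> ?R"
      then have p: "\<pi> \<in> paths X" by blast
      have "u = v" if uv: "u \<in> fst \<pi>" "v \<in> fst \<pi>" "snd u = snd v" "snd u \<in> T" for u v
      proof (rule ccontr)
        assume "u \<noteq> v"
        then have "d u v > 0" using uv pathD(3)[OF p] by (simp add: subset_iff)
        then obtain n where "1 / real (Suc n) < d u v" by (rule nat_approx_posE)
        then have "\<pi> \<in> jump_paths T (1 / real (Suc n))" using p uv unfolding jump_paths_def by force
        then show False using \<pi> by blast
      qed
      then show "\<pi> \<in> ?L" using p by blast
    qed
  qed
  have "gdelta_in Q.mtopology (paths X)" using gdelta_in_topspace[of Q.mtopology] by simp
  then show ?thesis unfolding eq by (rule Q.gdelta_in_Diff_UN_closedin) (rule closedin_jump_paths[OF assms])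
qed

lemma skor_paths_iff:
  assumes "closed_pos_interval I"
  shows "\<pi> \<in> skor_paths X I \<longleftrightarrow> \<pi> \<in> paths X \<and> domain_ext \<pi> = ereal ` I \<union> {-\<infinity>, \<infinity>} \<and>
    (\<forall>u\<in>fst \<pi>. \<forall>v\<in>fst \<pi>. snd u = snd v \<longrightarrow> snd u \<in> ereal ` frontier I \<longrightarrow> u = v)"
proof (cases "\<pi> \<in> paths X \<and> domain_ext \<pi> = ereal ` I \<union> {-\<infinity>, \<infinity>}")
  case True
  have "frontier I \<subseteq> I" using assms frontier_subset_closed unfolding closed_pos_interval_def by blast
  then have "t \<in> domain_real \<pi>" if "t \<in> frontier I" for t using that True unfolding domain_real_def by auto
  then have "(\<forall>t\<in>frontier I. left_val \<pi> t = right_val \<pi> t) \<longleftrightarrow>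
      (\<forall>t\<in>frontier I. \<forall>u\<in>fst \<pi>. \<forall>v\<in>fst \<pi>. snd u = ereal t \<longrightarrow> snd v = ereal t \<longrightarrow> u = v)"
    using left_eq_right_iff True \<open>\<And>t. t \<in> frontier I \<Longrightarrow> t \<in> domain_real \<pi>\<close> by (intro ball_cong refl) auto
  also have "\<dots> \<longleftrightarrow> (\<forall>u\<in>fst \<pi>. \<forall>v\<in>fst \<pi>. snd u = snd v \<longrightarrow> snd u \<in> ereal ` frontier I \<longrightarrow> u = v)"
  proof (intro iffI ballI impI)
    fix u v
    assume *: "\<forall>t\<in>frontier I. \<forall>u\<in>fst \<pi>. \<forall>v\<in>fst \<pi>. snd u = ereal t \<longrightarrow> snd v = ereal t \<longrightarrow> u = v"
      and uv: "u \<in> fst \<pi>" "v \<in> fst \<pi>" "snd u = snd v" "snd u \<in> ereal ` frontier I"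
    obtain t where "t \<in> frontier I" "snd u = ereal t" using uv(4) by (rule imageE)
    then show "u = v" using * uv(1-3) by simp
  next
    fix t u v
    assume "\<forall>u\<in>fst \<pi>. \<forall>v\<in>fst \<pi>. snd u = snd v \<longrightarrow> snd u \<in> ereal ` frontier I \<longrightarrow> u = v"
      and "t \<in> frontier I" "u \<in> fst \<pi>" "v \<in> fst \<pi>" "snd u = ereal t" "snd v = ereal t"
    then show "u = v" by simp
  qed
  finally show ?thesis using True unfolding skor_paths_def by blast
qed (auto simp: skor_paths_def)

lemma closed_ereal_image_infty:
  assumes "closed I"
  shows "closed (ereal ` I \<union> {-\<infinity>, \<infinity>})"
  unfolding closed_sequential_limits
proof (intro allI impI)
  fix t l assume *: "(\<forall>n. t n \<in> ereal ` I \<union> {-\<infinity>, \<infinity>}) \<and> t \<longlonglongrightarrow> l"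
  show "l \<in> ereal ` I \<union> {-\<infinity>, \<infinity>}"
  proof (cases l)
    case (real s)
    have "\<forall>\<^sub>F n in sequentially. -\<infinity> < t n \<and> t n < \<infinity>"
      using * order_tendstoD(1)[of t l sequentially "-\<infinity>"] order_tendstoD(2)[of t l sequentially \<infinity>] real by (simp add: eventually_conj_iff)
    then obtain N where N: "\<And>n. n \<ge> N \<Longrightarrow> -\<infinity> < t n \<and> t n < \<infinity>" unfolding eventually_sequentially by blast
    have "\<exists>s\<in>I. t (n + N) = ereal s" for n using *[THEN conjunct1, rule_format, of "n + N"] N[of "n + N"] by auto
    then obtain q where q: "\<And>n. q n \<in> I" "\<And>n. t (n + N) = ereal (q n)" by metis
    have "(\<lambda>n. t (n + N)) \<longlonglongrightarrow> l" using * LIMSEQ_ignore_initial_segment by blast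
    then have "q \<longlonglongrightarrow> s" unfolding q(2) real by simp
    then have "s \<in> I" using closed_sequentially[OF assms] q(1) by blast
    then show ?thesis using real by blast
  qed auto
qed

lemma gdelta_in_skor_paths:
  assumes "closed_pos_interval I"
  shows "gdelta_in (Metric_space.mtopology (paths X) (d_part d)) (skor_paths X I)"
proof -
  interpret Q: Metric_space "paths X" "d_part d" by (rule Metric_space_d_part)
  have I: "closed I" using assms unfolding closed_pos_interval_def by blast
  \<comment> \<open>The infinite times are added to make the set closed in the extended reals. The
    condition is unchanged, since only one point exists at each of them.\<close>
  let ?T = "ereal ` frontier I \<union> {-\<infinity>, \<infinity>}"
  have T: "closed ?T" by (rule closed_ereal_image_infty) simp
  have T_iff: "(\<forall>u\<in>fst \<pi>. \<forall>v\<in>fst \<pi>. snd u = snd v \<longrightarrow> snd u \<in> ereal ` frontier I \<longrightarrow> u = v) \<longleftrightarrow>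
     (\<forall>u\<in>fst \<pi>. \<forall>v\<in>fst \<pi>. snd u = snd v \<longrightarrow> snd u \<in> ?T \<longrightarrow> u = v)" if \<pi>: "\<pi> \<in> paths X" for \<pi>
  proof -
    have "u = v" if "u \<in> fst \<pi>" "v \<in> fst \<pi>" "snd u = snd v" "snd u = \<infinity> \<or> snd u = -\<infinity>" for u v
      using same_infinite_time[OF subsetD[OF pathD(3)[OF \<pi>] that(1)] subsetD[OF pathD(3)[OF \<pi>] that(2)] that(3)] that(4) by auto
    then show ?thesis by blast
  qed
  have eq: "skor_paths X I = {\<pi> \<in> paths X. domain_ext \<pi> = ereal ` I \<union> {-\<infinity>, \<infinity>}} \<inter>
      {\<pi> \<in> paths X. \<forall>u\<in>fst \<pi>. \<forall>v\<in>fst \<pi>. snd u = snd v \<longrightarrow> snd u \<in> ?T \<longrightarrow> u = v}"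
    (is "_ = ?R")
  proof (rule set_eqI)
    show "\<pi> \<in> skor_paths X I \<longleftrightarrow> \<pi> \<in> ?R" for \<pi>
      using skor_paths_iff[OF assms, of \<pi>] T_iff[of \<pi>] by (cases "\<pi> \<in> paths X") simp_all
  qed
  moreover have "gdelta_in Q.mtopology {\<pi> \<in> paths X. domain_ext \<pi> = ereal ` I \<union> {-\<infinity>, \<infinity>}}"
    by (intro closed_imp_gdelta_in Q.metrizable_space_mtopology closedin_domain_paths closed_ereal_image_infty I)
  ultimately show ?thesis by (subst eq) (intro gdelta_in_Int gdelta_in_no_jumps[OF T])
qed

lemma gdelta_in_paths_c: "gdelta_in (Metric_space.mtopology (paths X) (d_part d)) (paths_c X)"
proof -
  have "paths_c X = {\<pi> \<in> paths X. \<forall>u\<in>fst \<pi>. \<forall>v\<in>fst \<pi>. snd u = snd v \<longrightarrow> snd u \<in> UNIV \<longrightarrow> u = v}"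
    using paths_c_iff by blast
  then show ?thesis using gdelta_in_no_jumps[of UNIV] by simp
qed

end

lemma Polish_space_dense_complete:
  assumes "Polish_space X"
  obtains \<rho> where "metrizes \<rho> X" "Metric_space.mcomplete (topspace X) \<rho>" "\<exists>D. Metric_space.dense_set (topspace X) \<rho> D"
proof -
  obtain M \<rho> where \<rho>: "Metric_space M \<rho>" "Metric_space.mcomplete M \<rho>" "X = Metric_space.mtopology M \<rho>"
    using assms unfolding Polish_space_def completely_metrizable_space_def by blast
  then interpret Metric_space M \<rho> by simp
  have "topspace X = M" using \<rho> by simp
  moreover have "\<exists>D. dense_set D" using assms \<rho> separable_iff_dense_set unfolding Polish_space_def by blast
  ultimately show ?thesis using that \<rho> unfolding metrizes_def by metis
qed

text \<open>Being Polish is a property of the topology. It is shown for the cone metric of a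
  complete \<open>\<rho>\<close> and then transported to \<open>d\<close> through
  \<open>d_tot\<close>, whose topology is independent of the metric; this is why the hypothesis on
  \<open>Q\<close> concerns all metrics.\<close>

lemma Polish_space_paths_gdelta:
  assumes d: "squeezed_metric X d" and X: "Polish_space X"
    and Q: "\<And>d. squeezed_metric X d \<Longrightarrow> gdelta_in (Metric_space.mtopology (paths X) (d_part d)) Q"
  shows "Polish_space (Metric_space.mtopology Q (d_tot d))" "Polish_space (Metric_space.mtopology Q (d_part d))"
proof -
  interpret A: squeezed_metric X d by fact
  obtain \<rho> D where \<rho>: "metrizes \<rho> X" "Metric_space.mcomplete (topspace X) \<rho>" "Metric_space.dense_set (topspace X) \<rho> D"
    using Polish_space_dense_complete[OF X] by metis
  interpret R: Metric_space "topspace X" \<rho> using \<rho>(1) unfolding metrizes_def by blast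
  have c: "squeezed_metric X (cone_dist \<rho>)" by (rule squeezed_metric_cone_dist[OF \<rho>(1)])
  interpret C: squeezed_metric X "cone_dist \<rho>" by (rule c)
  interpret CP: Metric_space "paths X" "d_part (cone_dist \<rho>)" by (rule C.Metric_space_d_part)
  have QP: "Q \<subseteq> paths X" using gdelta_in_subset[OF Q[OF c]] by simp
  obtain D' where D': "completely_metrizable_space CP.mtopology" "CP.dense_set D'"
    using C.completely_metrizable_dense_paths R.mcomplete_cone_dist[OF refl \<rho>(2)] R.dense_set_cone_dist[OF refl \<rho>(3)] by blast
  have "Polish_space (Metric_space.mtopology Q (d_part (cone_dist \<rho>)))"
    by (rule CP.Polish_space_subset[OF D' Q[OF c]])
  also have "Metric_space.mtopology Q (d_part (cone_dist \<rho>)) = subtopology (Metric_space.mtopology (paths X) (d_tot (cone_dist \<rho>))) Q"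
    unfolding C.mtopology_d_part_subset[OF QP] by (rule mtopology_subset[OF C.Metric_space_d_tot QP])
  also have "\<dots> = subtopology (Metric_space.mtopology (paths X) (d_tot d)) Q"
    using mtopology_d_tot_independent[OF c d] by simp
  also have "\<dots> = Metric_space.mtopology Q (d_tot d)" by (rule mtopology_subset[OF A.Metric_space_d_tot QP, symmetric])
  finally show "Polish_space (Metric_space.mtopology Q (d_tot d))" .
  then show "Polish_space (Metric_space.mtopology Q (d_part d))" unfolding A.mtopology_d_part_subset[OF QP] .
qed

section \<open>Paths as right continuous functions\<close>

text \<open>The metric \<open>\<rho>\<close> is the one that appears in Skorokhod's distances. Using
  its own cone metric on the squeezed space makes the two sides comparable by direct
  estimates.\<close>

locale skorohod = squeezed_metric X "cone_dist \<rho>" for X :: "'a topology" and \<rho> +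
  fixes I :: "real set"
  assumes rho: "metrizes \<rho> X" and I: "closed_pos_interval I"
begin

sublocale R: Metric_space "topspace X" \<rho>
  using rho unfolding metrizes_def by blast

abbreviation sqd :: "'a spoint \<Rightarrow> 'a spoint \<Rightarrow> real" where
  "sqd \<equiv> cone_dist \<rho>"

lemma I_conv: "s \<in> I \<Longrightarrow> u \<in> I \<Longrightarrow> s \<le> t \<Longrightarrow> t \<le> u \<Longrightarrow> t \<in> I"
  using I unfolding closed_pos_interval_def is_interval_1 by blast

lemma I_closed: "closed I"
  using I unfolding closed_pos_interval_def by blast

lemma frontier_I: "t \<in> frontier I \<longleftrightarrow> t \<in> I \<and> ((\<forall>s\<in>I. t \<le> s) \<or> (\<forall>s\<in>I. s \<le> t))"
proof -
  have fr: "t \<in> frontier I \<longleftrightarrow> t \<in> I \<and> t \<notin> interior I"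
    unfolding frontier_def using I_closed by simp
  have "t \<in> interior I \<longleftrightarrow> (\<exists>s\<in>I. s < t) \<and> (\<exists>u\<in>I. t < u)"
  proof
    assume "t \<in> interior I"
    then obtain e where e: "e > 0" "ball t e \<subseteq> I" using mem_interior by blast
    then have "t - e / 2 \<in> I" "t + e / 2 \<in> I" by (auto simp: subset_iff dist_real_def)
    then show "(\<exists>s\<in>I. s < t) \<and> (\<exists>u\<in>I. t < u)" using e(1) by (intro conjI bexI[of _ "t - e / 2"] bexI[of _ "t + e / 2"]) auto
  next
    assume "(\<exists>s\<in>I. s < t) \<and> (\<exists>u\<in>I. t < u)"
    then obtain s u where su: "s \<in> I" "u \<in> I" "s < t" "t < u" by blast
    then have "{s<..<u} \<subseteq> I" using I_conv[OF su(1,2)] by auto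
    then show "t \<in> interior I" using su(3,4) by (intro interiorI[of "{s<..<u}"]) auto
  qed
  then show ?thesis using fr by (auto simp: not_less)
qed

text \<open>In a regular pair \<open>(f, g)\<close>, \<open>g\<close> consists of the left limits of \<open>f\<close>, with the convention
  that \<open>g = f\<close> at the left endpoint.\<close>

definition regular :: "(real \<Rightarrow> 'a) \<Rightarrow> (real \<Rightarrow> 'a) \<Rightarrow> bool" where
  "regular f g \<longleftrightarrow> (\<forall>t\<in>I. f t \<in> topspace X \<and> g t \<in> topspace X) \<and> (\<forall>t\<in>frontier I. g t = f t) \<and>
    (\<forall>t\<in>I. \<forall>e>0. \<exists>\<delta>>0. (\<forall>s\<in>I. t < s \<and> s < t + \<delta> \<longrightarrow> \<rho> (f s) (f t) < e) \<and>
      (\<forall>s\<in>I. t - \<delta> < s \<and> s < t \<longrightarrow> \<rho> (f s) (g t) < e))"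

definition graph_pts :: "(real \<Rightarrow> 'a) \<Rightarrow> (real \<Rightarrow> 'a) \<Rightarrow> 'a spoint set" where
  "graph_pts f g = (\<lambda>t. (Some (f t), ereal t)) ` I \<union> (\<lambda>t. (Some (g t), ereal t)) ` I \<union> {(None, -\<infinity>), (None, \<infinity>)}"

definition graph_ord :: "(real \<Rightarrow> 'a) \<Rightarrow> (real \<Rightarrow> 'a) \<Rightarrow> 'a spoint rel" where
  "graph_ord f g = {(u, v). u \<in> graph_pts f g \<and> v \<in> graph_pts f g \<and>
    (snd u < snd v \<or> u = v \<or> (\<exists>t\<in>I. u = (Some (g t), ereal t) \<and> v = (Some (f t), ereal t)))}"

abbreviation graph_path :: "(real \<Rightarrow> 'a) \<Rightarrow> (real \<Rightarrow> 'a) \<Rightarrow> 'a path" where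
  "graph_path f g \<equiv> (graph_pts f g, graph_ord f g)"

lemma regularD:
  assumes "regular f g"
  shows "t \<in> I \<Longrightarrow> f t \<in> topspace X" "t \<in> I \<Longrightarrow> g t \<in> topspace X" "t \<in> frontier I \<Longrightarrow> g t = f t"
    "t \<in> I \<Longrightarrow> e > 0 \<Longrightarrow> \<exists>\<delta>>0. (\<forall>s\<in>I. t < s \<and> s < t + \<delta> \<longrightarrow> \<rho> (f s) (f t) < e) \<and>
      (\<forall>s\<in>I. t - \<delta> < s \<and> s < t \<longrightarrow> \<rho> (f s) (g t) < e)"
  using assms unfolding regular_def by blast+

text \<open>A jump cannot sit at the left end of \<open>I\<close>, so there is room for earlier
  times at which \<open>f\<close> approximates its left limit.\<close>

lemma regular_left_approx:
  assumes r: "regular f g" and s: "s \<in> I" and ne: "g s \<noteq> f s" and c: "c < s" and e: "e > 0"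
  obtains q where "q \<in> I" "c < q" "q < s" "\<rho> (f q) (g s) < e"
proof -
  have "s \<notin> frontier I" using regularD(3)[OF r] ne by blast
  then obtain p where p: "p \<in> I" "p < s" using frontier_I s by (meson not_le)
  obtain \<delta> where \<delta>: "\<delta> > 0" "\<forall>q\<in>I. s - \<delta> < q \<and> q < s \<longrightarrow> \<rho> (f q) (g s) < e" using regularD(4)[OF r s e] by blast
  define m where "m = max (max c p) (s - \<delta>)"
  have m: "m < s" "c \<le> m" "p \<le> m" "s - \<delta> \<le> m" using c p \<delta> unfolding m_def by auto
  define q where "q = (m + s) / 2"
  have q: "m < q" "q < s" using m unfolding q_def by auto
  moreover then have "q \<in> I" using I_conv[OF p(1) s] m by auto
  ultimately show ?thesis using that[of q] \<delta>(2) m by auto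
qed

text \<open>The definition of \<open>regular\<close> controls only values of \<open>f\<close> near
  \<open>t\<close>. A left limit \<open>g s\<close> is itself approximated by values of
  \<open>f\<close> on the same side of \<open>t\<close>, so it obeys the same bound with a slightly
  larger margin.\<close>

lemma regular_strong:
  assumes r: "regular f g" and t: "t \<in> I" and e: "e > 0"
  obtains \<delta> where "\<delta> > 0" "\<And>s x. s \<in> I \<Longrightarrow> t < s \<Longrightarrow> s < t + \<delta> \<Longrightarrow> x = f s \<or> x = g s \<Longrightarrow> \<rho> x (f t) < e"
    "\<And>s x. s \<in> I \<Longrightarrow> t - \<delta> < s \<Longrightarrow> s < t \<Longrightarrow> x = f s \<or> x = g s \<Longrightarrow> \<rho> x (g t) < e"
proof -
  have e2: "e / 2 > 0" using e by simp
  obtain \<delta> where \<delta>: "\<delta> > 0" "\<And>s. s \<in> I \<Longrightarrow> t < s \<Longrightarrow> s < t + \<delta> \<Longrightarrow> \<rho> (f s) (f t) < e / 2"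
    "\<And>s. s \<in> I \<Longrightarrow> t - \<delta> < s \<Longrightarrow> s < t \<Longrightarrow> \<rho> (f s) (g t) < e / 2"
    using regularD(4)[OF r t e2] by blast
  note D = regularD(1,2)[OF r]
  show ?thesis
  proof (rule that[OF \<delta>(1)])
    fix s x assume s: "s \<in> I" "t < s" "s < t + \<delta>" and x: "x = f s \<or> x = g s"
    show "\<rho> x (f t) < e"
    proof (cases "x = f s")
      case True then show ?thesis using \<delta>(2)[OF s] e by simp
    next
      case False
      then have "g s \<noteq> f s" using x by auto
      then obtain q where q: "q \<in> I" "t < q" "q < s" "\<rho> (f q) (g s) < e / 2" by (rule regular_left_approx[OF r s(1) _ s(2) e2])
      have "\<rho> (g s) (f t) \<le> \<rho> (f q) (g s) + \<rho> (f q) (f t)" using R.triangle''[of "g s" "f q" "f t"] D s q t by blast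
      then show ?thesis using \<delta>(2)[OF q(1,2)] q s x False by simp
    qed
  next
    fix s x assume s: "s \<in> I" "t - \<delta> < s" "s < t" and x: "x = f s \<or> x = g s"
    show "\<rho> x (g t) < e"
    proof (cases "x = f s")
      case True then show ?thesis using \<delta>(3)[OF s] e by simp
    next
      case False
      then have "g s \<noteq> f s" using x by auto
      then obtain q where q: "q \<in> I" "t - \<delta> < q" "q < s" "\<rho> (f q) (g s) < e / 2" by (rule regular_left_approx[OF r s(1) _ s(2) e2])
      have "\<rho> (g s) (g t) \<le> \<rho> (f q) (g s) + \<rho> (f q) (g t)" using R.triangle''[of "g s" "f q" "g t"] D s q t by blast
      then show ?thesis using \<delta>(3)[OF q(1,2)] q s x False by simp
    qed
  qed
qed

lemma graph_pts_cases:
  assumes "z \<in> graph_pts f g"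
  obtains t x where "t \<in> I" "z = (Some x, ereal t)" "x = f t \<or> x = g t" | "z = (None, -\<infinity>)" | "z = (None, \<infinity>)"
  using assms unfolding graph_pts_def by blast

lemma graph_pts_mem [simp]:
  "(Some x, ereal t) \<in> graph_pts f g \<longleftrightarrow> t \<in> I \<and> (x = f t \<or> x = g t)"
  "(None, -\<infinity>) \<in> graph_pts f g" "(None, \<infinity>) \<in> graph_pts f g"
  unfolding graph_pts_def by auto

lemma graph_pts_squeezed:
  assumes "regular f g"
  shows "graph_pts f g \<subseteq> squeezed X"
proof
  fix z assume "z \<in> graph_pts f g"
  then show "z \<in> squeezed X" by (rule graph_pts_cases) (use regularD(1,2)[OF assms] in auto)
qed

text \<open>A subsequence stays on one side of \<open>t\<close>, and the side decides which of the
  two points at time \<open>t\<close> it approaches.\<close>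

lemma graph_pts_limit:
  assumes r: "regular f g" and \<sigma>: "\<And>n. \<sigma> n \<in> graph_pts f g" and t: "t \<in> I" and lim: "(\<lambda>n. snd (\<sigma> n)) \<longlonglongrightarrow> ereal t"
  obtains r where "strict_mono (r :: nat \<Rightarrow> nat)"
    "vanishes (\<lambda>n. sqd (\<sigma> (r n)) (Some (f t), ereal t)) \<or> vanishes (\<lambda>n. sqd (\<sigma> (r n)) (Some (g t), ereal t))"
proof -
  have \<sigma>M: "\<sigma> n \<in> squeezed X" for n using \<sigma> graph_pts_squeezed[OF r] by blast
  have fM: "(Some (f t), ereal t) \<in> squeezed X" "(Some (g t), ereal t) \<in> squeezed X" using regularD(1,2)[OF r t] by auto
  \<comment> \<open>Points at time \<open>t\<close> itself are assigned by their position: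
    \<open>f t\<close> counts as right, \<open>g t\<close> as left.\<close>
  define A where "A n \<longleftrightarrow> snd (\<sigma> n) > ereal t \<or> \<sigma> n = (Some (f t), ereal t)" for n
  define B where "B n \<longleftrightarrow> snd (\<sigma> n) < ereal t \<or> \<sigma> n = (Some (g t), ereal t)" for n
  have "A n \<or> B n" for n
    by (rule graph_pts_cases[OF \<sigma>[of n]]) (auto simp: A_def B_def)
  from subseq_disj[of A B, OF this] obtain q where q: "strict_mono (q :: nat \<Rightarrow> nat)" "(\<forall>n. A (q n)) \<or> (\<forall>n. B (q n))" by blast
  have limq: "(\<lambda>n. snd (\<sigma> (q n))) \<longlonglongrightarrow> ereal t" using LIMSEQ_subseq_LIMSEQ[OF lim q(1)] by (simp add: o_def)
  have close: "\<forall>\<^sub>F n in sequentially. ereal (t - \<delta>) < snd (\<sigma> (q n)) \<and> snd (\<sigma> (q n)) < ereal (t + \<delta>)" if "\<delta> > 0" for \<delta>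
    using order_tendstoD(1)[OF limq, of "ereal (t - \<delta>)"] order_tendstoD(2)[OF limq, of "ereal (t + \<delta>)"] that by (simp add: eventually_conj_iff)
  have "vanishes (\<lambda>n. sqd (\<sigma> (q n)) (Some (f t), ereal t))" if A: "\<forall>n. A (q n)"
  proof -
    have "vanishes (\<lambda>n. \<rho> (the (fst (\<sigma> (q n)))) (f t))"
      unfolding tendsto_iff
    proof (intro allI impI)
      fix e :: real assume e: "e > 0"
      obtain \<delta> where \<delta>: "\<delta> > 0" "\<And>s x. s \<in> I \<Longrightarrow> t < s \<Longrightarrow> s < t + \<delta> \<Longrightarrow> x = f s \<or> x = g s \<Longrightarrow> \<rho> x (f t) < e"
        by (rule regular_strong[OF r t e]) blast
      show "\<forall>\<^sub>F n in sequentially. dist (\<rho> (the (fst (\<sigma> (q n)))) (f t)) 0 < e"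
        using close[OF \<delta>(1)]
      proof eventually_elim
        case (elim n)
        show ?case
          by (rule graph_pts_cases[OF \<sigma>[of "q n"]])
            (use A[rule_format, of n] elim \<delta>(2) e regularD(1)[OF r t] in \<open>auto simp: A_def\<close>)
      qed
    qed
    then show ?thesis using tendsto_iff_snd[OF rho, of "\<lambda>n. \<sigma> (q n)" "(Some (f t), ereal t)"] \<sigma>M fM limq by simp
  qed
  moreover have "vanishes (\<lambda>n. sqd (\<sigma> (q n)) (Some (g t), ereal t))" if B: "\<forall>n. B (q n)"
  proof -
    have "vanishes (\<lambda>n. \<rho> (the (fst (\<sigma> (q n)))) (g t))"
      unfolding tendsto_iff
    proof (intro allI impI)
      fix e :: real assume e: "e > 0"
      obtain \<delta> where \<delta>: "\<delta> > 0" "\<And>s x. s \<in> I \<Longrightarrow> t - \<delta> < s \<Longrightarrow> s < t \<Longrightarrow> x = f s \<or> x = g s \<Longrightarrow> \<rho> x (g t) < e"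
        by (rule regular_strong[OF r t e]) blast
      show "\<forall>\<^sub>F n in sequentially. dist (\<rho> (the (fst (\<sigma> (q n)))) (g t)) 0 < e"
        using close[OF \<delta>(1)]
      proof eventually_elim
        case (elim n)
        show ?case
          by (rule graph_pts_cases[OF \<sigma>[of "q n"]])
            (use B[rule_format, of n] elim \<delta>(2) e regularD(2)[OF r t] in \<open>auto simp: B_def\<close>)
      qed
    qed
    then show ?thesis using tendsto_iff_snd[OF rho, of "\<lambda>n. \<sigma> (q n)" "(Some (g t), ereal t)"] \<sigma>M fM limq by simp
  qed
  ultimately show ?thesis using that q by blast
qed

lemma compactin_graph_pts:
  assumes r: "regular f g"
  shows "compactin mtopology (graph_pts f g)"
proof (rule compactinI[OF graph_pts_squeezed[OF r]])
  fix \<sigma> assume \<sigma>: "\<And>n::nat. \<sigma> n \<in> graph_pts f g"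
  have \<sigma>M: "\<sigma> n \<in> squeezed X" for n using \<sigma> graph_pts_squeezed[OF r] by blast
  obtain l q where q: "strict_mono (q :: nat \<Rightarrow> nat)" "(\<lambda>n. snd (\<sigma> (q n))) \<longlonglongrightarrow> l"
  proof -
    have "seq_compact (UNIV :: ereal set)" using compact_UNIV compact_imp_seq_compact by blast
    then obtain l q where "strict_mono (q :: nat \<Rightarrow> nat)" "((\<lambda>n. snd (\<sigma> n)) \<circ> q) \<longlonglongrightarrow> l"
      unfolding seq_compact_def by (metis UNIV_I)
    then show ?thesis using that by (simp add: o_def)
  qed
  show "\<exists>r l. strict_mono (r :: nat \<Rightarrow> nat) \<and> l \<in> graph_pts f g \<and> vanishes (\<lambda>n. sqd (\<sigma> (r n)) l)"
  proof (cases "\<bar>l\<bar> = \<infinity>")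
    case True
    then have l: "(None, l) \<in> graph_pts f g" by (cases l) auto
    then have "(None, l) \<in> squeezed X" using graph_pts_squeezed[OF r] by blast
    then have "vanishes (\<lambda>n. sqd (\<sigma> (q n)) (None, l))"
      using tendsto_iff_snd[OF rho, of "\<lambda>n. \<sigma> (q n)" "(None, l)"] \<sigma>M q(2) by simp
    then show ?thesis using q(1) l by blast
  next
    case False
    then obtain t where t: "l = ereal t" by (cases l) auto
    have "snd (\<sigma> n) \<in> ereal ` I \<union> {-\<infinity>, \<infinity>}" for n by (rule graph_pts_cases[OF \<sigma>[of n]]) auto
    then have "l \<in> ereal ` I \<union> {-\<infinity>, \<infinity>}"
      using closed_sequentially[OF closed_ereal_image_infty[OF I_closed] _ q(2)] by blast
    then have tI: "t \<in> I" using t by auto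
    obtain p where p: "strict_mono (p :: nat \<Rightarrow> nat)"
      "vanishes (\<lambda>n. sqd (\<sigma> (q (p n))) (Some (f t), ereal t)) \<or> vanishes (\<lambda>n. sqd (\<sigma> (q (p n))) (Some (g t), ereal t))"
      by (rule graph_pts_limit[OF r \<sigma> tI q(2)[unfolded t]])
    have "strict_mono (q \<circ> p)" using q(1) p(1) by (rule strict_mono_o)
    moreover have "(Some (f t), ereal t) \<in> graph_pts f g" "(Some (g t), ereal t) \<in> graph_pts f g" using tI by auto
    moreover have "vanishes (\<lambda>n. sqd (\<sigma> ((q \<circ> p) n)) (Some (f t), ereal t)) \<or> vanishes (\<lambda>n. sqd (\<sigma> ((q \<circ> p) n)) (Some (g t), ereal t))"
      using p(2) by simp
    ultimately show ?thesis by blast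
  qed
qed

text \<open>Just before a jump the graph is close to the left limit, hence far from
  \<open>f t\<close>. Half of the size of the jump as radius makes the two neighbourhoods
  disjoint.\<close>

lemma graph_pts_near_right:
  assumes r: "regular f g" and t: "t \<in> I" and ne: "f t \<noteq> g t" and \<sigma>: "\<And>n. \<sigma> n \<in> graph_pts f g"
    and lim: "vanishes (\<lambda>n. sqd (\<sigma> n) (Some (f t), ereal t))"
  shows "\<forall>\<^sub>F n in sequentially. snd (\<sigma> n) > ereal t \<or> \<sigma> n = (Some (f t), ereal t)"
proof -
  have M: "\<sigma> n \<in> squeezed X" "(Some (f t), ereal t) \<in> squeezed X" for n using \<sigma> graph_pts_squeezed[OF r] t regularD(1)[OF r] by auto
  define e where "e = \<rho> (f t) (g t) / 2"
  have e: "e > 0" using ne regularD(1,2)[OF r t] unfolding e_def by simp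
  obtain \<delta> where \<delta>: "\<delta> > 0" "\<And>s x. s \<in> I \<Longrightarrow> t - \<delta> < s \<Longrightarrow> s < t \<Longrightarrow> x = f s \<or> x = g s \<Longrightarrow> \<rho> x (g t) < e"
    by (rule regular_strong[OF r t e]) blast
  have l: "(\<lambda>n. snd (\<sigma> n)) \<longlonglongrightarrow> ereal t" "vanishes (\<lambda>n. \<rho> (the (fst (\<sigma> n))) (f t))"
    using tendsto_iff_snd[OF rho, of \<sigma> "(Some (f t), ereal t)"] M lim by simp_all
  have "\<forall>\<^sub>F n in sequentially. ereal (t - \<delta>) < snd (\<sigma> n)" using order_tendstoD(1)[OF l(1), of "ereal (t - \<delta>)"] \<delta>(1) by simp
  moreover have "\<forall>\<^sub>F n in sequentially. \<rho> (the (fst (\<sigma> n))) (f t) < e" by (rule order_tendstoD(2)[OF l(2) e])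
  ultimately show ?thesis
  proof eventually_elim
    case (elim n)
    show ?case
    proof (rule graph_pts_cases[OF \<sigma>[of n]])
      fix s x assume *: "s \<in> I" "\<sigma> n = (Some x, ereal s)" "x = f s \<or> x = g s"
      have x: "x \<in> topspace X" "\<rho> x (f t) < e" using M(1)[of n] * elim by auto
      have "\<not> \<rho> x (g t) < e"
        using R.triangle''[of "f t" x "g t"] x regularD(1,2)[OF r t] unfolding e_def by auto
      then have "\<not> s < t" "s = t \<Longrightarrow> x = f t" using \<delta>(2)[OF *(1) _ _ *(3)] elim(1) * e regularD(2)[OF r t] by auto
      then show ?thesis using * by (cases "s = t") auto
    qed (use elim in auto)
  qed
qed

lemma graph_pts_near_left:
  assumes r: "regular f g" and t: "t \<in> I" and ne: "f t \<noteq> g t" and \<sigma>: "\<And>n. \<sigma> n \<in> graph_pts f g"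
    and lim: "vanishes (\<lambda>n. sqd (\<sigma> n) (Some (g t), ereal t))"
  shows "\<forall>\<^sub>F n in sequentially. snd (\<sigma> n) < ereal t \<or> \<sigma> n = (Some (g t), ereal t)"
proof -
  have M: "\<sigma> n \<in> squeezed X" "(Some (g t), ereal t) \<in> squeezed X" for n using \<sigma> graph_pts_squeezed[OF r] t regularD(2)[OF r] by auto
  define e where "e = \<rho> (f t) (g t) / 2"
  have e: "e > 0" using ne regularD(1,2)[OF r t] unfolding e_def by simp
  obtain \<delta> where \<delta>: "\<delta> > 0" "\<And>s x. s \<in> I \<Longrightarrow> t < s \<Longrightarrow> s < t + \<delta> \<Longrightarrow> x = f s \<or> x = g s \<Longrightarrow> \<rho> x (f t) < e"
    by (rule regular_strong[OF r t e]) blast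
  have l: "(\<lambda>n. snd (\<sigma> n)) \<longlonglongrightarrow> ereal t" "vanishes (\<lambda>n. \<rho> (the (fst (\<sigma> n))) (g t))"
    using tendsto_iff_snd[OF rho, of \<sigma> "(Some (g t), ereal t)"] M lim by simp_all
  have "\<forall>\<^sub>F n in sequentially. snd (\<sigma> n) < ereal (t + \<delta>)" using order_tendstoD(2)[OF l(1), of "ereal (t + \<delta>)"] \<delta>(1) by simp
  moreover have "\<forall>\<^sub>F n in sequentially. \<rho> (the (fst (\<sigma> n))) (g t) < e" by (rule order_tendstoD(2)[OF l(2) e])
  ultimately show ?thesis
  proof eventually_elim
    case (elim n)
    show ?case
    proof (rule graph_pts_cases[OF \<sigma>[of n]])
      fix s x assume *: "s \<in> I" "\<sigma> n = (Some x, ereal s)" "x = f s \<or> x = g s"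
      have x: "x \<in> topspace X" "\<rho> x (g t) < e" using M(1)[of n] * elim by auto
      have "\<not> \<rho> x (f t) < e"
        using R.triangle''[of "f t" x "g t"] x regularD(1,2)[OF r t] unfolding e_def by auto
      then have "\<not> t < s" "s = t \<Longrightarrow> x = g t" using \<delta>(2)[OF *(1) _ _ *(3)] elim(1) * e regularD(1)[OF r t] by auto
      then show ?thesis using * by (cases "s = t") auto
    qed (use elim in auto)
  qed
qed

lemma graph_ord_cases:
  assumes "u \<in> graph_pts f g" "v \<in> graph_pts f g" "snd u = snd v"
  shows "u = v \<or> (\<exists>t\<in>I. u = (Some (g t), ereal t) \<and> v = (Some (f t), ereal t)) \<or>
    (\<exists>t\<in>I. u = (Some (f t), ereal t) \<and> v = (Some (g t), ereal t))"
  by (rule graph_pts_cases[OF assms(1)]; rule graph_pts_cases[OF assms(2)]) (use assms(3) in auto)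

lemma graph_ord_iff:
  "(u, v) \<in> graph_ord f g \<longleftrightarrow> u \<in> graph_pts f g \<and> v \<in> graph_pts f g \<and>
    (snd u < snd v \<or> u = v \<or> (\<exists>t\<in>I. u = (Some (g t), ereal t) \<and> v = (Some (f t), ereal t)))"
  unfolding graph_ord_def by simp

text \<open>The critical axiom is closedness of the order. It could fail only at a jump, with
  ordered pairs converging to the value followed by the left limit; but points near the value are
  not before the jump and points near the left limit not after it.\<close>

lemma graph_path_skor:
  assumes r: "regular f g"
  shows "graph_path f g \<in> skor_paths X I"
proof -
  let ?P = "graph_pts f g" and ?R = "graph_ord f g"
  have le: "snd u \<le> snd v" if "(u, v) \<in> ?R" for u v using that unfolding graph_ord_iff by auto
  have two: "x = f t \<or> x = g t" if "(Some x, ereal t) \<in> ?P" for x t using that by simp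
  have paths: "(?P, ?R) \<in> paths X"
    unfolding paths_iff
  proof (intro conjI allI impI)
    show "?P \<noteq> {}" unfolding graph_pts_def by blast
    show "compactin mtopology ?P" by (rule compactin_graph_pts[OF r])
    show "linear_order_on ?P ?R"
    proof (rule linear_order_onI)
      show "?R \<subseteq> ?P \<times> ?P" unfolding graph_ord_def by blast
      show "(z, z) \<in> ?R" if "z \<in> ?P" for z using that unfolding graph_ord_iff by blast
      show "x = y" if "(x, y) \<in> ?R" "(y, x) \<in> ?R" for x y using that unfolding graph_ord_iff by auto
      show "(x, y) \<in> ?R \<or> (y, x) \<in> ?R" if "x \<in> ?P" "y \<in> ?P" for x y
        using graph_ord_cases[OF that] that unfolding graph_ord_iff by (metis linorder_less_linear)
      show "(x, z) \<in> ?R" if xyz: "(x, y) \<in> ?R" "(y, z) \<in> ?R" for x y z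
      proof -
        have P: "x \<in> ?P" "z \<in> ?P" using xyz unfolding graph_ord_iff by auto
        show ?thesis
        proof (cases "snd x < snd z")
          case True then show ?thesis using P unfolding graph_ord_iff by blast
        next
          case False
          then have "snd x = snd y" "snd y = snd z" using le[OF xyz(1)] le[OF xyz(2)] by auto
          then show ?thesis using xyz unfolding graph_ord_iff by auto
        qed
      qed
    qed
    show "(x, y) \<in> ?R" if \<sigma>: "\<forall>n. (\<sigma> n, \<tau> n) \<in> ?R" and xy: "x \<in> ?P" "y \<in> ?P"
      and lim: "vanishes (\<lambda>n. sqd (\<sigma> n) x)" "vanishes (\<lambda>n. sqd (\<tau> n) y)" for \<sigma> \<tau> x y
    proof -
      have P: "\<sigma> n \<in> ?P" "\<tau> n \<in> ?P" for n using \<sigma> unfolding graph_ord_iff by blast+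
      have M: "\<sigma> n \<in> squeezed X" "\<tau> n \<in> squeezed X" "x \<in> squeezed X" "y \<in> squeezed X" for n
        using P xy graph_pts_squeezed[OF r] by blast+
      have "snd x \<le> snd y"
        by (rule LIMSEQ_le[OF tendsto_snd[OF M(1,3) lim(1)] tendsto_snd[OF M(2,4) lim(2)]]) (use \<sigma> le in blast)
      then consider "snd x < snd y" | "snd x = snd y" by fastforce
      then show ?thesis
      proof cases
        case 1 then show ?thesis using xy unfolding graph_ord_iff by blast
      next
        case 2
        show ?thesis
        proof (rule ccontr)
          assume nR: "(x, y) \<notin> ?R"
          then have ne: "x \<noteq> y" "\<not> (\<exists>t\<in>I. x = (Some (g t), ereal t) \<and> y = (Some (f t), ereal t))"
            using xy unfolding graph_ord_iff by blast+
          then obtain t where t: "t \<in> I" "x = (Some (f t), ereal t)" "y = (Some (g t), ereal t)"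
            using graph_ord_cases[OF xy 2] by blast
          then have fg: "f t \<noteq> g t" using ne(1) by auto
          have "\<forall>\<^sub>F n in sequentially. (snd (\<sigma> n) > ereal t \<or> \<sigma> n = x) \<and> (snd (\<tau> n) < ereal t \<or> \<tau> n = y)"
            using graph_pts_near_right[OF r t(1) fg P(1)] graph_pts_near_left[OF r t(1) fg P(2)] lim t(2,3) by (simp add: eventually_conj_iff)
          then obtain n where n: "snd (\<sigma> n) > ereal t \<or> \<sigma> n = x" "snd (\<tau> n) < ereal t \<or> \<tau> n = y"
            unfolding eventually_sequentially by blast
          have s\<tau>: "(\<sigma> n, \<tau> n) \<in> ?R" using \<sigma> by blast
          then have "snd (\<sigma> n) \<le> snd (\<tau> n)" by (rule le)
          then have "\<sigma> n = x \<and> \<tau> n = y" using n t(2,3) by auto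
          then show False using s\<tau> nR by simp
        qed
      qed
    qed
    show "((x, s), (x', s')) \<in> ?R" if "(x, s) \<in> ?P \<and> (x', s') \<in> ?P \<and> s < s'" for x s x' s'
      using that unfolding graph_ord_iff by simp
    show "finite {x. (Some x, ereal t) \<in> ?P}" "card {x. (Some x, ereal t) \<in> ?P} \<le> 2" for t
      using finite_card_le_2[of "{x. (Some x, ereal t) \<in> ?P}"] two by blast+
  qed
  show ?thesis
    unfolding skor_paths_iff[OF I]
  proof (intro conjI paths ballI impI)
    show "domain_ext (?P, ?R) = ereal ` I \<union> {-\<infinity>, \<infinity>}"
      unfolding domain_ext_def graph_pts_def by auto
    fix u v assume uv: "u \<in> fst (?P, ?R)" "v \<in> fst (?P, ?R)" "snd u = snd v" "snd u \<in> ereal ` frontier I"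
    then obtain t where t: "t \<in> frontier I" "snd u = ereal t" by blast
    have "u = v \<or> (\<exists>s. snd u = ereal s \<and> ((u = (Some (g s), ereal s) \<and> v = (Some (f s), ereal s)) \<or> (u = (Some (f s), ereal s) \<and> v = (Some (g s), ereal s))))"
      using graph_ord_cases[of u f g v] uv by auto
    then show "u = v" using regularD(3)[OF r t(1)] t(2) by auto
  qed
qed

lemma graph_path_values:
  assumes r: "regular f g" and t: "t \<in> I"
  shows "left_val (graph_path f g) t = g t" "right_val (graph_path f g) t = f t"
proof -
  have \<pi>: "graph_path f g \<in> paths X" using graph_path_skor[OF r] unfolding skor_paths_def by blast
  have "is_values (graph_path f g) t (g t) (f t)"
    unfolding is_values_def using t by (auto simp: graph_ord_iff)
  then show "left_val (graph_path f g) t = g t" "right_val (graph_path f g) t = f t" using is_values_eq[OF \<pi>] by blast+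
qed

lemma skor_pathD:
  assumes \<pi>: "\<pi> \<in> skor_paths X I"
  shows "\<pi> \<in> paths X" "fst \<pi> = graph_pts (right_val \<pi>) (left_val \<pi>)" "snd \<pi> = graph_ord (right_val \<pi>) (left_val \<pi>)"
    "t \<in> frontier I \<Longrightarrow> left_val \<pi> t = right_val \<pi> t" "t \<in> I \<Longrightarrow> t \<in> domain_real \<pi>"
proof -
  show p: "\<pi> \<in> paths X" using \<pi> unfolding skor_paths_def by blast
  show "left_val \<pi> t = right_val \<pi> t" if "t \<in> frontier I" for t using \<pi> that unfolding skor_paths_def by blast
  have dom: "domain_ext \<pi> = ereal ` I \<union> {-\<infinity>, \<infinity>}" using \<pi> unfolding skor_paths_def by blast
  show dr: "t \<in> domain_real \<pi>" if "t \<in> I" for t using dom that unfolding domain_real_def by auto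
  show P: "fst \<pi> = graph_pts (right_val \<pi>) (left_val \<pi>)"
  proof (intro equalityI subsetI)
    fix z assume z: "z \<in> fst \<pi>"
    then have sz: "snd z \<in> ereal ` I \<union> {-\<infinity>, \<infinity>}" using domain_extI dom by blast
    have zM: "z \<in> squeezed X" using z pathD(3)[OF p] by blast
    show "z \<in> graph_pts (right_val \<pi>) (left_val \<pi>)"
    proof (rule squeezed_cases[OF zM])
      fix x t assume zt: "z = (Some x, ereal t)" "x \<in> topspace X"
      then have "t \<in> I" using sz by auto
      then show ?thesis using path_values_iff[OF p dr, of t x] z zt by auto
    qed auto
  next
    fix z assume "z \<in> graph_pts (right_val \<pi>) (left_val \<pi>)"
    then show "z \<in> fst \<pi>"
    proof (rule graph_pts_cases)
      fix t x assume "t \<in> I" "z = (Some x, ereal t)" "x = right_val \<pi> t \<or> x = left_val \<pi> t"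
      then show ?thesis using path_values_iff[OF p dr, of t x] by auto
    next
      assume "z = (None, -\<infinity>)"
      moreover have "-\<infinity> \<in> domain_ext \<pi>" using dom by simp
      ultimately show ?thesis using pathD(3)[OF p] unfolding domain_ext_def by (auto dest!: subsetD elim: squeezed_cases)
    next
      assume "z = (None, \<infinity>)"
      moreover have "\<infinity> \<in> domain_ext \<pi>" using dom by simp
      ultimately show ?thesis using pathD(3)[OF p] unfolding domain_ext_def by (auto dest!: subsetD elim: squeezed_cases)
    qed
  qed
  have lr: "((Some (left_val \<pi> t), ereal t), (Some (right_val \<pi> t), ereal t)) \<in> snd \<pi>" if "t \<in> I" for t
    using is_values_left_right[OF p dr[OF that]] unfolding is_values_def by blast
  show "snd \<pi> = graph_ord (right_val \<pi>) (left_val \<pi>)"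
  proof (intro equalityI subrelI)
    fix u v assume uv: "(u, v) \<in> snd \<pi>"
    then have P': "u \<in> graph_pts (right_val \<pi>) (left_val \<pi>)" "v \<in> graph_pts (right_val \<pi>) (left_val \<pi>)" "snd u \<le> snd v"
      using pathD(12-14)[OF p uv] P by auto
    show "(u, v) \<in> graph_ord (right_val \<pi>) (left_val \<pi>)"
    proof (cases "snd u = snd v")
      case True
      show ?thesis
        using graph_ord_cases[OF P'(1,2) True] P' lr uv pathD(8)[OF p] unfolding graph_ord_iff by metis
    next
      case False then show ?thesis using P' unfolding graph_ord_iff by (simp add: less_le)
    qed
  next
    fix u v assume "(u, v) \<in> graph_ord (right_val \<pi>) (left_val \<pi>)"
    then show "(u, v) \<in> snd \<pi>"
      using pathD(6,10)[OF p] lr P unfolding graph_ord_iff by blast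
  qed
qed

text \<open>The order decides from which side each of the two points at time \<open>t\<close> is
  approached. Points at later times come after the upper one; the order is closed, so their limits
  do too, which excludes the lower point unless both agree. Points at earlier times are treated
  dually.\<close>

lemma skor_path_regular:
  assumes \<pi>: "\<pi> \<in> skor_paths X I"
  shows "regular (right_val \<pi>) (left_val \<pi>)"
  unfolding regular_def
proof (intro conjI ballI allI impI)
  note p = skor_pathD(1)[OF \<pi>]
  let ?f = "right_val \<pi>" and ?g = "left_val \<pi>"
  have pts: "(Some (?f t), ereal t) \<in> fst \<pi>" "(Some (?g t), ereal t) \<in> fst \<pi>" if "t \<in> I" for t
    using path_values_iff[OF p skor_pathD(5)[OF \<pi> that]] by auto
  show D: "?f t \<in> topspace X" "?g t \<in> topspace X" if "t \<in> I" for t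
    using pts[OF that] pathD(3)[OF p] by auto
  show "?g t = ?f t" if "t \<in> frontier I" for t by (rule skor_pathD(4)[OF \<pi> that])
  fix t and e :: real assume t: "t \<in> I" and e: "e > 0"
  let ?F = "(Some (?f t), ereal t)" and ?G = "(Some (?g t), ereal t)"
  have FM: "?F \<in> squeezed X" "?G \<in> squeezed X" using D[OF t] by auto
  have GF: "(?G, ?F) \<in> snd \<pi>"
    using is_values_left_right[OF p skor_pathD(5)[OF \<pi> t]] unfolding is_values_def by blast
  \<comment> \<open>Compactness provides a limit point \<open>w\<close> at time \<open>t\<close> for
    any sequence of times tending to \<open>t\<close>; \<open>det\<close> is the remaining task of
    showing that \<open>w\<close> is the expected one.\<close>
  have key: False if s: "\<And>n. s n \<in> I" "\<And>n. \<bar>s n - t\<bar> < 1 / real (Suc n)" and far: "\<And>n. e \<le> \<rho> (?f (s n)) x"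
    and x: "(Some x, ereal t) \<in> fst \<pi>" and det: "\<And>w. w \<in> fst \<pi> \<Longrightarrow> snd w = ereal t \<Longrightarrow> (\<And>r. strict_mono r \<Longrightarrow>
        vanishes (\<lambda>n. sqd (Some (?f (s (r n))), ereal (s (r n))) w) \<Longrightarrow> w = (Some x, ereal t))" for s x
  proof -
    have P: "(Some (?f (s n)), ereal (s n)) \<in> fst \<pi>" for n using pts s by blast
    have M: "(Some (?f (s n)), ereal (s n)) \<in> squeezed X" for n using P pathD(3)[OF p] by blast
    obtain r w where r: "strict_mono (r :: nat \<Rightarrow> nat)" "w \<in> fst \<pi>" "vanishes (\<lambda>n. sqd (Some (?f (s (r n))), ereal (s (r n))) w)"
      by (rule compactin_subseq[OF pathD(2)[OF p] P])
    have wM: "w \<in> squeezed X" using r(2) pathD(3)[OF p] by blast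
    have "vanishes (\<lambda>n. s n - t)"
      by (rule Lim_null_comparison[OF _ LIMSEQ_Suc[OF lim_1_over_n]])
        (use s(2) in \<open>auto intro!: always_eventually less_imp_le\<close>)
    then have "s \<longlonglongrightarrow> t" by (rule LIM_zero_cancel)
    then have "(\<lambda>n. ereal (s (r n))) \<longlonglongrightarrow> ereal t" using LIMSEQ_subseq_LIMSEQ[OF _ r(1)] by (force simp: o_def)
    moreover have "(\<lambda>n. ereal (s (r n))) \<longlonglongrightarrow> snd w" using tendsto_snd[OF M wM r(3)] by simp
    ultimately have "snd w = ereal t" using LIMSEQ_unique by blast
    then have "w = (Some x, ereal t)" using det r by blast
    then have "vanishes (\<lambda>n. \<rho> (?f (s (r n))) x)"
      using tendsto_iff_snd[OF rho M wM] r(3) by simp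
    then have "\<forall>\<^sub>F n in sequentially. \<rho> (?f (s (r n))) x < e" using e by (rule order_tendstoD(2))
    then show False using far by (simp add: not_less[symmetric])
  qed
  have right: "\<exists>\<delta>>0. \<forall>s\<in>I. t < s \<and> s < t + \<delta> \<longrightarrow> \<rho> (?f s) (?f t) < e"
  proof (rule ccontr)
    assume "\<not> ?thesis"
    then have "\<exists>s\<in>I. t < s \<and> s < t + 1 / real (Suc n) \<and> e \<le> \<rho> (?f s) (?f t)" for n by (meson not_less zero_less_divide_1_iff of_nat_0_less_iff zero_less_Suc)
    then obtain s where s: "\<And>n. s n \<in> I" "\<And>n. t < s n" "\<And>n. s n < t + 1 / real (Suc n)" "\<And>n. e \<le> \<rho> (?f (s n)) (?f t)" by metis
    show False
    proof (rule key[of s "?f t"])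
      show "\<bar>s n - t\<bar> < 1 / real (Suc n)" for n using s(2,3)[of n] by simp
      fix w r assume w: "w \<in> fst \<pi>" "snd w = ereal t" and r: "strict_mono (r :: nat \<Rightarrow> nat)" "vanishes (\<lambda>n. sqd (Some (?f (s (r n))), ereal (s (r n))) w)"
      have "(?F, (Some (?f (s (r n))), ereal (s (r n)))) \<in> snd \<pi>" for n
        by (rule pathD(10)[OF p]) (use pts s t in auto)
      \<comment> \<open>\<open>w\<close> can only be \<open>?F\<close> or \<open>?G\<close>. As
        \<open>?G\<close> precedes \<open>?F\<close>, the relation obtained here leaves
        \<open>?F\<close> by antisymmetry.\<close>
      then have Fw: "(?F, w) \<in> snd \<pi>"
        by (rule path_closed[OF p _ pts(1)[OF t] w(1) _ r(2)]) (use FM in auto)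
      obtain y where y: "w = (Some y, ereal t)" using path_point_real[OF p, of "fst w" t] w by (metis prod.collapse)
      then have "w = ?F \<or> w = ?G" using path_values_iff[OF p skor_pathD(5)[OF \<pi> t], of y] w(1) by auto
      then show "w = ?F" using pathD(8)[OF p Fw] GF by auto
    qed (use s pts t in auto)
  qed
  have left: "\<exists>\<delta>>0. \<forall>s\<in>I. t - \<delta> < s \<and> s < t \<longrightarrow> \<rho> (?f s) (?g t) < e"
  proof (rule ccontr)
    assume "\<not> ?thesis"
    then have "\<exists>s\<in>I. t - 1 / real (Suc n) < s \<and> s < t \<and> e \<le> \<rho> (?f s) (?g t)" for n by (meson not_less zero_less_divide_1_iff of_nat_0_less_iff zero_less_Suc)
    then obtain s where s: "\<And>n. s n \<in> I" "\<And>n. t - 1 / real (Suc n) < s n" "\<And>n. s n < t" "\<And>n. e \<le> \<rho> (?f (s n)) (?g t)" by metis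
    show False
    proof (rule key[of s "?g t"])
      show "\<bar>s n - t\<bar> < 1 / real (Suc n)" for n using s(2,3)[of n] by simp
      fix w r assume w: "w \<in> fst \<pi>" "snd w = ereal t" and r: "strict_mono (r :: nat \<Rightarrow> nat)" "vanishes (\<lambda>n. sqd (Some (?f (s (r n))), ereal (s (r n))) w)"
      have "((Some (?f (s (r n))), ereal (s (r n))), ?G) \<in> snd \<pi>" for n
        by (rule pathD(10)[OF p]) (use pts s t in auto)
      then have Gw: "(w, ?G) \<in> snd \<pi>"
        by (rule path_closed[OF p _ w(1) pts(2)[OF t] r(2)]) (use FM in auto)
      obtain y where y: "w = (Some y, ereal t)" using path_point_real[OF p, of "fst w" t] w by (metis prod.collapse)
      then have "w = ?F \<or> w = ?G" using path_values_iff[OF p skor_pathD(5)[OF \<pi> t], of y] w(1) by auto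
      then show "w = ?G" using pathD(8)[OF p Gw] GF by auto
    qed (use s pts t in auto)
  qed
  obtain \<delta>1 where 1: "\<delta>1 > 0" "\<forall>s\<in>I. t < s \<and> s < t + \<delta>1 \<longrightarrow> \<rho> (?f s) (?f t) < e" using right by blast
  obtain \<delta>2 where 2: "\<delta>2 > 0" "\<forall>s\<in>I. t - \<delta>2 < s \<and> s < t \<longrightarrow> \<rho> (?f s) (?g t) < e" using left by blast
  show "\<exists>\<delta>>0. (\<forall>s\<in>I. t < s \<and> s < t + \<delta> \<longrightarrow> \<rho> (?f s) (?f t) < e) \<and> (\<forall>s\<in>I. t - \<delta> < s \<and> s < t \<longrightarrow> \<rho> (?f s) (?g t) < e)"
    using 1 2 by (intro exI[of _ "min \<delta>1 \<delta>2"]) auto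
qed

lemma regular_cong:
  assumes "regular f g" "\<And>t. t \<in> I \<Longrightarrow> f' t = f t" "\<And>t. t \<in> I \<Longrightarrow> g' t = g t"
  shows "regular f' g'"
  using assms frontier_I unfolding regular_def by auto

lemma graph_path_cong:
  assumes "\<And>t. t \<in> I \<Longrightarrow> f' t = f t" "\<And>t. t \<in> I \<Longrightarrow> g' t = g t"
  shows "graph_path f' g' = graph_path f g"
proof -
  have P: "graph_pts f' g' = graph_pts f g" unfolding graph_pts_def using assms by (auto simp: image_iff)
  have "graph_ord f' g' = graph_ord f g" unfolding graph_ord_def P using assms by auto
  then show ?thesis using P by simp
qed

text \<open>Away from the left end, left limits are unique; at the left end both functions equal
  \<open>f\<close> by the frontier condition.\<close>

lemma regular_left_unique:
  assumes "regular f g" "regular f g'" "t \<in> I"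
  shows "g t = g' t"
proof (cases "\<exists>p\<in>I. p < t")
  case False
  then have "t \<in> frontier I" using frontier_I assms(3) by (meson not_less)
  then show ?thesis using regularD(3)[OF assms(1)] regularD(3)[OF assms(2)] by simp
next
  case True
  then obtain p where p: "p \<in> I" "p < t" by blast
  have "\<rho> (g t) (g' t) \<le> 0 + e" if "e > 0" for e
  proof -
    have e: "e / 2 > 0" using that by simp
    obtain \<delta>1 where 1: "\<delta>1 > 0" "\<And>s. s \<in> I \<Longrightarrow> t - \<delta>1 < s \<Longrightarrow> s < t \<Longrightarrow> \<rho> (f s) (g t) < e / 2" using regularD(4)[OF assms(1,3) e] by blast
    obtain \<delta>2 where 2: "\<delta>2 > 0" "\<And>s. s \<in> I \<Longrightarrow> t - \<delta>2 < s \<Longrightarrow> s < t \<Longrightarrow> \<rho> (f s) (g' t) < e / 2" using regularD(4)[OF assms(2,3) e] by blast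
    define m where "m = max p (max (t - \<delta>1) (t - \<delta>2))"
    have m: "p \<le> m" "t - \<delta>1 \<le> m" "t - \<delta>2 \<le> m" "m < t" using p 1(1) 2(1) unfolding m_def by auto
    define s where "s = (m + t) / 2"
    have s: "m < s" "s < t" using m unfolding s_def by auto
    have sI: "s \<in> I" using I_conv[OF p(1) assms(3)] s m by auto
    show ?thesis
      using R.triangle''[of "g t" "f s" "g' t"] 1(2)[OF sI] 2(2)[OF sI] s m sI regularD(1,2)[OF assms(1)] regularD(2)[OF assms(2)] assms(3) by auto
  qed
  then have "\<rho> (g t) (g' t) \<le> 0" by (rule field_le_epsilon)
  then have "\<rho> (g t) (g' t) = 0" using R.nonneg[of "g t" "g' t"] by simp
  then show ?thesis using R.zero[OF regularD(2)[OF assms(1,3)] regularD(2)[OF assms(2,3)]] by simp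
qed

lemma limitin_right_iff:
  assumes "l \<in> topspace X" "\<forall>s\<in>I. f s \<in> topspace X"
  shows "limitin X f l (at t within (I \<inter> {t<..})) \<longleftrightarrow> (\<forall>e>0. \<exists>\<delta>>0. \<forall>s\<in>I. t < s \<and> s < t + \<delta> \<longrightarrow> \<rho> (f s) l < e)"
proof -
  have X: "X = R.mtopology" using rho unfolding metrizes_def by simp
  have "limitin X f l (at t within (I \<inter> {t<..})) \<longleftrightarrow> (\<forall>e>0. \<forall>\<^sub>F s in at t within (I \<inter> {t<..}). f s \<in> topspace X \<and> \<rho> (f s) l < e)"
    using R.limitin_metric[of f l] X assms(1) by simp
  also have "\<dots> \<longleftrightarrow> (\<forall>e>0. \<exists>\<delta>>0. \<forall>s\<in>I. t < s \<and> s < t + \<delta> \<longrightarrow> \<rho> (f s) l < e)"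
  proof -
    have "(\<forall>s\<in>I \<inter> {t<..}. s \<noteq> t \<and> dist s t < \<delta> \<longrightarrow> f s \<in> topspace X \<and> \<rho> (f s) l < e) \<longleftrightarrow>
        (\<forall>s\<in>I. t < s \<and> s < t + \<delta> \<longrightarrow> \<rho> (f s) l < e)" for \<delta> e
      using assms(2) by (auto simp: dist_real_def)
    then show ?thesis unfolding eventually_at by simp
  qed
  finally show ?thesis .
qed

lemma limitin_left_iff:
  assumes "l \<in> topspace X" "\<forall>s\<in>I. f s \<in> topspace X"
  shows "limitin X f l (at t within (I \<inter> {..<t})) \<longleftrightarrow> (\<forall>e>0. \<exists>\<delta>>0. \<forall>s\<in>I. t - \<delta> < s \<and> s < t \<longrightarrow> \<rho> (f s) l < e)"
proof -
  have X: "X = R.mtopology" using rho unfolding metrizes_def by simp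
  have "limitin X f l (at t within (I \<inter> {..<t})) \<longleftrightarrow> (\<forall>e>0. \<forall>\<^sub>F s in at t within (I \<inter> {..<t}). f s \<in> topspace X \<and> \<rho> (f s) l < e)"
    using R.limitin_metric[of f l] X assms(1) by simp
  also have "\<dots> \<longleftrightarrow> (\<forall>e>0. \<exists>\<delta>>0. \<forall>s\<in>I. t - \<delta> < s \<and> s < t \<longrightarrow> \<rho> (f s) l < e)"
  proof -
    have "(\<forall>s\<in>I \<inter> {..<t}. s \<noteq> t \<and> dist s t < \<delta> \<longrightarrow> f s \<in> topspace X \<and> \<rho> (f s) l < e) \<longleftrightarrow>
        (\<forall>s\<in>I. t - \<delta> < s \<and> s < t \<longrightarrow> \<rho> (f s) l < e)" for \<delta> e
      using assms(2) by (auto simp: dist_real_def)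
    then show ?thesis unfolding eventually_at by simp
  qed
  finally show ?thesis .
qed

lemma cadlag_iff_regular: "f \<in> cadlag X I \<longleftrightarrow> f \<in> extensional I \<and> (\<exists>g. regular f g)"
proof
  assume f: "f \<in> cadlag X I"
  then have fD: "\<And>s. s \<in> I \<Longrightarrow> f s \<in> topspace X" and ext: "f \<in> extensional I"
    and right: "\<And>t. t \<in> I \<Longrightarrow> limitin X f (f t) (at t within (I \<inter> {t<..}))"
    and left: "\<And>t. t \<in> I \<Longrightarrow> \<exists>s\<in>I. s < t \<Longrightarrow> \<exists>l. limitin X f l (at t within (I \<inter> {..<t}))"
    and last: "\<And>r. r \<in> I \<Longrightarrow> \<forall>t\<in>I. t \<le> r \<Longrightarrow> limitin X f (f r) (at r within (I \<inter> {..<r}))"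
    unfolding cadlag_def by (auto simp: PiE_def Pi_def)
  have fD': "\<forall>s\<in>I. f s \<in> topspace X" using fD by blast
  \<comment> \<open>On the frontier the value \<open>f t\<close> is prescribed: at the left end
    there are no earlier times to check, and at the right end the last clause of
    \<open>cadlag\<close> applies.\<close>
  have "\<exists>l. l \<in> topspace X \<and> (t \<in> frontier I \<longrightarrow> l = f t) \<and> (\<forall>e>0. \<exists>\<delta>>0. \<forall>s\<in>I. t - \<delta> < s \<and> s < t \<longrightarrow> \<rho> (f s) l < e)" if t: "t \<in> I" for t
  proof (cases "t \<in> frontier I")
    case True
    then consider "\<forall>s\<in>I. t \<le> s" | "\<forall>s\<in>I. s \<le> t" using frontier_I by blast
    then have "\<forall>e>0. \<exists>\<delta>>0. \<forall>s\<in>I. t - \<delta> < s \<and> s < t \<longrightarrow> \<rho> (f s) (f t) < e"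
    proof cases
      case 1
      show ?thesis
      proof (intro allI impI)
        fix e :: real
        have "\<forall>s\<in>I. t - 1 < s \<and> s < t \<longrightarrow> \<rho> (f s) (f t) < e" using 1 by force
        then show "\<exists>\<delta>>0. \<forall>s\<in>I. t - \<delta> < s \<and> s < t \<longrightarrow> \<rho> (f s) (f t) < e" by (intro exI[of _ 1]) simp
      qed
    next
      case 2 show ?thesis using last[OF t 2] unfolding limitin_left_iff[OF fD[OF t] fD'] .
    qed
    then show ?thesis using fD[OF t] by blast
  next
    case False
    then have "\<exists>s\<in>I. s < t" using frontier_I t by (meson not_less)
    then obtain l where l: "limitin X f l (at t within (I \<inter> {..<t}))" using left[OF t] by blast
    then have "l \<in> topspace X" by (rule limitin_topspace)
    then show ?thesis using l limitin_left_iff[OF _ fD'] False by blast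
  qed
  then obtain g where g: "\<And>t. t \<in> I \<Longrightarrow> g t \<in> topspace X \<and> (t \<in> frontier I \<longrightarrow> g t = f t) \<and> (\<forall>e>0. \<exists>\<delta>>0. \<forall>s\<in>I. t - \<delta> < s \<and> s < t \<longrightarrow> \<rho> (f s) (g t) < e)"
    by metis
  have "regular f g"
    unfolding regular_def
  proof (intro conjI ballI allI impI)
    show "f t \<in> topspace X" "g t \<in> topspace X" if "t \<in> I" for t using fD g that by auto
    show "g t = f t" if "t \<in> frontier I" for t using g frontier_I that by blast
    fix t and e :: real assume t: "t \<in> I" "e > 0"
    obtain \<delta>1 where 1: "\<delta>1 > 0" "\<forall>s\<in>I. t < s \<and> s < t + \<delta>1 \<longrightarrow> \<rho> (f s) (f t) < e"
      using right[OF t(1)] limitin_right_iff[OF fD[OF t(1)] fD'] t(2) by blast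
    obtain \<delta>2 where 2: "\<delta>2 > 0" "\<forall>s\<in>I. t - \<delta>2 < s \<and> s < t \<longrightarrow> \<rho> (f s) (g t) < e" using g[OF t(1)] t(2) by blast
    show "\<exists>\<delta>>0. (\<forall>s\<in>I. t < s \<and> s < t + \<delta> \<longrightarrow> \<rho> (f s) (f t) < e) \<and> (\<forall>s\<in>I. t - \<delta> < s \<and> s < t \<longrightarrow> \<rho> (f s) (g t) < e)"
      using 1 2 by (intro exI[of _ "min \<delta>1 \<delta>2"]) auto
  qed
  then show "f \<in> extensional I \<and> (\<exists>g. regular f g)" using ext by blast
next
  assume "f \<in> extensional I \<and> (\<exists>g. regular f g)"
  then obtain g where r: "regular f g" and ext: "f \<in> extensional I" by blast
  note D = regularD(1,2)[OF r]
  have D': "\<forall>s\<in>I. f s \<in> topspace X" using D by blast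
  have left: "limitin X f (g t) (at t within (I \<inter> {..<t}))" if "t \<in> I" for t
    using limitin_left_iff[OF D(2)[OF that] D'] regularD(4)[OF r that] by blast
  show "f \<in> cadlag X I"
    unfolding cadlag_def mem_Collect_eq
  proof (intro conjI ballI impI)
    show "f \<in> I \<rightarrow>\<^sub>E topspace X" using ext D by (auto simp: PiE_def)
    show "limitin X f (f t) (at t within (I \<inter> {t<..}))" if "t \<in> I" for t
      using limitin_right_iff[OF D(1)[OF that] D'] regularD(4)[OF r that] by blast
    show "\<exists>l. limitin X f l (at t within (I \<inter> {..<t}))" if "t \<in> I" for t using left[OF that] by blast
    show "limitin X f (f t) (at t within (I \<inter> {..<t}))" if "t \<in> I" "\<forall>s\<in>I. s \<le> t" for t
      using left[OF that(1)] regularD(3)[OF r] frontier_I that by force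
  qed
qed

lemma path_fun_graph_path:
  assumes "regular f g"
  shows "path_fun I (graph_path f g) = restrict f I"
  unfolding path_fun_def using graph_path_values[OF assms] by (auto simp: restrict_def)

lemma skor_path_eq_graph_path:
  assumes \<pi>: "\<pi> \<in> skor_paths X I" and r: "regular (path_fun I \<pi>) g"
  shows "\<pi> = graph_path (path_fun I \<pi>) g"
proof -
  have f: "path_fun I \<pi> t = right_val \<pi> t" if "t \<in> I" for t using that unfolding path_fun_def by simp
  have "regular (path_fun I \<pi>) (left_val \<pi>)" using regular_cong[OF skor_path_regular[OF \<pi>]] f by blast
  then have "g t = left_val \<pi> t" if "t \<in> I" for t using regular_left_unique[OF r] that by blast
  then have "graph_path (path_fun I \<pi>) g = graph_path (right_val \<pi>) (left_val \<pi>)" using f by (intro graph_path_cong)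
  then show ?thesis using skor_pathD(2,3)[OF \<pi>] by (metis prod.collapse)
qed

lemma bij_betw_path_fun: "bij_betw (path_fun I) (skor_paths X I) (cadlag X I)"
proof -
  have reg: "path_fun I \<pi> \<in> cadlag X I" if "\<pi> \<in> skor_paths X I" for \<pi>
  proof -
    have "regular (path_fun I \<pi>) (left_val \<pi>)"
      using regular_cong[OF skor_path_regular[OF that]] unfolding path_fun_def by auto
    then show ?thesis unfolding cadlag_iff_regular by (auto simp: path_fun_def)
  qed
  show ?thesis
    unfolding bij_betw_def
  proof (intro conjI inj_onI equalityI subsetI)
    fix \<pi>1 \<pi>2 assume *: "\<pi>1 \<in> skor_paths X I" "\<pi>2 \<in> skor_paths X I" "path_fun I \<pi>1 = path_fun I \<pi>2"
    obtain g where "regular (path_fun I \<pi>1) g" using reg[OF *(1)] unfolding cadlag_iff_regular by blast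
    then show "\<pi>1 = \<pi>2" using skor_path_eq_graph_path[OF *(1)] skor_path_eq_graph_path[OF *(2)] *(3) by metis
  next
    fix f assume "f \<in> cadlag X I"
    then obtain g where g: "regular f g" "f \<in> extensional I" unfolding cadlag_iff_regular by blast
    then have "path_fun I (graph_path f g) = f" using path_fun_graph_path by (simp add: extensional_restrict)
    then show "f \<in> path_fun I ` skor_paths X I" using graph_path_skor[OF g(1)] by (metis image_eqI)
  qed (use reg in auto)
qed

text \<open>The points at time \<open>t\<close> determine the two values only up to order. But all
  points shortly before \<open>t\<close>, to whichever function they are attributed, approach the
  left limit; so the left limits of both paths agree, and with them the right ones.\<close>

lemma skor_paths_inject:
  assumes \<pi>: "\<pi>1 \<in> skor_paths X I" "\<pi>2 \<in> skor_paths X I" "fst \<pi>1 = fst \<pi>2"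
  shows "\<pi>1 = \<pi>2"
proof -
  note r = skor_path_regular[OF \<pi>(1)] skor_path_regular[OF \<pi>(2)]
  let ?f = "right_val \<pi>1" and ?g = "left_val \<pi>1" and ?f' = "right_val \<pi>2" and ?g' = "left_val \<pi>2"
  have eq: "graph_pts ?f ?g = graph_pts ?f' ?g'" using skor_pathD(2)[OF \<pi>(1)] skor_pathD(2)[OF \<pi>(2)] \<pi>(3) by simp
  have val: "x = ?f t \<or> x = ?g t \<longleftrightarrow> x = ?f' t \<or> x = ?g' t" if "t \<in> I" for x t
    using eq that graph_pts_mem(1)[of x t] by metis
  have fr: "?f t = ?f' t" "?g t = ?g' t" if "t \<in> frontier I" for t
    using val[of t "?f t"] val[of t "?g t"] regularD(3)[OF r(1) that] regularD(3)[OF r(2) that] that frontier_I by auto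
  have gg: "?g t = ?g' t" if t: "t \<in> I" for t
  proof (rule regular_left_unique[of ?f ?g])
    show "regular ?f ?g" by (rule r(1))
    show "regular ?f ?g'"
      unfolding regular_def
    proof (intro conjI ballI allI impI)
      show "?f t \<in> topspace X" "?g' t \<in> topspace X" if "t \<in> I" for t using that regularD(1)[OF r(1)] regularD(2)[OF r(2)] by auto
      show "?g' t = ?f t" if "t \<in> frontier I" for t using fr[OF that] regularD(3)[OF r(1) that] by simp
      fix t and e :: real assume t: "t \<in> I" "e > 0"
      obtain \<delta>1 where 1: "\<delta>1 > 0" "\<forall>s\<in>I. t < s \<and> s < t + \<delta>1 \<longrightarrow> \<rho> (?f s) (?f t) < e" using regularD(4)[OF r(1) t] by blast
      obtain \<delta>2 where 2: "\<delta>2 > 0" "\<And>s x. s \<in> I \<Longrightarrow> t - \<delta>2 < s \<Longrightarrow> s < t \<Longrightarrow> x = ?f' s \<or> x = ?g' s \<Longrightarrow> \<rho> x (?g' t) < e"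
        by (rule regular_strong[OF r(2) t]) blast
      show "\<exists>\<delta>>0. (\<forall>s\<in>I. t < s \<and> s < t + \<delta> \<longrightarrow> \<rho> (?f s) (?f t) < e) \<and> (\<forall>s\<in>I. t - \<delta> < s \<and> s < t \<longrightarrow> \<rho> (?f s) (?g' t) < e)"
      proof (intro exI[of _ "min \<delta>1 \<delta>2"] conjI ballI impI)
        show "\<rho> (?f s) (?g' t) < e" if "s \<in> I" "t - min \<delta>1 \<delta>2 < s \<and> s < t" for s
          using 2(2)[of s "?f s"] val[OF that(1), of "?f s"] that by auto
      qed (use 1 2 in auto)
    qed
  qed (rule t)
  have "?f t = ?f' t" if t: "t \<in> I" for t using gg[OF t] val[OF t] by metis
  then have "graph_path ?f' ?g' = graph_path ?f ?g" using gg by (intro graph_path_cong) auto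
  then show ?thesis using skor_pathD(2,3)[OF \<pi>(1)] skor_pathD(2,3)[OF \<pi>(2)] by (simp add: prod_eq_iff)
qed

end

section \<open>Comparison with Skorokhod's topologies\<close>

text \<open>The reverse of \<open>squeeze_lipschitz\<close>, with a factor that is bounded below on
  bounded sets of times.\<close>

lemma squeeze_diff_ge:
  assumes "s \<le> t"
  shows "(t - s) / ((1 + \<bar>s\<bar>) * (1 + \<bar>t\<bar>)) \<le> squeeze (ereal t) - squeeze (ereal s)"
proof -
  have pos: "0 < 1 + \<bar>t\<bar>" "0 < 1 + \<bar>s\<bar>" by linarith+
  then have "squeeze (ereal t) - squeeze (ereal s) = (t * (1 + \<bar>s\<bar>) - s * (1 + \<bar>t\<bar>)) / ((1 + \<bar>s\<bar>) * (1 + \<bar>t\<bar>))"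
    by (simp add: diff_frac_eq mult.commute)
  moreover have "s * \<bar>t\<bar> \<le> t * \<bar>s\<bar>"
    using assms by (cases "s \<ge> 0"; cases "t \<ge> 0") (auto simp: mult_nonpos_nonneg mult_nonneg_nonpos)
  then have "t - s \<le> t * (1 + \<bar>s\<bar>) - s * (1 + \<bar>t\<bar>)" by (simp add: algebra_simps)
  ultimately show ?thesis using pos by (simp add: divide_right_mono)
qed

lemma one_minus_abs_squeeze: "1 - \<bar>squeeze (ereal t)\<bar> = 1 / (1 + \<bar>t\<bar>)"
proof -
  have "0 < 1 + \<bar>t\<bar>" by linarith
  then show ?thesis by (simp add: abs_divide field_simps)
qed

lemma step_sequence_mono:
  fixes t :: "nat \<Rightarrow> real"
  assumes "\<And>i. i < k \<Longrightarrow> t i < t (Suc i)" "i \<le> j" "j \<le> k"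
  shows "t i \<le> t j"
  using assms(2,3)
proof (induction j rule: dec_induct)
  case (step n) then show ?case using assms(1)[of n] by simp
qed simp

text \<open>Affine interpolation, one piece being appended in each step. The cells are half-open to
  match the partitions used below.\<close>

lemma piecewise_bijection:
  fixes s t :: "nat \<Rightarrow> real"
  assumes "\<And>i. i < k \<Longrightarrow> s i < s (Suc i)" "\<And>i. i < k \<Longrightarrow> t i < t (Suc i)"
  shows "\<exists>h. strict_mono_on {s 0..s k} h \<and> h ` {s 0..s k} = {t 0..t k} \<and> h (s k) = t k \<and>
    (\<forall>i<k. \<forall>x. s i \<le> x \<and> x < s (Suc i) \<longrightarrow> t i \<le> h x \<and> h x < t (Suc i))"
  using assms
proof (induction k)
  case 0
  show ?case by (intro exI[of _ "\<lambda>_. t 0"]) (simp add: strict_mono_on_def)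
next
  case (Suc k)
  then obtain h where h: "strict_mono_on {s 0..s k} h" "h ` {s 0..s k} = {t 0..t k}" "h (s k) = t k"
    "\<forall>i<k. \<forall>x. s i \<le> x \<and> x < s (Suc i) \<longrightarrow> t i \<le> h x \<and> h x < t (Suc i)" by auto
  have mono: "u 0 \<le> u j" if "j \<le> k" "\<And>i. i < Suc k \<Longrightarrow> u i < u (Suc i)" for u :: "nat \<Rightarrow> real" and j
    using step_sequence_mono[of j u 0 j] that by simp
  have s0: "s 0 \<le> s k" "t 0 \<le> t k" "s k < s (Suc k)" "t k < t (Suc k)" using mono[of k s] mono[of k t] Suc.prems by auto
  define m where "m = (t (Suc k) - t k) / (s (Suc k) - s k)"
  have m: "m > 0" "m * (s (Suc k) - s k) = t (Suc k) - t k" using s0 unfolding m_def by auto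
  define l where "l x = t k + m * (x - s k)" for x
  have l: "l (s k) = t k" "l (s (Suc k)) = t (Suc k)" unfolding l_def using m by auto
  have lmono: "l x < l y \<longleftrightarrow> x < y" for x y unfolding l_def using m(1) by simp
  have lle: "l x \<le> l y \<longleftrightarrow> x \<le> y" for x y unfolding l_def using m(1) by simp
  define h' where "h' x = (if x < s k then h x else l x)" for x
  have hlt: "h x < t k" if "s 0 \<le> x" "x < s k" for x
    using strict_mono_onD[OF h(1), of x "s k"] that s0 h(3) by auto
  have hk: "h x = h' x" if "s 0 \<le> x" "x \<le> s k" for x using that h(3) l(1) unfolding h'_def by (cases "x = s k") auto
  show ?case
  proof (intro exI[of _ h'] conjI allI impI)
    show "strict_mono_on {s 0..s (Suc k)} h'"
    proof (rule strict_mono_onI)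
      fix x y assume xy: "x \<in> {s 0..s (Suc k)}" "y \<in> {s 0..s (Suc k)}" "x < y"
      show "h' x < h' y"
      proof (cases "y \<le> s k")
        case True
        then have "h x < h y" using strict_mono_onD[OF h(1), of x y] xy by auto
        then show ?thesis using hk[of x] hk[of y] xy True by auto
      next
        case False
        show ?thesis
        proof (cases "x < s k")
          case True
          have "h x < t k" using hlt xy True by auto
          moreover have "t k < l y" using lmono[of "s k" y] l False by simp
          ultimately show ?thesis using True False unfolding h'_def by simp
        next
          case x: False then show ?thesis using False lmono xy unfolding h'_def by simp
        qed
      qed
    qed
    have "h' ` {s 0..s (Suc k)} = h' ` {s 0..s k} \<union> h' ` {s k..s (Suc k)}"
      using s0 by (metis image_Un ivl_disj_un_two_touch(4) less_imp_le)
    also have "h' ` {s 0..s k} = {t 0..t k}"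
    proof -
      have "h' ` {s 0..s k} = h ` {s 0..s k}" using hk by (intro image_cong) auto
      then show ?thesis using h(2) by simp
    qed
    also have "h' ` {s k..s (Suc k)} = {t k..t (Suc k)}"
    proof -
      have "h' ` {s k..s (Suc k)} = l ` {s k..s (Suc k)}" by (intro image_cong) (auto simp: h'_def)
      also have "\<dots> = {t k..t (Suc k)}"
      proof (intro equalityI subsetI)
        fix y assume "y \<in> l ` {s k..s (Suc k)}"
        then obtain x where "y = l x" "s k \<le> x" "x \<le> s (Suc k)" by auto
        then show "y \<in> {t k..t (Suc k)}" using lle[of "s k" x] lle[of x "s (Suc k)"] l by auto
      next
        fix y assume y: "y \<in> {t k..t (Suc k)}"
        have ly: "y = l (s k + (y - t k) / m)" unfolding l_def using m(1) by simp
        then have "s k \<le> s k + (y - t k) / m" "s k + (y - t k) / m \<le> s (Suc k)"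
          using lle[of "s k" "s k + (y - t k) / m"] lle[of "s k + (y - t k) / m" "s (Suc k)"] l y by auto
        then show "y \<in> l ` {s k..s (Suc k)}" using ly by auto
      qed
      finally show ?thesis .
    qed
    also have "{t 0..t k} \<union> {t k..t (Suc k)} = {t 0..t (Suc k)}" using s0 by auto
    finally show "h' ` {s 0..s (Suc k)} = {t 0..t (Suc k)}" .
    show "h' (s (Suc k)) = t (Suc k)" using s0 l unfolding h'_def by simp
    fix i x assume i: "i < Suc k" and x: "s i \<le> x \<and> x < s (Suc i)"
    have "t i \<le> h' x \<and> h' x < t (Suc i)"
    proof (cases "i = k")
      case True
      then show ?thesis using x lle[of "s k" x] lmono[of x "s (Suc k)"] l unfolding h'_def by auto
    next
      case False
      then have ik: "i < k" using i by simp
      have "s (Suc j) \<le> s k" if "j < k" for j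
        using step_sequence_mono[of k s "Suc j" k] Suc.prems(1) that by simp
      then have "x < s k" using x ik by fastforce
      then show ?thesis using h(4) ik x unfolding h'_def by auto
    qed
    then show "t i \<le> h' x" "h' x < t (Suc i)" by auto
  qed
qed

lemma step_sequence_find:
  fixes t :: "nat \<Rightarrow> real"
  assumes "t 0 \<le> s" "s < t k"
  shows "\<exists>i<k. t i \<le> s \<and> s < t (Suc i)"
  using assms
proof (induction k)
  case (Suc k)
  show ?case
  proof (cases "s < t k")
    case True then show ?thesis using Suc by (meson less_SucI)
  next
    case False then show ?thesis using Suc by (intro exI[of _ k]) auto
  qed
qed simp

text \<open>The Schroeder--Bernstein construction.\<close>

lemma bernstein_local:
  assumes "inj_on p J" "p ` J \<subseteq> J" "inj_on q J" "q ` J \<subseteq> J"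
  shows "\<exists>h. bij_betw h J J \<and> (\<forall>s\<in>J. h s = p s \<or> s = q (h s))"
proof -
  define F where "F S = J - q ` (J - p ` S)" for S
  have "mono F" unfolding F_def mono_def by blast
  define S where "S = lfp F"
  have S: "S = J - q ` (J - p ` S)" using lfp_unfold[OF \<open>mono F\<close>] unfolding S_def[symmetric] F_def .
  then have SJ: "S \<subseteq> J" by blast
  have qS: "q ` (J - p ` S) = J - S" using S assms(4) by blast
  define h where "h s = (if s \<in> S then p s else inv_into (J - p ` S) q s)" for s
  have qi: "inj_on q (J - p ` S)" using assms(3) by (rule inj_on_subset) blast
  have b1: "bij_betw h S (p ` S)"
  proof -
    have "bij_betw p S (p ` S)" using assms(1) SJ by (meson bij_betw_imageI inj_on_subset)
    then show ?thesis by (rule bij_betw_cong[THEN iffD1, rotated]) (simp add: h_def)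
  qed
  have b2: "bij_betw h (J - S) (J - p ` S)"
  proof -
    have "bij_betw q (J - p ` S) (J - S)" using qi qS by (simp add: bij_betw_def)
    then have "bij_betw (inv_into (J - p ` S) q) (J - S) (J - p ` S)" by (rule bij_betw_inv_into)
    then show ?thesis by (rule bij_betw_cong[THEN iffD1, rotated]) (simp add: h_def)
  qed
  have "bij_betw h (S \<union> (J - S)) (p ` S \<union> (J - p ` S))" by (rule bij_betw_combine[OF b1 b2]) blast
  moreover have "S \<union> (J - S) = J" "p ` S \<union> (J - p ` S) = J" using SJ assms(2) by auto
  ultimately have "bij_betw h J J" by simp
  moreover have "h s = p s \<or> s = q (h s)" if "s \<in> J" for s
    using that qS unfolding h_def by (auto simp: f_inv_into_f)
  ultimately show ?thesis by blast
qed

lemma skor_dist_le: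
  assumes "l \<in> \<Lambda> J" "\<And>s. s \<in> J \<Longrightarrow> d (f s) (h (l s)) \<le> e" "\<And>s. s \<in> J \<Longrightarrow> \<bar>s - l s\<bar> \<le> e" "0 \<le> e"
  shows "skor_dist \<Lambda> d J f h \<le> e"
proof -
  have "(INF l\<in>\<Lambda> J. SUP s\<in>J. ennreal (max (d (f s) (h (l s))) \<bar>s - l s\<bar>)) \<le> (SUP s\<in>J. ennreal (max (d (f s) (h (l s))) \<bar>s - l s\<bar>))"
    using assms(1) by (rule INF_lower)
  also have "\<dots> \<le> ennreal e" using assms(2,3) by (auto intro!: SUP_least ennreal_leI)
  finally show ?thesis unfolding skor_dist_def using assms(4) by (simp add: enn2real_leI)
qed

text \<open>The time change \<open>l0\<close> with bounded displacements keeps the infimum finite,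
  as required by \<open>enn2real\<close>.\<close>

lemma skor_dist_lessD:
  assumes "l0 \<in> \<Lambda> J" "\<And>s. s \<in> J \<Longrightarrow> d (f s) (h (l0 s)) \<le> B" "\<And>s. s \<in> J \<Longrightarrow> \<bar>s - l0 s\<bar> \<le> B" "skor_dist \<Lambda> d J f h < e"
  shows "\<exists>l\<in>\<Lambda> J. \<forall>s\<in>J. d (f s) (h (l s)) < e \<and> \<bar>s - l s\<bar> < e"
proof -
  let ?I = "INF l\<in>\<Lambda> J. SUP s\<in>J. ennreal (max (d (f s) (h (l s))) \<bar>s - l s\<bar>)"
  have "?I \<le> (SUP s\<in>J. ennreal (max (d (f s) (h (l0 s))) \<bar>s - l0 s\<bar>))"
    using assms(1) by (rule INF_lower)
  also have "\<dots> \<le> ennreal B" using assms(2,3) by (auto intro!: SUP_least ennreal_leI)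
  finally have fin: "?I < top" by (simp add: order_le_less_trans)
  have e: "0 < e" using assms(4) unfolding skor_dist_def by (rule order_le_less_trans[OF enn2real_nonneg])
  have "?I = ennreal (enn2real ?I)" by (rule ennreal_enn2real[OF fin, symmetric])
  also have "\<dots> < ennreal e" by (rule ennreal_lessI[OF e assms(4)[unfolded skor_dist_def]])
  finally have "?I < ennreal e" .
  then obtain l where l: "l \<in> \<Lambda> J" "(SUP s\<in>J. ennreal (max (d (f s) (h (l s))) \<bar>s - l s\<bar>)) < ennreal e" by (auto simp: INF_less_iff)
  have "d (f s) (h (l s)) < e \<and> \<bar>s - l s\<bar> < e" if "s \<in> J" for s
  proof -
    have "ennreal (max (d (f s) (h (l s))) \<bar>s - l s\<bar>) \<le> (SUP s\<in>J. ennreal (max (d (f s) (h (l s))) \<bar>s - l s\<bar>))"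
      using that by (rule SUP_upper)
    then have "ennreal (max (d (f s) (h (l s))) \<bar>s - l s\<bar>) < ennreal e" using l by order
    then have "max (d (f s) (h (l s))) \<bar>s - l s\<bar> < e" using e by (meson ennreal_leI not_le)
    then show ?thesis by simp
  qed
  then show ?thesis using l by blast
qed

context skorohod
begin

section \<open>Estimates for the cone metric\<close>

lemma sqd_real_le:
  "sqd (Some x, ereal s) (Some y, ereal t) \<le> \<bar>s - t\<bar> + \<rho> x y"
proof -
  have "sqd (Some x, ereal s) (Some y, ereal t) \<le> \<bar>s - t\<bar> + 1 * \<rho> x y"
    unfolding cone_dist_def snd_conv fst_conv option.sel
    by (intro add_mono mult_mono squeeze_lipschitz) (auto simp del: squeeze.simps simp: min_le_iff_disj)
  then show ?thesis by simp
qed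

text \<open>After time \<open>b\<close> the difference of the squeezed times and the cone factor are
  both at most \<open>1 - squeeze b\<close>, whatever the positions in \<open>X\<close>.\<close>

lemma sqd_le_right:
  assumes "ereal b \<le> snd z" "ereal b \<le> snd w"
  shows "sqd z w \<le> 2 * (1 - squeeze (ereal b))"
proof -
  have b: "squeeze (ereal b) \<le> squeeze (snd z)" "squeeze (ereal b) \<le> squeeze (snd w)" by (simp_all only: squeeze_le_iff assms)
  have le1: "squeeze (snd z) \<le> 1" "squeeze (snd w) \<le> 1" using abs_squeeze_le by (simp_all add: abs_le_iff)
  let ?m = "min (1 - \<bar>squeeze (snd z)\<bar>) (1 - \<bar>squeeze (snd w)\<bar>)"
  have "?m * min 1 (\<rho> (the (fst z)) (the (fst w))) \<le> ?m * 1"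
    using abs_squeeze_le[of "snd z"] abs_squeeze_le[of "snd w"] by (intro mult_left_mono) auto
  also have "\<dots> \<le> 1 - squeeze (snd z)" by (auto simp: min_def)
  finally show ?thesis using b le1 unfolding cone_dist_def by (auto simp: abs_if simp del: squeeze.simps)
qed

lemma sqd_le_left:
  assumes "snd z \<le> ereal a" "snd w \<le> ereal a"
  shows "sqd z w \<le> 2 * (1 + squeeze (ereal a))"
proof -
  have b: "squeeze (snd z) \<le> squeeze (ereal a)" "squeeze (snd w) \<le> squeeze (ereal a)" by (simp_all only: squeeze_le_iff assms)
  have le1: "-1 \<le> squeeze (snd z)" "-1 \<le> squeeze (snd w)" using abs_squeeze_le[of "snd z"] abs_squeeze_le[of "snd w"] by linarith+
  let ?m = "min (1 - \<bar>squeeze (snd z)\<bar>) (1 - \<bar>squeeze (snd w)\<bar>)"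
  have "?m * min 1 (\<rho> (the (fst z)) (the (fst w))) \<le> ?m * 1"
    using abs_squeeze_le[of "snd z"] abs_squeeze_le[of "snd w"] by (intro mult_left_mono) auto
  also have "\<dots> \<le> 1 + squeeze (snd z)" by (auto simp: min_def)
  finally show ?thesis using b le1 unfolding cone_dist_def by (auto simp: abs_if simp del: squeeze.simps)
qed

text \<open>On a bounded window of times the cone stays uniformly away from its two tips, so
  closeness for \<open>sqd\<close> yields closeness of times and of positions.\<close>

lemma sqd_near:
  assumes \<eta>: "\<eta> > 0"
  obtains \<delta> where "\<delta> > 0"
    "\<And>z w s. a \<le> s \<Longrightarrow> s \<le> b \<Longrightarrow> snd z \<le> ereal (s - \<eta>) \<Longrightarrow> ereal s \<le> snd w \<Longrightarrow> \<not> sqd z w < \<delta>"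
    "\<And>z w s. z \<in> squeezed X \<Longrightarrow> w \<in> squeezed X \<Longrightarrow> snd z = ereal s \<Longrightarrow> a \<le> s \<Longrightarrow> s \<le> b \<Longrightarrow> sqd z w < \<delta> \<Longrightarrow>
      \<exists>x y t. z = (Some x, ereal s) \<and> w = (Some y, ereal t) \<and> \<bar>s - t\<bar> < \<eta> \<and> \<rho> x y < \<eta>"
proof -
  \<comment> \<open>\<open>M\<close> bounds \<open>1 + |u|\<close> for all times \<open>u\<close>
    within \<open>\<eta>\<close> of the window.\<close>
  define M where "M = 1 + \<bar>a\<bar> + \<bar>b\<bar> + \<eta>"
  have M: "M \<ge> 1" "M > 0" using \<eta> unfolding M_def by auto
  \<comment> \<open>The first bound forces the times to be close, through
    \<open>squeeze_diff_ge\<close>. The second one forces the positions to be close, as the heights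
    are at least \<open>1 / M\<close> and distances in \<open>X\<close> enter truncated at
    1.\<close>
  define \<delta> where "\<delta> = min (\<eta> / (M * M)) (min \<eta> 1 / M)"
  have \<delta>: "\<delta> > 0" "\<delta> \<le> \<eta> / (M * M)" "\<delta> \<le> min \<eta> 1 / M" using \<eta> M unfolding \<delta>_def by auto
  have time: "\<bar>squeeze (snd z) - squeeze (snd w)\<bar> \<le> sqd z w" for z w :: "'a spoint"
    unfolding cone_dist_def using abs_squeeze_le[of "snd z"] abs_squeeze_le[of "snd w"] by simp
  have gap: "\<delta> \<le> squeeze (ereal v) - squeeze (ereal u)" if "v - u = \<eta>" "\<bar>u\<bar> \<le> M - 1" "\<bar>v\<bar> \<le> M - 1" for u v
  proof -
    have "(1 + \<bar>u\<bar>) * (1 + \<bar>v\<bar>) \<le> M * M" using that M by (intro mult_mono) auto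
    then have "\<eta> / (M * M) \<le> \<eta> / ((1 + \<bar>u\<bar>) * (1 + \<bar>v\<bar>))" using \<eta> M by (intro divide_left_mono) (auto intro!: mult_pos_pos)
    then show ?thesis using squeeze_diff_ge[of u v] that \<eta> \<delta> by simp
  qed
  have sep: "\<not> sqd z w < \<delta>" if s: "a \<le> s" "s \<le> b" and zw: "snd z \<le> ereal (s - \<eta>)" "ereal s \<le> snd w" for z w s
  proof -
    have "\<delta> \<le> squeeze (ereal s) - squeeze (ereal (s - \<eta>))" using s \<eta> by (intro gap) (auto simp: M_def)
    moreover have "squeeze (snd z) \<le> squeeze (ereal (s - \<eta>))" "squeeze (ereal s) \<le> squeeze (snd w)" by (simp_all only: squeeze_le_iff zw)
    ultimately show ?thesis using time[of z w] by (simp del: squeeze.simps)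
  qed
  have sep': "\<not> sqd z w < \<delta>" if s: "a \<le> s" "s \<le> b" and zw: "snd z \<le> ereal s" "ereal (s + \<eta>) \<le> snd w" for z w s
  proof -
    have "\<delta> \<le> squeeze (ereal (s + \<eta>)) - squeeze (ereal s)" using s \<eta> by (intro gap) (auto simp: M_def)
    moreover have "squeeze (snd z) \<le> squeeze (ereal s)" "squeeze (ereal (s + \<eta>)) \<le> squeeze (snd w)" by (simp_all only: squeeze_le_iff zw)
    ultimately show ?thesis using time[of z w] by (simp del: squeeze.simps)
  qed
  have "\<exists>x y t. z = (Some x, ereal s) \<and> w = (Some y, ereal t) \<and> \<bar>s - t\<bar> < \<eta> \<and> \<rho> x y < \<eta>"
    if zw: "z \<in> squeezed X" "w \<in> squeezed X" and s: "snd z = ereal s" "a \<le> s" "s \<le> b" and less: "sqd z w < \<delta>" for z w s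
  proof -
    obtain x where x: "z = (Some x, ereal s)" using zw(1) s(1) by (rule_tac squeezed_cases[OF zw(1)]) auto
    have "\<not> ereal (s + \<eta>) \<le> snd w" using sep'[OF s(2,3), of z w] s(1) less by auto
    moreover have "\<not> snd w \<le> ereal (s - \<eta>)" using sep[OF s(2,3), of w z] s(1) less commute[of z w] by auto
    ultimately obtain y t where y: "w = (Some y, ereal t)" "s - \<eta> < t" "t < s + \<eta>" by (rule_tac squeezed_cases[OF zw(2)]) auto
    let ?p = "min (1 - \<bar>squeeze (ereal s)\<bar>) (1 - \<bar>squeeze (ereal t)\<bar>)"
    have "1 / M \<le> 1 / (1 + \<bar>s\<bar>)" "1 / M \<le> 1 / (1 + \<bar>t\<bar>)"
      using s y \<eta> by (intro divide_left_mono; auto simp: M_def intro!: mult_pos_pos)+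
    then have "1 / M \<le> ?p" unfolding one_minus_abs_squeeze by simp
    then have "1 / M * min 1 (\<rho> x y) \<le> ?p * min 1 (\<rho> x y)" by (rule mult_right_mono) simp
    also have "\<dots> \<le> sqd z w" unfolding cone_dist_def x y by (simp del: squeeze.simps)
    also have "\<dots> < min \<eta> 1 / M" using less \<delta> by simp
    finally have "min 1 (\<rho> x y) < min \<eta> 1" using M by (simp add: field_simps)
    then have "\<rho> x y < \<eta>" by (auto simp: min_def split: if_splits)
    then show ?thesis using x y by auto
  qed
  then show ?thesis using that[OF \<delta>(1)] sep by blast
qed

section \<open>Partitions of small oscillation\<close>

lemma regular_left_approx':
  assumes r: "regular f g" and s: "s \<in> I" and p: "p \<in> I" "p < s" and c: "c < s" and e: "e > 0"
  obtains q where "q \<in> I" "c < q" "p < q" "q < s" "\<rho> (f q) (g s) < e"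
proof -
  obtain \<delta> where \<delta>: "\<delta> > 0" "\<forall>q\<in>I. s - \<delta> < q \<and> q < s \<longrightarrow> \<rho> (f q) (g s) < e" using regularD(4)[OF r s e] by blast
  define m where "m = max (max c p) (s - \<delta>)"
  have m: "m < s" "c \<le> m" "p \<le> m" "s - \<delta> \<le> m" using c p \<delta> unfolding m_def by auto
  define q where "q = (m + s) / 2"
  have q: "m < q" "q < s" using m unfolding q_def by auto
  moreover then have "q \<in> I" using I_conv[OF p(1) s] m by auto
  ultimately show ?thesis using that[of q] \<delta>(2) m by auto
qed

lemma regular_continuity:
  assumes r: "regular f g" and t: "t \<in> I" "g t = f t" and e: "e > 0"
  obtains \<eta> where "\<eta> > 0" "\<And>s x. s \<in> I \<Longrightarrow> \<bar>s - t\<bar> < \<eta> \<Longrightarrow> x = f s \<or> x = g s \<Longrightarrow> \<rho> x (f t) < e"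
proof -
  obtain \<delta> where \<delta>: "\<delta> > 0" "\<And>s x. s \<in> I \<Longrightarrow> t < s \<Longrightarrow> s < t + \<delta> \<Longrightarrow> x = f s \<or> x = g s \<Longrightarrow> \<rho> x (f t) < e"
    "\<And>s x. s \<in> I \<Longrightarrow> t - \<delta> < s \<Longrightarrow> s < t \<Longrightarrow> x = f s \<or> x = g s \<Longrightarrow> \<rho> x (g t) < e"
    by (rule regular_strong[OF r t(1) e]) blast
  have "\<rho> x (f t) < e" if s: "s \<in> I" "\<bar>s - t\<bar> < \<delta>" "x = f s \<or> x = g s" for s x
  proof -
    consider "s < t" | "s = t" | "t < s" by linarith
    then show ?thesis
    proof cases
      case 1 then show ?thesis using \<delta>(3)[OF s(1) _ _ s(3)] s t by auto
    next
      case 2 then show ?thesis using s t e regularD(1)[OF r t(1)] by auto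
    next
      case 3 then show ?thesis using \<delta>(2)[OF s(1) _ _ s(3)] s t by auto
    qed
  qed
  then show ?thesis using that \<delta>(1) by blast
qed

text \<open>Cells are half-open because \<open>f\<close> may jump at the right end of a cell. The
  same \<open>e\<close> bounds the mesh and the oscillation.\<close>

definition partition :: "(real \<Rightarrow> 'a) \<Rightarrow> real \<Rightarrow> real \<Rightarrow> real \<Rightarrow> nat \<Rightarrow> (nat \<Rightarrow> real) \<Rightarrow> bool" where
  "partition f a b e k t \<longleftrightarrow> t 0 = a \<and> t k = b \<and>
    (\<forall>i<k. t i < t (Suc i) \<and> t (Suc i) - t i < e \<and> (\<forall>s. t i \<le> s \<and> s < t (Suc i) \<longrightarrow> \<rho> (f s) (f (t i)) < e))"

lemma partition_append:
  assumes "partition f a b e k t" "partition f b c e m u"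
  shows "partition f a c e (k + m) (\<lambda>i. if i \<le> k then t i else u (i - k))"
proof -
  let ?v = "\<lambda>i. if i \<le> k then t i else u (i - k)"
  have eq: "?v i = u (i - k)" if "k \<le> i" for i
    using assms that unfolding partition_def by (cases "i = k") auto
  have step: "?v i < ?v (Suc i) \<and> ?v (Suc i) - ?v i < e \<and> (\<forall>s. ?v i \<le> s \<and> s < ?v (Suc i) \<longrightarrow> \<rho> (f s) (f (?v i)) < e)"
    if i: "i < k + m" for i
  proof (cases "i < k")
    case True then show ?thesis using assms(1) unfolding partition_def by auto
  next
    case False
    then have e: "?v i = u (i - k)" "?v (Suc i) = u (Suc (i - k))" and "i - k < m" using eq[of i] eq[of "Suc i"] i by (simp_all add: Suc_diff_le)
    then show ?thesis using assms(2) unfolding partition_def e by blast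
  qed
  have "?v 0 = a" "?v (k + m) = c" using assms eq[of "k + m"] unfolding partition_def by simp_all
  then show ?thesis unfolding partition_def using step by blast
qed

text \<open>Bisection in the form of \<open>Bolzano\<close>: partitions of adjacent intervals can be
  joined, and near every point \<open>x\<close> at most two cells suffice.\<close>

lemma partition_ex:
  assumes r: "regular f g" and ab: "a \<in> I" "b \<in> I" "a \<le> b" and e: "e > 0"
  obtains k t where "partition f a b e k t"
proof -
  note D = regularD(1,2)[OF r]
  have "a \<le> a \<longrightarrow> b \<le> b \<longrightarrow> a \<le> b \<longrightarrow> (\<exists>k t. partition f a b e k t)"
    using ab(3)
  proof (induction rule: Bolzano[where P = "\<lambda>u v. a \<le> u \<longrightarrow> v \<le> b \<longrightarrow> u \<le> v \<longrightarrow> (\<exists>k t. partition f u v e k t)", consumes 1, case_names trans local])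
    case (trans u v w)
    show ?case
    proof (intro impI)
      assume "a \<le> u" "w \<le> b" "u \<le> w"
      then obtain k t m q where "partition f u v e k t" "partition f v w e m q" using trans by auto
      then show "\<exists>k t. partition f u w e k t" using partition_append by blast
    qed
  next
    case (local x)
    then have x: "x \<in> I" using I_conv[OF ab(1,2)] by blast
    have e2: "e / 2 > 0" using e by simp
    obtain \<delta> where \<delta>: "\<delta> > 0" "\<And>s. s \<in> I \<Longrightarrow> x < s \<Longrightarrow> s < x + \<delta> \<Longrightarrow> \<rho> (f s) (f x) < e / 2"
      "\<And>s. s \<in> I \<Longrightarrow> x - \<delta> < s \<Longrightarrow> s < x \<Longrightarrow> \<rho> (f s) (g x) < e / 2"
      using regularD(4)[OF r x e2] by blast
    have single: "partition f u v e 1 (\<lambda>i. if i = 0 then u else v)"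
      if "u < v" "v - u < e" "\<And>s. u \<le> s \<Longrightarrow> s < v \<Longrightarrow> \<rho> (f s) (f u) < e" for u v
      using that unfolding partition_def by auto
    have trivial: "partition f u u e 0 (\<lambda>_. u)" for u unfolding partition_def by simp
    \<comment> \<open>The interval is cut at \<open>x\<close>, where \<open>f\<close> may jump. To
      the left \<open>f\<close> is compared with \<open>g x\<close>, at cost \<open>e / 2\<close>
      for each of two values; to the right directly with \<open>f x\<close>.\<close>
    have "\<exists>k t. partition f u v e k t" if uv: "u \<le> x" "x \<le> v" "v - u < min \<delta> e" "a \<le> u" "v \<le> b" for u v
    proof -
      have inI: "s \<in> I" if "u \<le> s" "s \<le> v" for s using I_conv[OF ab(1,2)] that uv by auto
      have "\<exists>k t. partition f u x e k t"
      proof (cases "u = x")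
        case True then show ?thesis using trivial by auto
      next
        case False
        have "\<rho> (f s) (f u) < e" if s: "u \<le> s" "s < x" for s
        proof -
          have I': "s \<in> I" "u \<in> I" using inI s uv by auto
          have "\<rho> (f s) (g x) < e / 2" "\<rho> (f u) (g x) < e / 2" using \<delta>(3)[OF I'(1)] \<delta>(3)[OF I'(2)] s uv False by auto
          then show ?thesis using R.triangle'[of "f s" "g x" "f u"] D I' x by auto
        qed
        then show ?thesis using single[of u x] uv False by (metis diff_left_mono le_less_trans less_eq_real_def diff_right_mono min_less_iff_conj)
      qed
      moreover have "\<exists>k t. partition f x v e k t"
      proof (cases "x = v")
        case True then show ?thesis using trivial by auto
      next
        case False
        have "\<rho> (f s) (f x) < e" if s: "x \<le> s" "s < v" for s
        proof (cases "s = x")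
          case True then show ?thesis using D x e by simp
        next
          case sx: False
          have "s \<in> I" using inI s uv by auto
          then show ?thesis using \<delta>(2)[of s] s sx uv e by auto
        qed
        moreover have "v - x < e" using uv by auto
        ultimately show ?thesis using single[of x v] uv False by auto
      qed
      ultimately show ?thesis using partition_append by blast
    qed
    then show ?case using \<delta>(1) e by (intro exI[of _ "min \<delta> e"]) auto
  qed
  then show ?thesis using that ab(3) by blast
qed

lemma partitionD:
  assumes p: "partition f a b e k t" and ab: "a \<in> I" "b \<in> I"
  shows "t 0 = a" "t k = b" "i < k \<Longrightarrow> t i < t (Suc i)" "i < k \<Longrightarrow> t (Suc i) - t i < e"
    "i < k \<Longrightarrow> t i \<le> s \<Longrightarrow> s < t (Suc i) \<Longrightarrow> \<rho> (f s) (f (t i)) < e"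
    "i \<le> j \<Longrightarrow> j \<le> k \<Longrightarrow> t i \<le> t j" "i \<le> k \<Longrightarrow> t i \<in> I" "i \<le> k \<Longrightarrow> a \<le> t i" "i \<le> k \<Longrightarrow> t i \<le> b"
    "i < k \<Longrightarrow> t i \<le> s \<Longrightarrow> s \<le> t (Suc i) \<Longrightarrow> s \<in> I"
proof -
  show b: "t 0 = a" "t k = b" and st: "i < k \<Longrightarrow> t i < t (Suc i)" "i < k \<Longrightarrow> t (Suc i) - t i < e"
    "i < k \<Longrightarrow> t i \<le> s \<Longrightarrow> s < t (Suc i) \<Longrightarrow> \<rho> (f s) (f (t i)) < e" for i s
    using p unfolding partition_def by auto
  show mono: "i \<le> j \<Longrightarrow> j \<le> k \<Longrightarrow> t i \<le> t j" for i j using step_sequence_mono[of k t] st(1) by blast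
  show le: "i \<le> k \<Longrightarrow> a \<le> t i" "i \<le> k \<Longrightarrow> t i \<le> b" for i using mono[of 0 i] mono[of i k] b by auto
  show tI: "i \<le> k \<Longrightarrow> t i \<in> I" for i using I_conv[OF ab] le by blast
  show "i < k \<Longrightarrow> t i \<le> s \<Longrightarrow> s \<le> t (Suc i) \<Longrightarrow> s \<in> I" using I_conv[OF tI tI, of i "Suc i" s] by simp
qed

text \<open>A left limit in a cell, even at its excluded right end, is approximated by values inside
  the cell; the strict bound becomes a weak one.\<close>

lemma partition_left:
  assumes r: "regular f g" and p: "partition f a b e k t" and ab: "a \<in> I" "b \<in> I" and i: "i < k" "t i < s" "s \<le> t (Suc i)"
  shows "\<rho> (g s) (f (t i)) \<le> e"
proof (rule field_le_epsilon)
  fix \<epsilon> :: real assume \<epsilon>: "\<epsilon> > 0"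
  note pd = partitionD[OF p ab] and D = regularD(1,2)[OF r]
  have sI: "s \<in> I" "t i \<in> I" using pd(10)[OF i(1)] pd(7)[of i] i by auto
  obtain q where q: "q \<in> I" "t i < q" "q < s" "\<rho> (f q) (g s) < \<epsilon>"
    by (rule regular_left_approx'[OF r sI(1,2) i(2) i(2) \<epsilon>])
  have "\<rho> (f q) (f (t i)) < e" using pd(5)[OF i(1), of q] q i by simp
  then show "\<rho> (g s) (f (t i)) \<le> e + \<epsilon>" using R.triangle''[of "g s" "f q" "f (t i)"] D sI q by auto
qed

lemma regular_bounded:
  assumes r: "regular f g" and ab: "a \<in> I" "b \<in> I" "a \<le> b"
  obtains B where "\<And>s. s \<in> {a..b} \<Longrightarrow> \<rho> (f a) (f s) \<le> B"
proof -
  obtain k t where p: "partition f a b 1 k t" by (rule partition_ex[OF r ab zero_less_one])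
  note pd = partitionD[OF p ab(1,2)] and D = regularD(1,2)[OF r]
  define B where "B = Max ((\<lambda>i. \<rho> (f a) (f (t i))) ` {..k})"
  have B: "\<rho> (f a) (f (t i)) \<le> B" if "i \<le> k" for i unfolding B_def using that by (intro Max_ge) auto
  have "\<rho> (f a) (f s) \<le> B + 1" if s: "s \<in> {a..b}" for s
  proof (cases "s = b")
    case True then show ?thesis using B[of k] pd(2) by simp
  next
    case False
    then obtain i where i: "i < k" "t i \<le> s" "s < t (Suc i)" using step_sequence_find[of t s k] s pd(1,2) by auto
    have sI: "s \<in> I" using I_conv[OF ab(1,2)] s by auto
    show ?thesis
      using R.triangle'[of "f a" "f (t i)" "f s"] B[of i] pd(5)[OF i] pd(7)[of i] D ab sI i by auto
  qed
  then show ?thesis using that by blast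
qed

text \<open>A window between two continuity points, as in the definition of Skorokhod convergence.
  Finite endpoints of \<open>I\<close> qualify, since \<open>regular\<close> imposes
  \<open>g = f\<close> there.\<close>

definition good :: "(real \<Rightarrow> 'a) \<Rightarrow> (real \<Rightarrow> 'a) \<Rightarrow> real \<Rightarrow> real \<Rightarrow> bool" where
  "good f g a b \<longleftrightarrow> a \<in> I \<and> b \<in> I \<and> a < b \<and> g a = f a \<and> g b = f b"

lemma regular_dist_bounded:
  assumes "regular f g" "regular f' g'" "a \<in> I" "b \<in> I" "a \<le> b"
  obtains B where "\<And>s s'. s \<in> {a..b} \<Longrightarrow> s' \<in> {a..b} \<Longrightarrow> \<rho> (f s) (f' s') \<le> B"
proof -
  obtain B1 where 1: "\<And>s. s \<in> {a..b} \<Longrightarrow> \<rho> (f a) (f s) \<le> B1" using regular_bounded[OF assms(1,3-5)] by blast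
  obtain B2 where 2: "\<And>s. s \<in> {a..b} \<Longrightarrow> \<rho> (f' a) (f' s) \<le> B2" using regular_bounded[OF assms(2,3-5)] by blast
  have "\<rho> (f s) (f' s') \<le> B1 + (\<rho> (f a) (f' a) + B2)" if s: "s \<in> {a..b}" "s' \<in> {a..b}" for s s'
  proof -
    have "s \<in> I" "s' \<in> I" using I_conv[OF assms(3,4)] s by auto
    then show ?thesis
      using R.triangle''[of "f s" "f a" "f' s'"] R.triangle[of "f a" "f' a" "f' s'"] 1[OF s(1)] 2[OF s(2)]
        regularD(1)[OF assms(1)] regularD(1)[OF assms(2)] assms(3) by fastforce
  qed
  then show ?thesis using that by blast
qed

text \<open>Bounds obtained in the interior of a cell extend to its left end by right
  continuity.\<close>

lemma regular_right_le:
  assumes r: "regular f g" and s: "s \<in> I" "u \<in> I" "s < u" and z: "z \<in> topspace X"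
    and le: "\<And>q. s < q \<Longrightarrow> q < u \<Longrightarrow> \<rho> (f q) z \<le> c"
  shows "\<rho> (f s) z \<le> c"
proof (rule field_le_epsilon)
  fix e :: real assume e: "e > 0"
  obtain \<delta> where \<delta>: "\<delta> > 0" "\<And>q. q \<in> I \<Longrightarrow> s < q \<Longrightarrow> q < s + \<delta> \<Longrightarrow> \<rho> (f q) (f s) < e" using regularD(4)[OF r s(1) e] by blast
  define m where "m = min u (s + \<delta>)"
  have m: "s < m" "m \<le> u" "m \<le> s + \<delta>" using s \<delta> unfolding m_def by auto
  define q where "q = (s + m) / 2"
  have q: "s < q" "q < m" using m unfolding q_def by auto
  have qI: "q \<in> I" using I_conv[OF s(1,2)] q m by auto
  have "\<rho> (f q) (f s) < e" "\<rho> (f q) z \<le> c" using \<delta>(2)[OF qI] le q m by auto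
  then show "\<rho> (f s) z \<le> c + e" using R.triangle''[of "f s" "f q" z] regularD(1)[OF r] s qI z by auto
qed

lemma partition_gap:
  assumes p: "partition f a b e k t" and ab: "a < b"
  obtains \<gamma> where "\<gamma> > 0" "k > 0" "\<And>i. i < k \<Longrightarrow> t i + \<gamma> \<le> t (Suc i)"
proof -
  have t: "t 0 = a" "t k = b" "\<And>i. i < k \<Longrightarrow> t i < t (Suc i)" using p unfolding partition_def by auto
  then have k: "k > 0" using ab by (cases k) auto
  define \<gamma> where "\<gamma> = Min ((\<lambda>i. t (Suc i) - t i) ` {..<k})"
  have "\<gamma> > 0" unfolding \<gamma>_def using k t(3) by (subst Min_gr_iff) auto
  moreover have "t i + \<gamma> \<le> t (Suc i)" if "i < k" for i
  proof -
    have "\<gamma> \<le> t (Suc i) - t i" unfolding \<gamma>_def using that by (intro Min_le) auto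
    then show ?thesis by simp
  qed
  ultimately show ?thesis using that k by blast
qed

text \<open>The inverse of the time change maps \<open>t i\<close>, for \<open>t\<close> a partition for \<open>f\<close>, to the first time \<open>S i\<close> at which
  the correspondence has passed the right limit of \<open>f\<close> at \<open>t i\<close>.\<close>

lemma J1_change:
  assumes r: "regular f g" and gd: "good f g a b" and e: "e > 0"
  obtains \<delta> where "\<delta> > 0" "\<And>f' g' C. regular f' g' \<Longrightarrow> C \<in> Corr_mono (graph_path f' g') (graph_path f g) \<Longrightarrow>
    (\<And>z w. (z, w) \<in> C \<Longrightarrow> sqd z w < \<delta>) \<Longrightarrow>
    \<exists>l\<in>time_changes_mono {a..b}. \<forall>s\<in>{a..b}. \<rho> (f' s) (f (l s)) \<le> 4 * e \<and> \<bar>s - l s\<bar> \<le> 4 * e"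
proof -
  have ab: "a \<in> I" "b \<in> I" "a < b" "a \<le> b" "g a = f a" "g b = f b" using gd unfolding good_def by auto
  note D = regularD(1,2)[OF r]
  obtain \<eta>1 where \<eta>1: "\<eta>1 > 0" "\<And>s x. s \<in> I \<Longrightarrow> \<bar>s - a\<bar> < \<eta>1 \<Longrightarrow> x = f s \<or> x = g s \<Longrightarrow> \<rho> x (f a) < e"
    by (rule regular_continuity[OF r ab(1,5) e]) blast
  obtain \<eta>2 where \<eta>2: "\<eta>2 > 0" "\<And>s x. s \<in> I \<Longrightarrow> \<bar>s - b\<bar> < \<eta>2 \<Longrightarrow> x = f s \<or> x = g s \<Longrightarrow> \<rho> x (f b) < e"
    by (rule regular_continuity[OF r ab(2,6) e]) blast
  obtain k t where p: "partition f a b e k t" by (rule partition_ex[OF r ab(1,2,4) e])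
  note pd = partitionD[OF p ab(1,2)]
  obtain \<gamma> where \<gamma>: "\<gamma> > 0" "k > 0" "\<And>i. i < k \<Longrightarrow> t i + \<gamma> \<le> t (Suc i)" by (rule partition_gap[OF p ab(3)]) blast
  \<comment> \<open>\<open>3 * \<eta> \<le> \<gamma>\<close> keeps the points \<open>S i\<close>,
    which are within \<open>\<eta>\<close> of the \<open>t i\<close>, strictly increasing.
    \<open>\<eta>1\<close> and \<open>\<eta>2\<close> are radii of continuity at the ends of the
    window.\<close>
  define \<eta> where "\<eta> = min (min \<eta>1 \<eta>2) (min (\<gamma> / 3) e)"
  have \<eta>: "\<eta> > 0" "\<eta> \<le> \<eta>1" "\<eta> \<le> \<eta>2" "3 * \<eta> \<le> \<gamma>" "\<eta> \<le> e" using \<eta>1(1) \<eta>2(1) \<gamma>(1) e unfolding \<eta>_def by auto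
  obtain \<delta> where \<delta>: "\<delta> > 0" "\<And>z w s. z \<in> squeezed X \<Longrightarrow> w \<in> squeezed X \<Longrightarrow> snd z = ereal s \<Longrightarrow> a \<le> s \<Longrightarrow> s \<le> b \<Longrightarrow> sqd z w < \<delta> \<Longrightarrow>
      \<exists>x y t. z = (Some x, ereal s) \<and> w = (Some y, ereal t) \<and> \<bar>s - t\<bar> < \<eta> \<and> \<rho> x y < \<eta>"
    by (rule sqd_near[OF \<eta>(1), where a = a and b = b]) blast
  have "\<exists>l\<in>time_changes_mono {a..b}. \<forall>s\<in>{a..b}. \<rho> (f' s) (f (l s)) \<le> 4 * e \<and> \<bar>s - l s\<bar> \<le> 4 * e"
    if r': "regular f' g'" and C: "C \<in> Corr_mono (graph_path f' g') (graph_path f g)" and small: "\<And>z w. (z, w) \<in> C \<Longrightarrow> sqd z w < \<delta>"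
    for f' g' C
  proof -
    note D' = regularD(1,2)[OF r']
    have P: "graph_path f g \<in> paths X" "graph_path f' g' \<in> paths X"
      using graph_path_skor[OF r] graph_path_skor[OF r'] unfolding skor_paths_def by blast+
    note ord = pathD(7,8,9,10)[OF P(1), unfolded fst_conv snd_conv]
    have abI: "s \<in> I" if "s \<in> {a..b}" for s using I_conv[OF ab(1,2)] that by auto
    define z where "z s = (Some (f' s), ereal s)" for s
    have zG: "z s \<in> graph_pts f' g'" if "s \<in> {a..b}" for s using abI[OF that] unfolding z_def by simp
    have "\<forall>s\<in>{a..b}. \<exists>w. (z s, w) \<in> C" using Corr_monoD(2)[OF C] zG unfolding fst_conv by blast
    then obtain W where W: "\<And>s. s \<in> {a..b} \<Longrightarrow> (z s, W s) \<in> C" by metis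
    have WG: "W s \<in> graph_pts f g" if "s \<in> {a..b}" for s using Corr_monoD(1)[OF C] W[OF that] unfolding fst_conv by blast
    have "\<exists>y q. W s = (Some y, ereal q) \<and> q \<in> I \<and> (y = f q \<or> y = g q) \<and> \<bar>s - q\<bar> < \<eta> \<and> \<rho> (f' s) y < \<eta>" if s: "s \<in> {a..b}" for s
    proof -
      have "z s \<in> squeezed X" "W s \<in> squeezed X" using graph_pts_squeezed[OF r'] graph_pts_squeezed[OF r] zG[OF s] WG[OF s] by blast+
      then obtain x y q where "z s = (Some x, ereal s)" "W s = (Some y, ereal q)" "\<bar>s - q\<bar> < \<eta>" "\<rho> x y < \<eta>"
        using \<delta>(2)[of "z s" "W s" s] small[OF W[OF s]] s unfolding z_def by auto
      then show ?thesis using WG[OF s] unfolding z_def by auto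
    qed
    then obtain Y Q where YQ: "\<And>s. s \<in> {a..b} \<Longrightarrow> W s = (Some (Y s), ereal (Q s))" "\<And>s. s \<in> {a..b} \<Longrightarrow> Q s \<in> I"
      "\<And>s. s \<in> {a..b} \<Longrightarrow> Y s = f (Q s) \<or> Y s = g (Q s)" "\<And>s. s \<in> {a..b} \<Longrightarrow> \<bar>s - Q s\<bar> < \<eta>" "\<And>s. s \<in> {a..b} \<Longrightarrow> \<rho> (f' s) (Y s) < \<eta>"
      by metis
    have Wmono: "(W s, W s') \<in> graph_ord f g" if s: "s \<in> {a..b}" "s' \<in> {a..b}" "s < s'" for s s'
    proof -
      have "(z s, z s') \<in> graph_ord f' g'" "z s \<noteq> z s'" using zG[OF s(1)] zG[OF s(2)] s(3) unfolding graph_ord_iff z_def by auto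
      then have "(W s', W s) \<in> graph_ord f g \<Longrightarrow> W s' = W s" using Corr_monoD(4)[OF C W[OF s(1)] W[OF s(2)]] unfolding snd_conv by blast
      then show ?thesis using ord(3)[OF WG[OF s(1)] WG[OF s(2)]] by metis
    qed
    define p where "p i = (Some (f (t i)), ereal (t i))" for i
    have pG: "p i \<in> graph_pts f g" if "i \<le> k" for i using pd(7)[OF that] unfolding p_def by simp
    define U where "U i = {s \<in> {a..b}. (p i, W s) \<in> graph_ord f g}" for i
    \<comment> \<open>The ends are prescribed, as an increasing bijection of \<open>{a..b}\<close>
      fixes them; continuity of \<open>f\<close> at \<open>a\<close> and \<open>b\<close> makes up
      for this.\<close>
    define S where "S i = (if i = 0 then a else if i = k then b else Inf (U i))" for i
    have S0: "S 0 = a" "S k = b" using \<gamma>(2) unfolding S_def by auto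
    have bdd: "bdd_below (U i)" for i unfolding U_def by (rule bdd_belowI[of _ a]) auto
    have gap: "a + \<eta> \<le> t i" "t i + \<eta> \<le> b" if i: "0 < i" "i < k" for i
    proof -
      have "t (i - 1) + \<gamma> \<le> t i" using \<gamma>(3)[of "i - 1"] i by simp
      then show "a + \<eta> \<le> t i" using pd(8)[of "i - 1"] i \<eta> by linarith
      show "t i + \<eta> \<le> b" using \<gamma>(3)[of i] pd(9)[of "Suc i"] i \<eta> by simp
    qed
    \<comment> \<open>A partner differs in time by less than \<open>\<eta>\<close>, so at
      \<open>t i + \<eta>\<close> it is certainly later than \<open>t i\<close>.\<close>
    have mem: "t i + \<eta> \<in> U i" if i: "0 < i" "i < k" for i
    proof -
      have s: "t i + \<eta> \<in> {a..b}" using gap[OF i] pd(8)[of i] i \<eta> by auto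
      have "t i < Q (t i + \<eta>)" using YQ(4)[OF s] by auto
      then have "(p i, W (t i + \<eta>)) \<in> graph_ord f g" using pG[of i] WG[OF s] i YQ(1)[OF s] unfolding graph_ord_iff p_def by simp
      then show ?thesis using s unfolding U_def by simp
    qed
    have low: "t i - \<eta> \<le> s" if s: "s \<in> U i" and i: "i < k" for s i
    proof -
      have s': "s \<in> {a..b}" "(p i, W s) \<in> graph_ord f g" using s unfolding U_def by auto
      have "ereal (t i) \<le> snd (W s)" using pathD(12)[OF P(1), of "p i" "W s"] s'(2) unfolding p_def by simp
      then show ?thesis using YQ(1,4)[OF s'(1)] by auto
    qed
    have St: "\<bar>S i - t i\<bar> \<le> \<eta>" if "i \<le> k" for i
    proof (cases "i = 0 \<or> i = k")
      case True then show ?thesis using S0 pd(1,2) \<eta> by auto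
    next
      case False
      then have i: "0 < i" "i < k" using that by auto
      have "Inf (U i) \<le> t i + \<eta>" by (rule cInf_lower[OF mem[OF i] bdd])
      moreover have "t i - \<eta> \<le> Inf (U i)" by (rule cInf_greatest) (use mem[OF i] low i in blast)+
      ultimately show ?thesis using False unfolding S_def by auto
    qed
    have step: "S i < S (Suc i)" if "i < k" for i
      using St[of i] St[of "Suc i"] \<gamma>(3)[OF that] that \<eta> by auto
    have Sab: "a \<le> S i" "S i \<le> b" if "i \<le> k" for i
      using step_sequence_mono[of k S 0 i] step_sequence_mono[of k S i k] step that S0 by auto
    have up: "(p i, W s) \<in> graph_ord f g" if i: "0 < i" "i < k" and s: "s \<in> {a..b}" "S i < s" for i s
    proof -
      have "Inf (U i) < s" using i s unfolding S_def by simp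
      then obtain u where u: "u \<in> U i" "u < s" using cInf_lessD[of "U i" s] mem[OF i] by blast
      then have "(p i, W u) \<in> graph_ord f g" "(W u, W s) \<in> graph_ord f g" using Wmono[of u s] s unfolding U_def by auto
      then show ?thesis by (rule ord(1))
    qed
    have down: "(p i, W s) \<notin> graph_ord f g" if i: "0 < i" "i < k" and s: "s \<in> {a..b}" "s < S i" for i s
    proof
      assume "(p i, W s) \<in> graph_ord f g"
      then have "s \<in> U i" using s unfolding U_def by simp
      then have "Inf (U i) \<le> s" by (rule cInf_lower[OF _ bdd])
      then show False using i s unfolding S_def by simp
    qed
    \<comment> \<open>The time \<open>Q s\<close> of the partner may lie slightly outside the cell.
      At the ends of the window continuity of \<open>f\<close> absorbs this; at the inner division
      points the order relative to \<open>p i\<close> and \<open>p (Suc i)\<close> tells which side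
      of a jump the partner is on.\<close>
    have cell: "\<rho> (Y s) (f (t i)) \<le> 2 * e" if i: "i < k" and s: "S i < s" "s < S (Suc i)" for i s
    proof -
      have sab: "s \<in> {a..b}" using Sab[of i] Sab[of "Suc i"] s i by auto
      have tI: "t i \<in> I" using pd(7)[of i] i by simp
      consider "Q s \<le> t i" | "t i < Q s" "Q s < t (Suc i)" | "t (Suc i) \<le> Q s" by linarith
      then show ?thesis
      proof cases
        case 1
        show ?thesis
        proof (cases "i = 0")
          case True
          then have "\<bar>Q s - a\<bar> < \<eta>1" using 1 pd(1) YQ(4)[OF sab] s(1) S0 \<eta> by auto
          then show ?thesis using \<eta>1(2)[OF YQ(2)[OF sab] _ YQ(3)[OF sab]] True pd(1) e by auto
        next
          case False
          then have "(p i, W s) \<in> graph_ord f g" using up[of i s] i s sab by simp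
          \<comment> \<open>\<open>p i\<close> precedes \<open>W s\<close> although its time is not
            earlier. As \<open>p i\<close> is the later of the two points at its time,
            \<open>W s\<close> is \<open>p i\<close> itself.\<close>
          then have "Y s = f (t i)" using 1 YQ(1)[OF sab] unfolding graph_ord_iff p_def by auto
          then show ?thesis using D(1)[OF tI] e by simp
        qed
      next
        case 2
        then show ?thesis using pd(5)[OF i, of "Q s"] partition_left[OF r p ab(1,2) i, of "Q s"] YQ(3)[OF sab] e by auto
      next
        case 3
        have left: "\<rho> (g (t (Suc i))) (f (t i)) \<le> e" using partition_left[OF r p ab(1,2) i, of "t (Suc i)"] pd(3)[OF i] by simp
        show ?thesis
        proof (cases "Suc i = k")
          case True
          then have "\<bar>Q s - b\<bar> < \<eta>2" using 3 pd(2) YQ(4)[OF sab] s(2) S0 \<eta> by auto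
          then have "\<rho> (Y s) (f b) < e" using \<eta>2(2)[OF YQ(2)[OF sab] _ YQ(3)[OF sab]] by simp
          moreover have "\<rho> (f b) (f (t i)) \<le> e" using left True pd(2) ab(6) by simp
          moreover have "Y s \<in> topspace X" using YQ(2,3)[OF sab] D by auto
          ultimately show ?thesis using R.triangle[of "Y s" "f b" "f (t i)"] D(1)[OF ab(2)] D(1)[OF tI] by simp
        next
          case False
          then have i': "Suc i < k" using i by simp
          \<comment> \<open>Not having reached \<open>p (Suc i)\<close>, the partner can only be the
            left limit at that time.\<close>
          have no: "(p (Suc i), W s) \<notin> graph_ord f g" using down[of "Suc i" s] i' sab s(2) by simp
          then have "Q s = t (Suc i)" using 3 pG[of "Suc i"] WG[OF sab] i YQ(1)[OF sab] unfolding graph_ord_iff p_def by auto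
          moreover then have "Y s \<noteq> f (t (Suc i))" using no pG[of "Suc i"] WG[OF sab] i YQ(1)[OF sab] unfolding graph_ord_iff p_def by auto
          ultimately have "Y s = g (t (Suc i))" using YQ(3)[OF sab] by auto
          then show ?thesis using left e by simp
        qed
      qed
    qed
    have cell': "\<rho> (f' s) (f (t i)) \<le> 3 * e" if i: "i < k" and s: "S i < s" "s < S (Suc i)" for i s
    proof -
      have sab: "s \<in> {a..b}" using Sab[of i] Sab[of "Suc i"] s i by auto
      have "Y s \<in> topspace X" using YQ(2,3)[OF sab] D by auto
      then show ?thesis
        using R.triangle[of "f' s" "Y s" "f (t i)"] cell[OF i s] YQ(5)[OF sab] \<eta>(5) D'(1)[OF abI[OF sab]] D(1)[OF pd(7)[of i]] i by auto
    qed
    have cell'': "\<rho> (f' s) (f (t i)) \<le> 3 * e" if i: "i < k" and s: "S i \<le> s" "s < S (Suc i)" for i s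
    proof (cases "s = S i")
      case True
      have "S i \<in> I" "S (Suc i) \<in> I" using abI Sab[of i] Sab[of "Suc i"] i by auto
      then show ?thesis unfolding True
        by (rule regular_right_le[OF r' _ _ step[OF i]]) (use D(1)[OF pd(7)[of i]] cell'[OF i] i in auto)
    next
      case False then show ?thesis using cell'[OF i] s by simp
    qed
    obtain h where h: "strict_mono_on {S 0..S k} h" "h ` {S 0..S k} = {t 0..t k}" "h (S k) = t k"
      "\<And>i x. i < k \<Longrightarrow> S i \<le> x \<Longrightarrow> x < S (Suc i) \<Longrightarrow> t i \<le> h x \<and> h x < t (Suc i)"
      using piecewise_bijection[of k S t] step pd(3) by blast
    have h': "strict_mono_on {a..b} h" "h ` {a..b} = {a..b}" "h b = b" using h S0 pd(1,2) by simp_all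
    have "h \<in> time_changes_mono {a..b}"
      unfolding time_changes_mono_def bij_betw_def using h' strict_mono_on_imp_inj_on by blast
    \<comment> \<open>The point \<open>b\<close> lies in no half-open cell and is handled by
      continuity of \<open>f\<close>. Elsewhere \<open>3 * e\<close> come from \<open>cell''\<close>
      and another \<open>e\<close> from the oscillation of \<open>f\<close> in the cell.\<close>
    moreover have "\<rho> (f' s) (f (h s)) \<le> 4 * e \<and> \<bar>s - h s\<bar> \<le> 4 * e" if s: "s \<in> {a..b}" for s
    proof (cases "s = b")
      case True
      have "\<bar>Q b - b\<bar> < \<eta>2" using YQ(4)[OF s] True \<eta> by auto
      then have "\<rho> (Y b) (f b) < e" using \<eta>2(2)[OF YQ(2)[OF s] _ YQ(3)[OF s]] True by simp
      moreover have "Y b \<in> topspace X" using YQ(2,3)[OF s] D True by auto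
      ultimately show ?thesis
        using R.triangle[of "f' b" "Y b" "f b"] YQ(5)[OF s] \<eta>(5) D'(1)[OF ab(2)] D(1)[OF ab(2)] True h'(3) e by auto
    next
      case False
      then obtain i where i: "i < k" "S i \<le> s" "s < S (Suc i)" using step_sequence_find[of S s k] s S0 by auto
      note hi = h(4)[OF i]
      have hI: "h s \<in> I" using abI h'(2) s by blast
      have 1: "\<rho> (f (h s)) (f (t i)) < e" using pd(5)[OF i(1)] hi by simp
      have "\<rho> (f' s) (f (h s)) \<le> 4 * e"
        using R.triangle'[of "f' s" "f (t i)" "f (h s)"] 1 cell''[OF i] D'(1)[OF abI[OF s]] D(1)[OF hI] D(1)[OF pd(7)[of i]] i by auto
      moreover have "\<bar>s - h s\<bar> \<le> 4 * e"
        using hi i(2,3) St[of i] St[of "Suc i"] pd(4)[OF i(1)] i(1) \<eta>(5) e by auto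
      ultimately show ?thesis by blast
    qed
    ultimately show ?thesis by blast
  qed
  then show ?thesis using that \<delta>(1) by blast
qed

text \<open>A point of the graph of \<open>f2\<close> near the value \<open>f1 s\<close> is traded
  for a value of \<open>f2\<close> at a time in the half-open window: a left limit for an earlier
  value, a point beyond the window for a value near its end. There both functions are nearly
  constant, with \<open>A\<close> and \<open>B\<close> as common approximate values.\<close>

lemma cover_transfer:
  assumes r1: "regular f1 g1" and r2: "regular f2 g2" and ab: "a \<in> I" "b \<in> I" "a < b" and e: "e > 0"
    and AB: "A \<in> topspace X" "B \<in> topspace X" and \<eta>: "0 < \<eta>" "\<eta> \<le> e"
    and A: "\<And>s. s \<in> {a..b} \<Longrightarrow> \<bar>s - a\<bar> < \<eta> \<Longrightarrow> \<rho> (f1 s) A \<le> 2 * e \<and> \<rho> (f2 s) A \<le> 2 * e"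
    and B: "\<And>s. s \<in> {a..b} \<Longrightarrow> \<bar>s - b\<bar> < \<eta> \<Longrightarrow> \<rho> (f1 s) B \<le> 2 * e \<and> \<rho> (f2 s) B \<le> 2 * e"
    and s: "s \<in> {a..b}" and q: "q \<in> I" "y = f2 q \<or> y = g2 q" "\<bar>s - q\<bar> < \<eta>" "\<rho> (f1 s) y < \<eta>"
  shows "\<exists>u\<in>{a..<b}. \<rho> (f1 s) (f2 u) \<le> 4 * e \<and> \<bar>s - u\<bar> \<le> 2 * e"
proof -
  note D1 = regularD(1,2)[OF r1] and D2 = regularD(1,2)[OF r2]
  have sI: "s \<in> I" using I_conv[OF ab(1,2)] s by auto
  have yX: "y \<in> topspace X" using q D2 by auto
  consider "q \<le> a" | "a < q" "q < b" | "b \<le> q" by linarith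
  then show ?thesis
  proof cases
    case 1
    then have sa: "\<bar>s - a\<bar> < \<eta>" using s q(3) by auto
    have "\<rho> (f1 s) (f2 a) \<le> 4 * e"
      using R.triangle'[of "f1 s" A "f2 a"] A[OF s sa] A[of a] ab \<eta> D1(1)[OF sI] D2(1)[OF ab(1)] AB by auto
    then show ?thesis using sa \<eta> ab by (intro bexI[of _ a]) auto
  next
    case 2
    have "\<exists>u\<in>{a..<b}. \<rho> (f2 u) y < e \<and> \<bar>u - q\<bar> < e"
    proof (cases "y = f2 q")
      case True then show ?thesis using 2 e D2(1)[OF q(1)] by (intro bexI[of _ q]) auto
    next
      case False
      then have y: "y = g2 q" using q by blast
      obtain u where u: "u \<in> I" "q - e < u" "a < u" "u < q" "\<rho> (f2 u) (g2 q) < e"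
        by (rule regular_left_approx'[OF r2 q(1) ab(1) 2(1) _ e]) (use e in auto)
      then show ?thesis using 2 y by (intro bexI[of _ u]) auto
    qed
    then obtain u where u: "u \<in> {a..<b}" "\<rho> (f2 u) y < e" "\<bar>u - q\<bar> < e" by blast
    have uI: "u \<in> I" using I_conv[OF ab(1,2)] u by auto
    have "\<rho> (f1 s) (f2 u) \<le> 4 * e"
      using R.triangle'[of "f1 s" y "f2 u"] u q(4) \<eta> e yX D1(1)[OF sI] D2(1)[OF uI] by auto
    then show ?thesis using u q(3) \<eta> by (intro bexI[of _ u]) auto
  next
    case 3
    then have sb: "\<bar>s - b\<bar> < \<eta>" using s q(3) by auto
    \<comment> \<open>Strictly before \<open>b\<close>, since \<open>u\<close> has to lie in a
      half-open cell of a partition later on, but still in the range of \<open>B\<close>.\<close>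
    define u where "u = max a (b - \<eta> / 2)"
    have u: "u \<in> {a..b}" "u < b" "\<bar>u - b\<bar> < \<eta>" using ab \<eta> unfolding u_def by auto
    have uI: "u \<in> I" using I_conv[OF ab(1,2)] u by auto
    have "\<rho> (f1 s) (f2 u) \<le> 4 * e"
      using R.triangle'[of "f1 s" B "f2 u"] B[OF s sb] B[OF u(1,3)] D1(1)[OF sI] D2(1)[OF uI] AB by auto
    then show ?thesis using u sb s \<eta> by (intro bexI[of _ u]) auto
  qed
qed

text \<open>All times that \<open>u\<close> sends to one cell are spread injectively over that cell.
  Staying in the cell changes \<open>f\<close> by at most \<open>2 * e\<close> and the time by at
  most the mesh \<open>e\<close>.\<close>

lemma cell_injection:
  assumes r: "regular f g" and ab: "a \<in> I" "b \<in> I" "a < b" and e: "e > 0"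
    and u: "\<And>s. s \<in> {a..b} \<Longrightarrow> u s \<in> {a..<b}"
  obtains p where "inj_on p {a..b}" "p ` {a..b} \<subseteq> {a..b}"
    "\<And>s. s \<in> {a..b} \<Longrightarrow> \<rho> (f (u s)) (f (p s)) \<le> 2 * e \<and> \<bar>u s - p s\<bar> \<le> e"
proof -
  note D = regularD(1,2)[OF r]
  obtain k t where p: "partition f a b e k t" by (rule partition_ex[OF r ab(1,2) less_imp_le[OF ab(3)] e])
  note pd = partitionD[OF p ab(1,2)]
  have "\<forall>s\<in>{a..b}. \<exists>i<k. t i \<le> u s \<and> u s < t (Suc i)"
    using step_sequence_find[of t _ k] u pd(1,2) by fastforce
  then obtain i where i: "\<And>s. s \<in> {a..b} \<Longrightarrow> i s < k" "\<And>s. s \<in> {a..b} \<Longrightarrow> t (i s) \<le> u s" "\<And>s. s \<in> {a..b} \<Longrightarrow> u s < t (Suc (i s))"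
    by metis
  \<comment> \<open>\<open>(1 + squeeze s) / 2\<close> embeds the reals into the open unit interval.
    Scaled to the interiors of the cells, which are disjoint, it encodes both the cell and
    \<open>s\<close>.\<close>
  define h where "h s = t (i s) + (t (Suc (i s)) - t (i s)) * ((1 + squeeze (ereal s)) / 2)" for s
  have sq: "-1 < squeeze (ereal s)" "squeeze (ereal s) < 1" for s
    using squeeze_less_iff[of "-\<infinity>" "ereal s"] squeeze_less_iff[of "ereal s" \<infinity>] by auto
  have h: "t (i s) < h s" "h s < t (Suc (i s))" if s: "s \<in> {a..b}" for s
  proof -
    have g: "0 < t (Suc (i s)) - t (i s)" using pd(3)[OF i(1)[OF s]] by simp
    have "0 < (1 + squeeze (ereal s)) / 2" "(1 + squeeze (ereal s)) / 2 < 1" using sq[of s] by (simp_all del: squeeze.simps)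
    then have "0 < (t (Suc (i s)) - t (i s)) * ((1 + squeeze (ereal s)) / 2)"
      "(t (Suc (i s)) - t (i s)) * ((1 + squeeze (ereal s)) / 2) < (t (Suc (i s)) - t (i s)) * 1"
      using g by (intro mult_pos_pos mult_strict_left_mono; simp del: squeeze.simps)+
    then show "t (i s) < h s" "h s < t (Suc (i s))" unfolding h_def by (simp_all del: squeeze.simps)
  qed
  have cells: "t (Suc m) \<le> t n" if "m < n" "n < k" for m n using pd(6)[of "Suc m" n] that by simp
  have inj: "s = s'" if s: "s \<in> {a..b}" "s' \<in> {a..b}" and eq: "h s = h s'" for s s'
  proof -
    have "\<not> i s < i s'" "\<not> i s' < i s"
      using cells[of "i s" "i s'"] cells[of "i s'" "i s"] h[OF s(1)] h[OF s(2)] i(1)[OF s(1)] i(1)[OF s(2)] eq by auto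
    then have ii: "i s = i s'" by simp
    have "t (Suc (i s')) - t (i s') \<noteq> 0" using pd(3)[OF i(1)[OF s(2)]] by simp
    then have "squeeze (ereal s) = squeeze (ereal s')" using eq unfolding h_def ii by (simp del: squeeze.simps)
    then have "ereal s = ereal s'" by (metis squeeze_less_iff linorder_less_linear less_irrefl)
    then show ?thesis by simp
  qed
  have "\<rho> (f (u s)) (f (h s)) \<le> 2 * e \<and> \<bar>u s - h s\<bar> \<le> e" if s: "s \<in> {a..b}" for s
  proof
    note k = i(1)[OF s]
    have I: "u s \<in> I" "h s \<in> I" "t (i s) \<in> I" using pd(10)[OF k] h[OF s] i[OF s] pd(7)[of "i s"] k by auto
    have "\<rho> (f (u s)) (f (t (i s))) < e" "\<rho> (f (h s)) (f (t (i s))) < e" using pd(5)[OF k] i[OF s] h[OF s] by auto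
    then show "\<rho> (f (u s)) (f (h s)) \<le> 2 * e" using R.triangle'[of "f (u s)" "f (t (i s))" "f (h s)"] D(1) I by auto
    show "\<bar>u s - h s\<bar> \<le> e" using pd(4)[OF k] i(2,3)[OF s] h[OF s] by auto
  qed
  moreover have "inj_on h {a..b}" using inj by (intro inj_onI)
  moreover have "h s \<in> {a..b}" if s: "s \<in> {a..b}" for s
    using h[OF s] pd(8)[of "i s"] pd(9)[of "Suc (i s)"] i(1)[OF s] by auto
  then have "h ` {a..b} \<subseteq> {a..b}" by blast
  ultimately show ?thesis using that by blast
qed

text \<open>The merged bijection moves each time either as \<open>p\<close> does or as
  \<open>q\<close> does backwards, so the two errors do not add up: \<open>4 * e\<close> come from
  \<open>cover_transfer\<close> and \<open>2 * e\<close> from \<open>cell_injection\<close>.\<close>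

lemma J2_change:
  assumes r: "regular f g" and gd: "good f g a b" and e: "e > 0"
  obtains \<delta> where "\<delta> > 0" "\<And>f' g'. regular f' g' \<Longrightarrow> (\<And>z. z \<in> graph_pts f' g' \<Longrightarrow> \<exists>w\<in>graph_pts f g. sqd z w < \<delta>) \<Longrightarrow>
    (\<And>w. w \<in> graph_pts f g \<Longrightarrow> \<exists>z\<in>graph_pts f' g'. sqd z w < \<delta>) \<Longrightarrow>
    \<exists>l\<in>time_changes {a..b}. \<forall>s\<in>{a..b}. \<rho> (f' s) (f (l s)) \<le> 6 * e \<and> \<bar>s - l s\<bar> \<le> 6 * e"
proof -
  have ab: "a \<in> I" "b \<in> I" "a < b" "g a = f a" "g b = f b" using gd unfolding good_def by auto
  note D = regularD(1,2)[OF r]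
  obtain \<eta>1 where \<eta>1: "\<eta>1 > 0" "\<And>s x. s \<in> I \<Longrightarrow> \<bar>s - a\<bar> < \<eta>1 \<Longrightarrow> x = f s \<or> x = g s \<Longrightarrow> \<rho> x (f a) < e"
    by (rule regular_continuity[OF r ab(1,4) e]) blast
  obtain \<eta>2 where \<eta>2: "\<eta>2 > 0" "\<And>s x. s \<in> I \<Longrightarrow> \<bar>s - b\<bar> < \<eta>2 \<Longrightarrow> x = f s \<or> x = g s \<Longrightarrow> \<rho> x (f b) < e"
    by (rule regular_continuity[OF r ab(2,5) e]) blast
  \<comment> \<open>Halved, because a partner of a time within \<open>\<eta>\<close> of an end is
    within \<open>2 * \<eta>\<close> of that end.\<close>
  define \<eta> where "\<eta> = min (min \<eta>1 \<eta>2 / 2) e"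
  have \<eta>: "\<eta> > 0" "2 * \<eta> \<le> \<eta>1" "2 * \<eta> \<le> \<eta>2" "\<eta> \<le> e" using \<eta>1(1) \<eta>2(1) e unfolding \<eta>_def by auto
  obtain \<delta> where \<delta>: "\<delta> > 0" "\<And>z w s. z \<in> squeezed X \<Longrightarrow> w \<in> squeezed X \<Longrightarrow> snd z = ereal s \<Longrightarrow> a \<le> s \<Longrightarrow> s \<le> b \<Longrightarrow> sqd z w < \<delta> \<Longrightarrow>
      \<exists>x y t. z = (Some x, ereal s) \<and> w = (Some y, ereal t) \<and> \<bar>s - t\<bar> < \<eta> \<and> \<rho> x y < \<eta>"
    by (rule sqd_near[OF \<eta>(1), where a = a and b = b]) blast
  have "\<exists>l\<in>time_changes {a..b}. \<forall>s\<in>{a..b}. \<rho> (f' s) (f (l s)) \<le> 6 * e \<and> \<bar>s - l s\<bar> \<le> 6 * e"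
    if r': "regular f' g'" and fwd: "\<And>z. z \<in> graph_pts f' g' \<Longrightarrow> \<exists>w\<in>graph_pts f g. sqd z w < \<delta>"
      and bwd: "\<And>w. w \<in> graph_pts f g \<Longrightarrow> \<exists>z\<in>graph_pts f' g'. sqd z w < \<delta>" for f' g'
  proof -
    note D' = regularD(1,2)[OF r']
    have abI: "s \<in> I" if "s \<in> {a..b}" for s using I_conv[OF ab(1,2)] that by auto
    have near: "\<exists>q y. q \<in> I \<and> (y = f2 q \<or> y = g2 q) \<and> \<bar>s - q\<bar> < \<eta> \<and> \<rho> (f1 s) y < \<eta>"
      if n1: "regular f1 g1" and n2: "regular f2 g2" and n3: "\<And>z. z \<in> graph_pts f1 g1 \<Longrightarrow> \<exists>w\<in>graph_pts f2 g2. sqd z w < \<delta>" and n4: "s \<in> {a..b}" for f1 g1 f2 g2 s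
    proof -
      let ?z = "(Some (f1 s), ereal s)"
      have z: "?z \<in> graph_pts f1 g1" using abI[OF n4] by simp
      then obtain w where w: "w \<in> graph_pts f2 g2" "sqd ?z w < \<delta>" using n3 by blast
      have "?z \<in> squeezed X" "w \<in> squeezed X" using graph_pts_squeezed[OF n1] graph_pts_squeezed[OF n2] z w by blast+
      then obtain x y q where "?z = (Some x, ereal s)" "w = (Some y, ereal q)" "\<bar>s - q\<bar> < \<eta>" "\<rho> x y < \<eta>"
        using \<delta>(2)[of ?z w s] w(2) n4 by auto
      then show ?thesis using w(1) by auto
    qed
    have bwd': "\<And>w. w \<in> graph_pts f g \<Longrightarrow> \<exists>z\<in>graph_pts f' g'. sqd w z < \<delta>" using bwd commute by metis
    \<comment> \<open>Near a continuity point of \<open>f\<close> the other function is nearly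
      constant as well, although nothing is assumed on its continuity there.\<close>
    have close: "\<rho> (f' s) (f c) \<le> 2 * e \<and> \<rho> (f s) (f c) \<le> 2 * e"
      if c: "c \<in> I" and cont: "\<And>s x. s \<in> I \<Longrightarrow> \<bar>s - c\<bar> < 2 * \<eta> \<Longrightarrow> x = f s \<or> x = g s \<Longrightarrow> \<rho> x (f c) < e"
        and s: "s \<in> {a..b}" "\<bar>s - c\<bar> < \<eta>" for c s
    proof -
      obtain q y where q: "q \<in> I" "y = f q \<or> y = g q" "\<bar>s - q\<bar> < \<eta>" "\<rho> (f' s) y < \<eta>" using near[OF r' r fwd s(1)] by blast
      have "\<rho> y (f c) < e" using cont[OF q(1) _ q(2)] q(3) s(2) by auto
      moreover have "y \<in> topspace X" using q D by auto
      ultimately have "\<rho> (f' s) (f c) \<le> 2 * e"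
        using R.triangle[of "f' s" y "f c"] q(4) \<eta>(4) D'(1)[OF abI[OF s(1)]] D(1)[OF c] by auto
      moreover have "\<rho> (f s) (f c) < e" using cont[OF abI[OF s(1)], of "f s"] s(2) \<eta>(1) by auto
      ultimately show ?thesis using e by auto
    qed
    have A: "\<rho> (f' s) (f a) \<le> 2 * e \<and> \<rho> (f s) (f a) \<le> 2 * e" if "s \<in> {a..b}" "\<bar>s - a\<bar> < \<eta>" for s
      by (rule close[OF ab(1) _ that]) (rule \<eta>1(2); use \<eta> in auto)
    have B: "\<rho> (f' s) (f b) \<le> 2 * e \<and> \<rho> (f s) (f b) \<le> 2 * e" if "s \<in> {a..b}" "\<bar>s - b\<bar> < \<eta>" for s
      by (rule close[OF ab(2) _ that]) (rule \<eta>2(2); use \<eta> in auto)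
    have "\<forall>s\<in>{a..b}. \<exists>u\<in>{a..<b}. \<rho> (f' s) (f u) \<le> 4 * e \<and> \<bar>s - u\<bar> \<le> 2 * e"
    proof
      fix s assume s: "s \<in> {a..b}"
      obtain q y where q: "q \<in> I" "y = f q \<or> y = g q" "\<bar>s - q\<bar> < \<eta>" "\<rho> (f' s) y < \<eta>" using near[OF r' r fwd s(1)] by blast
      show "\<exists>u\<in>{a..<b}. \<rho> (f' s) (f u) \<le> 4 * e \<and> \<bar>s - u\<bar> \<le> 2 * e"
        by (rule cover_transfer[OF r' r ab(1-3) e D(1)[OF ab(1)] D(1)[OF ab(2)] \<eta>(1,4) A B s q])
    qed
    then obtain u where u: "\<And>s. s \<in> {a..b} \<Longrightarrow> u s \<in> {a..<b}" "\<And>s. s \<in> {a..b} \<Longrightarrow> \<rho> (f' s) (f (u s)) \<le> 4 * e \<and> \<bar>s - u s\<bar> \<le> 2 * e"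
      by metis
    have "\<forall>s\<in>{a..b}. \<exists>u\<in>{a..<b}. \<rho> (f s) (f' u) \<le> 4 * e \<and> \<bar>s - u\<bar> \<le> 2 * e"
    proof
      fix s assume s: "s \<in> {a..b}"
      obtain q y where q: "q \<in> I" "y = f' q \<or> y = g' q" "\<bar>s - q\<bar> < \<eta>" "\<rho> (f s) y < \<eta>" using near[OF r r' bwd' s(1)] by blast
      show "\<exists>u\<in>{a..<b}. \<rho> (f s) (f' u) \<le> 4 * e \<and> \<bar>s - u\<bar> \<le> 2 * e"
        by (rule cover_transfer[OF r r' ab(1-3) e D(1)[OF ab(1)] D(1)[OF ab(2)] \<eta>(1,4) _ _ s q]) (use A B in blast)+
    qed
    then obtain v where v: "\<And>s. s \<in> {a..b} \<Longrightarrow> v s \<in> {a..<b}" "\<And>s. s \<in> {a..b} \<Longrightarrow> \<rho> (f s) (f' (v s)) \<le> 4 * e \<and> \<bar>s - v s\<bar> \<le> 2 * e"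
      by metis
    obtain p where p: "inj_on p {a..b}" "p ` {a..b} \<subseteq> {a..b}" "\<And>s. s \<in> {a..b} \<Longrightarrow> \<rho> (f (u s)) (f (p s)) \<le> 2 * e \<and> \<bar>u s - p s\<bar> \<le> e"
      by (rule cell_injection[OF r ab(1-3) e u(1)]) blast+
    obtain q where q: "inj_on q {a..b}" "q ` {a..b} \<subseteq> {a..b}" "\<And>s. s \<in> {a..b} \<Longrightarrow> \<rho> (f' (v s)) (f' (q s)) \<le> 2 * e \<and> \<bar>v s - q s\<bar> \<le> e"
      by (rule cell_injection[OF r' ab(1-3) e v(1)]) blast+
    obtain h where h: "bij_betw h {a..b} {a..b}" "\<And>s. s \<in> {a..b} \<Longrightarrow> h s = p s \<or> s = q (h s)"
      using bernstein_local[OF p(1,2) q(1,2)] by blast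
    have pb: "\<rho> (f' s) (f (p s)) \<le> 6 * e \<and> \<bar>s - p s\<bar> \<le> 6 * e" if s: "s \<in> {a..b}" for s
    proof -
      have "u s \<in> {a..b}" "p s \<in> {a..b}" using u(1)[OF s] p(2) s by (fastforce, blast)
      then have "u s \<in> I" "p s \<in> I" using abI by blast+
      then show ?thesis
        using R.triangle[of "f' s" "f (u s)" "f (p s)"] u(2)[OF s] p(3)[OF s] D'(1)[OF abI[OF s]] D(1) e by auto
    qed
    have qb: "\<rho> (f s) (f' (q s)) \<le> 6 * e \<and> \<bar>s - q s\<bar> \<le> 6 * e" if s: "s \<in> {a..b}" for s
    proof -
      have "v s \<in> {a..b}" "q s \<in> {a..b}" using v(1)[OF s] q(2) s by (fastforce, blast)
      then have "v s \<in> I" "q s \<in> I" using abI by blast+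
      then show ?thesis
        using R.triangle[of "f s" "f' (v s)" "f' (q s)"] v(2)[OF s] q(3)[OF s] D(1)[OF abI[OF s]] D'(1) e by auto
    qed
    have "\<rho> (f' s) (f (h s)) \<le> 6 * e \<and> \<bar>s - h s\<bar> \<le> 6 * e" if s: "s \<in> {a..b}" for s
      using h(2)[OF s]
    proof
      assume "h s = p s" then show ?thesis using pb[OF s] by simp
    next
      \<comment> \<open>Here the step from \<open>s\<close> to \<open>h s\<close> is a reversed step
        of \<open>q\<close>, and the estimate is read backwards.\<close>
      assume sq: "s = q (h s)"
      have hs: "h s \<in> {a..b}" using bij_betwE[OF h(1)] s by blast
      have "\<rho> (f (h s)) (f' s) \<le> 6 * e \<and> \<bar>h s - s\<bar> \<le> 6 * e" using qb[OF hs] unfolding sq[symmetric] .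
      then show ?thesis using R.commute[of "f (h s)" "f' s"] by (simp add: abs_minus_commute)
    qed
    then show ?thesis using h(1) unfolding time_changes_def by blast
  qed
  then show ?thesis using that \<delta>(1) by blast
qed

end

section \<open>Inversion and composition of time changes, and the Skorokhod distance\<close>

lemma null_seqI:
  fixes x :: "nat \<Rightarrow> real"
  assumes "\<And>n. 0 \<le> x n" "c > 0" "\<And>e. e > 0 \<Longrightarrow> \<forall>\<^sub>F n in sequentially. x n \<le> c * e"
  shows "x \<longlonglongrightarrow> 0"
proof (rule order_tendstoI)
  fix e :: real assume e: "0 < e"
  then have "\<forall>\<^sub>F n in sequentially. x n \<le> c * (e / (2 * c))" by (intro assms(3)) (use assms(2) in auto)
  then show "\<forall>\<^sub>F n in sequentially. x n < e" by (rule eventually_mono) (use assms(2) e in auto)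
qed (use assms(1) in \<open>auto intro: always_eventually order.strict_trans2\<close>)

lemma skor_dist_nonneg [simp]: "0 \<le> skor_dist \<Lambda> d J f h"
  unfolding skor_dist_def by simp

lemma time_changes_mono_subset: "time_changes_mono J \<subseteq> time_changes J"
  unfolding time_changes_mono_def time_changes_def by blast

lemma time_change_id:
  assumes "\<Lambda> = time_changes \<or> \<Lambda> = time_changes_mono"
  shows "(\<lambda>s. s) \<in> \<Lambda> J"
  using assms unfolding time_changes_mono_def time_changes_def by (auto simp: bij_betw_def inj_on_def strict_mono_on_def)

lemma time_change_mem:
  assumes "\<Lambda> = time_changes \<or> \<Lambda> = time_changes_mono" "l \<in> \<Lambda> J" "s \<in> J"
  shows "l s \<in> J"
  using assms unfolding time_changes_mono_def time_changes_def by (auto dest: bij_betwE)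

lemma time_change_comp:
  assumes "\<Lambda> = time_changes \<or> \<Lambda> = time_changes_mono" "l \<in> \<Lambda> J" "m \<in> \<Lambda> J"
  shows "(\<lambda>s. m (l s)) \<in> \<Lambda> J"
proof -
  have "bij_betw (\<lambda>s. m (l s)) J J" if "bij_betw l J J" "bij_betw m J J"
    using bij_betw_trans[OF that] unfolding comp_def .
  moreover have "strict_mono_on J (\<lambda>s. m (l s))" if "strict_mono_on J l" "strict_mono_on J m" "bij_betw l J J"
    using that bij_betwE[OF that(3)] unfolding strict_mono_on_def by blast
  ultimately show ?thesis using assms unfolding time_changes_mono_def time_changes_def by blast
qed

lemma time_change_inverse:
  assumes "\<Lambda> = time_changes \<or> \<Lambda> = time_changes_mono" "l \<in> \<Lambda> J"
  obtains m where "m \<in> \<Lambda> J" "\<And>s. s \<in> J \<Longrightarrow> m s \<in> J" "\<And>s. s \<in> J \<Longrightarrow> l (m s) = s"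
proof -
  have b: "bij_betw l J J" using assms unfolding time_changes_mono_def time_changes_def by blast
  define m where "m = inv_into J l"
  have bm: "bij_betw m J J" unfolding m_def using b by (rule bij_betw_inv_into)
  have m: "m s \<in> J" "l (m s) = s" if "s \<in> J" for s
    using bij_betwE[OF bm] bij_betw_inv_into_right[OF b] that unfolding m_def by auto
  have "strict_mono_on J m" if l: "strict_mono_on J l"
  proof (rule strict_mono_onI)
    fix x y assume xy: "x \<in> J" "y \<in> J" "x < y"
    show "m x < m y"
    proof (rule ccontr)
      assume "\<not> m x < m y"
      then consider "m y < m x" | "m y = m x" by linarith
      then show False
      proof cases
        case 1 then have "l (m y) < l (m x)" using strict_mono_onD[OF l] m xy by blast
        then show False using m xy by simp
      next
        case 2 then show False using m[OF xy(1)] m[OF xy(2)] xy(3) by simp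
      qed
    qed
  qed
  then have "m \<in> \<Lambda> J" using assms bm unfolding time_changes_mono_def time_changes_def by blast
  then show ?thesis using that m by blast
qed

lemma skor_dist_commute:
  assumes \<Lambda>: "\<Lambda> = time_changes \<or> \<Lambda> = time_changes_mono" and d: "\<And>x y. d x y = d y x"
  shows "skor_dist \<Lambda> d J f h = skor_dist \<Lambda> d J h f"
proof -
  have le: "(INF l\<in>\<Lambda> J. SUP s\<in>J. ennreal (max (d (f s) (h (l s))) \<bar>s - l s\<bar>)) \<le>
      (INF l\<in>\<Lambda> J. SUP s\<in>J. ennreal (max (d (h s) (f (l s))) \<bar>s - l s\<bar>))" for f h
  proof (rule INF_greatest)
    fix l assume l: "l \<in> \<Lambda> J"
    obtain m where m: "m \<in> \<Lambda> J" "\<And>s. s \<in> J \<Longrightarrow> m s \<in> J" "\<And>s. s \<in> J \<Longrightarrow> l (m s) = s" by (rule time_change_inverse[OF \<Lambda> l]) blast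
    have "(SUP s\<in>J. ennreal (max (d (f s) (h (m s))) \<bar>s - m s\<bar>)) \<le> (SUP s\<in>J. ennreal (max (d (h s) (f (l s))) \<bar>s - l s\<bar>))"
    proof (rule SUP_least)
      fix s assume s: "s \<in> J"
      have "ennreal (max (d (f s) (h (m s))) \<bar>s - m s\<bar>) = ennreal (max (d (h (m s)) (f (l (m s)))) \<bar>m s - l (m s)\<bar>)"
        using m(3)[OF s] d[of "f s" "h (m s)"] by (simp add: abs_minus_commute)
      also have "\<dots> \<le> (SUP s\<in>J. ennreal (max (d (h s) (f (l s))) \<bar>s - l s\<bar>))" by (rule SUP_upper[OF m(2)[OF s]])
      finally show "ennreal (max (d (f s) (h (m s))) \<bar>s - m s\<bar>) \<le> (SUP s\<in>J. ennreal (max (d (h s) (f (l s))) \<bar>s - l s\<bar>))" .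
    qed
    then show "(INF l\<in>\<Lambda> J. SUP s\<in>J. ennreal (max (d (f s) (h (l s))) \<bar>s - l s\<bar>)) \<le> (SUP s\<in>J. ennreal (max (d (h s) (f (l s))) \<bar>s - l s\<bar>))"
      by (rule INF_lower2[OF m(1)])
  qed
  show ?thesis unfolding skor_dist_def using le[of f h] le[of h f] by (simp add: order_antisym)
qed

context skorohod
begin

section \<open>From time changes back to distances of graphs\<close>

lemma regular_skor_dist_lessD:
  assumes \<Lambda>: "\<Lambda> = time_changes \<or> \<Lambda> = time_changes_mono" and r: "regular f g" "regular f' g'" and ab: "a \<in> I" "b \<in> I" "a \<le> b"
    and less: "skor_dist \<Lambda> \<rho> {a..b} f f' < e"
  obtains l where "l \<in> \<Lambda> {a..b}" "\<And>s. s \<in> {a..b} \<Longrightarrow> \<rho> (f s) (f' (l s)) < e \<and> \<bar>s - l s\<bar> < e"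
proof -
  obtain B where B: "\<And>s s'. s \<in> {a..b} \<Longrightarrow> s' \<in> {a..b} \<Longrightarrow> \<rho> (f s) (f' s') \<le> B" by (rule regular_dist_bounded[OF r ab]) blast
  have "\<exists>l\<in>\<Lambda> {a..b}. \<forall>s\<in>{a..b}. \<rho> (f s) (f' (l s)) < e \<and> \<bar>s - l s\<bar> < e"
  proof (rule skor_dist_lessD[OF time_change_id[OF \<Lambda>] _ _ less])
    show "\<rho> (f s) (f' s) \<le> max B 0" if "s \<in> {a..b}" for s using B[OF that that] by simp
  qed simp
  then show ?thesis using that by blast
qed

text \<open>The part of the graph on which a time change acts directly; left limits are reached from
  it by approximation.\<close>

definition right_pts :: "(real \<Rightarrow> 'a) \<Rightarrow> 'a spoint set" where
  "right_pts f = (\<lambda>t. (Some (f t), ereal t)) ` I \<union> {(None, -\<infinity>), (None, \<infinity>)}"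

lemma right_pts_cases:
  assumes "r \<in> right_pts f"
  obtains t where "t \<in> I" "r = (Some (f t), ereal t)" | "r = (None, -\<infinity>)" | "r = (None, \<infinity>)"
  using assms unfolding right_pts_def by blast

lemma right_pts_graph: "right_pts f \<subseteq> graph_pts f g"
  unfolding right_pts_def graph_pts_def by blast

lemma right_pts_ord:
  assumes u: "u \<in> right_pts f" and v: "v \<in> right_pts f" and le: "snd u \<le> snd v"
  shows "(u, v) \<in> graph_ord f g"
proof -
  have "u = v" if "snd u = snd v"
    using that by (rule_tac right_pts_cases[OF u]; rule_tac right_pts_cases[OF v]) auto
  then show ?thesis using right_pts_graph u v le unfolding graph_ord_iff by (auto simp: less_le)
qed

text \<open>A left limit is approximated by values at slightly earlier times. The bound
  \<open>c\<close> keeps these later than a prescribed time, so that points at strictly ordered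
  times can keep their order.\<close>

lemma right_pts_approx:
  assumes r: "regular f g" and z: "z \<in> graph_pts f g" and e: "e > 0"
  shows "\<exists>u\<in>right_pts f. snd u \<le> snd z \<and> (c < snd z \<longrightarrow> c < snd u) \<and> sqd z u < e"
proof -
  have "sqd z z = 0" using graph_pts_squeezed[OF r] z zero by blast
  then have self: ?thesis if "z \<in> right_pts f" using that e by (intro bexI[of _ z]) auto
  show ?thesis
  proof (rule graph_pts_cases[OF z])
    fix t x assume t: "t \<in> I" and zx: "z = (Some x, ereal t)" and x: "x = f t \<or> x = g t"
    show ?thesis
    proof (cases "x = f t")
      case True then show ?thesis using self t zx unfolding right_pts_def by blast
    next
      case False
      then have ne: "g t \<noteq> f t" and x: "x = g t" using x by auto
      obtain c' where c': "c' < t" "c < ereal t \<longrightarrow> c < ereal c'"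
      proof (cases "c < ereal t")
        case True
        then obtain p where "c < ereal p" "ereal p < ereal t" using ereal_dense2 by blast
        then show ?thesis using that[of p] by simp
      next
        case False then show ?thesis using that[of "t - 1"] by simp
      qed
      define m where "m = max c' (t - e / 2)"
      have m: "m < t" "c' \<le> m" "t - e / 2 \<le> m" using c' e unfolding m_def by auto
      have e2: "e / 2 > 0" using e by simp
      obtain q where q: "q \<in> I" "m < q" "q < t" "\<rho> (f q) (g t) < e / 2" by (rule regular_left_approx[OF r t ne m(1) e2])
      let ?u = "(Some (f q), ereal q)"
      have "sqd z ?u \<le> \<bar>t - q\<bar> + \<rho> (g t) (f q)" unfolding zx x by (rule sqd_real_le)
      then have "sqd z ?u < e" using q m R.commute[of "f q" "g t"] by auto
      moreover have "c < snd z \<longrightarrow> c < snd ?u"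
      proof
        assume "c < snd z"
        then have "c < ereal c'" using c' zx by simp
        also have "ereal c' \<le> ereal q" using m q by simp
        finally show "c < snd ?u" by simp
      qed
      moreover have "?u \<in> right_pts f" using q unfolding right_pts_def by blast
      ultimately show ?thesis using q zx by (intro bexI[of _ ?u]) auto
    qed
  qed (use self in \<open>auto simp: right_pts_def\<close>)
qed

text \<open>On either side of the window there is nothing left of \<open>I\<close>, or the remaining
  part of the squeezed space has diameter at most \<open>\<eta>\<close>, in the form of
  \<open>sqd_le_left\<close> and \<open>sqd_le_right\<close>.\<close>

definition tail_ok :: "real \<Rightarrow> real \<Rightarrow> real \<Rightarrow> bool" where
  "tail_ok a b \<eta> \<longleftrightarrow> ((\<forall>t\<in>I. a \<le> t) \<or> 2 * (1 + squeeze (ereal a)) \<le> \<eta>) \<and> ((\<forall>t\<in>I. t \<le> b) \<or> 2 * (1 - squeeze (ereal b)) \<le> \<eta>)"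

text \<open>Inside the window \<open>\<Phi>\<close> follows the time change. Points outside are sent
  to the point at infinity on their side, which is cheap by \<open>tail_ok\<close> and preserves the
  order of times.\<close>

lemma time_change_right_pts:
  assumes ab: "a \<in> I" "b \<in> I" "a \<le> b" and tail: "tail_ok a b \<eta>" and \<eta>: "\<eta> > 0"
    and l: "\<And>s. s \<in> {a..b} \<Longrightarrow> l s \<in> {a..b}" "\<And>s. s \<in> {a..b} \<Longrightarrow> \<rho> (f' s) (f (l s)) \<le> \<eta> \<and> \<bar>s - l s\<bar> \<le> \<eta>"
  obtains \<Phi> where "\<And>u. u \<in> right_pts f' \<Longrightarrow> \<Phi> u \<in> right_pts f" "\<And>u. u \<in> right_pts f' \<Longrightarrow> sqd u (\<Phi> u) \<le> 2 * \<eta>"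
    "\<And>u v. mono_on {a..b} l \<Longrightarrow> u \<in> right_pts f' \<Longrightarrow> v \<in> right_pts f' \<Longrightarrow> snd u \<le> snd v \<Longrightarrow> snd (\<Phi> u) \<le> snd (\<Phi> v)"
proof -
  define L where "L z = l (real_of_ereal (snd z))" for z :: "'a spoint"
  define \<Phi> where "\<Phi> z = (if snd z < ereal a then (None, -\<infinity>) else if ereal b < snd z then (None, \<infinity>) else (Some (f (L z)), ereal (L z)))" for z
  have mid: "\<exists>s\<in>{a..b}. snd z = ereal s \<and> L z = l s" if "\<not> snd z < ereal a" "\<not> ereal b < snd z" for z
    using that unfolding L_def by (cases "snd z") auto
  have 1: "\<Phi> u \<in> right_pts f" for u
  proof -
    consider "snd u < ereal a" | "ereal b < snd u" | "\<not> snd u < ereal a" "\<not> ereal b < snd u" by blast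
    then show ?thesis
    proof cases
      case 3
      then obtain s where "s \<in> {a..b}" "L u = l s" using mid by blast
      then have "L u \<in> I" using l(1)[of s] I_conv[OF ab(1,2)] by auto
      then show ?thesis using 3 unfolding \<Phi>_def right_pts_def by auto
    qed (auto simp: \<Phi>_def right_pts_def)
  qed
  have z0: "sqd (None, -\<infinity>) (None, -\<infinity>) = 0" "sqd (None, \<infinity>) (None, \<infinity>) = 0"
    using zero[of "(None, -\<infinity>)" "(None, -\<infinity>)"] zero[of "(None, \<infinity>)" "(None, \<infinity>)"] unfolding squeezed_def by auto
  have 2: "sqd u (\<Phi> u) \<le> 2 * \<eta>" if u: "u \<in> right_pts f'" for u
    using u
  proof (cases rule: right_pts_cases)
    case (1 t)
    consider "t < a" | "b < t" | "a \<le> t" "t \<le> b" by linarith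
    then show ?thesis
    proof cases
      assume t: "t < a"
      then have "2 * (1 + squeeze (ereal a)) \<le> \<eta>" using tail 1(1) unfolding tail_ok_def by (meson not_le)
      moreover have "\<Phi> u = (None, -\<infinity>)" using t 1 unfolding \<Phi>_def by simp
      then have "sqd u (\<Phi> u) \<le> 2 * (1 + squeeze (ereal a))" using t 1 by (intro sqd_le_left) auto
      ultimately show ?thesis using \<eta> by linarith
    next
      assume t: "b < t"
      then have "2 * (1 - squeeze (ereal b)) \<le> \<eta>" using tail 1(1) unfolding tail_ok_def by (meson not_le)
      moreover have "\<Phi> u = (None, \<infinity>)" using t 1 ab unfolding \<Phi>_def by simp
      then have "sqd u (\<Phi> u) \<le> 2 * (1 - squeeze (ereal b))" using t 1 by (intro sqd_le_right) auto
      ultimately show ?thesis using \<eta> by linarith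
    next
      assume t: "a \<le> t" "t \<le> b"
      then have "\<Phi> u = (Some (f (l t)), ereal (l t))" using 1 unfolding \<Phi>_def L_def by simp
      then have "sqd u (\<Phi> u) \<le> \<bar>t - l t\<bar> + \<rho> (f' t) (f (l t))" unfolding 1(2) by (simp only: sqd_real_le)
      then show ?thesis using l(2)[of t] t by auto
    qed
  next
    case 2
    then have "\<Phi> u = u" unfolding \<Phi>_def by simp
    then show ?thesis using 2 z0 \<eta> by simp
  next
    case 3
    then have "\<Phi> u = u" unfolding \<Phi>_def by simp
    then show ?thesis using 3 z0 \<eta> by simp
  qed
  have 3: "snd (\<Phi> u) \<le> snd (\<Phi> v)" if m: "mono_on {a..b} l" and uv: "snd u \<le> snd v" for u v
  proof -
    consider "snd u < ereal a" | "ereal b < snd v" | "\<not> snd u < ereal a" "\<not> ereal b < snd v" by blast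
    then show ?thesis
    proof cases
      case 1 then show ?thesis unfolding \<Phi>_def by simp
    next
      case 2
      moreover have "ereal a \<le> ereal b" using ab by simp
      ultimately have "\<not> snd v < ereal a" by order
      then show ?thesis using 2 unfolding \<Phi>_def by simp
    next
      case 3
      then have 4: "\<not> snd v < ereal a" "\<not> ereal b < snd u" using uv by order+
      obtain s s' where s: "s \<in> {a..b}" "snd u = ereal s" "L u = l s" and s': "s' \<in> {a..b}" "snd v = ereal s'" "L v = l s'"
        using mid[OF 3(1) 4(2)] mid[OF 4(1) 3(2)] by blast
      then have "l s \<le> l s'" using mono_onD[OF m s(1) s'(1)] uv by simp
      then show ?thesis using 3 4 s s' unfolding \<Phi>_def by simp
    qed
  qed
  show ?thesis by (rule that[OF 1 2 3])
qed

text \<open>A point of the graph is replaced by a value of \<open>f'\<close> at cost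
  \<open>\<eta>\<close>, and this is moved by \<open>\<Phi>\<close> at cost
  \<open>2 * \<eta>\<close>.\<close>

lemma time_change_graph_pts:
  assumes r': "regular f' g'" and ab: "a \<in> I" "b \<in> I" "a \<le> b" and tail: "tail_ok a b \<eta>" and \<eta>: "\<eta> > 0"
    and l: "\<And>s. s \<in> {a..b} \<Longrightarrow> l s \<in> {a..b}" "\<And>s. s \<in> {a..b} \<Longrightarrow> \<rho> (f' s) (f (l s)) \<le> \<eta> \<and> \<bar>s - l s\<bar> \<le> \<eta>"
    and r: "regular f g"
  shows "z \<in> graph_pts f' g' \<Longrightarrow> \<exists>w\<in>graph_pts f g. sqd z w \<le> 3 * \<eta>"
    "mono_on {a..b} l \<Longrightarrow> (z, z') \<in> graph_ord f' g' \<Longrightarrow> \<exists>w w'. (w, w') \<in> graph_ord f g \<and> sqd z w \<le> 3 * \<eta> \<and> sqd z' w' \<le> 3 * \<eta>"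
proof -
  obtain \<Phi> where \<Phi>: "\<And>u. u \<in> right_pts f' \<Longrightarrow> \<Phi> u \<in> right_pts f" "\<And>u. u \<in> right_pts f' \<Longrightarrow> sqd u (\<Phi> u) \<le> 2 * \<eta>"
    "\<And>u v. mono_on {a..b} l \<Longrightarrow> u \<in> right_pts f' \<Longrightarrow> v \<in> right_pts f' \<Longrightarrow> snd u \<le> snd v \<Longrightarrow> snd (\<Phi> u) \<le> snd (\<Phi> v)"
    by (rule time_change_right_pts[OF ab tail \<eta> l]) blast+
  have near: "sqd z (\<Phi> u) \<le> 3 * \<eta>" if z: "z \<in> graph_pts f' g'" and u: "u \<in> right_pts f'" "sqd z u < \<eta>" for z u
  proof -
    have "z \<in> squeezed X" "u \<in> squeezed X" "\<Phi> u \<in> squeezed X"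
      using z u(1) \<Phi>(1)[OF u(1)] right_pts_graph graph_pts_squeezed[OF r'] graph_pts_squeezed[OF r] by blast+
    then show ?thesis using triangle[of z u "\<Phi> u"] \<Phi>(2)[OF u(1)] u(2) by simp
  qed
  show "\<exists>w\<in>graph_pts f g. sqd z w \<le> 3 * \<eta>" if z: "z \<in> graph_pts f' g'"
  proof -
    obtain u where u: "u \<in> right_pts f'" "sqd z u < \<eta>" using right_pts_approx[OF r' z \<eta>] by blast
    then show ?thesis using near[OF z u] \<Phi>(1)[OF u(1)] right_pts_graph by blast
  qed
  show "\<exists>w w'. (w, w') \<in> graph_ord f g \<and> sqd z w \<le> 3 * \<eta> \<and> sqd z' w' \<le> 3 * \<eta>"
    if m: "mono_on {a..b} l" and zz: "(z, z') \<in> graph_ord f' g'"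
  proof -
    have G: "z \<in> graph_pts f' g'" "z' \<in> graph_pts f' g'" using zz unfolding graph_ord_iff by blast+
    obtain u where u: "u \<in> right_pts f'" "snd u \<le> snd z" "sqd z u < \<eta>" using right_pts_approx[OF r' G(1) \<eta>] by blast
    \<comment> \<open>The replacement of \<open>z'\<close> must not come before \<open>u\<close>. If
      \<open>z'\<close> is later than \<open>z\<close>, it is chosen after \<open>snd z\<close>; at
      a jump \<open>z'\<close> carries the right value and is kept.\<close>
    have "\<exists>u'\<in>right_pts f'. snd u \<le> snd u' \<and> sqd z' u' < \<eta>"
    proof (cases "z = z'")
      case True
      show ?thesis by (rule bexI[OF _ u(1)]) (use u(3) True in simp)
    next
      case False
      then consider "snd z < snd z'" | t where "t \<in> I" "z = (Some (g' t), ereal t)" "z' = (Some (f' t), ereal t)"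
        using zz unfolding graph_ord_iff by blast
      then show ?thesis
      proof cases
        case 1
        obtain u' where u': "u' \<in> right_pts f'" "snd z < snd u'" "sqd z' u' < \<eta>" using right_pts_approx[OF r' G(2) \<eta>] 1 by blast
        have "snd u \<le> snd u'" using u(2) u'(2) by order
        then show ?thesis using u' by blast
      next
        case 2
        have "sqd z' z' = 0" using graph_pts_squeezed[OF r'] G(2) zero by blast
        moreover have "z' \<in> right_pts f'" using 2 unfolding right_pts_def by blast
        moreover have "snd u \<le> snd z'" using u(2) 2 by simp
        ultimately show ?thesis using \<eta> by (intro bexI[of _ z']) auto
      qed
    qed
    then obtain u' where u': "u' \<in> right_pts f'" "snd u \<le> snd u'" "sqd z' u' < \<eta>" by blast
    have "(\<Phi> u, \<Phi> u') \<in> graph_ord f g"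
      by (rule right_pts_ord[OF \<Phi>(1)[OF u(1)] \<Phi>(1)[OF u'(1)] \<Phi>(3)[OF m u(1) u'(1,2)]])
    then show ?thesis using near[OF G(1) u(1,3)] near[OF G(2) u'(1,3)] by blast
  qed
qed

lemma inverse_bounds:
  assumes m: "\<And>s. s \<in> J \<Longrightarrow> m s \<in> J" "\<And>s. s \<in> J \<Longrightarrow> l (m s) = s"
    and l: "\<And>s. s \<in> J \<Longrightarrow> \<rho> (f' s) (f (l s)) \<le> \<eta> \<and> \<bar>s - l s\<bar> \<le> \<eta>" and s: "s \<in> J"
  shows "\<rho> (f s) (f' (m s)) \<le> \<eta> \<and> \<bar>s - m s\<bar> \<le> \<eta>"
  using l[OF m(1)[OF s]] m(2)[OF s] R.commute[of "f s" "f' (m s)"] by (simp add: abs_minus_commute)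

lemma graph_path_paths:
  assumes "regular f g"
  shows "graph_path f g \<in> paths X"
  using graph_path_skor[OF assms] unfolding skor_paths_def by blast

text \<open>For \<open>d_part\<close> it is enough to match ordered pairs with ordered pairs, in one
  direction by the time change and in the other by its inverse. The passage to \<open>d_tot\<close>
  is left to the equality of the topologies.\<close>

lemma d_part_le_time_change:
  assumes r: "regular f' g'" "regular f g" and ab: "a \<in> I" "b \<in> I" "a \<le> b" and tail: "tail_ok a b \<eta>" and \<eta>: "\<eta> > 0"
    and l: "l \<in> time_changes_mono {a..b}" "\<And>s. s \<in> {a..b} \<Longrightarrow> \<rho> (f' s) (f (l s)) \<le> \<eta> \<and> \<bar>s - l s\<bar> \<le> \<eta>"
  shows "d_part sqd (graph_path f' g') (graph_path f g) \<le> 3 * \<eta>"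
proof -
  have \<Lambda>: "time_changes_mono = time_changes \<or> time_changes_mono = time_changes_mono" by simp
  obtain m where m: "m \<in> time_changes_mono {a..b}" "\<And>s. s \<in> {a..b} \<Longrightarrow> m s \<in> {a..b}" "\<And>s. s \<in> {a..b} \<Longrightarrow> l (m s) = s"
    by (rule time_change_inverse[OF \<Lambda> l(1)]) blast
  have mono: "mono_on {a..b} h" if "h \<in> time_changes_mono {a..b}" for h
    using that unfolding time_changes_mono_def by (auto intro: strict_mono_on_imp_mono_on)
  note lb = time_change_mem[OF \<Lambda> l(1)] and mb = inverse_bounds[of "{a..b}" m l f' f \<eta>, OF m(2,3) l(2)]
  show ?thesis
  proof (rule d_part_le[OF graph_path_paths[OF r(1)] graph_path_paths[OF r(2)]], unfold snd_conv)
    show "\<exists>w w'. (w, w') \<in> graph_ord f g \<and> sqd z w \<le> 3 * \<eta> \<and> sqd z' w' \<le> 3 * \<eta>" if "(z, z') \<in> graph_ord f' g'" for z z'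
      by (rule time_change_graph_pts(2)[OF r(1) ab tail \<eta> lb l(2) r(2) mono[OF l(1)] that])
    have "\<exists>z z'. (z, z') \<in> graph_ord f' g' \<and> sqd w z \<le> 3 * \<eta> \<and> sqd w' z' \<le> 3 * \<eta>" if "(w, w') \<in> graph_ord f g" for w w'
      by (rule time_change_graph_pts(2)[OF r(2) ab tail \<eta> m(2) mb r(1) mono[OF m(1)] that])
    then show "\<exists>z z'. (z, z') \<in> graph_ord f' g' \<and> sqd z w \<le> 3 * \<eta> \<and> sqd z' w' \<le> 3 * \<eta>" if "(w, w') \<in> graph_ord f g" for w w'
      using that commute by metis
  qed (use \<eta> in simp)
qed

lemma d_H_le_time_change:
  assumes r: "regular f' g'" "regular f g" and ab: "a \<in> I" "b \<in> I" "a \<le> b" and tail: "tail_ok a b \<eta>" and \<eta>: "\<eta> > 0"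
    and l: "l \<in> time_changes {a..b}" "\<And>s. s \<in> {a..b} \<Longrightarrow> \<rho> (f' s) (f (l s)) \<le> \<eta> \<and> \<bar>s - l s\<bar> \<le> \<eta>"
  shows "d_H sqd (graph_path f' g') (graph_path f g) \<le> 3 * \<eta>"
proof -
  have \<Lambda>: "time_changes = time_changes \<or> time_changes = time_changes_mono" by simp
  obtain m where m: "m \<in> time_changes {a..b}" "\<And>s. s \<in> {a..b} \<Longrightarrow> m s \<in> {a..b}" "\<And>s. s \<in> {a..b} \<Longrightarrow> l (m s) = s"
    by (rule time_change_inverse[OF \<Lambda> l(1)]) blast
  note lb = time_change_mem[OF \<Lambda> l(1)] and mb = inverse_bounds[of "{a..b}" m l f' f \<eta>, OF m(2,3) l(2)]
  show ?thesis
  proof (rule d_H_le[OF graph_path_paths[OF r(1)] graph_path_paths[OF r(2)]], unfold fst_conv)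
    show "\<exists>w\<in>graph_pts f g. sqd z w \<le> 3 * \<eta>" if "z \<in> graph_pts f' g'" for z
      by (rule time_change_graph_pts(1)[OF r(1) ab tail \<eta> lb l(2) r(2) that])
    have "\<exists>z\<in>graph_pts f' g'. sqd w z \<le> 3 * \<eta>" if "w \<in> graph_pts f g" for w
      by (rule time_change_graph_pts(1)[OF r(2) ab tail \<eta> m(2) mb r(1) that])
    then show "\<exists>z\<in>graph_pts f' g'. sqd z w \<le> 3 * \<eta>" if "w \<in> graph_pts f g" for w
      using that commute by metis
  qed (use \<eta> in simp)
qed

text \<open>Off the division points of a partition for \<open>1 / Suc m\<close>, the left and right
  limits differ by at most \<open>2 / Suc m\<close>. A point that avoids the countably many division
  points of all these partitions is therefore a continuity point.\<close>

lemma continuity_point_ex: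
  assumes r: "regular f g" and cd: "c < d" "c \<in> I" "d \<in> I"
  obtains t where "c < t" "t < d" "g t = f t"
proof -
  note D = regularD(1,2)[OF r]
  have "\<exists>k t. partition f c d (1 / real (Suc m)) k t" for m
  proof -
    have "1 / real (Suc m) > 0" by simp
    then obtain k t where "partition f c d (1 / real (Suc m)) k t" by (rule partition_ex[OF r cd(2,3) less_imp_le[OF cd(1)]])
    then show ?thesis by blast
  qed
  then obtain k t where p: "\<And>m. partition f c d (1 / real (Suc m)) (k m) (t m)" by metis
  have "countable (\<Union>m. t m ` {..k m})" by (intro countable_UN) (auto intro: countable_finite)
  then have "\<not> {c<..<d} \<subseteq> (\<Union>m. t m ` {..k m})" using uncountable_open_interval[of c d] cd(1) countable_subset by blast
  then obtain s where "s \<in> {c<..<d}" and "s \<notin> (\<Union>m. t m ` {..k m})" by blast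
  then have s: "c < s" "s < d" "s \<notin> (\<Union>m. t m ` {..k m})" by simp_all
  have sI: "s \<in> I" using I_conv[OF cd(2,3)] s by auto
  have "\<rho> (f s) (g s) \<le> 2 * (1 / real (Suc m))" for m
  proof -
    note pd = partitionD[OF p[of m] cd(2,3)]
    obtain i where i: "i < k m" "t m i \<le> s" "s < t m (Suc i)" using step_sequence_find[of "t m" s "k m"] s pd(1,2) by auto
    have "s \<noteq> t m i" using s(3) i(1) by (auto dest: less_imp_le)
    then have "\<rho> (g s) (f (t m i)) \<le> 1 / real (Suc m)" using i by (intro partition_left[OF r p[of m] cd(2,3) i(1)]) auto
    then show ?thesis using pd(5)[OF i] R.triangle'[of "f s" "f (t m i)" "g s"] D sI pd(7)[of i] i(1) by auto
  qed
  then have le: "\<rho> (f s) (g s) / 2 \<le> inverse (real (Suc m))" for m by (simp add: inverse_eq_divide)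
  have "\<not> 0 < \<rho> (f s) (g s) / 2" using reals_Archimedean[of "\<rho> (f s) (g s) / 2"] le by (meson not_le)
  then have "\<rho> (f s) (g s) = 0" using R.nonneg[of "f s" "g s"] by linarith
  then show ?thesis using that[of s] s R.zero D sI by metis
qed

text \<open>Either \<open>I\<close> has a first point, where \<open>regular\<close> gives
  \<open>g = f\<close>, or there are continuity points so far to the left that what lies beyond has
  diameter at most \<open>\<eta>\<close>.\<close>

lemma lower_window:
  assumes r: "regular f g" and p: "p \<in> I" and \<eta>: "\<eta> > 0"
  obtains a where "a \<in> I" "a \<le> p" "g a = f a"
    "(\<forall>t\<in>I. a \<le> t) \<or> (\<not> compact I \<and> 2 * (1 + squeeze (ereal a)) \<le> \<eta>)"
proof (cases "bdd_below I")
  case True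
  then have "Inf I \<in> I" using closed_contains_Inf[of I] I_closed p by blast
  moreover have "\<forall>t\<in>I. Inf I \<le> t" using True cInf_lower by blast
  moreover have "g (Inf I) = f (Inf I)" using calculation frontier_I regularD(3)[OF r] by blast
  ultimately show ?thesis using that[of "Inf I"] p by blast
next
  case False
  have nc: "\<not> compact I"
  proof
    assume "compact I"
    then have "bounded I" by (rule compact_imp_bounded)
    then have "bdd_below I" by (rule bounded_imp_bdd_below)
    then show False using False by blast
  qed
  \<comment> \<open>For \<open>a < 0\<close> one has \<open>1 + squeeze a = 1 / (1 - a)\<close>, so
    \<open>a < - 2 / \<eta>\<close> makes the bound of \<open>sqd_le_left\<close> at most
    \<open>\<eta>\<close>.\<close>
  define M where "M = min p (- 2 / \<eta>)"
  obtain c where c: "c \<in> I" "c < M" using False unfolding bdd_below_def by (meson not_le)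
  have MI: "M \<in> I" using I_conv[OF c(1) p] c(2) unfolding M_def by simp
  obtain a where a: "c < a" "a < M" "g a = f a" by (rule continuity_point_ex[OF r c(2,1) MI])
  have aI: "a \<in> I" using I_conv[OF c(1) MI] a by simp
  have a0: "a < - 2 / \<eta>" "a \<le> p" using a unfolding M_def by auto
  then have "a < 0" using \<eta> by (smt (verit) divide_nonneg_pos minus_divide_left)
  then have "1 + squeeze (ereal a) = 1 / (1 - a)" by (simp add: field_simps)
  moreover have "2 / (1 - a) \<le> \<eta>"
  proof -
    have "2 / \<eta> < 1 - a" using a0(1) by simp
    then have "2 < \<eta> * (1 - a)" using \<eta> by (simp add: field_simps)
    then show ?thesis using \<open>a < 0\<close> by (simp add: field_simps)
  qed
  ultimately have "2 * (1 + squeeze (ereal a)) \<le> \<eta>" by (simp del: squeeze.simps)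
  then show ?thesis using that[OF aI a0(2) a(3)] nc by blast
qed

lemma upper_window:
  assumes r: "regular f g" and p: "p \<in> I" and \<eta>: "\<eta> > 0"
  obtains b where "b \<in> I" "p \<le> b" "g b = f b"
    "(\<forall>t\<in>I. t \<le> b) \<or> (\<not> compact I \<and> 2 * (1 - squeeze (ereal b)) \<le> \<eta>)"
proof (cases "bdd_above I")
  case True
  then have "Sup I \<in> I" using closed_contains_Sup[of I] I_closed p by blast
  moreover have "\<forall>t\<in>I. t \<le> Sup I" using True cSup_upper by blast
  moreover have "g (Sup I) = f (Sup I)" using calculation frontier_I regularD(3)[OF r] by blast
  ultimately show ?thesis using that[of "Sup I"] p by blast
next
  case False
  have nc: "\<not> compact I"
  proof
    assume "compact I"
    then have "bounded I" by (rule compact_imp_bounded)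
    then have "bdd_above I" by (rule bounded_imp_bdd_above)
    then show False using False by blast
  qed
  define M where "M = max p (2 / \<eta>)"
  obtain c where c: "c \<in> I" "M < c" using False unfolding bdd_above_def by (meson not_le)
  have MI: "M \<in> I" using I_conv[OF p c(1)] c(2) unfolding M_def by simp
  obtain b where b: "M < b" "b < c" "g b = f b" by (rule continuity_point_ex[OF r c(2) MI c(1)])
  have bI: "b \<in> I" using I_conv[OF MI c(1)] b by simp
  have b0: "2 / \<eta> < b" "p \<le> b" using b unfolding M_def by auto
  then have "b > 0" using \<eta> by (smt (verit) divide_nonneg_pos)
  then have "1 - squeeze (ereal b) = 1 / (1 + b)" by (simp add: field_simps)
  moreover have "2 / (1 + b) \<le> \<eta>"
  proof -
    have "2 / \<eta> < 1 + b" using b0(1) by simp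
    then have "2 < \<eta> * (1 + b)" using \<eta> by (simp add: field_simps)
    then show ?thesis using \<open>b > 0\<close> by (simp add: field_simps)
  qed
  ultimately have "2 * (1 - squeeze (ereal b)) \<le> \<eta>" by (simp del: squeeze.simps)
  then show ?thesis using that[OF bI b0(2) b(3)] nc by blast
qed

text \<open>For compact \<open>I\<close> the Skorokhod distance is taken over \<open>I\<close>
  itself, so the whole interval is then the only window. This lets one criterion cover both cases of
  \<open>skor_topology\<close>.\<close>

definition window :: "(real \<Rightarrow> 'a) \<Rightarrow> (real \<Rightarrow> 'a) \<Rightarrow> real \<Rightarrow> real \<Rightarrow> bool" where
  "window f g a b \<longleftrightarrow> good f g a b \<and> (compact I \<longrightarrow> {a..b} = I)"

lemma window_ex:
  assumes r: "regular f g" and \<eta>: "\<eta> > 0"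
  obtains a b where "window f g a b" "tail_ok a b \<eta>"
proof -
  obtain p q where pq: "p \<in> I" "q \<in> I" "p < q" using I unfolding closed_pos_interval_def by blast
  obtain a where a: "a \<in> I" "a \<le> p" "g a = f a" "(\<forall>t\<in>I. a \<le> t) \<or> (\<not> compact I \<and> 2 * (1 + squeeze (ereal a)) \<le> \<eta>)"
    by (rule lower_window[OF r pq(1) \<eta>])
  obtain b where b: "b \<in> I" "q \<le> b" "g b = f b" "(\<forall>t\<in>I. t \<le> b) \<or> (\<not> compact I \<and> 2 * (1 - squeeze (ereal b)) \<le> \<eta>)"
    by (rule upper_window[OF r pq(2) \<eta>])
  have "{a..b} = I" if "compact I"
  proof -
    have "I \<subseteq> {a..b}" using that a(4) b(4) by auto
    then show ?thesis using I_conv[OF a(1) b(1)] by auto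
  qed
  then have "window f g a b" unfolding window_def good_def using a b pq by auto
  moreover have "tail_ok a b \<eta>" unfolding tail_ok_def using a(4) b(4) by blast
  ultimately show ?thesis using that by blast
qed

lemma continuity_point_iff:
  assumes r: "regular f g" and t: "t \<in> I"
  shows "t \<in> frontier I \<or> limitin X f (f t) (at t within I) \<longleftrightarrow> g t = f t"
proof
  have X: "X = R.mtopology" using rho unfolding metrizes_def by simp
  note D = regularD(1,2)[OF r]
  show "g t = f t" if "t \<in> frontier I \<or> limitin X f (f t) (at t within I)"
  proof (cases "t \<in> frontier I")
    case True then show ?thesis by (rule regularD(3)[OF r])
  next
    case False
    then have "limitin X f (f t) (at t within I)" using that by blast
    then have "limitin X f (f t) (at t within (I \<inter> {..<t}))" 
      unfolding limitin_def using filter_leD[OF at_le[of "I \<inter> {..<t}" I t]] by blast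
    moreover have "\<forall>s\<in>I. f s \<in> topspace X" using D by blast
    ultimately have lim: "\<forall>e>0. \<exists>\<delta>>0. \<forall>s\<in>I. t - \<delta> < s \<and> s < t \<longrightarrow> \<rho> (f s) (f t) < e"
      using limitin_left_iff[OF D(1)[OF t]] by blast
    \<comment> \<open>With \<open>f t\<close> as its left limit at \<open>t\<close> the pair stays
      regular, and uniqueness of left limits gives \<open>g t = f t\<close>.\<close>
    have "regular f (g(t := f t))"
      unfolding regular_def
    proof (intro conjI ballI allI impI)
      fix s assume "s \<in> I" then show "f s \<in> topspace X" "(g(t := f t)) s \<in> topspace X" using D t by auto
    next
      fix s assume "s \<in> frontier I" then show "(g(t := f t)) s = f s" using regularD(3)[OF r] by simp
    next
      fix s e :: real assume s: "s \<in> I" and e: "e > 0"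
      obtain \<delta>1 where 1: "\<delta>1 > 0" "\<forall>u\<in>I. s < u \<and> u < s + \<delta>1 \<longrightarrow> \<rho> (f u) (f s) < e" "\<forall>u\<in>I. s - \<delta>1 < u \<and> u < s \<longrightarrow> \<rho> (f u) (g s) < e"
        using regularD(4)[OF r s e] by blast
      obtain \<delta>2 where 2: "\<delta>2 > 0" "\<forall>s\<in>I. t - \<delta>2 < s \<and> s < t \<longrightarrow> \<rho> (f s) (f t) < e" using lim e by blast
      show "\<exists>\<delta>>0. (\<forall>u\<in>I. s < u \<and> u < s + \<delta> \<longrightarrow> \<rho> (f u) (f s) < e) \<and> (\<forall>u\<in>I. s - \<delta> < u \<and> u < s \<longrightarrow> \<rho> (f u) ((g(t := f t)) s) < e)"
        using 1 2 by (intro exI[of _ "min \<delta>1 \<delta>2"]) auto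
    qed
    then show ?thesis using regular_left_unique[OF r _ t] by fastforce
  qed
  show "t \<in> frontier I \<or> limitin X f (f t) (at t within I)" if gt: "g t = f t"
  proof -
    have "\<forall>\<^sub>F s in at t within I. f s \<in> topspace X \<and> \<rho> (f s) (f t) < e" if e: "e > 0" for e
    proof -
      obtain \<eta> where \<eta>: "\<eta> > 0" "\<And>s x. s \<in> I \<Longrightarrow> \<bar>s - t\<bar> < \<eta> \<Longrightarrow> x = f s \<or> x = g s \<Longrightarrow> \<rho> x (f t) < e"
        by (rule regular_continuity[OF r t gt e]) blast
      show ?thesis unfolding eventually_at using \<eta> D(1) by (intro exI[of _ \<eta>]) (auto simp: dist_real_def)
    qed
    then have "limitin R.mtopology f (f t) (at t within I)" using R.limitin_metric D(1)[OF t] by blast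
    then show ?thesis using X by simp
  qed
qed

text \<open>Convergence of sequences in \<open>skor_topology\<close>, with the compact and the
  noncompact case in one predicate.\<close>

definition skor_lim :: "(real set \<Rightarrow> (real \<Rightarrow> real) set) \<Rightarrow> (nat \<Rightarrow> real \<Rightarrow> 'a) \<Rightarrow> (real \<Rightarrow> 'a) \<Rightarrow> bool" where
  "skor_lim \<Lambda> fs f \<longleftrightarrow> (if compact I then vanishes (\<lambda>n. skor_dist \<Lambda> \<rho> I (fs n) f) else skor_conv \<Lambda> \<rho> X I fs f)"

lemma skor_lim_iff:
  assumes r: "regular f g"
  shows "skor_lim \<Lambda> fs f \<longleftrightarrow> (\<forall>a b. window f g a b \<longrightarrow> vanishes (\<lambda>n. skor_dist \<Lambda> \<rho> {a..b} (fs n) f))"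
proof (cases "compact I")
  case True
  obtain a b where "window f g a b" by (rule window_ex[OF r zero_less_one])
  then have "(\<forall>a b. window f g a b \<longrightarrow> vanishes (\<lambda>n. skor_dist \<Lambda> \<rho> {a..b} (fs n) f)) \<longleftrightarrow> vanishes (\<lambda>n. skor_dist \<Lambda> \<rho> I (fs n) f)"
    using True unfolding window_def by metis
  then show ?thesis using True unfolding skor_lim_def by simp
next
  case False
  have "a < b \<and> {a..b} \<subseteq> I \<and> (\<forall>t\<in>{a, b}. t \<in> frontier I \<or> limitin X f (f t) (at t within I)) \<longleftrightarrow> window f g a b" for a b
  proof -
    have "a < b \<and> {a..b} \<subseteq> I \<longleftrightarrow> a < b \<and> a \<in> I \<and> b \<in> I" using I_conv[of a b] by auto
    then show ?thesis using continuity_point_iff[OF r, of a] continuity_point_iff[OF r, of b] False unfolding window_def good_def by blast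
  qed
  then show ?thesis using False unfolding skor_lim_def skor_conv_def by simp
qed

section \<open>Convergence of graphs and Skorokhod convergence\<close>

lemma d_tot_tendsto_iff:
  assumes rn: "\<And>n. regular (fs n) (gs n)" and r: "regular f g"
  shows "vanishes (\<lambda>n. d_tot sqd (graph_path (fs n) (gs n)) (graph_path f g)) \<longleftrightarrow> skor_lim time_changes_mono fs f"
proof
  note P = graph_path_paths[OF rn] graph_path_paths[OF r]
  assume lim: "vanishes (\<lambda>n. d_tot sqd (graph_path (fs n) (gs n)) (graph_path f g))"
  have "vanishes (\<lambda>n. skor_dist time_changes_mono \<rho> {a..b} (fs n) f)" if w: "window f g a b" for a b
  proof (rule null_seqI[where c = 4])
    fix e :: real assume e: "e > 0"
    have gd: "good f g a b" using w unfolding window_def by blast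
    obtain \<delta> where \<delta>: "\<delta> > 0" "\<And>f' g' C. regular f' g' \<Longrightarrow> C \<in> Corr_mono (graph_path f' g') (graph_path f g) \<Longrightarrow>
      (\<And>z w. (z, w) \<in> C \<Longrightarrow> sqd z w < \<delta>) \<Longrightarrow>
      \<exists>l\<in>time_changes_mono {a..b}. \<forall>s\<in>{a..b}. \<rho> (f' s) (f (l s)) \<le> 4 * e \<and> \<bar>s - l s\<bar> \<le> 4 * e"
      by (rule J1_change[OF r gd e]) blast
    have "skor_dist time_changes_mono \<rho> {a..b} (fs n) f \<le> 4 * e" if less: "d_tot sqd (graph_path (fs n) (gs n)) (graph_path f g) < \<delta>" for n
    proof -
      obtain C where C: "C \<in> Corr_mono (graph_path (fs n) (gs n)) (graph_path f g)" "\<And>z w. (z, w) \<in> C \<Longrightarrow> sqd z w < \<delta>"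
        by (rule d_tot_lessD[OF P less]) blast
      obtain l where "l \<in> time_changes_mono {a..b}" "\<forall>s\<in>{a..b}. \<rho> (fs n s) (f (l s)) \<le> 4 * e \<and> \<bar>s - l s\<bar> \<le> 4 * e"
        using \<delta>(2)[OF rn[of n] C] by blast
      then show ?thesis using e by (intro skor_dist_le) auto
    qed
    then show "\<forall>\<^sub>F n in sequentially. skor_dist time_changes_mono \<rho> {a..b} (fs n) f \<le> 4 * e"
      using order_tendstoD(2)[OF lim \<delta>(1)] by (rule eventually_mono[rotated])
  qed auto
  then show "skor_lim time_changes_mono fs f" using skor_lim_iff[OF r] by blast
next
  note P = graph_path_paths[OF rn] graph_path_paths[OF r]
  have \<Lambda>: "time_changes_mono = time_changes \<or> time_changes_mono = time_changes_mono" by simp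
  assume "skor_lim time_changes_mono fs f"
  then have lim: "vanishes (\<lambda>n. skor_dist time_changes_mono \<rho> {a..b} (fs n) f)" if "window f g a b" for a b
    using skor_lim_iff[OF r] that by blast
  \<comment> \<open>The window is chosen for each \<open>\<eta>\<close> so large that its complement
    is negligible; convergence on this one window then bounds \<open>d_part\<close>
    eventually.\<close>
  have part: "vanishes (\<lambda>n. d_part sqd (graph_path (fs n) (gs n)) (graph_path f g))"
  proof (rule null_seqI[where c = 3])
    fix \<eta> :: real assume \<eta>: "\<eta> > 0"
    obtain a b where w: "window f g a b" and tail: "tail_ok a b \<eta>" by (rule window_ex[OF r \<eta>])
    have ab: "a \<in> I" "b \<in> I" "a \<le> b" using w unfolding window_def good_def by auto
    have "d_part sqd (graph_path (fs n) (gs n)) (graph_path f g) \<le> 3 * \<eta>"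
      if less: "skor_dist time_changes_mono \<rho> {a..b} (fs n) f < \<eta>" for n
    proof -
      obtain l where l: "l \<in> time_changes_mono {a..b}" "\<And>s. s \<in> {a..b} \<Longrightarrow> \<rho> (fs n s) (f (l s)) < \<eta> \<and> \<bar>s - l s\<bar> < \<eta>"
        by (rule regular_skor_dist_lessD[OF \<Lambda> rn r ab less]) blast
      show ?thesis by (rule d_part_le_time_change[OF rn r ab tail \<eta> l(1)]) (use l(2) in fastforce)
    qed
    then show "\<forall>\<^sub>F n in sequentially. d_part sqd (graph_path (fs n) (gs n)) (graph_path f g) \<le> 3 * \<eta>"
      using order_tendstoD(2)[OF lim[OF w] \<eta>] by (rule eventually_mono[rotated])
  qed auto
  show "vanishes (\<lambda>n. d_tot sqd (graph_path (fs n) (gs n)) (graph_path f g))"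
  proof (rule null_seqI[where c = 1])
    fix e :: real assume e: "e > 0"
    obtain \<delta> where \<delta>: "\<delta> > 0" "\<And>\<pi>'. \<pi>' \<in> paths X \<Longrightarrow> d_part sqd (graph_path f g) \<pi>' < \<delta> \<Longrightarrow> d_tot sqd (graph_path f g) \<pi>' < e"
      by (rule d_tot_small[OF P(2) e]) blast
    have "d_tot sqd (graph_path (fs n) (gs n)) (graph_path f g) \<le> 1 * e" if less: "d_part sqd (graph_path (fs n) (gs n)) (graph_path f g) < \<delta>" for n
      using \<delta>(2)[OF P(1)[of n]] less Metric_space.commute[OF Metric_space_d_part, of "graph_path (fs n) (gs n)" "graph_path f g"]
        d_tot_commute[of "graph_path (fs n) (gs n)" "graph_path f g"] by simp
    then show "\<forall>\<^sub>F n in sequentially. d_tot sqd (graph_path (fs n) (gs n)) (graph_path f g) \<le> 1 * e"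
      using order_tendstoD(2)[OF part \<delta>(1)] by (rule eventually_mono[rotated])
  qed (auto simp: d_tot_def)
qed

lemma d_H_tendsto_iff:
  assumes rn: "\<And>n. regular (fs n) (gs n)" and r: "regular f g"
  shows "vanishes (\<lambda>n. d_H sqd (graph_path (fs n) (gs n)) (graph_path f g)) \<longleftrightarrow> skor_lim time_changes fs f"
proof
  note P = graph_path_paths[OF rn] graph_path_paths[OF r]
  assume lim: "vanishes (\<lambda>n. d_H sqd (graph_path (fs n) (gs n)) (graph_path f g))"
  have "vanishes (\<lambda>n. skor_dist time_changes \<rho> {a..b} (fs n) f)" if w: "window f g a b" for a b
  proof (rule null_seqI[where c = 6])
    fix e :: real assume e: "e > 0"
    have gd: "good f g a b" using w unfolding window_def by blast
    obtain \<delta> where \<delta>: "\<delta> > 0" "\<And>f' g'. regular f' g' \<Longrightarrow> (\<And>z. z \<in> graph_pts f' g' \<Longrightarrow> \<exists>w\<in>graph_pts f g. sqd z w < \<delta>) \<Longrightarrow>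
      (\<And>w. w \<in> graph_pts f g \<Longrightarrow> \<exists>z\<in>graph_pts f' g'. sqd z w < \<delta>) \<Longrightarrow>
      \<exists>l\<in>time_changes {a..b}. \<forall>s\<in>{a..b}. \<rho> (f' s) (f (l s)) \<le> 6 * e \<and> \<bar>s - l s\<bar> \<le> 6 * e"
      by (rule J2_change[OF r gd e]) blast
    have "skor_dist time_changes \<rho> {a..b} (fs n) f \<le> 6 * e" if less: "d_H sqd (graph_path (fs n) (gs n)) (graph_path f g) < \<delta>" for n
    proof -
      obtain l where "l \<in> time_changes {a..b}" "\<forall>s\<in>{a..b}. \<rho> (fs n s) (f (l s)) \<le> 6 * e \<and> \<bar>s - l s\<bar> \<le> 6 * e"
        using \<delta>(2)[OF rn[of n] d_H_lessD[OF P less, unfolded fst_conv]] by blast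
      then show ?thesis using e by (intro skor_dist_le) auto
    qed
    then show "\<forall>\<^sub>F n in sequentially. skor_dist time_changes \<rho> {a..b} (fs n) f \<le> 6 * e"
      using order_tendstoD(2)[OF lim \<delta>(1)] by (rule eventually_mono[rotated])
  qed auto
  then show "skor_lim time_changes fs f" using skor_lim_iff[OF r] by blast
next
  have \<Lambda>: "time_changes = time_changes \<or> time_changes = time_changes_mono" by simp
  assume "skor_lim time_changes fs f"
  then have lim: "vanishes (\<lambda>n. skor_dist time_changes \<rho> {a..b} (fs n) f)" if "window f g a b" for a b
    using skor_lim_iff[OF r] that by blast
  show "vanishes (\<lambda>n. d_H sqd (graph_path (fs n) (gs n)) (graph_path f g))"
  proof (rule null_seqI[where c = 3])
    fix \<eta> :: real assume \<eta>: "\<eta> > 0"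
    obtain a b where w: "window f g a b" and tail: "tail_ok a b \<eta>" by (rule window_ex[OF r \<eta>])
    have ab: "a \<in> I" "b \<in> I" "a \<le> b" using w unfolding window_def good_def by auto
    have "d_H sqd (graph_path (fs n) (gs n)) (graph_path f g) \<le> 3 * \<eta>"
      if less: "skor_dist time_changes \<rho> {a..b} (fs n) f < \<eta>" for n
    proof -
      obtain l where l: "l \<in> time_changes {a..b}" "\<And>s. s \<in> {a..b} \<Longrightarrow> \<rho> (fs n s) (f (l s)) < \<eta> \<and> \<bar>s - l s\<bar> < \<eta>"
        by (rule regular_skor_dist_lessD[OF \<Lambda> rn r ab less]) blast
      show ?thesis by (rule d_H_le_time_change[OF rn r ab tail \<eta> l(1)]) (use l(2) in fastforce)
    qed
    then show "\<forall>\<^sub>F n in sequentially. d_H sqd (graph_path (fs n) (gs n)) (graph_path f g) \<le> 3 * \<eta>"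
      using order_tendstoD(2)[OF lim[OF w] \<eta>] by (rule eventually_mono[rotated])
  qed (auto simp: d_H_def)
qed

text \<open>Definiteness is borrowed from \<open>d_H\<close>: at Skorokhod distance 0 the graphs
  coincide, and a graph determines its function. This covers both families, as increasing time
  changes are in particular time changes.\<close>

lemma Metric_space_skor_dist:
  assumes c: "compact I" and \<Lambda>: "\<Lambda> = time_changes \<or> \<Lambda> = time_changes_mono"
  shows "Metric_space (cadlag X I) (skor_dist \<Lambda> \<rho> I)"
proof
  show "0 \<le> skor_dist \<Lambda> \<rho> I f h" for f h by simp
  show "skor_dist \<Lambda> \<rho> I f h = skor_dist \<Lambda> \<rho> I h f" for f h by (rule skor_dist_commute[OF \<Lambda> R.commute])
  obtain a b where ab: "{a..b} = I" "a \<in> I" "b \<in> I" "a \<le> b"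
  proof -
    have "connected I" using I is_interval_connected_1 unfolding closed_pos_interval_def by blast
    then obtain a b where "I = {a..b}" using c connected_compact_interval_1 by blast
    moreover have "I \<noteq> {}" using I unfolding closed_pos_interval_def by blast
    ultimately show ?thesis using that[of a b] by auto
  qed
  have tail: "tail_ok a b \<eta>" for \<eta> unfolding tail_ok_def using ab by auto
  have lessD: "\<exists>l\<in>\<Lambda> I. \<forall>s\<in>I. \<rho> (f s) (h (l s)) < e \<and> \<bar>s - l s\<bar> < e"
    if f: "f \<in> cadlag X I" and h: "h \<in> cadlag X I" and less: "skor_dist \<Lambda> \<rho> I f h < e" for f h e
  proof -
    obtain g g' where r: "regular f g" "regular h g'" using f h unfolding cadlag_iff_regular by blast
    show ?thesis using regular_skor_dist_lessD[OF \<Lambda> r ab(2-4)] less ab(1) by metis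
  qed
  show "skor_dist \<Lambda> \<rho> I f h = 0 \<longleftrightarrow> f = h" if f: "f \<in> cadlag X I" and h: "h \<in> cadlag X I" for f h
  proof
    obtain g g' where r: "regular f g" "regular h g'" using f h unfolding cadlag_iff_regular by blast
    note P = graph_path_skor[OF r(1)] graph_path_skor[OF r(2)]
    assume z: "skor_dist \<Lambda> \<rho> I f h = 0"
    have "d_H sqd (graph_path f g) (graph_path h g') \<le> e" if e: "e > 0" for e
    proof -
      have "skor_dist \<Lambda> \<rho> I f h < e / 3" using z e by simp
      then obtain l where l: "l \<in> \<Lambda> I" "\<forall>s\<in>I. \<rho> (f s) (h (l s)) < e / 3 \<and> \<bar>s - l s\<bar> < e / 3" using lessD[OF f h] by blast
      have lt: "l \<in> time_changes {a..b}" using l(1) \<Lambda> time_changes_mono_subset ab(1) by blast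
      have "d_H sqd (graph_path f g) (graph_path h g') \<le> 3 * (e / 3)"
        by (rule d_H_le_time_change[OF r ab(2-4) tail _ lt]) (use l(2) e ab(1) in \<open>auto intro: less_imp_le\<close>)
      then show ?thesis by simp
    qed
    then have "d_H sqd (graph_path f g) (graph_path h g') \<le> 0" by (rule_tac field_le_epsilon) simp
    then have "d_H sqd (graph_path f g) (graph_path h g') = 0" by (simp add: d_H_def order_antisym)
    moreover have "Metric_space (skor_paths X I) (d_H sqd)"
      by (rule Metric_space_d_H) (use skor_paths_inject in \<open>auto simp: skor_paths_def\<close>)
    ultimately have "graph_path f g = graph_path h g'" using Metric_space.zero[OF _ P] by blast
    then have "restrict f I = restrict h I" using path_fun_graph_path[OF r(1)] path_fun_graph_path[OF r(2)] by simp
    moreover have "f \<in> extensional I" "h \<in> extensional I" using f h unfolding cadlag_iff_regular by blast+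
    ultimately show "f = h" by (simp add: extensional_restrict)
  next
    assume fh: "f = h"
    have fX: "f s \<in> topspace X" if "s \<in> I" for s using f that unfolding cadlag_def by (auto simp: PiE_def)
    have "skor_dist \<Lambda> \<rho> I f f \<le> 0"
      by (rule skor_dist_le[OF time_change_id[OF \<Lambda>]]) (use fX in auto)
    then show "skor_dist \<Lambda> \<rho> I f h = 0" unfolding fh by (rule order_antisym) simp
  qed
  show "skor_dist \<Lambda> \<rho> I f k \<le> skor_dist \<Lambda> \<rho> I f h + skor_dist \<Lambda> \<rho> I h k"
    if f: "f \<in> cadlag X I" and h: "h \<in> cadlag X I" and k: "k \<in> cadlag X I" for f h k
  proof (rule field_le_epsilon)
    fix e :: real assume e: "e > 0"
    let ?p = "skor_dist \<Lambda> \<rho> I f h + e / 2" and ?q = "skor_dist \<Lambda> \<rho> I h k + e / 2"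
    obtain l where l: "l \<in> \<Lambda> I" "\<forall>s\<in>I. \<rho> (f s) (h (l s)) < ?p \<and> \<bar>s - l s\<bar> < ?p" using lessD[OF f h, of ?p] e by auto
    obtain m where m: "m \<in> \<Lambda> I" "\<forall>s\<in>I. \<rho> (h s) (k (m s)) < ?q \<and> \<bar>s - m s\<bar> < ?q" using lessD[OF h k, of ?q] e by auto
    have val: "u s \<in> topspace X" if "u \<in> cadlag X I" "s \<in> I" for u s using that unfolding cadlag_def by (auto simp: PiE_def)
    have "skor_dist \<Lambda> \<rho> I f k \<le> ?p + ?q"
    proof (rule skor_dist_le[where l = "\<lambda>s. m (l s)"])
      show "(\<lambda>s. m (l s)) \<in> \<Lambda> I" by (rule time_change_comp[OF \<Lambda> l(1) m(1)])
    next
      fix s assume s: "s \<in> I"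
      have ls: "l s \<in> I" by (rule time_change_mem[OF \<Lambda> l(1) s])
      have ms: "m (l s) \<in> I" by (rule time_change_mem[OF \<Lambda> m(1) ls])
      show "\<rho> (f s) (k (m (l s))) \<le> ?p + ?q"
        using R.triangle[OF val[OF f s] val[OF h ls] val[OF k ms]] l(2) m(2) s ls by fastforce
      have "\<bar>s - l s\<bar> < ?p" "\<bar>l s - m (l s)\<bar> < ?q" using l(2) m(2) s ls by blast+
      then show "\<bar>s - m (l s)\<bar> \<le> ?p + ?q" by linarith
    qed (use e in simp)
    then show "skor_dist \<Lambda> \<rho> I f k \<le> skor_dist \<Lambda> \<rho> I f h + skor_dist \<Lambda> \<rho> I h k + e" by simp
  qed
qed

text \<open>For compact \<open>I\<close>, two metrics with the same convergent sequences are
  compared. Otherwise the topology of \<open>m\<close> meets the defining description, which only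
  one metrizable topology can meet.\<close>

lemma skor_topology_eqI:
  assumes \<Lambda>: "\<Lambda> = time_changes \<or> \<Lambda> = time_changes_mono" and m: "Metric_space (cadlag X I) m"
    and lim: "\<And>fs f. (\<And>n. fs n \<in> cadlag X I) \<Longrightarrow> f \<in> cadlag X I \<Longrightarrow> vanishes (\<lambda>n. m (fs n) f) \<longleftrightarrow> skor_lim \<Lambda> fs f"
  shows "skor_topology \<Lambda> \<rho> X I = Metric_space.mtopology (cadlag X I) m"
proof -
  interpret M: Metric_space "cadlag X I" m by (rule m)
  have met: "metrizable_space M.mtopology" by (rule M.metrizable_space_mtopology)
  have M: "limitin M.mtopology fs f sequentially \<longleftrightarrow> skor_lim \<Lambda> fs f" if h: "range fs \<subseteq> cadlag X I" "f \<in> cadlag X I" for fs :: "nat \<Rightarrow> real \<Rightarrow> 'a" and f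
  proof -
    have fs: "fs n \<in> cadlag X I" for n using h(1) by blast
    show ?thesis using M.limitin_seq_iff[of fs f, OF fs h(2)] lim[of fs f, OF fs h(2)] by simp
  qed
  show ?thesis
  proof (cases "compact I")
    case True
    interpret S: Metric_space "cadlag X I" "skor_dist \<Lambda> \<rho> I" by (rule Metric_space_skor_dist[OF True \<Lambda>])
    have "S.mtopology = M.mtopology"
    proof (rule metrizable_space_eqI[OF S.metrizable_space_mtopology met])
      fix fs :: "nat \<Rightarrow> real \<Rightarrow> 'a" and f assume h: "range fs \<subseteq> topspace M.mtopology" "f \<in> topspace M.mtopology"
      then have h': "range fs \<subseteq> cadlag X I" "f \<in> cadlag X I" by simp_all
      have fs: "fs n \<in> cadlag X I" for n using h'(1) by blast
      show "limitin S.mtopology fs f sequentially = limitin M.mtopology fs f sequentially"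
        using S.limitin_seq_iff[of fs f, OF fs h'(2)] M[OF h'] True unfolding skor_lim_def by simp
    qed simp
    then show ?thesis using True unfolding skor_topology_def by simp
  next
    case False
    have "(THE T. topspace T = cadlag X I \<and> metrizable_space T \<and>
        (\<forall>fs f. range fs \<subseteq> cadlag X I \<longrightarrow> f \<in> cadlag X I \<longrightarrow>
           (limitin T fs f sequentially \<longleftrightarrow> skor_conv \<Lambda> \<rho> X I fs f))) = M.mtopology"
    proof (rule the_equality)
      show "topspace M.mtopology = cadlag X I \<and> metrizable_space M.mtopology \<and>
        (\<forall>fs f. range fs \<subseteq> cadlag X I \<longrightarrow> f \<in> cadlag X I \<longrightarrow>
           (limitin M.mtopology fs f sequentially \<longleftrightarrow> skor_conv \<Lambda> \<rho> X I fs f))"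
        using met M False unfolding skor_lim_def by simp
    next
      fix T assume T: "topspace T = cadlag X I \<and> metrizable_space T \<and>
        (\<forall>fs f. range fs \<subseteq> cadlag X I \<longrightarrow> f \<in> cadlag X I \<longrightarrow>
           (limitin T fs f sequentially \<longleftrightarrow> skor_conv \<Lambda> \<rho> X I fs f))"
      show "T = M.mtopology"
        by (rule metrizable_space_eqI) (use T met M False in \<open>simp_all add: skor_lim_def\<close>)
    qed
    then show ?thesis using False unfolding skor_topology_def by simp
  qed
qed

text \<open>The metric is transported along the bijection \<open>path_fun I\<close>, which thereby
  becomes an isometry; it remains to recognize convergence for the transported metric.\<close>

lemma homeomorphic_map_skor_topology:
  assumes \<Lambda>: "\<Lambda> = time_changes \<or> \<Lambda> = time_changes_mono" and \<delta>: "Metric_space (skor_paths X I) \<delta>"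
    and lim: "\<And>fs gs f g. (\<And>n. regular (fs n) (gs n)) \<Longrightarrow> regular f g \<Longrightarrow>
      vanishes (\<lambda>n. \<delta> (graph_path (fs n) (gs n)) (graph_path f g)) \<longleftrightarrow> skor_lim \<Lambda> fs f"
  shows "homeomorphic_map (Metric_space.mtopology (skor_paths X I) \<delta>) (skor_topology \<Lambda> \<rho> X I) (path_fun I)"
proof -
  let ?Q = "skor_paths X I"
  define \<psi> where "\<psi> = inv_into ?Q (path_fun I)"
  note bij = bij_betw_path_fun
  have \<psi>: "\<psi> f \<in> ?Q" "path_fun I (\<psi> f) = f" if "f \<in> cadlag X I" for f
    using bij_betwE[OF bij_betw_inv_into[OF bij]] bij_betw_inv_into_right[OF bij] that unfolding \<psi>_def by auto
  have \<psi>i: "\<psi> (path_fun I \<pi>) = \<pi>" if "\<pi> \<in> ?Q" for \<pi> using bij_betw_inv_into_left[OF bij that] unfolding \<psi>_def .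
  define m where "m f h = \<delta> (\<psi> f) (\<psi> h)" for f h
  interpret D: Metric_space ?Q \<delta> by (rule \<delta>)
  have m: "Metric_space (cadlag X I) m"
  proof
    show "0 \<le> m f h" for f h unfolding m_def by simp
    show "m f h = m h f" for f h unfolding m_def by (rule D.commute)
    show "m f h = 0 \<longleftrightarrow> f = h" if "f \<in> cadlag X I" "h \<in> cadlag X I" for f h
      unfolding m_def using D.zero[OF \<psi>(1)[OF that(1)] \<psi>(1)[OF that(2)]] \<psi>(2) that by metis
    show "m f k \<le> m f h + m h k" if "f \<in> cadlag X I" "h \<in> cadlag X I" "k \<in> cadlag X I" for f h k
      unfolding m_def by (intro D.triangle \<psi>(1) that)
  qed
  interpret DM: Metric_space12 ?Q \<delta> "cadlag X I" m by (rule Metric_space12.intro[OF \<delta> m])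
  have eq: "\<psi> f = graph_path f (left_val (\<psi> f)) \<and> regular f (left_val (\<psi> f))" if f: "f \<in> cadlag X I" for f
  proof -
    have "path_fun I (\<psi> f) t = right_val (\<psi> f) t" if "t \<in> I" for t using that unfolding path_fun_def by simp
    then have "regular (path_fun I (\<psi> f)) (left_val (\<psi> f))" using regular_cong[OF skor_path_regular[OF \<psi>(1)[OF f]]] by blast
    then show ?thesis using skor_path_eq_graph_path[OF \<psi>(1)[OF f]] \<psi>(2)[OF f] by metis
  qed
  have "homeomorphic_map D.mtopology DM.M2.mtopology (path_fun I)"
    by (rule DM.isometry_imp_homeomorphic_map) (use bij \<psi>i in \<open>auto simp: m_def bij_betw_def\<close>)
  moreover have "skor_topology \<Lambda> \<rho> X I = DM.M2.mtopology"
  proof (rule skor_topology_eqI[OF \<Lambda> m])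
    fix fs :: "nat \<Rightarrow> real \<Rightarrow> 'a" and f assume fs: "\<And>n. fs n \<in> cadlag X I" and f: "f \<in> cadlag X I"
    have "vanishes (\<lambda>n. \<delta> (graph_path (fs n) (left_val (\<psi> (fs n)))) (graph_path f (left_val (\<psi> f)))) \<longleftrightarrow> skor_lim \<Lambda> fs f"
      by (rule lim) (use eq fs f in blast)+
    moreover have "m (fs n) f = \<delta> (graph_path (fs n) (left_val (\<psi> (fs n)))) (graph_path f (left_val (\<psi> f)))" for n
      unfolding m_def using eq[OF fs[of n]] eq[OF f] by metis
    ultimately show "vanishes (\<lambda>n. m (fs n) f) \<longleftrightarrow> skor_lim \<Lambda> fs f" by simp
  qed
  ultimately show ?thesis by simp
qed

lemma skor_paths_subset: "skor_paths X I \<subseteq> paths X"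
  unfolding skor_paths_def by blast

lemma homeomorphic_map_J1:
  "homeomorphic_map (Metric_space.mtopology (skor_paths X I) (d_tot sqd)) (J1_topology \<rho> X I) (path_fun I)"
proof (rule homeomorphic_map_skor_topology)
  show "Metric_space (skor_paths X I) (d_tot sqd)" by (rule Metric_space_d_tot_subset[OF skor_paths_subset])
  show "vanishes (\<lambda>n. d_tot sqd (graph_path (fs n) (gs n)) (graph_path f g)) \<longleftrightarrow> skor_lim time_changes_mono fs f"
    if "\<And>n. regular (fs n) (gs n)" "regular f g" for fs gs f g
    using that by (rule d_tot_tendsto_iff)
qed simp

lemma homeomorphic_map_J2:
  "homeomorphic_map (Metric_space.mtopology (skor_paths X I) (d_H sqd)) (J2_topology \<rho> X I) (path_fun I)"
proof (rule homeomorphic_map_skor_topology)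
  show "Metric_space (skor_paths X I) (d_H sqd)"
    using skor_paths_subset skor_paths_inject by (rule Metric_space_d_H)
  show "vanishes (\<lambda>n. d_H sqd (graph_path (fs n) (gs n)) (graph_path f g)) \<longleftrightarrow> skor_lim time_changes fs f"
    if "\<And>n. regular (fs n) (gs n)" "regular f g" for fs gs f g
    using that by (rule d_H_tendsto_iff)
qed simp

end

section \<open>Transfer to an arbitrary metric on the squeezed space\<close>

context squeezed_metric
begin

lemma skorohod_cone_dist:
  assumes "closed_pos_interval I" "metrizes \<rho> X"
  shows "skorohod X \<rho> I"
  using squeezed_metric_cone_dist[OF assms(2)] assms
  unfolding skorohod_def skorohod_axioms_def by blast

lemma homeomorphic_map_J1_topology:
  assumes "closed_pos_interval I" "metrizes \<rho> X"
  shows "homeomorphic_map (Metric_space.mtopology (skor_paths X I) (d_tot d)) (J1_topology \<rho> X I) (path_fun I)"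
proof -
  interpret S: skorohod X \<rho> I using assms by (rule skorohod_cone_dist)
  have "Metric_space.mtopology (skor_paths X I) (d_tot d) = Metric_space.mtopology (skor_paths X I) (d_tot (cone_dist \<rho>))"
    using mtopology_subset[OF Metric_space_d_tot S.skor_paths_subset] mtopology_subset[OF S.Metric_space_d_tot S.skor_paths_subset]
      mtopology_d_tot_independent[OF squeezed_metric_axioms S.squeezed_metric_axioms] by simp
  then show ?thesis using S.homeomorphic_map_J1 by simp
qed

text \<open>The topology of \<open>d_H\<close> on these paths is independent of the metric as well,
  since \<open>d_H_near\<close> holds in both directions; so the result for the cone metric
  applies.\<close>

lemma skor_paths_d_H:
  assumes "closed_pos_interval I" "metrizes \<rho> X"
  shows "Metric_space (skor_paths X I) (d_H d)"
    "homeomorphic_map (Metric_space.mtopology (skor_paths X I) (d_H d)) (J2_topology \<rho> X I) (path_fun I)"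
proof -
  interpret S: skorohod X \<rho> I using assms by (rule skorohod_cone_dist)
  interpret A: squeezed_metric2 X d "cone_dist \<rho>" by unfold_locales
  interpret B: squeezed_metric2 X "cone_dist \<rho>" d by unfold_locales
  show met: "Metric_space (skor_paths X I) (d_H d)"
    using S.skor_paths_subset S.skor_paths_inject by (rule Metric_space_d_H)
  have met': "Metric_space (skor_paths X I) (d_H (cone_dist \<rho>))"
    using S.skor_paths_subset S.skor_paths_inject by (rule S.Metric_space_d_H)
  have "Metric_space.mtopology (skor_paths X I) (d_H d) = Metric_space.mtopology (skor_paths X I) (d_H (cone_dist \<rho>))"
    by (rule mtopology_eqI[OF met met']) (use A.d_H_near B.d_H_near S.skor_paths_subset in \<open>meson subsetD\<close>)+
  then show "homeomorphic_map (Metric_space.mtopology (skor_paths X I) (d_H d)) (J2_topology \<rho> X I) (path_fun I)"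
    using S.homeomorphic_map_J2 by simp
qed

end

theorem theorem1p4:
  fixes X :: "'a topology" and dsqz :: "'a spoint \<Rightarrow> 'a spoint \<Rightarrow> real"
  assumes "metrizable_space X" and "metrizes dsqz (squeezed_topology X)"
  shows
    \<comment> \<open>(a)\<close>
    "(\<forall>\<pi>1 \<in> paths X. \<forall>\<pi>2 \<in> paths X.
        d_H dsqz \<pi>1 \<pi>2 \<le> d_part dsqz \<pi>1 \<pi>2 \<and> d_part dsqz \<pi>1 \<pi>2 \<le> d_tot dsqz \<pi>1 \<pi>2) \<and>
     \<comment> \<open>(b)\<close>
     (Metric_space (paths X) (d_tot dsqz) \<and> Metric_space (paths X) (d_part dsqz) \<and>
      Metric_space.mtopology (paths X) (d_tot dsqz) =
        Metric_space.mtopology (paths X) (d_part dsqz) \<and>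
      (\<forall>dsqz'. metrizes dsqz' (squeezed_topology X) \<longrightarrow>
        Metric_space.mtopology (paths X) (d_tot dsqz') =
          Metric_space.mtopology (paths X) (d_tot dsqz))) \<and>
     \<comment> \<open>(c)\<close>
     (Metric_space (paths_c X) (d_H dsqz) \<and> Metric_space (paths_c X) (d_tot dsqz) \<and>
      Metric_space (paths_c X) (d_part dsqz) \<and>
      Metric_space.mtopology (paths_c X) (d_H dsqz) =
        Metric_space.mtopology (paths_c X) (d_tot dsqz) \<and>
      Metric_space.mtopology (paths_c X) (d_part dsqz) =
        Metric_space.mtopology (paths_c X) (d_tot dsqz)) \<and>
     \<comment> \<open>(d)\<close>
     closedin (Metric_space.mtopology (paths X) (d_tot dsqz)) (paths_int_c X) \<and>
     \<comment> \<open>(e)\<close>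
     (Polish_space X \<longrightarrow>
      (\<forall>\<delta> \<in> {d_tot dsqz, d_part dsqz}.
        Polish_space (Metric_space.mtopology (paths X) \<delta>) \<and>
        Polish_space (Metric_space.mtopology (paths_c X) \<delta>) \<and>
        (\<forall>I. closed_pos_interval I \<longrightarrow>
          Polish_space (Metric_space.mtopology (skor_paths X I) \<delta>)))) \<and>
     \<comment> \<open>(f)\<close>
     (\<forall>I d. closed_pos_interval I \<and> metrizes d X \<longrightarrow>
        homeomorphic_map (Metric_space.mtopology (skor_paths X I) (d_tot dsqz))
          (J1_topology d X I) (path_fun I) \<and>
        homeomorphic_map (Metric_space.mtopology (skor_paths X I) (d_part dsqz))
          (J1_topology d X I) (path_fun I) \<and>
        Metric_space (skor_paths X I) (d_H dsqz) \<and>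
        homeomorphic_map (Metric_space.mtopology (skor_paths X I) (d_H dsqz))
          (J2_topology d X I) (path_fun I))"
proof -
  have sq: "squeezed_metric X dsqz" using squeezed_metric_iff[OF assms(1)] assms(2) by blast
  then interpret squeezed_metric X dsqz .
  have skor: "skor_paths X I \<subseteq> paths X" for I unfolding skor_paths_def by blast
  have gdelta_paths: "gdelta_in (Metric_space.mtopology (paths X) (d_part d)) (paths X)" if "squeezed_metric X d" for d
  proof -
    interpret P: Metric_space "paths X" "d_part d" using that by (rule squeezed_metric.Metric_space_d_part)
    show ?thesis using gdelta_in_topspace[of P.mtopology] by simp
  qed
  have Polish: "\<forall>\<delta> \<in> {d_tot dsqz, d_part dsqz}.
        Polish_space (Metric_space.mtopology (paths X) \<delta>) \<and>
        Polish_space (Metric_space.mtopology (paths_c X) \<delta>) \<and>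
        (\<forall>I. closed_pos_interval I \<longrightarrow> Polish_space (Metric_space.mtopology (skor_paths X I) \<delta>))"
    if X: "Polish_space X"
    using Polish_space_paths_gdelta[OF sq X gdelta_paths]
      Polish_space_paths_gdelta[OF sq X squeezed_metric.gdelta_in_paths_c]
      Polish_space_paths_gdelta[OF sq X squeezed_metric.gdelta_in_skor_paths] by blast
  have indep: "Metric_space.mtopology (paths X) (d_tot dsqz') = Metric_space.mtopology (paths X) (d_tot dsqz)"
    if "metrizes dsqz' (squeezed_topology X)" for dsqz'
    using mtopology_d_tot_independent[OF _ sq] squeezed_metric_iff[OF assms(1)] that by blast
  have J1: "homeomorphic_map (Metric_space.mtopology (skor_paths X I) (d_part dsqz)) (J1_topology d X I) (path_fun I)"
    if "closed_pos_interval I" "metrizes d X" for I d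
    using homeomorphic_map_J1_topology[OF that] mtopology_d_part_subset[OF skor] by simp
  show ?thesis
    using d_H_le_d_part d_part_le_d_tot Metric_space_d_tot Metric_space_d_part mtopology_d_tot_eq_d_part indep
      Metric_space_d_H_paths_c Metric_space_d_tot_subset[OF paths_c_subset] Metric_space_d_part_subset[OF paths_c_subset]
      mtopology_d_H_paths_c mtopology_d_part_subset[OF paths_c_subset] closedin_paths_int_c Polish
      homeomorphic_map_J1_topology J1 skor_paths_d_H
    by (intro conjI ballI allI impI) blast+
qed

end
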